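(* Let $M^2$ be a smooth connected $2$-manifold (orientable or not) and let $f:M^2\to\mathbb{R}^3_1$ be a maxface. Then there exists a real analytic normal vector field of $f$ defined on $M^2$. In particular, $f$ is a co-orientable frontal.
   Context: $\mathbb{R}^3_1$ is Lorentz-Minkowski $3$-space with the metric $\langle x,y\rangle=-x_0y_0+x_1y_1+x_2y_2$. Maxfaces. For an orientable $2$-manifold $M^2$, a $C^\infty$ map $f:M^2\to\mathbb{R}^3_1$ is a maxface (spacelike maximal surface with admissible singular points) if there is an open dense subset $W\subset M^2$ such that $f|_W$ is a spacelike immersion with zero mean curvature, and every singular point $p$ of $f$ is admissible: (1) on a neighborhood $U$ of $p$ there is a positive $C^1$ function $\beta$ on $U\cap W$ such that $\beta\,ds^2$ extends to a $C^1$ Riemannian metric on $U$, where $ds^2$ is the first fundamental form of $f$; and (2) $df(p)\neq0$. Such an $M^2$ has a complex structure for which $f|_W$ is conformal. For a non-orientable $M^2$, with double covering $\hat\pi:\hat M^2\to M^2$ by an orientable $2$-manifold, a $C^\infty$ map $f:M^2\to\mathbb{R}^3_1$ is a maxface if $f\circ\hat\pi$ is a maxface. Real analyticity refers to the real analytic structure induced by the complex structure of $M^2$ (or $\hat M^2$). A normal vector field of $f$ is a nowhere vanishing vector field $\eta$ along $f$ such that $\eta_p\in T_{f(p)}\mathbb{R}^3_1$ is Lorentzian orthogonal to $df(T_pM^2)$ for all $p\in M^2$. A $C^\infty$ map $f:M^2\to N^3$ is a frontal if it lifts to a $C^\infty$ map $L_f:M^2\to P(T^*N^3)$ whose differential maps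 $TM^2$ into the canonical contact hyperplane field; it is co-orientable if $L_f$ lifts to a $C^\infty$ map into $T^*N^3$. *)

theory Defs
  imports "HOL-Analysis.Analysis"
begin

section \<open>Maps of class C-k between open subsets of vector spaces\<close>

text \<open>Intended for an open domain \<open>S\<close> in a finite-dimensional space.\<close>

primrec Ck_on :: "nat \<Rightarrow> 'a::real_normed_vector set \<Rightarrow> ('a \<Rightarrow> 'b::real_normed_vector) \<Rightarrow> bool"
  where
    "Ck_on 0 S F \<longleftrightarrow> continuous_on S F"
  | "Ck_on (Suc k) S F \<longleftrightarrow>
       F differentiable_on S \<and> (\<forall>v. Ck_on k S (\<lambda>x. frechet_derivative F (at x) v))"

definition smooth_on :: "'a::real_normed_vector set \<Rightarrow> ('a \<Rightarrow> 'b::real_normed_vector) \<Rightarrow> bool"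
  where "smooth_on S F \<longleftrightarrow> (\<forall>k. Ck_on k S F)"

text \<open>Real analyticity in the two real variables \<open>Re z\<close>, \<open>Im z\<close>.\<close>

definition real_analytic_on :: "complex set \<Rightarrow> (complex \<Rightarrow> 'b::real_normed_vector) \<Rightarrow> bool"
  where "real_analytic_on S F \<longleftrightarrow>
    (\<forall>z0\<in>S. \<exists>r>0. \<exists>a :: nat \<Rightarrow> nat \<Rightarrow> 'b. \<forall>z\<in>ball z0 r.
       ((\<lambda>(m, n). (Re (z - z0) ^ m * Im (z - z0) ^ n) *\<^sub>R a m n) has_sum F z) UNIV)"

section \<open>Smooth surfaces\<close>

text \<open>A chart is a pair of its domain and its coordinate map. The model space \<open>\<real>\<^sup>2\<close> is represented
  by the real vector space \<^typ>\<open>complex\<close>, so that the charts of a complex structure are charts of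
  the same type.\<close>

type_synonym 'a chart = "'a set \<times> ('a \<Rightarrow> complex)"

definition is_chart :: "'a topology \<Rightarrow> 'a chart \<Rightarrow> bool"
  where "is_chart X c \<longleftrightarrow>
    openin X (fst c) \<and> open (snd c ` fst c) \<and>
    homeomorphic_map (subtopology X (fst c)) (top_of_set (snd c ` fst c)) (snd c)"

definition local_rep :: "'a chart \<Rightarrow> ('a \<Rightarrow> 'b) \<Rightarrow> complex \<Rightarrow> 'b"
  where "local_rep c f = f \<circ> inv_into (fst c) (snd c)"

definition overlap :: "'a chart \<Rightarrow> 'a chart \<Rightarrow> complex set"
  where "overlap c d = snd c ` (fst c \<inter> fst d)"

definition smoothly_compatible :: "'a chart \<Rightarrow> 'a chart \<Rightarrow> bool"
  where "smoothly_compatible c d \<longleftrightarrow>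
    smooth_on (overlap c d) (local_rep c (snd d)) \<and> smooth_on (overlap d c) (local_rep d (snd c))"

definition smooth_atlas :: "'a topology \<Rightarrow> 'a chart set \<Rightarrow> bool"
  where "smooth_atlas X A \<longleftrightarrow>
    (\<forall>c\<in>A. is_chart X c) \<and> (\<Union>c\<in>A. fst c) = topspace X \<and>
    (\<forall>c\<in>A. \<forall>d\<in>A. smoothly_compatible c d)"

text \<open>The atlas need not be maximal; it stands for the smooth structure it generates.\<close>

definition smooth_2manifold :: "'a topology \<Rightarrow> 'a chart set \<Rightarrow> bool"
  where "smooth_2manifold X A \<longleftrightarrow> Hausdorff_space X \<and> second_countable X \<and> smooth_atlas X A"

definition smooth_map :: "'a chart set \<Rightarrow> ('a \<Rightarrow> 'b::real_normed_vector) \<Rightarrow> bool"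
  where "smooth_map A f \<longleftrightarrow> (\<forall>c\<in>A. smooth_on (snd c ` fst c) (local_rep c f))"

definition jacobian :: "(complex \<Rightarrow> complex) \<Rightarrow> complex \<Rightarrow> real"
  where "jacobian F z =
    (let u = frechet_derivative F (at z) 1; v = frechet_derivative F (at z) \<i>
     in Re u * Im v - Im u * Re v)"

definition orientable :: "'a topology \<Rightarrow> 'a chart set \<Rightarrow> bool"
  where "orientable X A \<longleftrightarrow>
    (\<exists>B. smooth_atlas X B \<and> (\<forall>b\<in>B. \<forall>c\<in>A. smoothly_compatible b c) \<and>
         (\<forall>b\<in>B. \<forall>c\<in>B. \<forall>z\<in>overlap b c. jacobian (local_rep b (snd c)) z > 0))"

text \<open>A smooth two-sheeted covering \<open>\<pi>\<close> of \<open>(X, A)\<close> by \<open>(Y, B)\<close>.\<close>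

definition double_covering ::
    "'b topology \<Rightarrow> 'b chart set \<Rightarrow> ('b \<Rightarrow> 'a) \<Rightarrow> 'a topology \<Rightarrow> 'a chart set \<Rightarrow> bool"
  where "double_covering Y B \<pi> X A \<longleftrightarrow>
    continuous_map Y X \<pi> \<and>
    (\<forall>p\<in>topspace X. \<exists>U V1 V2. openin X U \<and> p \<in> U \<and> openin Y V1 \<and> openin Y V2 \<and>
       V1 \<inter> V2 = {} \<and> V1 \<union> V2 = {q \<in> topspace Y. \<pi> q \<in> U} \<and>
       homeomorphic_map (subtopology Y V1) (subtopology X U) \<pi> \<and>
       homeomorphic_map (subtopology Y V2) (subtopology X U) \<pi>) \<and>
    (\<forall>b\<in>B. \<forall>c\<in>A.
       smooth_on (snd b ` {q \<in> fst b. \<pi> q \<in> fst c}) (local_rep b (snd c \<circ> \<pi>)) \<and>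
       (\<forall>z\<in>snd b ` {q \<in> fst b. \<pi> q \<in> fst c}. jacobian (local_rep b (snd c \<circ> \<pi>)) z \<noteq> 0))"

text \<open>The differential at \<open>p\<close> of a map into a vector space, and its second derivatives, in the
  coordinates of the chart \<open>c\<close>; tangent vectors at \<open>p\<close> are given by their coordinates.\<close>

definition differential :: "'a chart \<Rightarrow> ('a \<Rightarrow> 'b::real_normed_vector) \<Rightarrow> 'a \<Rightarrow> complex \<Rightarrow> 'b"
  where "differential c f p = frechet_derivative (local_rep c f) (at (snd c p))"

definition second_derivative ::
    "'a chart \<Rightarrow> ('a \<Rightarrow> 'b::real_normed_vector) \<Rightarrow> 'a \<Rightarrow> complex \<Rightarrow> complex \<Rightarrow> 'b"
  where "second_derivative c f p v w =
    frechet_derivative (\<lambda>z. frechet_derivative (local_rep c f) (at z) w) (at (snd c p)) v"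

section \<open>Maxfaces in Lorentz-Minkowski space\<close>

text \<open>The coordinates \<open>x\<^sub>0, x\<^sub>1, x\<^sub>2\<close> are the components of \<^typ>\<open>real^3\<close> at the three elements
  \<open>0, 1, 2\<close> of the index type \<^typ>\<open>3\<close> (in which \<open>0 = 3\<close>).\<close>

definition lorentz :: "real^3 \<Rightarrow> real^3 \<Rightarrow> real"
  where "lorentz x y = - (x $ 0) * (y $ 0) + x $ 1 * y $ 1 + x $ 2 * y $ 2"

definition first_form :: "'a chart \<Rightarrow> ('a \<Rightarrow> real^3) \<Rightarrow> 'a \<Rightarrow> complex \<Rightarrow> complex \<Rightarrow> real"
  where "first_form c f p v w = lorentz (differential c f p v) (differential c f p w)"

text \<open>Positive definiteness of the first fundamental form makes \<open>f\<close> an immersion.\<close>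

definition spacelike_immersion_on :: "'a chart set \<Rightarrow> 'a set \<Rightarrow> ('a \<Rightarrow> real^3) \<Rightarrow> bool"
  where "spacelike_immersion_on A W f \<longleftrightarrow>
    (\<forall>c\<in>A. \<forall>p\<in>fst c \<inter> W. \<forall>v. v \<noteq> 0 \<longrightarrow> first_form c f p v v > 0)"

definition unit_normal_at :: "'a chart \<Rightarrow> ('a \<Rightarrow> real^3) \<Rightarrow> 'a \<Rightarrow> real^3 \<Rightarrow> bool"
  where "unit_normal_at c f p \<nu> \<longleftrightarrow>
    lorentz \<nu> \<nu> = -1 \<and> (\<forall>v. lorentz \<nu> (differential c f p v) = 0)"

definition mean_curvature :: "'a chart \<Rightarrow> ('a \<Rightarrow> real^3) \<Rightarrow> 'a \<Rightarrow> real^3 \<Rightarrow> real"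
  where "mean_curvature c f p \<nu> =
    (let E = first_form c f p 1 1; F = first_form c f p 1 \<i>; G = first_form c f p \<i> \<i>;
         L = lorentz (second_derivative c f p 1 1) \<nu>;
         M = lorentz (second_derivative c f p 1 \<i>) \<nu>;
         N = lorentz (second_derivative c f p \<i> \<i>) \<nu>
     in (E * N - 2 * F * M + G * L) / (2 * (E * G - F\<^sup>2)))"

definition zero_mean_curvature_on :: "'a chart set \<Rightarrow> 'a set \<Rightarrow> ('a \<Rightarrow> real^3) \<Rightarrow> bool"
  where "zero_mean_curvature_on A W f \<longleftrightarrow>
    (\<forall>c\<in>A. \<forall>p\<in>fst c \<inter> W. \<forall>\<nu>. unit_normal_at c f p \<nu> \<longrightarrow> mean_curvature c f p \<nu> = 0)"

text \<open>A singular point is a point at which the first fundamental form degenerates. This includes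
  points at which \<open>f\<close> is an immersion with lightlike tangent plane: they are not admissible.\<close>

definition singular_point :: "'a chart set \<Rightarrow> ('a \<Rightarrow> real^3) \<Rightarrow> 'a \<Rightarrow> bool"
  where "singular_point A f p \<longleftrightarrow>
    (\<exists>c\<in>A. p \<in> fst c \<and> (\<exists>v. v \<noteq> 0 \<and> (\<forall>w. first_form c f p v w = 0)))"

definition C1_metric_on :: "complex set \<Rightarrow> (complex \<Rightarrow> complex \<Rightarrow> complex \<Rightarrow> real) \<Rightarrow> bool"
  where "C1_metric_on D g \<longleftrightarrow>
    (\<forall>z\<in>D. bilinear (g z) \<and> (\<forall>v w. g z v w = g z w v) \<and> (\<forall>v. v \<noteq> 0 \<longrightarrow> g z v v > 0)) \<and>
    (\<forall>v w. Ck_on 1 D (\<lambda>z. g z v w))"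

text \<open>The neighborhood \<open>U\<close> is taken inside the domain of a chart, so that the extended metric can be
  written in coordinates; since \<open>U\<close> may be shrunk, this is no restriction.\<close>

definition admissible_point ::
    "'a topology \<Rightarrow> 'a chart set \<Rightarrow> 'a set \<Rightarrow> ('a \<Rightarrow> real^3) \<Rightarrow> 'a \<Rightarrow> bool"
  where "admissible_point X A W f p \<longleftrightarrow>
    (\<exists>c\<in>A. \<exists>U \<beta> g. openin X U \<and> p \<in> U \<and> U \<subseteq> fst c \<and>
       (\<forall>q\<in>U \<inter> W. \<beta> q > (0::real)) \<and> Ck_on 1 (snd c ` (U \<inter> W)) (local_rep c \<beta>) \<and>
       C1_metric_on (snd c ` U) g \<and>
       (\<forall>q\<in>U \<inter> W. \<forall>v w. g (snd c q) v w = \<beta> q * first_form c f q v w)) \<and>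
    (\<exists>c\<in>A. p \<in> fst c \<and> (\<exists>v. differential c f p v \<noteq> 0))"

definition maxface_regular_on ::
    "'a topology \<Rightarrow> 'a chart set \<Rightarrow> 'a set \<Rightarrow> ('a \<Rightarrow> real^3) \<Rightarrow> bool"
  where "maxface_regular_on X A W f \<longleftrightarrow>
    smooth_map A f \<and> openin X W \<and> X closure_of W = topspace X \<and>
    spacelike_immersion_on A W f \<and> zero_mean_curvature_on A W f \<and>
    (\<forall>p\<in>topspace X. singular_point A f p \<longrightarrow> admissible_point X A W f p)"

definition orientable_maxface :: "'a topology \<Rightarrow> 'a chart set \<Rightarrow> ('a \<Rightarrow> real^3) \<Rightarrow> bool"
  where "orientable_maxface X A f \<longleftrightarrow> orientable X A \<and> (\<exists>W. maxface_regular_on X A W f)"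

text \<open>Up to isomorphism, every double covering of \<open>X\<close> has its points in \<^typ>\<open>'a \<times> bool\<close>.\<close>

definition orientable_double_covering ::
    "('a \<times> bool) topology \<Rightarrow> ('a \<times> bool) chart set \<Rightarrow> ('a \<times> bool \<Rightarrow> 'a) \<Rightarrow>
     'a topology \<Rightarrow> 'a chart set \<Rightarrow> bool"
  where "orientable_double_covering Y B \<pi> X A \<longleftrightarrow>
    smooth_2manifold Y B \<and> orientable Y B \<and> double_covering Y B \<pi> X A"

definition maxface :: "'a topology \<Rightarrow> 'a chart set \<Rightarrow> ('a \<Rightarrow> real^3) \<Rightarrow> bool"
  where "maxface X A f \<longleftrightarrow>
    (if orientable X A then orientable_maxface X A f
     else smooth_map A f \<and>
       (\<exists>Y B \<pi>. orientable_double_covering Y B \<pi> X A \<and> orientable_maxface Y B (f \<circ> \<pi>)))"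

section \<open>The complex structure and real analyticity\<close>

text \<open>A complex structure on the smooth surface \<open>(X, A)\<close>: a holomorphic atlas consisting of charts of
  the given smooth structure.\<close>

definition complex_structure :: "'a topology \<Rightarrow> 'a chart set \<Rightarrow> 'a chart set \<Rightarrow> bool"
  where "complex_structure X A H \<longleftrightarrow>
    smooth_atlas X H \<and> (\<forall>h\<in>H. \<forall>c\<in>A. smoothly_compatible h c) \<and>
    (\<forall>h\<in>H. \<forall>k\<in>H. local_rep h (snd k) holomorphic_on overlap h k)"

definition conformal_on :: "'a chart set \<Rightarrow> 'a set \<Rightarrow> ('a \<Rightarrow> real^3) \<Rightarrow> bool"
  where "conformal_on H W f \<longleftrightarrow>
    (\<forall>h\<in>H. \<forall>p\<in>fst h \<inter> W. \<exists>\<rho>>0. \<forall>v w. first_form h f p v w = \<rho> * (v \<bullet> w))"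

text \<open>By density of \<open>W\<close> the choice of \<open>W\<close> does not matter, and on a connected surface the complex
  structure is unique up to conjugation, which does not affect real analyticity.\<close>

definition maxface_complex_structure ::
    "'a topology \<Rightarrow> 'a chart set \<Rightarrow> ('a \<Rightarrow> real^3) \<Rightarrow> 'a chart set \<Rightarrow> bool"
  where "maxface_complex_structure X A f H \<longleftrightarrow>
    complex_structure X A H \<and> (\<exists>W. maxface_regular_on X A W f \<and> conformal_on H W f)"

definition real_analytic_map :: "'a chart set \<Rightarrow> ('a \<Rightarrow> 'b::real_normed_vector) \<Rightarrow> bool"
  where "real_analytic_map H \<eta> \<longleftrightarrow> (\<forall>h\<in>H. real_analytic_on (snd h ` fst h) (local_rep h \<eta>))"

definition maxface_real_analytic ::
    "'a topology \<Rightarrow> 'a chart set \<Rightarrow> ('a \<Rightarrow> real^3) \<Rightarrow> ('a \<Rightarrow> real^3) \<Rightarrow> bool"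
  where "maxface_real_analytic X A f \<eta> \<longleftrightarrow>
    (if orientable X A
     then \<exists>H. maxface_complex_structure X A f H \<and> real_analytic_map H \<eta>
     else \<exists>Y B \<pi> H. orientable_double_covering Y B \<pi> X A \<and>
            maxface_complex_structure Y B (f \<circ> \<pi>) H \<and> real_analytic_map H (\<eta> \<circ> \<pi>))"

text \<open>The tangent spaces of \<^typ>\<open>real^3\<close> are identified with \<^typ>\<open>real^3\<close>.\<close>

definition normal_vector_field ::
    "'a topology \<Rightarrow> 'a chart set \<Rightarrow> ('a \<Rightarrow> real^3) \<Rightarrow> ('a \<Rightarrow> real^3) \<Rightarrow> bool"
  where "normal_vector_field X A f \<eta> \<longleftrightarrow>
    (\<forall>p\<in>topspace X. \<eta> p \<noteq> 0) \<and>
    (\<forall>c\<in>A. \<forall>p\<in>fst c. \<forall>v. lorentz (\<eta> p) (differential c f p v) = 0)"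

section \<open>Frontals\<close>

text \<open>For \<open>N = \<real>\<^sup>3\<close> the bundle \<open>T\<^sup>*N\<close> is \<open>\<real>\<^sup>3 \<times> (\<real>\<^sup>3)\<^sup>*\<close>. A covector \<open>\<xi>\<close> is represented by its
  coefficients with respect to \<open>dx\<^sub>0, dx\<^sub>1, dx\<^sub>2\<close>, so that its value on a tangent vector \<open>v\<close> is
  \<open>\<xi> \<bullet> v\<close> (the Lorentz product plays no role here). The fibres of \<open>P(T\<^sup>*N)\<close> consist of the lines
  through the origin of the covector space; \<open>affine_point i\<close> gives the coordinates of the affine
  chart \<open>affine_lines i\<close> of this projective plane.\<close>

definition proj_line :: "(real^3) set \<Rightarrow> bool"
  where "proj_line l \<longleftrightarrow> (\<exists>\<xi>. \<xi> \<noteq> 0 \<and> l = span {\<xi>})"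

definition affine_lines :: "3 \<Rightarrow> (real^3) set set"
  where "affine_lines i = {l. proj_line l \<and> (\<exists>\<xi>\<in>l. \<xi> $ i \<noteq> 0)}"

definition affine_point :: "3 \<Rightarrow> (real^3) set \<Rightarrow> real^3"
  where "affine_point i l = (THE \<xi>. \<xi> \<in> l \<and> \<xi> $ i = 1)"

definition smooth_map_PT ::
    "'a topology \<Rightarrow> 'a chart set \<Rightarrow> ('a \<Rightarrow> (real^3) \<times> (real^3) set) \<Rightarrow> bool"
  where "smooth_map_PT X A \<Lambda> \<longleftrightarrow>
    smooth_map A (\<lambda>p. fst (\<Lambda> p)) \<and> (\<forall>p\<in>topspace X. proj_line (snd (\<Lambda> p))) \<and>
    (\<forall>i. openin X {p \<in> topspace X. snd (\<Lambda> p) \<in> affine_lines i} \<and>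
         (\<forall>c\<in>A. smooth_on (snd c ` {p \<in> fst c. snd (\<Lambda> p) \<in> affine_lines i})
                   (local_rep c (\<lambda>p. affine_point i (snd (\<Lambda> p))))))"

text \<open>The contact hyperplane at \<open>(x, l)\<close> consists of the tangent vectors of \<open>P(T\<^sup>*N)\<close> whose projection
  to \<open>N\<close> is annihilated by the covectors in \<open>l\<close>.\<close>

definition contact_tangent :: "'a chart set \<Rightarrow> ('a \<Rightarrow> (real^3) \<times> (real^3) set) \<Rightarrow> bool"
  where "contact_tangent A \<Lambda> \<longleftrightarrow>
    (\<forall>c\<in>A. \<forall>p\<in>fst c. \<forall>v. \<forall>\<xi>\<in>snd (\<Lambda> p). \<xi> \<bullet> differential c (\<lambda>q. fst (\<Lambda> q)) p v = 0)"

definition frontal_lift ::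
    "'a topology \<Rightarrow> 'a chart set \<Rightarrow> ('a \<Rightarrow> real^3) \<Rightarrow> ('a \<Rightarrow> (real^3) \<times> (real^3) set) \<Rightarrow> bool"
  where "frontal_lift X A f \<Lambda> \<longleftrightarrow>
    smooth_map_PT X A \<Lambda> \<and> (\<forall>p\<in>topspace X. fst (\<Lambda> p) = f p) \<and> contact_tangent A \<Lambda>"

definition frontal :: "'a topology \<Rightarrow> 'a chart set \<Rightarrow> ('a \<Rightarrow> real^3) \<Rightarrow> bool"
  where "frontal X A f \<longleftrightarrow> smooth_map A f \<and> (\<exists>\<Lambda>. frontal_lift X A f \<Lambda>)"

definition co_orientable_frontal :: "'a topology \<Rightarrow> 'a chart set \<Rightarrow> ('a \<Rightarrow> real^3) \<Rightarrow> bool"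
  where "co_orientable_frontal X A f \<longleftrightarrow> smooth_map A f \<and>
    (\<exists>\<Lambda>. frontal_lift X A f \<Lambda> \<and>
       (\<exists>\<mu> :: 'a \<Rightarrow> (real^3) \<times> (real^3). smooth_map A \<mu> \<and>
          (\<forall>p\<in>topspace X. snd (\<mu> p) \<noteq> 0 \<and> \<Lambda> p = (fst (\<mu> p), span {snd (\<mu> p)}))))"

end

theory Submission
  imports Defs "HOL-Complex_Analysis.Complex_Analysis"
begin

text \<open>Near a point \<open>p\<close> one of the components \<open>f\<^sub>1\<close>, \<open>f\<^sub>2\<close> has non-zero differential. Vanishing mean
  curvature says that the conjugate differentials of the components of \<open>f\<close> are closed, first on the
  dense set \<open>W\<close> and then everywhere by continuity, so that the components are real parts of isotropic
  primitives. That of the chosen component is a conformal coordinate \<open>z\<close>. In null coordinates for the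
  other two components \<open>df\<close> is given by \<open>Re (\<mu> dz)\<close>, \<open>Re (dz / \<mu>)\<close> and \<open>Re dz\<close> with \<open>\<mu>\<close> holomorphic in
  \<open>z\<close>, and up to the order and sign of the last two entries
  \<open>(1, 2 Re \<mu> / (\<bar>\<mu>\<bar>\<^sup>2 + 1), (\<bar>\<mu>\<bar>\<^sup>2 - 1) / (\<bar>\<mu>\<bar>\<^sup>2 + 1))\<close> is a normal vector, real analytic in \<open>z\<close>. At regular points
  it is the only normal vector with time component \<open>1\<close>, so by density of \<open>W\<close> the local fields glue,
  and they descend along the orientable double covering.

  A priori \<open>z\<close> is only \<open>C\<^sup>2\<close> in the given coordinates, because the conformal metric is only \<open>C\<^sup>1\<close>.
  Its smoothness comes from the fact that \<open>f\<close> is singular exactly where the harmonic function \<open>Im \<mu>\<close>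
  vanishes: a continuous quotient of smooth functions by one which, in a suitable sense, has the
  zeros of a harmonic function is itself smooth.\<close>

section \<open>Calculus of smooth maps\<close>

text \<open>What lets a normal field cross the singular set is its normalization. The normal vector
  written in terms of \<mu> has Lorentz square \<open>- 4 * (Im \<mu>)\<^sup>2 / (1 +
  \<bar>\<mu>\<bar>\<^sup>2)\<^sup>2\<close>. So the unit normal blows up where \<mu> becomes real,
  while the multiple with time component 1 merely turns lightlike. Fixing the time component also
  fixes the sign without any reference to an orientation of the surface, and therefore the two
  points over a point of a non-orientable surface carry the same vector. The main obstacle is not
  analyticity in z but membership of z in the given smooth structure. Each unknown (|\<mu>|^2, Re
  \<mu>, the Jacobian J of z, the differential of z) is reached through continuous quotients by the
  smooth function D = J Im \<mu>, a 2x2 minor of df. Since z enters only through its differential at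
  one point and J only as a continuous factor, all that is known of D there are its leading terms
  along straight lines. They suffice: the leading form has distinct real slopes, and each slope
  yields one smooth zero curve of D.\<close>

abbreviation fderiv :: "('a::real_normed_vector \<Rightarrow> 'b::real_normed_vector) \<Rightarrow> 'a \<Rightarrow> 'a \<Rightarrow> 'b"
  where "fderiv F x \<equiv> frechet_derivative F (at x)"

text \<open>The recursion differentiates with \<open>at x\<close>; on an open set equal values force
  equal derivatives, so the agreement passes to each further order.\<close>

lemma Ck_on_cong:
  assumes "open S" "\<And>x. x \<in> S \<Longrightarrow> F x = G x"
  shows "Ck_on k S F \<longleftrightarrow> Ck_on k S G"
proof -
  have *: "Ck_on k S G" if "Ck_on k S F" "\<And>x. x \<in> S \<Longrightarrow> F x = G x" for F G
    using that
  proof (induction k arbitrary: F G)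
    case 0
    then show ?case using continuous_on_cong by force
  next
    case (Suc k)
    have d: "(F has_derivative fderiv F x) (at x)" if "x \<in> S" for x
      using Suc.prems(1) that differentiable_on_eq_differentiable_at[OF assms(1)] frechet_derivative_works
      by (metis Ck_on.simps(2))
    have dG: "(G has_derivative fderiv F x) (at x)" if "x \<in> S" for x
      using has_derivative_transform_within_open[OF d[OF that] assms(1) that] Suc.prems(2) by blast
    then have "fderiv G x = fderiv F x" if "x \<in> S" for x
      using frechet_derivative_at that by fastforce
    moreover have "G differentiable_on S"
      using dG assms(1) differentiable_on_eq_differentiable_at differentiable_def by blast
    moreover have "Ck_on k S (\<lambda>x. fderiv G x v)" for v
      using Suc.IH[of "\<lambda>x. fderiv F x v"] Suc.prems(1) calculation(1) by simp
    ultimately show ?case by simp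
  qed
  show ?thesis using *[of F G] *[of G F] assms(2) by metis
qed

text \<open>Derivatives are unique, so any explicit formula \<open>F'\<close> may replace the choice
  operator \<open>frechet_derivative\<close> of the recursion. Most closure properties below are
  obtained through this rule.\<close>

lemma Ck_on_SucI:
  assumes "open S" "\<And>x. x \<in> S \<Longrightarrow> (F has_derivative F' x) (at x)" "\<And>v. Ck_on k S (\<lambda>x. F' x v)"
  shows "Ck_on (Suc k) S F"
proof -
  have "F differentiable_on S"
    using assms differentiable_on_eq_differentiable_at differentiable_def by blast
  moreover have "Ck_on k S (\<lambda>x. fderiv F x v)" for v
    using assms(3) by (subst Ck_on_cong[OF assms(1), where G = "\<lambda>x. F' x v"])
      (use assms(2) frechet_derivative_at in \<open>fastforce+\<close>)
  ultimately show ?thesis by simp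
qed

lemma Ck_on_SucD:
  assumes "open S" "Ck_on (Suc k) S F" "x \<in> S"
  shows "(F has_derivative fderiv F x) (at x)"
  using assms(2,3) differentiable_on_eq_differentiable_at[OF assms(1)] frechet_derivative_works
  by (metis Ck_on.simps(2))

lemma Ck_on_Suc_mono: "Ck_on (Suc k) S F \<Longrightarrow> Ck_on k S F"
proof (induction k arbitrary: F)
  case 0
  then show ?case by (simp add: differentiable_imp_continuous_on)
next
  case (Suc k)
  then show ?case by (metis Ck_on.simps(2))
qed

lemma Ck_on_le: "Ck_on k S F \<Longrightarrow> j \<le> k \<Longrightarrow> Ck_on j S F"
  by (induction k) (auto simp: le_Suc_eq simp del: Ck_on.simps dest: Ck_on_Suc_mono)

lemma Ck_on_continuous: "Ck_on k S F \<Longrightarrow> continuous_on S F"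
  using Ck_on_le[of k S F 0] by simp

lemma Ck_on_subset: "Ck_on k S F \<Longrightarrow> T \<subseteq> S \<Longrightarrow> Ck_on k T F"
  by (induction k arbitrary: F) (auto intro: continuous_on_subset differentiable_on_subset)

lemma Ck_on_local:
  assumes "open S" "\<And>x. x \<in> S \<Longrightarrow> \<exists>T. open T \<and> x \<in> T \<and> Ck_on k T F"
  shows "Ck_on k S F"
  using assms(2)
proof (induction k arbitrary: F)
  case 0
  show ?case unfolding Ck_on.simps continuous_on_eq_continuous_at[OF assms(1)]
  proof
    fix x assume "x \<in> S"
    then obtain T where "open T" "x \<in> T" "Ck_on 0 T F" using 0 by blast
    then show "isCont F x" by (simp add: continuous_on_eq_continuous_at)
  qed
next
  case (Suc k)
  have "F differentiable_on S" unfolding differentiable_on_eq_differentiable_at[OF assms(1)]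
  proof
    fix x assume "x \<in> S"
    then obtain T where "open T" "x \<in> T" "Ck_on (Suc k) T F" using Suc by blast
    then show "F differentiable (at x)" by (simp add: differentiable_on_eq_differentiable_at)
  qed
  moreover have "Ck_on k S (\<lambda>x. fderiv F x v)" for v
    using Suc.prems by (intro Suc.IH) fastforce
  ultimately show ?case by simp
qed

lemma Ck_on_const: "Ck_on k S (\<lambda>x. c)"
  by (induction k arbitrary: c) (auto simp: frechet_derivative_const)

lemma Ck_on_add:
  assumes "open S" "Ck_on k S F" "Ck_on k S G"
  shows "Ck_on k S (\<lambda>x. F x + G x)"
  using assms(2,3)
proof (induction k arbitrary: F G)
  case 0
  then show ?case by (simp add: continuous_on_add)
next
  case (Suc k)
  show ?case
    by (rule Ck_on_SucI[OF assms(1) has_derivative_add[OF Ck_on_SucD[OF assms(1) Suc.prems(1)]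
            Ck_on_SucD[OF assms(1) Suc.prems(2)]]]) (use Suc in auto)
qed

lemma Ck_on_sum:
  assumes "open S" "\<And>i. i \<in> I \<Longrightarrow> Ck_on k S (F i)"
  shows "Ck_on k S (\<lambda>x. \<Sum>i\<in>I. F i x)"
  using assms(2)
  by (induction I rule: infinite_finite_induct) (auto simp: Ck_on_const Ck_on_add assms(1))

lemma (in bounded_bilinear) Ck_on_prod:
  assumes "open S" "Ck_on k S F" "Ck_on k S G"
  shows "Ck_on k S (\<lambda>x. prod (F x) (G x))"
  using assms(2,3)
proof (induction k arbitrary: F G)
  case 0
  then show ?case by (simp add: continuous_on)
next
  case (Suc k)
  have *: "Ck_on k S (\<lambda>x. fderiv F x v)" "Ck_on k S (\<lambda>x. fderiv G x v)" for v
    using Suc.prems by auto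
  have "Ck_on k S (\<lambda>x. prod (F x) (fderiv G x v) + prod (fderiv F x v) (G x))" for v
    by (intro Ck_on_add assms(1) Suc.IH * Suc.prems[THEN Ck_on_Suc_mono])
  then show ?case
    using Ck_on_SucI[OF assms(1) FDERIV[OF Ck_on_SucD[OF assms(1) Suc.prems(1)]
            Ck_on_SucD[OF assms(1) Suc.prems(2)]]] by blast
qed

lemma Ck_on_linear:
  assumes "open S" "bounded_linear L" "Ck_on k S F"
  shows "Ck_on k S (\<lambda>x. L (F x))"
  using assms(3)
proof (induction k arbitrary: F)
  case 0
  then show ?case using bounded_linear.continuous_on[OF assms(2)] by simp
next
  case (Suc k)
  show ?case
    by (rule Ck_on_SucI[OF assms(1) bounded_linear.has_derivative[OF assms(2) Ck_on_SucD[OF assms(1) Suc.prems]]])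
      (use Suc in auto)
qed

lemma Ck_on_id: "open S \<Longrightarrow> Ck_on k S (\<lambda>x. x)"
  by (cases k) (simp_all only: Ck_on.simps(1) continuous_on_id Ck_on_SucI[OF _ has_derivative_ident] Ck_on_const)

lemma frechet_derivative_Basis_sum:
  fixes F :: "'a::euclidean_space \<Rightarrow> 'b::real_normed_vector"
  assumes "(F has_derivative F') (at x)"
  shows "F' v = (\<Sum>i\<in>Basis. (v \<bullet> i) *\<^sub>R F' i)"
proof -
  have "linear F'" using assms has_derivative_linear by blast
  then show ?thesis
    by (metis (no_types, lifting) euclidean_representation linear_sum linear_cmul sum.cong)
qed

text \<open>The derivative of the composite applies \<open>fderiv F (G x)\<close> to a direction
  that itself varies with \<open>x\<close>, whereas the recursion controls only fixed directions.
  Expanding that direction in the finite basis of the middle space leaves sums of products; this is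
  why the middle space is Euclidean.\<close>

lemma Ck_on_compose:
  fixes F :: "'b::euclidean_space \<Rightarrow> 'c::real_normed_vector" and G :: "'a::real_normed_vector \<Rightarrow> 'b"
  assumes "open S" "open T" "Ck_on k T F" "Ck_on k S G" "\<And>x. x \<in> S \<Longrightarrow> G x \<in> T"
  shows "Ck_on k S (\<lambda>x. F (G x))"
  using assms(3,4)
proof (induction k arbitrary: F)
  case 0
  then show ?case using continuous_on_compose2[of T F S G] assms(5) by auto
next
  case (Suc k)
  let ?F' = "\<lambda>y. fderiv F y" and ?G' = "\<lambda>x. fderiv G x"
  have dF: "(F has_derivative ?F' y) (at y)" if "y \<in> T" for y
    using Ck_on_SucD[OF assms(2) Suc.prems(1) that] .
  have d: "((\<lambda>x. F (G x)) has_derivative (\<lambda>v. ?F' (G x) (?G' x v))) (at x)" if "x \<in> S" for x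
    using has_derivative_compose[OF Ck_on_SucD[OF assms(1) Suc.prems(2) that] dF] assms(5) that by blast
  have "Ck_on k S (\<lambda>x. ?F' (G x) (?G' x v))" for v
  proof (subst Ck_on_cong[OF assms(1)])
    show "?F' (G x) (?G' x v) = (\<Sum>i\<in>Basis. (?G' x v \<bullet> i) *\<^sub>R ?F' (G x) i)" if "x \<in> S" for x
      using frechet_derivative_Basis_sum[OF dF] assms(5) that by blast
    show "Ck_on k S (\<lambda>x. \<Sum>i\<in>Basis. (?G' x v \<bullet> i) *\<^sub>R ?F' (G x) i)"
      by (intro Ck_on_sum bounded_bilinear.Ck_on_prod[OF bounded_bilinear_scaleR]
          Ck_on_linear[OF assms(1) bounded_linear_inner_left] assms(1) Suc.IH Suc.prems(2)[THEN Ck_on_Suc_mono])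
       (use Suc.prems in auto)
  qed
  then show ?case using Ck_on_SucI[OF assms(1) d] by blast
qed

lemma Ck_on_inverse:
  fixes F :: "'a::real_normed_vector \<Rightarrow> 'b::real_normed_div_algebra"
  assumes "open S" "Ck_on k S F" "\<And>x. x \<in> S \<Longrightarrow> F x \<noteq> 0"
  shows "Ck_on k S (\<lambda>x. inverse (F x))"
  using assms(2)
proof (induction k)
  case 0
  then show ?case using assms(3) by (auto intro!: continuous_intros)
next
  case (Suc k)
  have d: "((\<lambda>x. inverse (F x)) has_derivative
     (\<lambda>v. - (inverse (F x) * fderiv F x v * inverse (F x)))) (at x)" if "x \<in> S" for x
    using Deriv.has_derivative_inverse[OF assms(3)[OF that] Ck_on_SucD[OF assms(1) Suc.prems that]] .
  have "Ck_on k S (\<lambda>x. - (inverse (F x) * fderiv F x v * inverse (F x)))" for v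
    by (intro Ck_on_linear[OF assms(1) bounded_linear_minus[OF bounded_linear_ident]]
        bounded_bilinear.Ck_on_prod[OF bounded_bilinear_mult] assms(1) Suc.IH Suc.prems[THEN Ck_on_Suc_mono])
      (use Suc.prems in auto)
  then show ?case using Ck_on_SucI[OF assms(1) d] by blast
qed

lemma Ck_on_sqrt:
  assumes "open S" "Ck_on k S F" "\<And>x. x \<in> S \<Longrightarrow> F x > 0"
  shows "Ck_on k S (\<lambda>x. sqrt (F x))"
  using assms(2)
proof (induction k)
  case 0
  then show ?case by (auto intro!: continuous_intros)
next
  case (Suc k)
  have d: "((\<lambda>x. sqrt (F x)) has_derivative
     (\<lambda>v. fderiv F x v * (inverse (sqrt (F x)) * (1/2)))) (at x)" if "x \<in> S" for x
    by (rule has_derivative_eq_rhs[OF has_derivative_real_sqrt[OF assms(3)[OF that] Ck_on_SucD[OF assms(1) Suc.prems that]]])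
      (rule ext, simp)
  have nz: "sqrt (F x) \<noteq> 0" if "x \<in> S" for x using assms(3)[OF that] by simp
  have *: "Ck_on k S (\<lambda>x. fderiv F x v)" for v using Suc.prems by simp
  have "Ck_on k S (\<lambda>x. fderiv F x v * (inverse (sqrt (F x)) * (1/2)))" for v
    by (intro bounded_bilinear.Ck_on_prod[OF bounded_bilinear_mult] assms(1) Suc.IH
       Suc.prems[THEN Ck_on_Suc_mono] Ck_on_inverse Ck_on_const nz *)
  then show ?case using Ck_on_SucI[OF assms(1) d] by blast
qed

section \<open>Closure properties of smooth maps\<close>

lemma smooth_onD: "smooth_on S F \<Longrightarrow> Ck_on k S F"
  by (simp add: smooth_on_def)

lemma smooth_on_cong: "open S \<Longrightarrow> (\<And>x. x \<in> S \<Longrightarrow> F x = G x) \<Longrightarrow> smooth_on S F \<longleftrightarrow> smooth_on S G"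
  unfolding smooth_on_def using Ck_on_cong by blast

lemma smooth_on_subset: "smooth_on S F \<Longrightarrow> T \<subseteq> S \<Longrightarrow> smooth_on T F"
  unfolding smooth_on_def using Ck_on_subset by blast

lemma smooth_on_continuous: "smooth_on S F \<Longrightarrow> continuous_on S F"
  unfolding smooth_on_def using Ck_on_continuous by blast

lemma smooth_on_local:
  "open S \<Longrightarrow> (\<And>x. x \<in> S \<Longrightarrow> \<exists>T. open T \<and> x \<in> T \<and> smooth_on T F) \<Longrightarrow> smooth_on S F"
  unfolding smooth_on_def by (meson Ck_on_local)

lemma smooth_on_const: "smooth_on S (\<lambda>x. c)"
  by (simp add: smooth_on_def Ck_on_const)

lemma smooth_on_id: "open S \<Longrightarrow> smooth_on S (\<lambda>x. x)"
  by (simp add: smooth_on_def Ck_on_id)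

lemma smooth_on_linear: "open S \<Longrightarrow> bounded_linear L \<Longrightarrow> smooth_on S F \<Longrightarrow> smooth_on S (\<lambda>x. L (F x))"
  by (simp add: smooth_on_def Ck_on_linear)

lemmas smooth_on_Re = smooth_on_linear[OF _ bounded_linear_Re]
lemmas smooth_on_Im = smooth_on_linear[OF _ bounded_linear_Im]
lemmas smooth_on_of_real = smooth_on_linear[OF _ bounded_linear_of_real]
lemmas smooth_on_cnj = smooth_on_linear[OF _ bounded_linear_cnj]
lemmas smooth_on_minus = smooth_on_linear[OF _ bounded_linear_minus[OF bounded_linear_ident]]
lemmas smooth_on_vec_nth = smooth_on_linear[OF _ bounded_linear_vec_nth]

lemma smooth_on_add: "open S \<Longrightarrow> smooth_on S F \<Longrightarrow> smooth_on S G \<Longrightarrow> smooth_on S (\<lambda>x. F x + G x)"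
  by (simp add: smooth_on_def Ck_on_add)

lemma smooth_on_diff: "open S \<Longrightarrow> smooth_on S F \<Longrightarrow> smooth_on S G \<Longrightarrow> smooth_on S (\<lambda>x. F x - G x)"
  using smooth_on_add[of S F "\<lambda>x. - G x"] smooth_on_minus[of S G] by simp

lemma smooth_on_sum: "open S \<Longrightarrow> (\<And>i. i \<in> I \<Longrightarrow> smooth_on S (F i)) \<Longrightarrow> smooth_on S (\<lambda>x. \<Sum>i\<in>I. F i x)"
  by (simp add: smooth_on_def Ck_on_sum)

lemma smooth_on_scaleR:
  "open S \<Longrightarrow> smooth_on S F \<Longrightarrow> smooth_on S G \<Longrightarrow> smooth_on S (\<lambda>x. F x *\<^sub>R G x)"
  by (simp add: smooth_on_def bounded_bilinear.Ck_on_prod[OF bounded_bilinear_scaleR])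

lemma smooth_on_mult:
  fixes F :: "_ \<Rightarrow> 'b::real_normed_algebra"
  shows "open S \<Longrightarrow> smooth_on S F \<Longrightarrow> smooth_on S G \<Longrightarrow> smooth_on S (\<lambda>x. F x * G x)"
  by (simp add: smooth_on_def bounded_bilinear.Ck_on_prod[OF bounded_bilinear_mult])

lemma smooth_on_inverse:
  fixes F :: "_ \<Rightarrow> 'b::real_normed_div_algebra"
  shows "open S \<Longrightarrow> smooth_on S F \<Longrightarrow> (\<And>x. x \<in> S \<Longrightarrow> F x \<noteq> 0) \<Longrightarrow> smooth_on S (\<lambda>x. inverse (F x))"
  by (simp add: smooth_on_def Ck_on_inverse)

lemma smooth_on_divide:
  fixes F :: "_ \<Rightarrow> 'b::real_normed_field"
  shows "open S \<Longrightarrow> smooth_on S F \<Longrightarrow> smooth_on S G \<Longrightarrow> (\<And>x. x \<in> S \<Longrightarrow> G x \<noteq> 0)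
    \<Longrightarrow> smooth_on S (\<lambda>x. F x / G x)"
  by (simp add: divide_inverse smooth_on_mult smooth_on_inverse)

lemma smooth_on_sqrt:
  "open S \<Longrightarrow> smooth_on S F \<Longrightarrow> (\<And>x. x \<in> S \<Longrightarrow> F x > 0) \<Longrightarrow> smooth_on S (\<lambda>x. sqrt (F x))"
  by (simp add: smooth_on_def Ck_on_sqrt)

lemma smooth_on_Complex:
  assumes "open S" "smooth_on S F" "smooth_on S G"
  shows "smooth_on S (\<lambda>x. Complex (F x) (G x))"
  unfolding Complex_eq by (intro smooth_on_add smooth_on_mult smooth_on_of_real smooth_on_const assms)

lemma smooth_on_vec:
  fixes F :: "'a::real_normed_vector \<Rightarrow> real^'n"
  assumes "open S" "\<And>i. smooth_on S (\<lambda>x. F x $ i)"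
  shows "smooth_on S F"
proof -
  have "F = (\<lambda>x. \<Sum>i\<in>UNIV. (F x $ i) *\<^sub>R axis i 1)"
    by (simp add: fun_eq_iff vec_eq_iff axis_def if_distrib cong: if_cong)
  moreover have "smooth_on S (\<lambda>x. \<Sum>i\<in>UNIV. (F x $ i) *\<^sub>R axis i (1::real))"
    by (intro smooth_on_sum smooth_on_scaleR smooth_on_const assms)
  ultimately show ?thesis by metis
qed

lemma smooth_on_Pair:
  assumes "open S" "smooth_on S F" "smooth_on S G"
  shows "smooth_on S (\<lambda>x. (F x, G x))"
proof -
  have "smooth_on S (\<lambda>x. (F x, 0) + (0, G x))"
    by (intro smooth_on_add assms smooth_on_linear[OF _ bounded_linear_Pair[OF bounded_linear_ident bounded_linear_zero]]
      smooth_on_linear[OF _ bounded_linear_Pair[OF bounded_linear_zero bounded_linear_ident]])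
  then show ?thesis by simp
qed

lemma smooth_on_compose:
  fixes F :: "'b::euclidean_space \<Rightarrow> 'c::real_normed_vector"
  assumes "open S" "open T" "smooth_on T F" "smooth_on S G" "\<And>x. x \<in> S \<Longrightarrow> G x \<in> T"
  shows "smooth_on S (\<lambda>x. F (G x))"
  using assms unfolding smooth_on_def by (metis Ck_on_compose)

lemma smooth_on_frechet: "smooth_on S F \<Longrightarrow> smooth_on S (\<lambda>x. fderiv F x v)"
  unfolding smooth_on_def by (metis Ck_on.simps(2))

lemma smooth_on_has_derivative:
  "open S \<Longrightarrow> smooth_on S F \<Longrightarrow> x \<in> S \<Longrightarrow> (F has_derivative fderiv F x) (at x)"
  unfolding smooth_on_def using Ck_on_SucD by blast

lemma smooth_onI_derivative:
  assumes "open S" "\<And>x. x \<in> S \<Longrightarrow> (F has_derivative F' x) (at x)" "\<And>v. smooth_on S (\<lambda>x. F' x v)"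
  shows "smooth_on S F"
  unfolding smooth_on_def
proof
  fix k show "Ck_on k S F"
    by (rule Ck_on_Suc_mono[OF Ck_on_SucI[OF assms(1,2)]]) (use assms(3) in \<open>auto simp: smooth_on_def\<close>)
qed

lemma complex_linear_expand:
  fixes L :: "complex \<Rightarrow> 'b::real_vector"
  assumes "linear L"
  shows "L v = Re v *\<^sub>R L 1 + Im v *\<^sub>R L \<i>"
proof -
  have "v = Re v *\<^sub>R 1 + Im v *\<^sub>R \<i>" by (simp add: complex_eq_iff)
  then show ?thesis by (metis assms linear_add linear_cmul)
qed

lemma smooth_onI_partials:
  fixes F :: "complex \<Rightarrow> 'b::real_normed_vector"
  assumes S: "open S" and "\<And>x. x \<in> S \<Longrightarrow> (F has_derivative (\<lambda>v. Re v *\<^sub>R a x + Im v *\<^sub>R b x)) (at x)"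
    and "smooth_on S a" "smooth_on S b"
  shows "smooth_on S F"
  by (rule smooth_onI_derivative[OF assms(1,2)])
    (auto intro!: smooth_on_add smooth_on_scaleR S assms smooth_on_const)

section \<open>Inverse functions\<close>

text \<open>The determinant of the 2x2 matrix with columns \<open>a\<close> and
  \<open>b\<close>.\<close>

definition cross2 :: "complex \<Rightarrow> complex \<Rightarrow> real"
  where "cross2 a b = Re a * Im b - Im a * Re b"

lemma jacobian_cross2:
  "jacobian F z = cross2 (fderiv F z 1) (fderiv F z \<i>)"
  by (simp add: jacobian_def cross2_def Let_def)

text \<open>Cramer's rule writes the derivative of the inverse out in terms of \<open>a\<close> and
  \<open>b\<close>, which is the form that the bootstrap of the next lemma can differentiate again.
  Of the regularity of \<open>F\<close> only differentiability at the single point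
  \<open>G y\<close> enters.\<close>

lemma has_derivative_local_inverse:
  fixes F G :: "complex \<Rightarrow> complex"
  assumes "open T" "y \<in> T" "continuous_on T G" "\<And>x. x \<in> T \<Longrightarrow> F (G x) = x"
    and dF: "(F has_derivative (\<lambda>v. Re v *\<^sub>R a + Im v *\<^sub>R b)) (at (G y))" and J: "cross2 a b \<noteq> 0"
  shows "(G has_derivative (\<lambda>v. Complex (cross2 v b / cross2 a b) (cross2 a v / cross2 a b))) (at y)"
proof (rule has_derivative_inverse_basic[where f = F and g = G and y = y, OF dF])
  show "bounded_linear (\<lambda>v. Complex (cross2 v b / cross2 a b) (cross2 a v / cross2 a b))"
    unfolding linear_conv_bounded_linear[symmetric]
    by unfold_locales (auto simp: complex_eq_iff cross2_def field_simps add_divide_distrib diff_divide_distrib)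
  show "(\<lambda>v. Complex (cross2 v b / cross2 a b) (cross2 a v / cross2 a b)) \<circ> (\<lambda>v. Re v *\<^sub>R a + Im v *\<^sub>R b) = id"
    using J by (auto simp: fun_eq_iff complex_eq_iff cross2_def divide_simps) (auto simp: algebra_simps)
  show "continuous (at y) G" using assms by (simp add: continuous_on_eq_continuous_at)
qed (use assms in auto)

text \<open>Bootstrap: if \<open>G\<close> is of class C-k, then so are the partials of
  \<open>F\<close> along \<open>G\<close>, hence by Cramer's rule the derivative of
  \<open>G\<close>, and \<open>G\<close> gains one order.\<close>

lemma smooth_on_local_inverse:
  fixes F G :: "complex \<Rightarrow> complex"
  assumes "open S" "open T" "smooth_on S F" "continuous_on T G" "\<And>y. y \<in> T \<Longrightarrow> G y \<in> S"
    and FG: "\<And>y. y \<in> T \<Longrightarrow> F (G y) = y" and J: "\<And>x. x \<in> S \<Longrightarrow> jacobian F x \<noteq> 0"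
  shows "smooth_on T G"
proof -
  define a where "a = (\<lambda>x. fderiv F x 1)"
  define b where "b = (\<lambda>x. fderiv F x \<i>)"
  have J': "cross2 (a x) (b x) \<noteq> 0" if "x \<in> S" for x
    using J[OF that] by (simp add: a_def b_def jacobian_cross2)
  have dF: "(F has_derivative (\<lambda>v. Re v *\<^sub>R a x + Im v *\<^sub>R b x)) (at x)" if "x \<in> S" for x
    using smooth_on_has_derivative[OF assms(1,3) that] complex_linear_expand[OF has_derivative_linear]
    unfolding a_def b_def by (metis (no_types, lifting) has_derivative_eq_rhs ext)
  note dG = has_derivative_local_inverse[OF assms(2) _ assms(4) FG dF[OF assms(5)] J'[OF assms(5)]]
  have sa: "Ck_on k S a" and sb: "Ck_on k S b" for k
    unfolding a_def b_def using smooth_on_frechet[OF assms(3)] by (auto simp: smooth_on_def)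
  have "Ck_on k T G" for k
  proof (induction k)
    case 0
    then show ?case using assms(4) by simp
  next
    case (Suc k)
    have c: "Ck_on k T (\<lambda>y. a (G y))" "Ck_on k T (\<lambda>y. b (G y))"
      using Ck_on_compose[OF assms(2,1) sa Suc] Ck_on_compose[OF assms(2,1) sb Suc] assms(5) by auto
    note intros = Ck_on_add bounded_bilinear.Ck_on_prod[OF bounded_bilinear_mult] Ck_on_const c assms(2)
      Ck_on_linear[OF _ bounded_linear_Re] Ck_on_linear[OF _ bounded_linear_Im]
      Ck_on_linear[OF _ bounded_linear_minus[OF bounded_linear_ident]]
      Ck_on_linear[OF _ bounded_linear_of_real] Ck_on_inverse
    have x: "Ck_on k T (\<lambda>y. cross2 (f y) (g y))" if "Ck_on k T f" "Ck_on k T g" for f g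
      unfolding cross2_def diff_conv_add_uminus using that by (intro intros)
    have "Ck_on k T (\<lambda>y. Complex (cross2 v (b (G y)) / cross2 (a (G y)) (b (G y)))
         (cross2 (a (G y)) v / cross2 (a (G y)) (b (G y))))" for v
      unfolding Complex_eq divide_inverse by (intro intros x J' assms(5))
    then show ?case
      using Ck_on_SucI[OF assms(2) dG] by blast
  qed
  then show ?thesis by (simp add: smooth_on_def)
qed

text \<open>The inverse function theorem with the derivative given by two continuous partials. Only
  class C^1 is asked for because the conformal coordinate has to be inverted before it is known to
  be smooth.\<close>

lemma local_homeomorphism:
  fixes F :: "complex \<Rightarrow> complex"
  assumes "open S" "p \<in> S" and dF: "\<And>x. x \<in> S \<Longrightarrow> (F has_derivative (\<lambda>v. Re v *\<^sub>R a x + Im v *\<^sub>R b x)) (at x)"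
    and "continuous_on S a" "continuous_on S b" and J: "cross2 (a p) (b p) \<noteq> 0"
  obtains U V G where "open U" "p \<in> U" "U \<subseteq> S" "open V" "homeomorphism U V F G"
proof -
  define F' where "F' = (\<lambda>x. (blinfun_scaleR_left (a x) o\<^sub>L Blinfun Re) + (blinfun_scaleR_left (b x) o\<^sub>L Blinfun Im))"
  have F': "blinfun_apply (F' x) = (\<lambda>v. Re v *\<^sub>R a x + Im v *\<^sub>R b x)" for x
    unfolding F'_def
    by (simp add: fun_eq_iff plus_blinfun.rep_eq bounded_linear_Blinfun_apply bounded_linear_Re bounded_linear_Im)
  have c: "continuous_on S F'"
    unfolding F'_def by (intro continuous_intros assms)
  define G' where "G' = Blinfun (\<lambda>v. Complex (cross2 v (b p) / cross2 (a p) (b p)) (cross2 (a p) v / cross2 (a p) (b p)))"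
  have bl: "bounded_linear (\<lambda>v. Complex (cross2 v (b p) / cross2 (a p) (b p)) (cross2 (a p) v / cross2 (a p) (b p)))"
    unfolding linear_conv_bounded_linear[symmetric]
    by unfold_locales (auto simp: complex_eq_iff cross2_def field_simps add_divide_distrib diff_divide_distrib)
  have "G' o\<^sub>L F' p = id_blinfun"
    by (rule blinfun_eqI, simp add: F' G'_def bounded_linear_Blinfun_apply[OF bl])
     (use J in \<open>auto simp: complex_eq_iff cross2_def divide_simps\<close>, auto simp: algebra_simps)
  from inverse_function_theorem[OF assms(1) _ c assms(2) this, of F] dF F'
  obtain U V G where "open U" "U \<subseteq> S" "p \<in> U" "open V" "homeomorphism U V F G"
    by metis
  then show thesis using that by blast
qed

section \<open>Dividing smooth functions\<close>

definition squeeze :: "real \<Rightarrow> complex \<Rightarrow> complex"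
  where "squeeze \<tau> w = Complex (Re w) (\<tau> * Im w)"

lemma squeeze_simps [simp]: "Re (squeeze \<tau> w) = Re w" "Im (squeeze \<tau> w) = \<tau> * Im w" "squeeze 1 w = w"
  by (simp_all add: squeeze_def complex_eq_iff)

lemma continuous_on_squeeze [continuous_intros]:
  "continuous_on T f \<Longrightarrow> continuous_on T g \<Longrightarrow> continuous_on T (\<lambda>x. squeeze (f x) (g x))"
  unfolding squeeze_def by (intro continuous_intros) auto

lemma has_derivative_squeeze:
  "((\<lambda>w. squeeze \<tau> w) has_derivative (\<lambda>v. squeeze \<tau> v)) (at w)"
proof -
  have "bounded_linear (squeeze \<tau>)"
    unfolding linear_conv_bounded_linear[symmetric]
    by unfold_locales (auto simp: complex_eq_iff algebra_simps)
  then show ?thesis by (rule bounded_linear_imp_has_derivative)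
qed

text \<open>The weight \<open>\<tau> ^ m\<close> records differentiations: each derivative in the
  imaginary direction raises \<open>m\<close> by one. For \<open>m = 0\<close> and the imaginary
  partial of \<open>g\<close> in place of \<open>F\<close> this is the quotient in Hadamard's
  lemma.\<close>

definition moment :: "nat \<Rightarrow> (complex \<Rightarrow> real) \<Rightarrow> complex \<Rightarrow> real"
  where "moment m F w = integral {0..1} (\<lambda>\<tau>. \<tau> ^ m * F (squeeze \<tau> w))"

text \<open>Differentiation under the integral sign turns the partials of \<open>moment m F\<close>
  into moments of the partials of \<open>F\<close>, of weights \<open>m\<close> and
  \<open>Suc m\<close>; hence the induction is over all \<open>m\<close> at once. The hypothesis
  \<open>star\<close> keeps the segments of integration inside \<open>S\<close>.\<close>

lemma Ck_on_moment:
  assumes S: "open S" and star: "\<And>w \<tau>. w \<in> S \<Longrightarrow> \<tau> \<in> {0..1} \<Longrightarrow> squeeze \<tau> w \<in> S"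
    and "Ck_on k S F"
  shows "Ck_on k S (moment m F)"
  using assms(3)
proof (induction k arbitrary: m F)
  have cont: "continuous_on (U \<times> {0..1}) (\<lambda>(w, \<tau>). F (squeeze \<tau> w))" if "continuous_on S F" "U \<subseteq> S" for F :: "complex \<Rightarrow> real" and U
    unfolding case_prod_beta
    by (rule continuous_on_compose2[OF that(1)])
      (use that star in \<open>auto intro!: continuous_intros\<close>)
  {
    case (0 m F)
    have "continuous_on (S \<times> {0..1}) (\<lambda>(w, \<tau>). \<tau> ^ m * F (squeeze \<tau> w))"
      using cont[of F S] 0 by (auto simp: case_prod_beta intro!: continuous_intros)
    then have "continuous_on S (\<lambda>w. integral (cbox 0 1) (\<lambda>\<tau>. \<tau> ^ m * F (squeeze \<tau> w)))"
      by (intro integral_continuous_on_param) simp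
    then show ?case by (simp add: moment_def[abs_def])
  next
    case (Suc k m F)
    define F1 where "F1 = (\<lambda>w. fderiv F w 1)"
    define F2 where "F2 = (\<lambda>w. fderiv F w \<i>)"
    have C: "Ck_on k S F1" "Ck_on k S F2" using Suc.prems by (auto simp: F1_def F2_def)
    then have c: "continuous_on S F1" "continuous_on S F2" "continuous_on S F"
      using Ck_on_continuous Suc.prems by blast+
    have dF: "(F has_derivative (\<lambda>v. Re v * F1 w + Im v * F2 w)) (at w)" if "w \<in> S" for w
    proof -
      note d = Ck_on_SucD[OF S Suc.prems that]
      show ?thesis
        unfolding F1_def F2_def
        by (rule has_derivative_eq_rhs[OF d], rule ext)
          (subst complex_linear_expand[OF has_derivative_linear[OF d]], simp)
    qed
    let ?B = "\<lambda>w \<tau>. (\<tau> ^ m * F1 (squeeze \<tau> w)) *\<^sub>R Blinfun Re + (\<tau> ^ Suc m * F2 (squeeze \<tau> w)) *\<^sub>R Blinfun Im"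
    have apply_B: "blinfun_apply (?B w \<tau>) v = Re v * (\<tau> ^ m * F1 (squeeze \<tau> w)) + Im v * (\<tau> ^ Suc m * F2 (squeeze \<tau> w))" for w \<tau> v
      by (simp add: plus_blinfun.rep_eq scaleR_blinfun.rep_eq bounded_linear_Blinfun_apply bounded_linear_Re bounded_linear_Im)
    have D: "(moment m F has_derivative (\<lambda>v. Re v * moment m F1 w + Im v * moment (Suc m) F2 w)) (at w)"
      if w: "w \<in> S" for w
    proof -
      obtain e where e: "e > 0" "ball w e \<subseteq> S" using S w open_contains_ball by blast
      have int: "(\<lambda>\<tau>. \<tau> ^ j * H (squeeze \<tau> y)) integrable_on {0..1}" if "continuous_on S H" "y \<in> S" for H j and y
      proof (rule integrable_continuous_real)
        have "continuous_on {0..1} (\<lambda>\<tau>. H (squeeze \<tau> y))"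
          by (rule continuous_on_compose2[OF that(1)]) (use star that(2) in \<open>auto intro!: continuous_intros\<close>)
        then show "continuous_on {0..1} (\<lambda>\<tau>. \<tau> ^ j * H (squeeze \<tau> y))" by (intro continuous_intros)
      qed
      have "((\<lambda>w. integral (cbox 0 1) (\<lambda>\<tau>. \<tau> ^ m * F (squeeze \<tau> w))) has_derivative integral (cbox 0 1) (?B w)) (at w within ball w e)"
      proof (rule leibniz_rule)
        fix y and \<tau> :: real assume y: "y \<in> ball w e" "\<tau> \<in> cbox 0 1"
        then have s: "squeeze \<tau> y \<in> S" using e star by auto
        have "((\<lambda>y. F (squeeze \<tau> y)) has_derivative (\<lambda>v. Re v * F1 (squeeze \<tau> y) + \<tau> * Im v * F2 (squeeze \<tau> y))) (at y)"
          by (rule has_derivative_eq_rhs[OF has_derivative_compose[OF has_derivative_squeeze dF[OF s]]]) auto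
        then have "((\<lambda>y. \<tau> ^ m * F (squeeze \<tau> y)) has_derivative (\<lambda>v. \<tau> ^ m * (Re v * F1 (squeeze \<tau> y) + \<tau> * Im v * F2 (squeeze \<tau> y)))) (at y)"
          by (rule has_derivative_mult_right)
        then show "((\<lambda>y. \<tau> ^ m * F (squeeze \<tau> y)) has_derivative blinfun_apply (?B y \<tau>)) (at y within ball w e)"
          by (rule has_derivative_at_withinI[OF has_derivative_eq_rhs]) (rule ext, subst apply_B, simp add: algebra_simps)
      next
        show "(\<lambda>\<tau>. \<tau> ^ m * F (squeeze \<tau> y)) integrable_on cbox 0 1" if "y \<in> ball w e" for y
          using int[OF c(3)] that e by auto
        show "continuous_on (ball w e \<times> cbox 0 1) (\<lambda>(w, \<tau>). ?B w \<tau>)"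
          using cont[OF c(1) e(2)] cont[OF c(2) e(2)]
          by (auto simp: case_prod_beta intro!: continuous_intros)
      qed (use e in auto)
      moreover have "blinfun_apply (integral (cbox 0 1) (?B w)) = (\<lambda>v. Re v * moment m F1 w + Im v * moment (Suc m) F2 w)"
      proof
        fix v
        have I: "?B w integrable_on cbox 0 1"
        proof (rule integrable_continuous)
          have "continuous_on {0..1} (\<lambda>\<tau>. H (squeeze \<tau> w))" if "continuous_on S H" for H :: "complex \<Rightarrow> real"
            by (rule continuous_on_compose2[OF that]) (use star w in \<open>auto intro!: continuous_intros\<close>)
          then show "continuous_on (cbox 0 1) (?B w)" using c by (auto intro!: continuous_intros)
        qed
        have "blinfun_apply (integral (cbox 0 1) (?B w)) v = integral (cbox 0 1) (\<lambda>\<tau>. blinfun_apply (?B w \<tau>) v)"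
          using integral_linear[OF I, of "\<lambda>B. blinfun_apply B v"] by (simp add: o_def bounded_linear_blinfun_apply blinfun.bounded_linear_left)
        also have "\<dots> = integral {0..1} (\<lambda>\<tau>. Re v * (\<tau> ^ m * F1 (squeeze \<tau> w)) + Im v * (\<tau> ^ Suc m * F2 (squeeze \<tau> w)))"
          unfolding apply_B by simp
        also have "\<dots> = Re v * moment m F1 w + Im v * moment (Suc m) F2 w"
          unfolding moment_def
          by (subst integral_add) (use int[OF c(1) w, of m] int[OF c(2) w, of "Suc m"] in \<open>auto intro!: integrable_on_mult_right simp del: power_Suc\<close>)
        finally show "blinfun_apply (integral (cbox 0 1) (?B w)) v = Re v * moment m F1 w + Im v * moment (Suc m) F2 w" .
      qed
      ultimately show ?thesis
        unfolding moment_def[abs_def] using at_within_open[of w "ball w e"] e by simp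
    qed
    have "Ck_on k S (\<lambda>w. Re v * moment m F1 w + Im v * moment (Suc m) F2 w)" for v
      by (intro Ck_on_add S bounded_bilinear.Ck_on_prod[OF bounded_bilinear_mult] Ck_on_const Suc.IH C)
    then show ?case using Ck_on_SucI[OF S D] by blast
  }
qed

text \<open>Integrate the derivative of \<open>g\<close> along the vertical segment from the real
  axis, where \<open>g\<close> vanishes, up to \<open>w\<close>: the chain rule supplies the factor
  \<open>Im w\<close>.\<close>

lemma Hadamard_division:
  assumes S: "open S" and star: "\<And>w \<tau>. w \<in> S \<Longrightarrow> \<tau> \<in> {0..1} \<Longrightarrow> squeeze \<tau> w \<in> S"
    and g: "smooth_on S g" and 0: "\<And>w. w \<in> S \<Longrightarrow> Im w = 0 \<Longrightarrow> g w = (0::real)"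
  obtains h where "smooth_on S h" "\<And>w. w \<in> S \<Longrightarrow> g w = Im w * h w"
proof
  let ?g2 = "\<lambda>w. fderiv g w \<i>"
  show "smooth_on S (moment 0 ?g2)"
    using smooth_on_frechet[OF g] Ck_on_moment[OF S star] unfolding smooth_on_def by blast
  fix w assume w: "w \<in> S"
  have "((\<lambda>\<tau>. Im w * ?g2 (squeeze \<tau> w)) has_integral g (squeeze 1 w) - g (squeeze 0 w)) {0..1}"
  proof (rule fundamental_theorem_of_calculus)
    fix \<tau> :: real assume \<tau>: "\<tau> \<in> {0..1}"
    note d = smooth_on_has_derivative[OF S g star[OF w \<tau>]]
    have "((\<lambda>\<tau>. squeeze \<tau> w) has_derivative (\<lambda>t. (t * Im w) *\<^sub>R \<i>)) (at \<tau> within {0..1})"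
    proof -
      have "(\<lambda>\<tau>. squeeze \<tau> w) = (\<lambda>\<tau>. of_real (Re w) + (\<tau> * Im w) *\<^sub>R \<i>)"
        by (simp add: fun_eq_iff complex_eq_iff)
      then show ?thesis by (auto intro!: derivative_eq_intros)
    qed
    from has_derivative_compose[OF this d]
    show "((\<lambda>\<tau>. g (squeeze \<tau> w)) has_vector_derivative Im w * ?g2 (squeeze \<tau> w)) (at \<tau> within {0..1})"
    proof -
      have "(\<lambda>x. fderiv g (squeeze \<tau> w) ((x * Im w) *\<^sub>R \<i>)) = (\<lambda>x. x *\<^sub>R (Im w * ?g2 (squeeze \<tau> w)))"
        by (rule ext, subst linear_cmul[OF has_derivative_linear[OF d]]) (simp only: real_scaleR_def mult.assoc)
      with \<open>((\<lambda>x. g (squeeze x w)) has_derivative _) _\<close> show ?thesis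
        unfolding has_vector_derivative_def by metis
    qed
  qed simp
  moreover have "g (squeeze 0 w) = 0" using 0[OF star[OF w, of 0]] by simp
  ultimately have "integral {0..1} (\<lambda>\<tau>. Im w * ?g2 (squeeze \<tau> w)) = g w"
    by (simp only: integral_unique squeeze_simps diff_zero)
  then show "g w = Im w * moment 0 ?g2 w" by (simp add: moment_def)
qed

lemma rectangle_in_open:
  assumes "open N" "0 \<in> N"
  obtains r where "r > 0" "{w. \<bar>Re w\<bar> < r \<and> \<bar>Im w\<bar> < r} \<subseteq> N"
proof -
  obtain e where e: "e > 0" "ball 0 e \<subseteq> N" using assms open_contains_ball by blast
  have *: "norm w < e" if "\<bar>Re w\<bar> < e/2" "\<bar>Im w\<bar> < e/2" for w using cmod_le[of w] that by simp
  have "{w. \<bar>Re w\<bar> < e/2 \<and> \<bar>Im w\<bar> < e/2} \<subseteq> N"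
    using * by (intro subset_trans[OF _ e(2)]) auto
  then show thesis using that[of "e/2"] e by simp
qed

lemma open_rectangle: "open {w. \<bar>Re w - a\<bar> < r \<and> \<bar>Im w\<bar> < s}"
  by (intro open_Collect_conj open_Collect_less continuous_intros)

text \<open>A vertical shear by \<open>Re w * \<Omega> w\<close> straightens the curve to the real
  axis, where Hadamard's lemma applies. \<open>\<Omega>\<close> depends on \<open>Re w\<close>
  alone, which the shear preserves, so the opposite shear is its inverse. The factor
  \<open>Re w\<close> makes the curve pass through the origin, with slope
  \<open>\<Omega> 0\<close>.\<close>

lemma curve_division:
  assumes \<Omega>: "smooth_on {w. \<bar>Re w\<bar> < r} \<Omega>" and \<Omega>_Re: "\<And>w. \<Omega> w = \<Omega> (of_real (Re w))" and "r > 0"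
    and N: "open N" "0 \<in> N" and g: "smooth_on N g"
    and 0: "\<And>w. w \<in> N \<Longrightarrow> \<bar>Re w\<bar> < r \<Longrightarrow> Im w = Re w * \<Omega> w \<Longrightarrow> g w = (0::real)"
  obtains N' h where "open N'" "0 \<in> N'" "N' \<subseteq> N" "N' \<subseteq> {w. \<bar>Re w\<bar> < r}" "smooth_on N' h"
    "\<And>w. w \<in> N' \<Longrightarrow> g w = (Im w - Re w * \<Omega> w) * h w"
proof -
  let ?T = "{w. \<bar>Re w\<bar> < r}"
  have T: "open ?T" by (intro open_Collect_less continuous_intros)
  define shear where "shear = (\<lambda>s w. w + of_real (s * (Re w * \<Omega> w)) * \<i>)"
  have Re_shear: "Re (shear s w) = Re w" and Im_shear: "Im (shear s w) = Im w + s * (Re w * \<Omega> w)" for s w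
    by (simp_all add: shear_def)
  have \<Omega>_eq: "Re v = Re w \<Longrightarrow> \<Omega> v = \<Omega> w" for v w using \<Omega>_Re by metis
  have inv: "shear s (shear (-s) w) = w" for s w
    using \<Omega>_eq[OF Re_shear] by (simp add: complex_eq_iff Re_shear Im_shear)
  have sm: "smooth_on ?T (shear s)" for s
    unfolding shear_def by (intro smooth_on_add smooth_on_mult smooth_on_of_real smooth_on_const smooth_on_Re smooth_on_id T \<Omega>)
  have "isCont (shear 1) 0" using smooth_on_continuous[OF sm] T \<open>r > 0\<close> by (simp add: continuous_on_eq_continuous_at)
  moreover have "shear 1 0 \<in> N" using N by (simp add: shear_def)
  ultimately have "eventually (\<lambda>w. shear 1 w \<in> N) (nhds 0)"
    using N(1) topological_tendstoD[of "shear 1" "shear 1 0" "nhds 0" N] by (simp add: isCont_def tendsto_at_iff_tendsto_nhds)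
  then obtain d where d: "d > 0" "\<And>w. norm w < d \<Longrightarrow> shear 1 w \<in> N"
    by (auto simp: eventually_nhds_metric)
  obtain t where t: "t > 0" "{w. \<bar>Re w\<bar> < t \<and> \<bar>Im w\<bar> < t} \<subseteq> ball 0 d \<inter> ?T"
    using rectangle_in_open[of "ball 0 d \<inter> ?T"] d T \<open>r > 0\<close> by auto
  define R where "R = {w. \<bar>Re w\<bar> < t \<and> \<bar>Im w\<bar> < t}"
  have R: "open R" "R \<subseteq> ?T" "shear 1 ` R \<subseteq> N"
    using t d open_rectangle[of 0 t t] by (auto simp: R_def)
  obtain h where h: "smooth_on R h" "\<And>w. w \<in> R \<Longrightarrow> g (shear 1 w) = Im w * h w"
  proof (rule Hadamard_division)
    show "squeeze \<tau> w \<in> R" if "w \<in> R" "\<tau> \<in> {0..1}" for w \<tau>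
    proof -
      have "\<bar>\<tau> * Im w\<bar> \<le> \<bar>Im w\<bar>" using that mult_left_le_one_le[of "\<bar>Im w\<bar>" "\<bar>\<tau>\<bar>"] by (auto simp: abs_mult)
      then show ?thesis using that by (auto simp: R_def)
    qed
    show "smooth_on R (\<lambda>w. g (shear 1 w))"
      by (rule smooth_on_compose[OF R(1) N(1) g smooth_on_subset[OF sm R(2)]]) (use R in auto)
    show "g (shear 1 w) = 0" if "w \<in> R" "Im w = 0" for w
      using that R 0[of "shear 1 w"] \<Omega>_eq[OF Re_shear] by (auto simp: Re_shear Im_shear)
  qed (use R in auto)
  show thesis
  proof
    let ?N = "?T \<inter> shear (-1) -` R"
    show o: "open ?N"
      using continuous_open_preimage[OF smooth_on_continuous[OF sm] T R(1), of "-1"] by blast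
    show "0 \<in> ?N" using \<open>r > 0\<close> t by (simp add: shear_def R_def)
    show "?N \<subseteq> N" using R(3) inv[of 1] by (force simp: image_subset_iff)
    show "smooth_on ?N (\<lambda>w. h (shear (-1) w))"
      by (rule smooth_on_compose[OF o R(1) h(1) smooth_on_subset[OF sm]]) auto
    show "g w = (Im w - Re w * \<Omega> w) * h (shear (-1) w)" if "w \<in> ?N" for w
      using that h(2)[of "shear (-1) w"] inv[of 1 w] by (simp add: Im_shear)
  qed auto
qed

lemma continuous_agree_off_finite:
  fixes \<phi> \<psi> :: "real \<Rightarrow> real"
  assumes "finite Z" "isCont \<phi> a" "isCont \<psi> a" "open I" "a \<in> I" "\<And>x. x \<in> I \<Longrightarrow> x \<notin> Z \<Longrightarrow> \<phi> x = \<psi> x"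
  shows "\<phi> a = \<psi> a"
proof -
  have "eventually (\<lambda>x. x \<in> I \<and> x \<notin> Z - {a}) (at a)"
  proof (rule eventually_at_in_open'[of "I - (Z - {a})" a, THEN eventually_mono])
    show "open (I - (Z - {a}))" using assms(1,4) by (intro open_Diff finite_imp_closed) auto
  qed (use assms in auto)
  then have ev: "eventually (\<lambda>x. \<phi> x = \<psi> x) (at a)"
    using eventually_neq_at_within[of a a UNIV] by eventually_elim (use assms in auto)
  have "\<phi> \<midarrow>a\<rightarrow> \<phi> a" "\<psi> \<midarrow>a\<rightarrow> \<psi> a" using assms by (auto simp: isCont_def)
  then show ?thesis
    using tendsto_cong[OF ev] tendsto_unique[OF trivial_limit_at] by blast
qed

section \<open>Blow-up and the zero curves of the divisor\<close>

text \<open>In blow-up coordinates \<open>(\<omega>, x) \<mapsto> (x, x \<omega>)\<close> the divisor becomes \<open>x\<^sup>k\<close> times a function whose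
  restriction to \<open>x = 0\<close> has only simple zeros; each of them extends to a smooth zero curve of \<open>D\<close>,
  by which \<open>D\<close> and \<open>g\<close> can both be divided.\<close>

definition blowup :: "complex \<Rightarrow> complex"
  where "blowup e = Complex (Im e) (Im e * Re e)"

lemma smooth_blowup: "open S \<Longrightarrow> smooth_on S blowup"
  unfolding blowup_def by (intro smooth_on_Complex smooth_on_mult smooth_on_Re smooth_on_Im smooth_on_id)

text \<open>\<open>Im e = 0\<close> is the exceptional line, and its point
  \<open>of_real \<omega>\<close> is the direction of slope \<open>\<omega>\<close>. Hadamard's
  lemma takes out one factor \<open>Im e\<close> after another: as long as fewer than
  \<open>k\<close> are removed, the quotient restricted to the exceptional line is a limit of
  \<open>D / x ^ j\<close>, which is 0. A finite exceptional set \<open>Z\<close> does no harm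
  because both sides are continuous in the slope.\<close>

lemma blowup_factor:
  assumes N: "open N" "0 \<in> N" and D: "smooth_on N (D :: complex \<Rightarrow> real)" and Z: "finite Z"
    and P: "\<And>\<omega>. isCont P \<omega>"
    and lim: "\<And>\<omega>. \<omega> \<notin> Z \<Longrightarrow> ((\<lambda>x. D (Complex x (x * \<omega>)) / x ^ k) \<longlongrightarrow> P \<omega>) (at 0)"
  obtains E \<delta> where "\<delta> > 0" "smooth_on {e. \<bar>Re e - l\<bar> < 1 \<and> \<bar>Im e\<bar> < \<delta>} E"
    "\<And>e. \<bar>Re e - l\<bar> < 1 \<Longrightarrow> \<bar>Im e\<bar> < \<delta> \<Longrightarrow> blowup e \<in> N \<and> D (blowup e) = Im e ^ k * E e"
    "\<And>\<omega>. \<bar>\<omega> - l\<bar> < 1 \<Longrightarrow> E (of_real \<omega>) = P \<omega>"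
proof -
  obtain r where r: "r > 0" "{w. \<bar>Re w\<bar> < r \<and> \<bar>Im w\<bar> < r} \<subseteq> N" using rectangle_in_open[OF N] .
  \<comment> \<open>On the strip the slope is at most \<open>\<bar>l\<bar> + 1\<close> in absolute
    value, so this bound on \<open>x\<close> keeps \<open>x * \<omega>\<close> below
    \<open>r\<close>.\<close>
  define \<delta> where "\<delta> = r / (\<bar>l\<bar> + 1)"
  have \<delta>: "\<delta> > 0" using r by (simp add: \<delta>_def add_nonneg_pos)
  let ?M = "{e. \<bar>Re e - l\<bar> < 1 \<and> \<bar>Im e\<bar> < \<delta>}"
  have M: "open ?M" by (rule open_rectangle)
  have MN: "blowup e \<in> N" if "e \<in> ?M" for e
  proof -
    have "\<delta> \<le> r" using r by (simp add: \<delta>_def field_simps)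
    moreover have "\<bar>Im e * Re e\<bar> < r"
    proof -
      have "\<bar>Re e\<bar> \<le> \<bar>l\<bar> + 1" "\<bar>Im e\<bar> < \<delta>" using that by auto
      then have "\<bar>Im e\<bar> * \<bar>Re e\<bar> \<le> \<bar>Im e\<bar> * (\<bar>l\<bar> + 1)" by (intro mult_left_mono) auto
      also have "\<dots> < \<delta> * (\<bar>l\<bar> + 1)" using that by (intro mult_strict_right_mono) auto
      also have "\<dots> = r" by (simp add: \<delta>_def)
      finally show ?thesis by (simp add: abs_mult)
    qed
    ultimately show ?thesis using that r(2) by (auto simp: blowup_def)
  qed
  have line: "isCont (\<lambda>\<omega>. E (of_real \<omega>)) \<omega>" "((\<lambda>x. E (Complex \<omega> x)) \<longlongrightarrow> E (of_real \<omega>)) (at 0)"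
    if "smooth_on ?M E" "\<bar>\<omega> - l\<bar> < 1" for E :: "complex \<Rightarrow> real" and \<omega>
  proof -
    have "of_real \<omega> \<in> ?M" using that \<delta> by simp
    then have c: "isCont E (of_real \<omega>)"
      using smooth_on_continuous[OF that(1)] M by (simp add: continuous_on_eq_continuous_at)
    then show "isCont (\<lambda>\<omega>. E (of_real \<omega>)) \<omega>" by (intro isCont_o2[where f = complex_of_real, OF _ c] continuous_intros)
    have "((\<lambda>x. Complex \<omega> x) \<longlongrightarrow> of_real \<omega>) (at 0)"
      unfolding complex_of_real_def by (intro tendsto_intros)
    then show "((\<lambda>x. E (Complex \<omega> x)) \<longlongrightarrow> E (of_real \<omega>)) (at 0)"
      by (rule isCont_tendsto_compose[OF c])
  qed
  have near: "eventually (\<lambda>x. x \<noteq> 0 \<and> \<bar>x\<bar> < \<delta>) (at 0)"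
    unfolding eventually_at using \<delta> by (intro exI[of _ \<delta>]) (auto simp: dist_norm)
  \<comment> \<open>Stated for any power \<open>j\<close> and any limit \<open>Q\<close>: it serves
    for \<open>j < k\<close> with \<open>Q = 0\<close>, where it permits the next division, and for
    \<open>j = k\<close> with \<open>Q = P\<close>.\<close>
  have value0: "E (of_real \<omega>) = Q \<omega>"
    if E: "smooth_on ?M E" "\<bar>\<omega> - l\<bar> < 1" and Q: "\<And>\<omega>. isCont Q \<omega>"
      and eq: "\<And>e. e \<in> ?M \<Longrightarrow> D (blowup e) = Im e ^ j * E e"
      and l: "\<And>\<omega>. \<omega> \<notin> Z \<Longrightarrow> ((\<lambda>x. D (Complex x (x * \<omega>)) / x ^ j) \<longlongrightarrow> Q \<omega>) (at 0)" for E Q j \<omega>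
  proof (rule continuous_agree_off_finite[OF Z, where I = "{l-1<..<l+1}" and \<phi> = "\<lambda>\<omega>. E (of_real \<omega>)" and \<psi> = Q and a = \<omega>])
    fix \<omega>' assume w: "\<omega>' \<in> {l-1<..<l+1}" "\<omega>' \<notin> Z"
    have "eventually (\<lambda>x. D (Complex x (x * \<omega>')) / x ^ j = E (Complex \<omega>' x)) (at 0)"
      using near
    proof eventually_elim
      case (elim x)
      then show ?case using eq[of "Complex \<omega>' x"] w by (auto simp: blowup_def)
    qed
    from Lim_transform_eventually[OF l[OF w(2)] this]
    have *: "((\<lambda>x. E (Complex \<omega>' x)) \<longlongrightarrow> Q \<omega>') (at 0)" .
    have "\<bar>\<omega>' - l\<bar> < 1" using w by auto
    from tendsto_unique[OF trivial_limit_at line(2)[OF E(1) this] *]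
    show "E (of_real \<omega>') = Q \<omega>'" .
  qed (use line(1)[OF E] E(2) Q in auto)
  have "\<exists>E. smooth_on ?M E \<and> (\<forall>e\<in>?M. D (blowup e) = Im e ^ j * E e)" if "j \<le> k" for j
    using that
  proof (induction j)
    case 0
    have "smooth_on ?M (\<lambda>e. D (blowup e))"
      using smooth_on_compose[OF M N(1) D smooth_blowup[OF M]] MN by blast
    then show ?case by auto
  next
    case (Suc j)
    then obtain E where E: "smooth_on ?M E" "\<forall>e\<in>?M. D (blowup e) = Im e ^ j * E e" by auto
    obtain h where h: "smooth_on ?M h" "\<And>e. e \<in> ?M \<Longrightarrow> E e = Im e * h e"
    proof (rule Hadamard_division[OF M _ E(1)])
      show "squeeze \<tau> w \<in> ?M" if "w \<in> ?M" "\<tau> \<in> {0..1}" for w \<tau>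
      proof -
        have "\<bar>\<tau> * Im w\<bar> \<le> \<bar>Im w\<bar>" using that mult_left_le_one_le[of "\<bar>Im w\<bar>" "\<bar>\<tau>\<bar>"] by (auto simp: abs_mult)
        then show ?thesis using that by auto
      qed
      fix w assume w: "w \<in> ?M" "Im w = 0"
      have "E (of_real (Re w)) = 0"
      proof (rule value0[OF E(1), where Q = "\<lambda>_. 0" and j = j])
        fix \<omega> assume z: "\<omega> \<notin> Z"
        have "((\<lambda>x. D (Complex x (x * \<omega>)) / x ^ k * x ^ (k - j)) \<longlongrightarrow> P \<omega> * 0 ^ (k - j)) (at 0)"
          by (intro tendsto_intros lim z)
        moreover have "0 ^ (k - j) = (0::real)" using Suc.prems by (simp add: power_0_left)
        moreover have "eventually (\<lambda>x. D (Complex x (x * \<omega>)) / x ^ k * x ^ (k - j) = D (Complex x (x * \<omega>)) / x ^ j) (at 0)"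
          using near
        proof eventually_elim
          case (elim x)
          have "x ^ k = x ^ j * x ^ (k - j)" using Suc.prems by (simp flip: power_add)
          then show ?case using elim by simp
        qed
        ultimately show "((\<lambda>x. D (Complex x (x * \<omega>)) / x ^ j) \<longlongrightarrow> 0) (at 0)"
          by (simp add: Lim_transform_eventually)
      qed (use E(2) w in auto)
      moreover have "w = of_real (Re w)" using w by (simp add: complex_eq_iff)
      ultimately show "E w = 0" by simp
    qed blast
    then show ?case using E(2) by (intro exI[of _ h]) auto
  qed
  then obtain E where E: "smooth_on ?M E" "\<forall>e\<in>?M. D (blowup e) = Im e ^ k * E e" by auto
  show thesis
  proof (rule that[OF \<delta> E(1)])
    show "E (of_real \<omega>) = P \<omega>" if "\<bar>\<omega> - l\<bar> < 1" for \<omega>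
      by (rule value0[OF E(1) that P _ lim]) (use E(2) in auto)
  qed (use E(2) MN in auto)
qed

text \<open>\<open>l\<close> is a simple zero of the leading form, so \<open>E\<close> has a
  non-zero derivative in the slope at the point of the exceptional line with slope \<open>l\<close>,
  and the implicit function theorem gives the zeros of \<open>E\<close> near it as a graph over
  \<open>x\<close>. Blown down, this graph is a curve through the origin with slope
  \<open>l\<close>.\<close>

lemma zero_curve:
  assumes N: "open N" "0 \<in> N" and D: "smooth_on N (D :: complex \<Rightarrow> real)" and Z: "finite Z"
    and L: "finite L" "l \<notin> L" and "C \<noteq> 0"
    and lim: "\<And>\<omega>. \<omega> \<notin> Z \<Longrightarrow> ((\<lambda>x. D (Complex x (x * \<omega>)) / x ^ k) \<longlongrightarrow> C * (\<Prod>m\<in>insert l L. \<omega> - m)) (at 0)"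
  obtains \<Omega> r where "r > 0" "smooth_on {w. \<bar>Re w\<bar> < r} \<Omega>" "\<And>w. \<Omega> w = \<Omega> (of_real (Re w))" "\<Omega> 0 = l"
    "\<And>w. \<bar>Re w\<bar> < r \<Longrightarrow> Im w = Re w * \<Omega> w \<Longrightarrow> D w = 0"
proof -
  let ?P = "\<lambda>\<omega>. C * (\<Prod>m\<in>insert l L. \<omega> - m)"
  obtain E \<delta> where \<delta>: "\<delta> > 0" and E: "smooth_on {e. \<bar>Re e - l\<bar> < 1 \<and> \<bar>Im e\<bar> < \<delta>} E"
    and fac: "\<And>e. \<bar>Re e - l\<bar> < 1 \<Longrightarrow> \<bar>Im e\<bar> < \<delta> \<Longrightarrow> blowup e \<in> N \<and> D (blowup e) = Im e ^ k * E e"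
    and E0: "\<And>\<omega>. \<bar>\<omega> - l\<bar> < 1 \<Longrightarrow> E (of_real \<omega>) = ?P \<omega>"
  proof (rule blowup_factor[OF N D Z _ lim])
    show "isCont ?P \<omega>" for \<omega> by (intro continuous_intros)
  qed blast+
  let ?M = "{e. \<bar>Re e - l\<bar> < 1 \<and> \<bar>Im e\<bar> < \<delta>}"
  have M: "open ?M" by (rule open_rectangle)
  have lM: "of_real l \<in> ?M" using \<delta> by simp
  let ?E' = "\<lambda>e. fderiv E e"
  have dE: "(E has_derivative ?E' e) (at e)" if "e \<in> ?M" for e
    using smooth_on_has_derivative[OF M E that] .
  have E'l: "?E' (of_real l) 1 \<noteq> 0"
  proof -
    have "((\<lambda>\<omega>. E (of_real \<omega>)) has_derivative (\<lambda>t. ?E' (of_real l) (of_real t))) (at l)"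
      by (rule has_derivative_compose[where f = complex_of_real and g = E, OF _ dE[OF lM]]) (auto intro!: derivative_eq_intros)
    moreover have "(\<lambda>t. ?E' (of_real l) (of_real t)) = (\<lambda>t. ?E' (of_real l) 1 * t)"
      using linear_cmul[OF has_derivative_linear[OF dE[OF lM]], of _ 1]
      by (simp add: fun_eq_iff scaleR_conv_of_real)
    ultimately have d1: "((\<lambda>\<omega>. E (of_real \<omega>)) has_real_derivative ?E' (of_real l) 1) (at l)"
      by (simp add: has_field_derivative_def)
    \<comment> \<open>Caratheodory's form of differentiability reads the derivative at
      \<open>l\<close> off the factor \<open>\<omega> - l\<close>; the remaining factors come from
      \<open>L\<close> and do not vanish at \<open>l\<close>.\<close>
    have "?P \<omega> - ?P l = C * (\<Prod>m\<in>L. \<omega> - m) * (\<omega> - l)" for \<omega>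
      using L by (simp add: mult_ac)
    then have "(?P has_real_derivative C * (\<Prod>m\<in>L. l - m)) (at l)"
      unfolding CARAT_DERIV by (intro exI[of _ "\<lambda>\<omega>. C * (\<Prod>m\<in>L. \<omega> - m)"]) (auto intro!: continuous_intros)
    then have "((\<lambda>\<omega>. E (of_real \<omega>)) has_real_derivative C * (\<Prod>m\<in>L. l - m)) (at l)"
      by (rule has_field_derivative_transform_within_open[of _ _ _ "{l-1<..<l+1}"]) (use E0 in auto)
    then have "?E' (of_real l) 1 = C * (\<Prod>m\<in>L. l - m)" using d1 DERIV_unique by blast
    then show ?thesis using \<open>C \<noteq> 0\<close> L by auto
  qed
  have sE': "continuous_on ?M (\<lambda>e. ?E' e v)" for v
    by (intro smooth_on_continuous smooth_on_frechet E)
  define S where "S = ?M \<inter> (\<lambda>e. ?E' e 1) -` (- {0})"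
  have S: "open S" "of_real l \<in> S" "S \<subseteq> ?M"
  proof -
    show "open S" unfolding S_def by (rule continuous_open_preimage[OF sE' M]) auto
    show "of_real l \<in> S" "S \<subseteq> ?M" using E'l lM unfolding S_def by blast+
  qed
  \<comment> \<open>Keeps \<open>x = Im e\<close> and replaces the slope by the value of
    \<open>E\<close>. Its inverse therefore sends the real number \<open>x\<close> to the zero of
    \<open>E\<close> over \<open>x\<close>.\<close>
  define \<Phi> where "\<Phi> = (\<lambda>e. Complex (Im e) (E e))"
  have s\<Phi>: "smooth_on ?M \<Phi>"
    unfolding \<Phi>_def by (intro smooth_on_Complex smooth_on_Im smooth_on_id M E)
  define a where "a = (\<lambda>e. Complex 0 (?E' e 1))"
  define b where "b = (\<lambda>e. Complex 1 (?E' e \<i>))"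
  have d\<Phi>: "(\<Phi> has_derivative (\<lambda>v. Re v *\<^sub>R a e + Im v *\<^sub>R b e)) (at e)" if "e \<in> ?M" for e
  proof -
    have "(\<Phi> has_derivative (\<lambda>v. of_real (Im v) + \<i> * of_real (?E' e v))) (at e)"
      unfolding \<Phi>_def Complex_eq
      by (intro has_derivative_add has_derivative_of_real has_derivative_mult_right has_derivative_Im has_derivative_ident dE that)
    then show ?thesis
      by (rule has_derivative_eq_rhs, intro ext, subst complex_linear_expand[OF has_derivative_linear[OF dE[OF that]]])
        (simp add: complex_eq_iff a_def b_def)
  qed
  have J: "jacobian \<Phi> e = - ?E' e 1" if "e \<in> ?M" for e
    unfolding jacobian_cross2 frechet_derivative_at[OF d\<Phi>[OF that], symmetric] cross2_def a_def b_def by simp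
  obtain U V G where UV: "open U" "of_real l \<in> U" "U \<subseteq> S" "open V" "homeomorphism U V \<Phi> G"
  proof (rule local_homeomorphism[OF S(1,2)])
    show "(\<Phi> has_derivative (\<lambda>v. Re v *\<^sub>R a e + Im v *\<^sub>R b e)) (at e)" if "e \<in> S" for e using d\<Phi> that S by blast
    show "continuous_on S a" "continuous_on S b"
      unfolding a_def b_def using sE' S by (auto intro!: continuous_intros intro: continuous_on_subset)
    show "cross2 (a (of_real l)) (b (of_real l)) \<noteq> 0" using E'l by (simp add: a_def b_def cross2_def)
  qed blast
  have sG: "smooth_on V G"
  proof (rule smooth_on_local_inverse[OF UV(1,4) smooth_on_subset[OF s\<Phi>]])
    show "jacobian \<Phi> x \<noteq> 0" if "x \<in> U" for x
    proof -
      have "x \<in> ?M" "?E' x 1 \<noteq> 0" using that UV(3) unfolding S_def by blast+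
      then show ?thesis using J[of x] by simp
    qed
  qed (use UV S in \<open>auto simp: homeomorphism_def\<close>)
  have El: "E (of_real l) = 0" using E0[of l] L by simp
  then have \<Phi>l: "\<Phi> (of_real l) = 0" by (simp add: \<Phi>_def complex_eq_iff)
  then have "0 \<in> V" using UV by (metis homeomorphism_def imageI)
  then obtain r where r: "r > 0" "ball 0 r \<subseteq> V" using UV(4) open_contains_ball by blast
  have inV: "of_real (Re w) \<in> V" if "\<bar>Re w\<bar> < r" for w using that r by (auto simp: subset_iff)
  show thesis
  proof (rule that[OF r(1)])
    let ?\<Omega> = "\<lambda>w. Re (G (of_real (Re w)))"
    have T: "open {w. \<bar>Re w\<bar> < r}" by (intro open_Collect_less continuous_intros)
    show "smooth_on {w. \<bar>Re w\<bar> < r} ?\<Omega>"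
      by (intro smooth_on_Re[OF T] smooth_on_compose[OF T UV(4) sG] smooth_on_of_real smooth_on_id T) (use inV in auto)
    show "?\<Omega> 0 = l" using \<Phi>l UV by (metis Re_complex_of_real homeomorphism_def of_real_0 zero_complex.simps(1))
    have main: "blowup e = w \<and> Im e ^ k * E e = D w \<and> E e = 0" if w: "\<bar>Re w\<bar> < r" "Im w = Re w * ?\<Omega> w" and "e = G (of_real (Re w))" for w e
    proof -
      have e: "e \<in> U" "\<Phi> e = of_real (Re w)" using inV[OF w(1)] UV that(3) by (auto simp: homeomorphism_def)
      then have "Im e = Re w" "E e = 0" by (auto simp: \<Phi>_def complex_eq_iff)
      moreover have "blowup e = w" using w(2) that(3) \<open>Im e = Re w\<close> by (simp add: blowup_def complex_eq_iff)
      moreover have "D (blowup e) = Im e ^ k * E e" using fac e UV(3) S by blast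
      ultimately show ?thesis by simp
    qed
    show "D w = 0" if "\<bar>Re w\<bar> < r" "Im w = Re w * ?\<Omega> w" for w using main[OF that refl] by auto
  qed auto
qed

text \<open>Induction on the set \<open>L\<close> of slopes of the leading form. Each slope gives a
  zero curve of \<open>D\<close>, on which \<open>g = D * q\<close> vanishes as well; dividing both
  by the equation of the curve leaves \<open>q\<close> unchanged and lowers the order by one. When
  no slope is left, \<open>q\<close> is a quotient by a function that does not vanish at 0. The set
  \<open>Z\<close> grows along the way: after division by the curve of slope \<open>l\<close>, the
  limit of the reduced divisor is computed by dividing by \<omega> - l, which is possible only for
  the other slopes.\<close>

lemma division_germ:
  assumes "finite L"
    and N: "open N" "0 \<in> N" and D: "smooth_on N (D :: complex \<Rightarrow> real)" and Z: "finite Z" and C: "C \<noteq> 0"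
    and lim: "\<And>\<omega>. \<omega> \<notin> Z \<Longrightarrow> ((\<lambda>x. D (Complex x (x * \<omega>)) / x ^ card L) \<longlongrightarrow> C * (\<Prod>m\<in>L. \<omega> - m)) (at 0)"
    and g: "smooth_on N g" and q: "continuous_on N q" and gq: "\<And>w. w \<in> N \<Longrightarrow> g w = D w * q w"
  shows "\<exists>N'. open N' \<and> 0 \<in> N' \<and> smooth_on N' q"
  using assms
proof (induction L arbitrary: N D Z g)
  case (empty N D Z g)
  \<comment> \<open>With no slopes left, the limit hypothesis along any ray off \<open>Z\<close>
    identifies \<open>D 0\<close> with \<open>C\<close>.\<close>
  obtain \<omega> where "\<omega> \<notin> Z" using empty.prems(4) ex_new_if_finite infinite_UNIV_char_0 by blast
  then have "((\<lambda>x. D (Complex x (x * \<omega>))) \<longlongrightarrow> C) (at 0)" using empty.prems(6) by fastforce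
  moreover have "((\<lambda>x. D (Complex x (x * \<omega>))) \<longlongrightarrow> D 0) (at 0)"
  proof (rule isCont_tendsto_compose[of 0 D])
    show "isCont D 0" using smooth_on_continuous[OF empty.prems(3)] empty.prems(1,2) by (simp add: continuous_on_eq_continuous_at)
    have "((\<lambda>x. Complex x (x * \<omega>)) \<longlongrightarrow> Complex 0 (0 * \<omega>)) (at 0)" by (intro tendsto_intros)
    then show "((\<lambda>x. Complex x (x * \<omega>)) \<longlongrightarrow> 0) (at 0)" by (simp add: zero_complex.code)
  qed
  ultimately have "D 0 \<noteq> 0" using C tendsto_unique[OF trivial_limit_at] by blast
  define N' where "N' = N \<inter> D -` (- {0})"
  have N': "open N'" "0 \<in> N'"
    using continuous_open_preimage[OF smooth_on_continuous[OF empty.prems(3)] empty.prems(1), of "-{0}"] \<open>D 0 \<noteq> 0\<close> empty.prems(2)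
    by (auto simp: N'_def)
  have "smooth_on N' (\<lambda>w. g w / D w)"
    by (intro smooth_on_divide N' smooth_on_subset[OF empty.prems(3)] smooth_on_subset[OF empty.prems(7)]) (auto simp: N'_def)
  then have "smooth_on N' q"
    by (subst smooth_on_cong[OF N'(1), of _ "\<lambda>w. g w / D w"]) (use empty.prems(9) in \<open>auto simp: N'_def\<close>)
  then show ?case using N' by blast
next
  case (insert l L N D Z g)
  note N = insert.prems(1,2) and D = insert.prems(3) and Z = insert.prems(4) and lim = insert.prems(6)
    and g = insert.prems(7) and q = insert.prems(8) and gq = insert.prems(9)
  obtain \<Omega> r where r: "r > 0" and \<Omega>: "smooth_on {w. \<bar>Re w\<bar> < r} \<Omega>" "\<And>w. \<Omega> w = \<Omega> (of_real (Re w))" "\<Omega> 0 = l"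
    and D0: "\<And>w. \<bar>Re w\<bar> < r \<Longrightarrow> Im w = Re w * \<Omega> w \<Longrightarrow> D w = 0"
    by (rule zero_curve[OF N D Z insert.hyps C lim]) (assumption, rule that)
  let ?ell = "\<lambda>w. Im w - Re w * \<Omega> w"
  obtain N1 D1 where N1: "open N1" "0 \<in> N1" "N1 \<subseteq> N" "N1 \<subseteq> {w. \<bar>Re w\<bar> < r}"
    and D1: "smooth_on N1 D1" "\<And>w. w \<in> N1 \<Longrightarrow> D w = ?ell w * D1 w"
  proof (rule curve_division[OF \<Omega>(1,2) r N D])
    show "D w = 0" if "\<bar>Re w\<bar> < r" "Im w = Re w * \<Omega> w" for w using D0[OF that] .
  qed (rule that)
  obtain N2 g2 where N2: "open N2" "0 \<in> N2" "N2 \<subseteq> N"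
    and g2: "smooth_on N2 g2" "\<And>w. w \<in> N2 \<Longrightarrow> g w = ?ell w * g2 w"
  proof (rule curve_division[OF \<Omega>(1,2) r N g])
    show "g w = 0" if "w \<in> N" "\<bar>Re w\<bar> < r" "Im w = Re w * \<Omega> w" for w using D0[OF that(2,3)] gq[OF that(1)] by simp
  qed (rule that)
  define N3 where "N3 = N1 \<inter> N2"
  have N3: "open N3" "0 \<in> N3" using N1 N2 by (auto simp: N3_def)
  \<comment> \<open>Off the curve its equation can be cancelled. A vertical line meets the curve in
    a single point, where continuity takes over.\<close>
  have eq: "g2 w = D1 w * q w" if w: "w \<in> N3" for w
  proof -
    let ?vert = "\<lambda>t. Complex (Re w) t"
    have vert: "isCont ?vert t" for t unfolding Complex_eq by (intro continuous_intros)
    have c: "isCont g2 w" "isCont D1 w" "isCont q w"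
      using smooth_on_continuous[OF g2(1)] smooth_on_continuous[OF D1(1)] q w N1 N2 N
      by (auto simp: N3_def continuous_on_eq_continuous_at)
    have "g2 (?vert (Im w)) = D1 (?vert (Im w)) * q (?vert (Im w))"
    proof (rule continuous_agree_off_finite[where I = "?vert -` N3" and Z = "{Re w * \<Omega> w}" and a = "Im w"
        and \<phi> = "\<lambda>t. g2 (?vert t)" and \<psi> = "\<lambda>t. D1 (?vert t) * q (?vert t)"])
      show "open (?vert -` N3)"
        using vert N3(1) by (intro continuous_open_vimage) (auto simp: continuous_on_eq_continuous_at)
      fix t assume t: "t \<in> ?vert -` N3" "t \<notin> {Re w * \<Omega> w}"
      have "\<Omega> (?vert t) = \<Omega> w" using \<Omega>(2) by (metis complex.sel(1))
      then have "?ell (?vert t) \<noteq> 0" using t by simp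
      moreover have "?ell (?vert t) * g2 (?vert t) = ?ell (?vert t) * (D1 (?vert t) * q (?vert t))"
        using t D1(2)[of "?vert t"] g2(2)[of "?vert t"] gq[of "?vert t"] N1 by (auto simp: N3_def)
      ultimately show "g2 (?vert t) = D1 (?vert t) * q (?vert t)" by simp
    qed (use c w in \<open>auto intro!: continuous_intros isCont_o2[OF vert]\<close>)
    then show ?thesis by simp
  qed
  show ?case
  proof (rule insert.IH[of N3 D1 "insert l Z" g2])
    show "smooth_on N3 D1" "smooth_on N3 g2" "continuous_on N3 q"
      using D1 g2 q N1 N2 by (auto simp: N3_def intro: smooth_on_subset continuous_on_subset)
    show "finite (insert l Z)" using Z by simp
    fix \<omega> assume w: "\<omega> \<notin> insert l Z"
    let ?p = "\<lambda>x. Complex x (x * \<omega>)"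
    have p: "(?p \<longlongrightarrow> 0) (at 0)"
    proof -
      have "(?p \<longlongrightarrow> Complex 0 (0 * \<omega>)) (at 0)" by (intro tendsto_intros)
      then show ?thesis by (simp add: zero_complex.code)
    qed
    have "isCont \<Omega> 0"
    proof -
      have "open {w. \<bar>Re w\<bar> < r}" by (intro open_Collect_less continuous_intros)
      then show ?thesis using smooth_on_continuous[OF \<Omega>(1)] r by (simp add: continuous_on_eq_continuous_at)
    qed
    then have "((\<lambda>x. \<Omega> (?p x)) \<longlongrightarrow> l) (at 0)" using isCont_tendsto_compose[OF _ p] \<Omega>(3) by metis
    note \<Omega>_lim = this
    have "eventually (\<lambda>x. \<Omega> (?p x) \<noteq> \<omega>) (at 0)"
      using w by (intro tendsto_imp_eventually_ne[OF \<Omega>_lim]) auto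
    note ne = this
    have l1: "((\<lambda>x. (D (?p x) / x ^ card (insert l L)) / (\<omega> - \<Omega> (?p x))) \<longlongrightarrow> C * (\<Prod>m\<in>insert l L. \<omega> - m) / (\<omega> - l)) (at 0)"
      using w by (intro tendsto_divide lim tendsto_diff tendsto_const \<Omega>_lim) auto
    have eqC: "C * (\<Prod>m\<in>insert l L. \<omega> - m) / (\<omega> - l) = C * (\<Prod>m\<in>L. \<omega> - m)"
      using w insert.hyps by simp
    have ev: "eventually (\<lambda>x. (D (?p x) / x ^ card (insert l L)) / (\<omega> - \<Omega> (?p x)) = D1 (?p x) / x ^ card L) (at 0)"
      using ne eventually_neq_at_within[of 0 0 UNIV] topological_tendstoD[OF p N1(1,2)]
    proof eventually_elim
      case (elim x)
      have "D (?p x) = x * (\<omega> - \<Omega> (?p x)) * D1 (?p x)" using D1(2)[OF elim(3)] by (simp add: algebra_simps)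
      then show ?case using elim insert.hyps by simp
    qed
    show "((\<lambda>x. D1 (?p x) / x ^ card L) \<longlongrightarrow> C * (\<Prod>m\<in>L. \<omega> - m)) (at 0)"
      using Lim_transform_eventually[OF l1 ev] unfolding eqC .
  qed (use N3 C eq in auto)
qed

text \<open>Zero counting: \<open>Complex \<omega> (-1)\<close> is \<omega> - i, with argument in
  (-pi, 0), and the real part of its k-th power vanishes when k times the argument is an odd
  multiple of pi/2. This happens for k values of \<omega>, and a monic polynomial of degree k has no
  room for further or multiple zeros.\<close>

lemma Re_power_factorization:
  assumes "k > 0"
  obtains L where "finite L" "card L = k" "\<And>\<omega>. Re (Complex \<omega> (-1) ^ k) = (\<Prod>l\<in>L. \<omega> - l)"
proof -
  \<comment> \<open>Multiplication of R + i S by \<omega> - i gives (\<omega> R + S) + i (\<omega> S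
    - R); the lower degree of \<open>S\<close> is what keeps the real part monic.\<close>
  have "\<exists>R S :: real poly. lead_coeff R = 1 \<and> degree R = j \<and> (S = 0 \<or> degree S < j) \<and>
      (\<forall>\<omega>. Complex \<omega> (-1) ^ j = Complex (poly R \<omega>) (poly S \<omega>))" for j
  proof (induction j)
    case 0
    show ?case by (rule exI[of _ 1], rule exI[of _ 0]) (simp add: complex_eq_iff)
  next
    case (Suc j)
    then obtain R S :: "real poly" where RS: "lead_coeff R = 1" "degree R = j" "S = 0 \<or> degree S < j"
      "\<And>\<omega>. Complex \<omega> (-1) ^ j = Complex (poly R \<omega>) (poly S \<omega>)" by blast
    have R0: "R \<noteq> 0" using RS(1) by auto
    have dS: "degree S < Suc j" using RS(3) by auto
    have dR: "degree (pCons 0 R) = Suc j" using R0 RS(2) by simp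
    have "degree (pCons 0 S - R) < Suc j"
      using RS(2,3) by (intro degree_diff_less) auto
    moreover have "degree (pCons 0 R + S) = Suc j" using degree_add_eq_left[of S "pCons 0 R"] dS dR by simp
    moreover have "lead_coeff (pCons 0 R + S) = 1"
      using lead_coeff_add_le[of S "pCons 0 R"] dS dR R0 RS by (simp add: add.commute)
    moreover have "Complex \<omega> (-1) ^ Suc j = Complex (poly (pCons 0 R + S) \<omega>) (poly (pCons 0 S - R) \<omega>)" for \<omega>
      using RS(4) by (simp add: complex_eq_iff)
    ultimately show ?case by blast
  qed
  from this[of k] obtain R S :: "real poly" where R: "lead_coeff R = 1" "degree R = k" "\<And>\<omega>. Re (Complex \<omega> (-1) ^ k) = poly R \<omega>"
    by auto
  \<comment> \<open>Since tan \<phi> - i has argument \<phi> - pi/2, this choice makes k times the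
    argument equal to -(2 j + 1) pi/2.\<close>
  define \<phi> where "\<phi> = (\<lambda>j. pi/2 - (2 * real j + 1) * pi / (2 * real k))"
  have \<phi>: "-(pi/2) < \<phi> j \<and> \<phi> j < pi/2" if "j < k" for j
  proof -
    have "real j + 1 \<le> real k" using that by linarith
    then have "(2 * real j + 1) * pi < 2 * real k * pi" by (intro mult_strict_right_mono) auto
    then have "(2 * real j + 1) * pi / (2 * real k) < pi" using that by (simp add: divide_less_eq mult_ac)
    moreover have "(2 * real j + 1) * pi / (2 * real k) > 0" using that by (intro divide_pos_pos mult_pos_pos) auto
    ultimately show ?thesis unfolding \<phi>_def by linarith
  qed
  define L where "L = (\<lambda>j. tan (\<phi> j)) ` {..<k}"
  have inj: "inj_on (\<lambda>j. tan (\<phi> j)) {..<k}"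
  proof (rule inj_onI)
    fix i j assume ij: "i \<in> {..<k}" "j \<in> {..<k}" "tan (\<phi> i) = tan (\<phi> j)"
    then have "\<phi> i = \<phi> j"
      using \<phi>[of i] \<phi>[of j] tan_monotone[of "\<phi> i" "\<phi> j"] tan_monotone[of "\<phi> j" "\<phi> i"]
      by (cases "\<phi> i" "\<phi> j" rule: linorder_cases) auto
    then show "i = j" using assms by (simp add: \<phi>_def field_simps)
  qed
  have fin: "finite L" and card: "card L = k" by (auto simp: L_def card_image[OF inj])
  have root: "poly R l = 0" if "l \<in> L" for l
  proof -
    obtain j where j: "j < k" "l = tan (\<phi> j)" using \<open>l \<in> L\<close> by (auto simp: L_def)
    have c: "cos (\<phi> j) > 0" using \<phi>[OF j(1)] cos_gt_zero_pi by auto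
    have "cos (\<phi> j - pi/2) = sin (\<phi> j)" "sin (\<phi> j - pi/2) = - cos (\<phi> j)"
      by (simp_all add: sin_diff cos_diff)
    then have "Complex l (-1) = of_real (1 / cos (\<phi> j)) * cis (\<phi> j - pi/2)"
      using c by (simp add: complex_eq_iff j(2) tan_def)
    then have "Complex l (-1) ^ k = of_real ((1 / cos (\<phi> j)) ^ k) * cis (real k * (\<phi> j - pi/2))"
      by (simp only: power_mult_distrib Complex.DeMoivre of_real_power)
    moreover have "real k * (\<phi> j - pi/2) = - ((2 * real j + 1) * (pi/2))"
      using assms by (simp add: \<phi>_def field_simps)
    moreover have "cos ((2 * real j + 1) * (pi/2)) = 0"
      unfolding cos_zero_iff_int by (intro exI[of _ "2 * int j + 1"]) auto
    ultimately have "Re (Complex l (-1) ^ k) = 0" by (simp add: cis.sel)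
    then show ?thesis using R(3) by simp
  qed
  define Q where "Q = (\<Prod>l\<in>L. [:- l, 1:])"
  have Q: "degree Q = k" "lead_coeff Q = 1" "\<And>\<omega>. poly Q \<omega> = (\<Prod>l\<in>L. \<omega> - l)"
  proof -
    show "degree Q = k" using card by (simp add: Q_def degree_prod_eq_sum_degree)
    show "lead_coeff Q = 1" unfolding Q_def lead_coeff_prod by simp
    show "poly Q \<omega> = (\<Prod>l\<in>L. \<omega> - l)" for \<omega> by (simp add: Q_def poly_prod)
  qed
  have "R - Q = 0"
  proof (rule ccontr)
    assume ne: "R - Q \<noteq> 0"
    have "degree (R - Q) < k"
    proof (rule ccontr)
      assume "\<not> degree (R - Q) < k"
      moreover have "degree (R - Q) \<le> k" using degree_diff_le[of R k Q] R Q by simp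
      ultimately have "degree (R - Q) = k" by simp
      then have "coeff (R - Q) k = lead_coeff (R - Q)" by simp
      also have "\<dots> \<noteq> 0" using ne leading_coeff_0_iff by blast
      finally show False using R Q by simp
    qed
    moreover have "card L \<le> card {x. poly (R - Q) x = 0}"
    proof (rule card_mono[OF poly_roots_finite[OF ne]])
      have "poly Q l = 0" if "l \<in> L" for l using Q(3) fin that by simp
      then show "L \<subseteq> {x. poly (R - Q) x = 0}" using root by auto
    qed
    moreover have "card {x. poly (R - Q) x = 0} \<le> degree (R - Q)" using card_poly_roots_bound[OF ne] by simp
    ultimately show False using card by simp
  qed
  then show thesis using that[OF fin card] R(3) Q(3) by simp
qed

text \<open>If \<open>Im M\<close> vanishes at \<open>Z p\<close>, then \<open>M\<close> minus its
  value there is a k-th power times a non-vanishing holomorphic function; \<open>nz\<close>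
  guarantees that it is not constant. As \<open>Z\<close> is differentiable at \<open>p\<close>, the
  leading term of \<open>D\<close> along each straight line through \<open>p\<close> is
  \<open>J p\<close> times the imaginary part of a constant times the k-th power of the image
  direction. In suitable linear coordinates this is the form factored above, and
  \<open>division_germ\<close> applies.\<close>

lemma division_by_harmonic_at:
  fixes g q D J :: "complex \<Rightarrow> real" and M Z :: "complex \<Rightarrow> complex"
  assumes U: "open U" "p \<in> U" and dZ: "(Z has_derivative (\<lambda>v. Re v *\<^sub>R a + Im v *\<^sub>R b)) (at p)"
    and ab: "cross2 a b \<noteq> 0" and T: "open T" "Z p \<in> T" and M: "M holomorphic_on T"
    and nz: "\<And>e. e > 0 \<Longrightarrow> \<exists>\<zeta>\<in>ball (Z p) e. Im (M \<zeta>) \<noteq> 0"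
    and J: "continuous_on U J" "J p \<noteq> 0" and D: "smooth_on U D" "\<And>w. w \<in> U \<Longrightarrow> D w = Im (M (Z w)) * J w"
    and g: "smooth_on U g" and q: "continuous_on U q" and gq: "\<And>w. w \<in> U \<Longrightarrow> g w = D w * q w"
  shows "\<exists>N. open N \<and> p \<in> N \<and> smooth_on N q"
proof (cases "Im (M (Z p)) = 0")
  case False
  define N where "N = U \<inter> D -` (- {0})"
  have N: "open N" "p \<in> N"
  proof -
    show "open N" unfolding N_def by (rule continuous_open_preimage[OF smooth_on_continuous[OF D(1)] U(1)]) auto
    show "p \<in> N" using False D(2)[OF U(2)] J U by (simp add: N_def)
  qed
  have "smooth_on N (\<lambda>w. g w / D w)"
    by (intro smooth_on_divide N smooth_on_subset[OF D(1)] smooth_on_subset[OF g]) (auto simp: N_def)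
  then have "smooth_on N q"
    by (subst smooth_on_cong[OF N(1), of _ "\<lambda>w. g w / D w"]) (use gq in \<open>auto simp: N_def\<close>)
  then show ?thesis using N by blast
next
  case True
  define \<zeta>0 where "\<zeta>0 = Z p"
  obtain \<rho> where \<rho>: "\<rho> > 0" "ball \<zeta>0 \<rho> \<subseteq> T" using T open_contains_ball unfolding \<zeta>0_def by blast
  define M1 where "M1 = (\<lambda>\<zeta>. M \<zeta> - M \<zeta>0)"
  have Im_M1: "Im (M1 \<zeta>) = Im (M \<zeta>)" for \<zeta> using True by (simp add: M1_def \<zeta>0_def)
  obtain h t k where k: "0 < k" "0 < t" "ball \<zeta>0 t \<subseteq> ball \<zeta>0 \<rho>" "h holomorphic_on ball \<zeta>0 t"
    "\<And>\<zeta>. \<zeta> \<in> ball \<zeta>0 t \<Longrightarrow> M1 \<zeta> = (\<zeta> - \<zeta>0) ^ k * h \<zeta>" "\<And>\<zeta>. \<zeta> \<in> ball \<zeta>0 t \<Longrightarrow> h \<zeta> \<noteq> 0"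
  proof (rule holomorphic_factor_zero_nonconstant[of M1 "ball \<zeta>0 \<rho>" \<zeta>0])
    show "M1 holomorphic_on ball \<zeta>0 \<rho>" unfolding M1_def
      by (intro holomorphic_intros holomorphic_on_subset[OF M \<rho>(2)])
    show "\<not> M1 constant_on ball \<zeta>0 \<rho>"
    proof
      assume "M1 constant_on ball \<zeta>0 \<rho>"
      then have "M1 \<zeta> = M1 \<zeta>0" if "\<zeta> \<in> ball \<zeta>0 \<rho>" for \<zeta>
        using that \<rho> unfolding constant_on_def by (metis centre_in_ball)
      moreover obtain \<zeta> where "\<zeta> \<in> ball \<zeta>0 \<rho>" "Im (M \<zeta>) \<noteq> 0" using nz[OF \<rho>(1)] \<zeta>0_def by blast
      ultimately show False using Im_M1[of \<zeta>] by (simp add: M1_def)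
    qed
  qed (use \<rho> in \<open>auto simp: M1_def\<close>)
  define c where "c = h \<zeta>0"
  have c: "c \<noteq> 0" using k(2,6) by (simp add: c_def)
  \<comment> \<open>The constants normalize the leading form to i (\<omega> - i)^k. As 1 + i
    \<omega> = i (\<omega> - i), the constant \<open>c'\<close> turns the factor i^k into i, and
    scaling by the root \<open>e\<close> replaces \<open>c\<close> by \<open>c'\<close>. The
    vertical direction is then not a zero, so all zero directions have finite slopes.\<close>
  define c' where "c' = \<i> / \<i> ^ k"
  have c': "c' \<noteq> 0" by (simp add: c'_def)
  obtain e where e: "c / c' = e ^ k" using exists_complex_root k(1) by blast
  then have e0: "e \<noteq> 0" using c c' k(1) by (metis divide_eq_0_iff power_eq_0_iff)
  \<comment> \<open>The inverse of the differential of \<open>Z\<close> at \<open>p\<close> after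
    division by \<open>e\<close>: to first order, Z (p + K u) is Z p + u / e.\<close>
  define K where "K = (\<lambda>u. Complex (cross2 (u / e) b / cross2 a b) (cross2 a (u / e) / cross2 a b))"
  define K' where "K' = (\<lambda>v. e * (Re v *\<^sub>R a + Im v *\<^sub>R b))"
  have AK: "Re (K u) *\<^sub>R a + Im (K u) *\<^sub>R b = u / e" for u
  proof -
    have "Re (K u) *\<^sub>R a + Im (K u) *\<^sub>R b = x" if "x = u / e" for x
      unfolding K_def that[symmetric]
      using ab by (simp add: complex_eq_iff divide_simps) (simp add: cross2_def algebra_simps)
    then show ?thesis by simp
  qed
  have K'K: "K' (K u) = u" for u unfolding K'_def AK using e0 by simp
  have KK': "K (K' v) = v" for v
    using ab e0 unfolding K_def K'_def by (simp add: complex_eq_iff divide_simps) (simp add: cross2_def algebra_simps)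
  have linK: "bounded_linear K"
  proof -
    have "bounded_linear (\<lambda>v. Complex (cross2 v b / cross2 a b) (cross2 a v / cross2 a b))"
      unfolding linear_conv_bounded_linear[symmetric]
      by unfold_locales (auto simp: complex_eq_iff cross2_def field_simps add_divide_distrib diff_divide_distrib)
    from bounded_linear_compose[OF this bounded_linear_divide[of e]] show ?thesis by (simp add: K_def)
  qed
  have linK': "bounded_linear K'"
    unfolding linear_conv_bounded_linear[symmetric] K'_def
    by unfold_locales (auto simp: complex_eq_iff algebra_simps)
  define \<sigma> where "\<sigma> = (\<lambda>u. p + K u)"
  have s\<sigma>: "smooth_on S \<sigma>" if "open S" for S
    unfolding \<sigma>_def by (intro smooth_on_add smooth_on_const smooth_on_linear[OF _ linK] smooth_on_id that)
  have \<sigma>0: "\<sigma> 0 = p" using linear_0[OF bounded_linear.linear[OF linK]] by (simp add: \<sigma>_def)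
  define N where "N = \<sigma> -` U"
  have N: "open N" "0 \<in> N"
    using open_vimage[OF U(1) smooth_on_continuous[OF s\<sigma>[OF open_UNIV]]] U(2) \<sigma>0
    by (auto simp: N_def)
  obtain L where L: "finite L" "card L = k" "\<And>\<omega>. Re (Complex \<omega> (-1) ^ k) = (\<Prod>l\<in>L. \<omega> - l)"
    using Re_power_factorization[OF k(1)] by blast
  have "\<exists>N'. open N' \<and> 0 \<in> N' \<and> smooth_on N' (\<lambda>u. q (\<sigma> u))"
  proof (rule division_germ[OF L(1) N, where Z = "{}" and C = "J p"])
    show "smooth_on N (\<lambda>u. D (\<sigma> u))" "smooth_on N (\<lambda>u. g (\<sigma> u))"
      by (rule smooth_on_compose[OF N(1) U(1) _ s\<sigma>[OF N(1)]]; use D g in \<open>simp add: N_def\<close>)+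
    show "continuous_on N (\<lambda>u. q (\<sigma> u))"
      by (rule continuous_on_compose2[OF q smooth_on_continuous[OF s\<sigma>[OF N(1)]]]) (auto simp: N_def)
    show "g (\<sigma> u) = D (\<sigma> u) * q (\<sigma> u)" if "u \<in> N" for u using that gq by (simp add: N_def)
    fix \<omega> :: real
    define \<kappa> where "\<kappa> = Complex 1 \<omega>"
    define w where "w = (\<lambda>x. p + x *\<^sub>R K \<kappa>)"
    have w: "\<sigma> (Complex x (x * \<omega>)) = w x" for x
    proof -
      have "Complex x (x * \<omega>) = x *\<^sub>R \<kappa>" by (simp add: complex_eq_iff \<kappa>_def)
      then show ?thesis using linear_cmul[OF bounded_linear.linear[OF linK]] by (simp add: \<sigma>_def w_def)
    qed
    have wlim: "(w \<longlongrightarrow> p) (at 0)"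
    proof -
      have "(w \<longlongrightarrow> p + 0 *\<^sub>R K \<kappa>) (at 0)" unfolding w_def by (intro tendsto_intros)
      then show ?thesis by simp
    qed
    have dw: "(w has_derivative (\<lambda>x. x *\<^sub>R K \<kappa>)) (at 0)"
      unfolding w_def by (auto intro!: derivative_eq_intros)
    have "((\<lambda>x. Z (w x)) has_derivative (\<lambda>x. x *\<^sub>R (\<kappa> / e))) (at 0)"
    proof (rule has_derivative_eq_rhs[OF has_derivative_compose[OF dw]])
      show "(Z has_derivative (\<lambda>v. Re v *\<^sub>R a + Im v *\<^sub>R b)) (at (w 0))" using dZ by (simp add: w_def)
      show "(\<lambda>x. Re (x *\<^sub>R K \<kappa>) *\<^sub>R a + Im (x *\<^sub>R K \<kappa>) *\<^sub>R b) = (\<lambda>x. x *\<^sub>R (\<kappa> / e))"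
        unfolding AK[symmetric] by (simp add: fun_eq_iff scaleR_add_right)
    qed
    note dZw = this
    have quot: "((\<lambda>x. (Z (w x) - \<zeta>0) / of_real x) \<longlongrightarrow> \<kappa> / e) (at 0)"
    proof -
      have R: "((\<lambda>x. P (Z (w x))) has_real_derivative P (\<kappa> / e)) (at 0)" if "bounded_linear P" for P
        unfolding has_field_derivative_def
        by (rule has_derivative_eq_rhs[OF bounded_linear.has_derivative[OF that dZw]])
          (simp add: fun_eq_iff linear_cmul[OF bounded_linear.linear[OF that]])
      have "((\<lambda>x. (P (Z (w x)) - P \<zeta>0) / x) \<longlongrightarrow> P (\<kappa> / e)) (at 0)" if "bounded_linear P" for P
        using R[OF that] unfolding DERIV_def by (simp add: w_def \<zeta>0_def)
      from tendsto_Complex[OF this[OF bounded_linear_Re] this[OF bounded_linear_Im]]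
      show ?thesis by (simp add: complex_eq_iff tendsto_complex_iff)
    qed
    have Zlim: "((\<lambda>x. Z (w x)) \<longlongrightarrow> \<zeta>0) (at 0)"
    proof -
      have "isCont Z p" using dZ has_derivative_continuous by blast
      then show ?thesis unfolding \<zeta>0_def using wlim by (rule isCont_tendsto_compose)
    qed
    have "isCont h \<zeta>0"
      using holomorphic_on_imp_continuous_on[OF k(4)] k(2) by (simp add: continuous_on_eq_continuous_at)
    then have hlim: "((\<lambda>x. h (Z (w x))) \<longlongrightarrow> c) (at 0)"
      unfolding c_def using Zlim by (rule isCont_tendsto_compose)
    have "isCont J p" using J(1) U by (simp add: continuous_on_eq_continuous_at)
    then have Jlim: "((\<lambda>x. J (w x)) \<longlongrightarrow> J p) (at 0)" using wlim by (rule isCont_tendsto_compose)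
    have "((\<lambda>x. J (w x) * Im (((Z (w x) - \<zeta>0) / of_real x) ^ k * h (Z (w x)))) \<longlongrightarrow> J p * Im ((\<kappa> / e) ^ k * c)) (at 0)"
      by (intro tendsto_intros Jlim quot hlim)
    note l1 = this
    have "eventually (\<lambda>x. Z (w x) \<in> ball \<zeta>0 t) (at 0)"
      using topological_tendstoD[OF Zlim open_ball] k(2) by simp
    moreover have "eventually (\<lambda>x. w x \<in> U) (at 0)" using topological_tendstoD[OF wlim U] .
    ultimately have ev: "eventually (\<lambda>x. J (w x) * Im (((Z (w x) - \<zeta>0) / of_real x) ^ k * h (Z (w x)))
        = D (\<sigma> (Complex x (x * \<omega>))) / x ^ card L) (at 0)"
    proof eventually_elim
      case (elim x)
      have "((Z (w x) - \<zeta>0) / of_real x) ^ k * h (Z (w x)) = M1 (Z (w x)) / of_real (x ^ k)"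
        using k(5)[OF elim(1)] by (simp add: power_divide)
      then show ?case
        unfolding w D(2)[OF elim(2)] L(2) by (simp only: Im_divide_of_real Im_M1) simp
    qed
    have "Im ((\<kappa> / e) ^ k * c) = (\<Prod>l\<in>L. \<omega> - l)"
    proof -
      have "\<kappa> = \<i> * Complex \<omega> (-1)" by (simp add: complex_eq_iff \<kappa>_def)
      moreover have "c = c' * e ^ k" using e c' by (simp add: field_simps)
      ultimately have "(\<kappa> / e) ^ k * c = \<i> * Complex \<omega> (-1) ^ k"
        using e0 by (simp add: c'_def power_divide power_mult_distrib)
      then show ?thesis using L(3) by simp
    qed
    then show "((\<lambda>x. D (\<sigma> (Complex x (x * \<omega>))) / x ^ card L) \<longlongrightarrow> J p * (\<Prod>l\<in>L. \<omega> - l)) (at 0)"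
      using Lim_transform_eventually[OF l1 ev] by simp
  qed (use J in auto)
  then obtain N' where N': "open N'" "0 \<in> N'" "smooth_on N' (\<lambda>u. q (\<sigma> u))" by blast
  define \<tau> where "\<tau> = (\<lambda>w. K' (w - p))"
  have s\<tau>: "smooth_on S \<tau>" if "open S" for S
    unfolding \<tau>_def by (intro smooth_on_diff smooth_on_const smooth_on_linear[OF _ linK'] smooth_on_id that)
  have \<sigma>\<tau>: "\<sigma> (\<tau> w) = w" for w by (simp add: \<sigma>_def \<tau>_def KK')
  have \<tau>p: "\<tau> p = 0" using linear_0[OF bounded_linear.linear[OF linK']] by (simp add: \<tau>_def)
  have o: "open (\<tau> -` N')"
    by (rule open_vimage[OF N'(1) smooth_on_continuous[OF s\<tau>[OF open_UNIV]]])
  have "smooth_on (\<tau> -` N') (\<lambda>w. q (\<sigma> (\<tau> w)))"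
    by (rule smooth_on_compose[OF o N'(1,3) s\<tau>[OF o]]) simp
  then show ?thesis using o \<tau>p N'(2) by (intro exI[of _ "\<tau> -` N'"]) (simp add: \<sigma>\<tau>)
qed

section \<open>Double power series\<close>

definition monom2 :: "nat \<times> nat \<Rightarrow> real \<Rightarrow> real \<Rightarrow> real"
  where "monom2 d x y = x ^ fst d * y ^ snd d"

text \<open>\<open>N\<close> is the norm of \<open>F\<close> in the Banach algebra of double power
  series that converge absolutely on the square of half side \<open>r\<close>. An upper bound
  \<open>\<rho>\<close> is carried instead of \<open>N\<close>, so that norms of sums, products and
  series need only be estimated.\<close>

definition majorized :: "real \<Rightarrow> real \<Rightarrow> (real \<Rightarrow> real \<Rightarrow> complex) \<Rightarrow> bool"
  where "majorized r \<rho> F \<longleftrightarrow> (\<exists>a N. ((\<lambda>d. norm (a d) * monom2 d r r) has_sum N) UNIV \<and> N \<le> \<rho> \<and>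
    (\<forall>x y. \<bar>x\<bar> \<le> r \<longrightarrow> \<bar>y\<bar> \<le> r \<longrightarrow> ((\<lambda>d. a d * of_real (monom2 d x y)) has_sum F x y) UNIV))"

lemma monom2_nonneg: "r \<ge> 0 \<Longrightarrow> monom2 d r r \<ge> 0"
  by (simp add: monom2_def)

lemma monom2_le: "\<bar>x\<bar> \<le> r \<Longrightarrow> \<bar>y\<bar> \<le> r \<Longrightarrow> \<bar>monom2 d x y\<bar> \<le> monom2 d r r"
  by (auto simp: monom2_def abs_mult power_abs intro!: mult_mono power_mono)

text \<open>Products and series of double power series arise as families of monomials in which a
  degree may occur many times, recorded by \<open>d\<close>. Absolute convergence permits collecting
  equal degrees, and by the triangle inequality the norm does not grow.\<close>

lemma majorized_regroup:
  fixes \<alpha> :: "'i \<Rightarrow> complex" and d :: "'i \<Rightarrow> nat \<times> nat"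
  assumes r: "r > 0" and N: "((\<lambda>i. norm (\<alpha> i) * monom2 (d i) r r) has_sum N) UNIV" "N \<le> \<rho>"
    and F: "\<And>x y. \<bar>x\<bar> \<le> r \<Longrightarrow> \<bar>y\<bar> \<le> r \<Longrightarrow> ((\<lambda>i. \<alpha> i * of_real (monom2 (d i) x y)) has_sum F x y) UNIV"
  shows "majorized r \<rho> F"
proof -
  define A where "A = (\<lambda>p. {i. d i = p})"
  have bij: "bij_betw snd (Sigma UNIV A) UNIV"
    by (auto simp: bij_betw_def inj_on_def A_def image_iff)
  have pos: "monom2 p r r > 0" for p using r by (simp add: monom2_def)
  have sA: "(\<lambda>i. norm (\<alpha> i)) summable_on A p" for p
  proof -
    have "(\<lambda>i. norm (\<alpha> i) * monom2 (d i) r r) summable_on A p"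
      using N(1) summable_on_subset_banach[of _ UNIV "A p"] by (auto simp: summable_on_def)
    then have "(\<lambda>i. norm (\<alpha> i) * monom2 p r r) summable_on A p"
      by (rule summable_on_cong[THEN iffD1, rotated]) (simp add: A_def)
    then show ?thesis using pos[of p] by (metis less_irrefl summable_on_cmult_left')
  qed
  define a where "a = (\<lambda>p. infsum \<alpha> (A p))"
  have a: "(\<alpha> has_sum a p) (A p)" for p
    using abs_summable_summable[OF sA] by (simp add: a_def)
  have "((\<lambda>z. norm (\<alpha> (snd z)) * monom2 (d (snd z)) r r) has_sum N) (Sigma UNIV A)"
    using N(1) has_sum_reindex_bij_betw[OF bij, of "\<lambda>i. norm (\<alpha> i) * monom2 (d i) r r"] by simp
  then have "((\<lambda>p. infsum (\<lambda>i. norm (\<alpha> i)) (A p) * monom2 p r r) has_sum N) UNIV"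
  proof (rule has_sum_SigmaD)
    fix p
    have "((\<lambda>i. norm (\<alpha> i) * monom2 p r r) has_sum infsum (\<lambda>i. norm (\<alpha> i)) (A p) * monom2 p r r) (A p)"
      by (intro has_sum_cmult_left has_sum_infsum sA)
    then show "((\<lambda>y. norm (\<alpha> (snd (p, y))) * monom2 (d (snd (p, y))) r r) has_sum infsum (\<lambda>i. norm (\<alpha> i)) (A p) * monom2 p r r) (A p)"
      by (rule has_sum_cong[THEN iffD1, rotated]) (simp add: A_def)
  qed
  note N' = this
  have le: "norm (a p) * monom2 p r r \<le> infsum (\<lambda>i. norm (\<alpha> i)) (A p) * monom2 p r r" for p
    using norm_infsum_bound[OF sA] pos[of p] by (simp add: a_def)
  have "(\<lambda>p. norm (a p) * monom2 p r r) summable_on UNIV"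
    by (rule summable_on_comparison_test[of "\<lambda>p. infsum (\<lambda>i. norm (\<alpha> i)) (A p) * monom2 p r r"])
      (use N' le pos in \<open>auto simp: summable_on_def less_imp_le\<close>)
  then obtain N1 where N1: "((\<lambda>p. norm (a p) * monom2 p r r) has_sum N1) UNIV" by (auto simp: summable_on_def)
  have "N1 \<le> \<rho>" using has_sum_mono[OF N1 N' le] N(2) by linarith
  moreover have "((\<lambda>p. a p * of_real (monom2 p x y)) has_sum F x y) UNIV" if xy: "\<bar>x\<bar> \<le> r" "\<bar>y\<bar> \<le> r" for x y
  proof -
    have "((\<lambda>z. \<alpha> (snd z) * of_real (monom2 (d (snd z)) x y)) has_sum F x y) (Sigma UNIV A)"
      using F[OF xy] has_sum_reindex_bij_betw[OF bij, of "\<lambda>i. \<alpha> i * of_real (monom2 (d i) x y)"] by simp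
    then show ?thesis
    proof (rule has_sum_SigmaD)
      fix p
      have "((\<lambda>i. \<alpha> i * of_real (monom2 p x y)) has_sum a p * of_real (monom2 p x y)) (A p)"
        by (intro has_sum_cmult_left a)
      then show "((\<lambda>i. \<alpha> (snd (p, i)) * of_real (monom2 (d (snd (p, i))) x y)) has_sum a p * of_real (monom2 p x y)) (A p)"
        by (rule has_sum_cong[THEN iffD1, rotated]) (simp add: A_def)
    qed
  qed
  ultimately show ?thesis using N1 unfolding majorized_def by blast
qed

text \<open>The expansions of all \<open>G n\<close> form one family indexed by \<open>n\<close> and
  the degree, absolutely summable by the majorants. Summed over the degree first it gives
  \<open>F\<close>; regrouped by degree it is the required double series.\<close>

lemma majorized_series:
  assumes r: "r > 0" and G: "\<And>n::nat. majorized r (\<sigma> n) (G n)" and c: "summable (\<lambda>n. norm (c n) * \<sigma> n)"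
    and \<sigma>: "\<And>n. \<sigma> n \<ge> 0"
    and F: "\<And>x y. \<bar>x\<bar> \<le> r \<Longrightarrow> \<bar>y\<bar> \<le> r \<Longrightarrow> ((\<lambda>n. c n * G n x y) has_sum F x y) UNIV"
  shows "majorized r (\<Sum>n. norm (c n) * \<sigma> n) F"
proof -
  let ?P = "\<lambda>n aN. ((\<lambda>d. norm (fst aN d) * monom2 d r r) has_sum snd aN) UNIV \<and> snd aN \<le> \<sigma> n \<and>
    (\<forall>x y. \<bar>x\<bar> \<le> r \<longrightarrow> \<bar>y\<bar> \<le> r \<longrightarrow> ((\<lambda>d. fst aN d * of_real (monom2 d x y)) has_sum G n x y) UNIV)"
  have "\<forall>n. \<exists>aN. ?P n aN"
    using G unfolding majorized_def by simp
  from choice[OF this] obtain aN where P: "\<forall>n. ?P n (aN n)" ..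
  define a N where "a = (\<lambda>n. fst (aN n))" and "N = (\<lambda>n. snd (aN n))"
  have aN: "\<And>n. ((\<lambda>d. norm (a n d) * monom2 d r r) has_sum N n) UNIV" "\<And>n. N n \<le> \<sigma> n"
    "\<And>n x y. \<bar>x\<bar> \<le> r \<Longrightarrow> \<bar>y\<bar> \<le> r \<Longrightarrow> ((\<lambda>d. a n d * of_real (monom2 d x y)) has_sum G n x y) UNIV"
    using P by (simp_all add: a_def N_def)
  let ?\<alpha> = "\<lambda>(n, d). c n * a n d"
  have N0: "N n \<ge> 0" for n by (rule has_sum_nonneg[OF aN(1)]) (use r in \<open>simp add: monom2_nonneg\<close>)
  have "summable (\<lambda>n. norm (c n) * N n)"
    by (rule summable_comparison_test'[OF c, of 0]) (use aN(2) N0 in \<open>auto simp: abs_mult intro!: mult_left_mono\<close>)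
  then have "((\<lambda>n. norm (c n) * N n) has_sum (\<Sum>n. norm (c n) * N n)) UNIV"
    using N0 by (intro norm_summable_imp_has_sum) (auto simp: summable_sums)
  note sN = this
  have inner: "((\<lambda>d. norm (?\<alpha> (n, d)) * monom2 (snd (n, d)) r r) has_sum norm (c n) * N n) UNIV" for n
    using has_sum_cmult_right[OF aN(1)[of n], of "norm (c n)"] by (simp add: norm_mult mult_ac)
  have sm: "(\<lambda>i. norm (?\<alpha> i) * monom2 (snd i) r r) summable_on (Sigma UNIV (\<lambda>_. UNIV))"
    by (rule summable_on_SigmaI[OF inner]) (use sN r in \<open>auto simp: summable_on_def monom2_nonneg\<close>)
  have hs: "((\<lambda>i. norm (?\<alpha> i) * monom2 (snd i) r r) has_sum (\<Sum>n. norm (c n) * N n)) UNIV"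
    using has_sum_SigmaI[OF inner sN sm] by simp
  show ?thesis
  proof (rule majorized_regroup[OF r, of ?\<alpha> snd])
    show "((\<lambda>i. norm (?\<alpha> i) * monom2 (snd i) r r) has_sum (\<Sum>n. norm (c n) * N n)) UNIV" by (rule hs)
    show "(\<Sum>n. norm (c n) * N n) \<le> (\<Sum>n. norm (c n) * \<sigma> n)"
      by (rule suminf_le) (use aN(2) c \<open>summable (\<lambda>n. norm (c n) * N n)\<close> in \<open>auto intro!: mult_left_mono\<close>)
    fix x y :: real assume xy: "\<bar>x\<bar> \<le> r" "\<bar>y\<bar> \<le> r"
    have "(\<lambda>i. norm (?\<alpha> i * of_real (monom2 (snd i) x y))) summable_on UNIV"
    proof (rule summable_on_comparison_test)
      show "(\<lambda>i. norm (?\<alpha> i) * monom2 (snd i) r r) summable_on UNIV" using sm by simp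
      show "norm (?\<alpha> i * of_real (monom2 (snd i) x y)) \<le> norm (?\<alpha> i) * monom2 (snd i) r r" for i
        using monom2_le[OF xy] by (simp add: norm_mult mult_left_mono)
    qed auto
    then have "(\<lambda>i. ?\<alpha> i * of_real (monom2 (snd i) x y)) summable_on (Sigma UNIV (\<lambda>_. UNIV))"
      using abs_summable_summable by auto
    moreover have "((\<lambda>d. ?\<alpha> (n, d) * of_real (monom2 (snd (n, d)) x y)) has_sum c n * G n x y) UNIV" for n
      using has_sum_cmult_right[OF aN(3)[OF xy, of n], of "c n"] by (simp add: mult_ac)
    ultimately have "((\<lambda>i. ?\<alpha> i * of_real (monom2 (snd i) x y)) has_sum F x y) (Sigma UNIV (\<lambda>_. UNIV))"
      by (intro has_sum_SigmaI[OF _ F[OF xy]]) auto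
    then show "((\<lambda>i. ?\<alpha> i * of_real (monom2 (snd i) x y)) has_sum F x y) UNIV" by simp
  qed
qed

lemma majorized_cong_nonneg: "majorized r \<rho> F \<Longrightarrow> r \<ge> 0 \<Longrightarrow> \<rho> \<ge> 0"
  unfolding majorized_def by (meson has_sum_nonneg monom2_nonneg mult_nonneg_nonneg norm_ge_zero order_trans)

text \<open>The weights \<open>monom2 d r r\<close> are multiplicative in the degree, which makes
  the norm submultiplicative.\<close>

lemma majorized_mult:
  assumes r: "r > 0" and F: "majorized r \<rho> F" and G: "majorized r \<sigma> G"
  shows "majorized r (\<rho> * \<sigma>) (\<lambda>x y. F x y * G x y)"
proof -
  obtain a N where a: "((\<lambda>d. norm (a d) * monom2 d r r) has_sum N) UNIV" "N \<le> \<rho>"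
    "\<And>x y. \<bar>x\<bar> \<le> r \<Longrightarrow> \<bar>y\<bar> \<le> r \<Longrightarrow> ((\<lambda>d. a d * of_real (monom2 d x y)) has_sum F x y) UNIV"
    using F unfolding majorized_def by blast
  obtain b K where b: "((\<lambda>d. norm (b d) * monom2 d r r) has_sum K) UNIV" "K \<le> \<sigma>"
    "\<And>x y. \<bar>x\<bar> \<le> r \<Longrightarrow> \<bar>y\<bar> \<le> r \<Longrightarrow> ((\<lambda>d. b d * of_real (monom2 d x y)) has_sum G x y) UNIV"
    using G unfolding majorized_def by blast
  have N0: "N \<ge> 0" "K \<ge> 0" using has_sum_nonneg[OF a(1)] has_sum_nonneg[OF b(1)] r by (auto simp: monom2_nonneg)
  have m: "monom2 (d + d') x y = monom2 d x y * monom2 d' x y" for d d' x y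
    by (simp add: monom2_def power_add)
  let ?\<alpha> = "\<lambda>(d, d'). a d * b d'" and ?d = "\<lambda>(d, d'). d + d'"
  have inner: "((\<lambda>d'. norm (?\<alpha> (d, d')) * monom2 (?d (d, d')) r r) has_sum norm (a d) * monom2 d r r * K) UNIV" for d
    using has_sum_cmult_right[OF b(1), of "norm (a d) * monom2 d r r"] by (simp add: norm_mult m mult_ac)
  have outer: "((\<lambda>d. norm (a d) * monom2 d r r * K) has_sum N * K) UNIV"
    by (intro has_sum_cmult_left a)
  have sm: "(\<lambda>i. norm (?\<alpha> i) * monom2 (?d i) r r) summable_on (Sigma UNIV (\<lambda>_. UNIV))"
    by (rule summable_on_SigmaI[OF inner]) (use outer r in \<open>auto simp: summable_on_def monom2_nonneg\<close>)
  show ?thesis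
  proof (rule majorized_regroup[OF r, of ?\<alpha> ?d "N * K"])
    show "((\<lambda>i. norm (?\<alpha> i) * monom2 (?d i) r r) has_sum N * K) UNIV"
      using has_sum_SigmaI[OF inner outer sm] by simp
    show "N * K \<le> \<rho> * \<sigma>" using a(2) b(2) N0 by (intro mult_mono) auto
    fix x y :: real assume xy: "\<bar>x\<bar> \<le> r" "\<bar>y\<bar> \<le> r"
    have "(\<lambda>i. norm (?\<alpha> i * of_real (monom2 (?d i) x y))) summable_on UNIV"
    proof (rule summable_on_comparison_test)
      show "(\<lambda>i. norm (?\<alpha> i) * monom2 (?d i) r r) summable_on UNIV" using sm by simp
      show "norm (?\<alpha> i * of_real (monom2 (?d i) x y)) \<le> norm (?\<alpha> i) * monom2 (?d i) r r" for i
        using monom2_le[OF xy] by (simp add: norm_mult mult_left_mono)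
    qed auto
    then have "(\<lambda>i. ?\<alpha> i * of_real (monom2 (?d i) x y)) summable_on (Sigma UNIV (\<lambda>_. UNIV))"
      using abs_summable_summable by auto
    moreover have "((\<lambda>d'. ?\<alpha> (d, d') * of_real (monom2 (?d (d, d')) x y)) has_sum a d * of_real (monom2 d x y) * G x y) UNIV" for d
      using has_sum_cmult_right[OF b(3)[OF xy], of "a d * of_real (monom2 d x y)"] by (simp add: m mult_ac)
    moreover have "((\<lambda>d. a d * of_real (monom2 d x y) * G x y) has_sum F x y * G x y) UNIV"
      by (intro has_sum_cmult_left a xy)
    ultimately have "((\<lambda>i. ?\<alpha> i * of_real (monom2 (?d i) x y)) has_sum F x y * G x y) (Sigma UNIV (\<lambda>_. UNIV))"
      by (intro has_sum_SigmaI) auto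
    then show "((\<lambda>i. ?\<alpha> i * of_real (monom2 (?d i) x y)) has_sum F x y * G x y) UNIV" by simp
  qed
qed

lemma has_sum_single: "f i = s \<Longrightarrow> (\<And>j. j \<noteq> i \<Longrightarrow> f j = 0) \<Longrightarrow> (f has_sum s) UNIV"
  using has_sum_finite_neutralI[of "{i}" UNIV f s] by auto

lemma majorized_const: "majorized r (norm c) (\<lambda>x y. c)"
  unfolding majorized_def
  by (rule exI[of _ "\<lambda>d. if d = (0,0) then c else 0"], rule exI[of _ "norm c"])
    (auto intro!: has_sum_single[of _ "(0,0)"] simp: monom2_def split: if_splits)

lemma majorized_monom2: "r \<ge> 0 \<Longrightarrow> majorized r (monom2 d r r) (\<lambda>x y. of_real (monom2 d x y))"
  unfolding majorized_def
  by (rule exI[of _ "\<lambda>e. if e = d then 1 else 0"], rule exI[of _ "monom2 d r r"])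
    (auto intro!: has_sum_single[of _ d])

lemma majorized_power: "r > 0 \<Longrightarrow> majorized r \<rho> F \<Longrightarrow> majorized r (\<rho> ^ n) (\<lambda>x y. F x y ^ n)"
proof (induction n)
  case 0
  then show ?case using majorized_const[of r 1] by simp
next
  case (Suc n)
  then show ?case using majorized_mult[of r \<rho> F "\<rho> ^ n" "\<lambda>x y. F x y ^ n"] by simp
qed

lemma majorized_add:
  assumes "majorized r \<rho> F" "majorized r \<sigma> G" "r > 0"
  shows "majorized r (\<rho> + \<sigma>) (\<lambda>x y. F x y + G x y)"
proof -
  obtain a N where a: "((\<lambda>d. norm (a d) * monom2 d r r) has_sum N) UNIV" "N \<le> \<rho>"
    "\<And>x y. \<bar>x\<bar> \<le> r \<Longrightarrow> \<bar>y\<bar> \<le> r \<Longrightarrow> ((\<lambda>d. a d * of_real (monom2 d x y)) has_sum F x y) UNIV"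
    using assms unfolding majorized_def by blast
  obtain b K where b: "((\<lambda>d. norm (b d) * monom2 d r r) has_sum K) UNIV" "K \<le> \<sigma>"
    "\<And>x y. \<bar>x\<bar> \<le> r \<Longrightarrow> \<bar>y\<bar> \<le> r \<Longrightarrow> ((\<lambda>d. b d * of_real (monom2 d x y)) has_sum G x y) UNIV"
    using assms unfolding majorized_def by blast
  have ab: "((\<lambda>d. norm (a d) * monom2 d r r + norm (b d) * monom2 d r r) has_sum N + K) UNIV"
    by (intro has_sum_add a b)
  have le: "norm (a d + b d) * monom2 d r r \<le> norm (a d) * monom2 d r r + norm (b d) * monom2 d r r" for d
    using mult_right_mono[OF norm_triangle_ineq[of "a d" "b d"] monom2_nonneg[of r d]] assms(3) by (simp add: distrib_right)
  have "(\<lambda>d. norm (a d + b d) * monom2 d r r) summable_on UNIV"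
    by (rule summable_on_comparison_test[of "\<lambda>d. norm (a d) * monom2 d r r + norm (b d) * monom2 d r r"])
      (use ab le assms(3) in \<open>auto simp: summable_on_def monom2_nonneg\<close>)
  then obtain N1 where N1: "((\<lambda>d. norm (a d + b d) * monom2 d r r) has_sum N1) UNIV" by (auto simp: summable_on_def)
  moreover have "N1 \<le> \<rho> + \<sigma>" using has_sum_mono[OF N1 ab le] a(2) b(2) by linarith
  moreover have "((\<lambda>d. (a d + b d) * of_real (monom2 d x y)) has_sum F x y + G x y) UNIV" if "\<bar>x\<bar> \<le> r" "\<bar>y\<bar> \<le> r" for x y
    using has_sum_add[OF a(3)[OF that] b(3)[OF that]] by (simp add: distrib_right)
  ultimately show ?thesis unfolding majorized_def by (intro exI[of _ "\<lambda>d. a d + b d"] exI[of _ N1]) blast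
qed

lemma majorized_cnj:
  assumes "majorized r \<rho> F"
  shows "majorized r \<rho> (\<lambda>x y. cnj (F x y))"
proof -
  obtain a N where a: "((\<lambda>d. norm (a d) * monom2 d r r) has_sum N) UNIV" "N \<le> \<rho>"
    "\<And>x y. \<bar>x\<bar> \<le> r \<Longrightarrow> \<bar>y\<bar> \<le> r \<Longrightarrow> ((\<lambda>d. a d * of_real (monom2 d x y)) has_sum F x y) UNIV"
    using assms unfolding majorized_def by blast
  have "((\<lambda>d. cnj (a d) * of_real (monom2 d x y)) has_sum cnj (F x y)) UNIV" if "\<bar>x\<bar> \<le> r" "\<bar>y\<bar> \<le> r" for x y
    using has_sum_bounded_linear[OF bounded_linear_cnj a(3)[OF that]] by simp
  then show ?thesis unfolding majorized_def using a by (intro exI[of _ "\<lambda>d. cnj (a d)"] exI[of _ N]) simp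
qed

text \<open>If \<open>F\<close> vanishes at the origin, every monomial that occurs has degree at
  least one and gains the factor \<open>s / r\<close>. In this way a function vanishing at the
  center is made small enough for a geometric series.\<close>

lemma majorized_shrink:
  assumes "majorized r \<rho> F" "0 < s" "s \<le> r"
  shows "majorized s \<rho> F" and "F 0 0 = 0 \<Longrightarrow> majorized s (s / r * \<rho>) F"
proof -
  obtain a N where a: "((\<lambda>d. norm (a d) * monom2 d r r) has_sum N) UNIV" "N \<le> \<rho>"
    "\<And>x y. \<bar>x\<bar> \<le> r \<Longrightarrow> \<bar>y\<bar> \<le> r \<Longrightarrow> ((\<lambda>d. a d * of_real (monom2 d x y)) has_sum F x y) UNIV"
    using assms unfolding majorized_def by blast
  have *: "majorized s (t * \<rho>) F" if t: "t \<ge> 0" "\<And>d. norm (a d) * monom2 d s s \<le> t * (norm (a d) * monom2 d r r)" for t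
  proof -
    have tN: "((\<lambda>d. t * (norm (a d) * monom2 d r r)) has_sum t * N) UNIV"
      by (intro has_sum_cmult_right a)
    have "(\<lambda>d. norm (a d) * monom2 d s s) summable_on UNIV"
      by (rule summable_on_comparison_test[of "\<lambda>d. t * (norm (a d) * monom2 d r r)"])
        (use tN t assms in \<open>auto simp: summable_on_def monom2_nonneg\<close>)
    then obtain N1 where N1: "((\<lambda>d. norm (a d) * monom2 d s s) has_sum N1) UNIV" by (auto simp: summable_on_def)
    have "N1 \<le> t * N" using has_sum_mono[OF N1 tN t(2)] .
    also have "\<dots> \<le> t * \<rho>" using a(2) t by (intro mult_left_mono)
    finally have "N1 \<le> t * \<rho>" .
    then show ?thesis unfolding majorized_def using N1 a(3) assms(3) by (intro exI[of _ a] exI[of _ N1]) auto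
  qed
  have "monom2 d s s \<le> monom2 d r r" for d using monom2_le[of s r s d] assms by simp
  then show "majorized s \<rho> F" using *[of 1] by (simp add: mult_left_mono)
  assume F0: "F 0 0 = 0"
  have "a (0,0) = 0"
  proof -
    have "((\<lambda>d. a d * of_real (monom2 d 0 0)) has_sum a (0,0)) UNIV"
      by (rule has_sum_single[of _ "(0,0)"]) (auto simp: monom2_def power_0_left)
    moreover have "((\<lambda>d. a d * of_real (monom2 d 0 0)) has_sum 0) UNIV" using a(3)[of 0 0] F0 assms by simp
    ultimately show ?thesis using has_sum_unique by blast
  qed
  moreover have "monom2 d s s \<le> s / r * monom2 d r r" if "d \<noteq> (0,0)" for d
  proof -
    have "fst d + snd d \<noteq> 0" using that by (cases d) auto
    then obtain k where k: "fst d + snd d = Suc k" using not0_implies_Suc by blast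
    have "s ^ k \<le> r ^ k" using assms by (intro power_mono) auto
    then have "s * s ^ k \<le> s / r * (r * r ^ k)" using assms by simp
    then show ?thesis by (simp add: monom2_def k flip: power_add)
  qed
  ultimately have "norm (a d) * monom2 d s s \<le> s / r * (norm (a d) * monom2 d r r)" for d
    using mult_left_mono[of "monom2 d s s" "s / r * monom2 d r r" "norm (a d)"]
    by (cases "d = (0,0)") (simp_all only: mult.left_commute norm_ge_zero not_False_eq_True, simp_all)
  then show "majorized s (s / r * \<rho>) F" using *[of "s / r"] assms by simp
qed

lemma majorized_mono: "majorized r \<rho> F \<Longrightarrow> \<rho> \<le> \<sigma> \<Longrightarrow> majorized r \<sigma> F"
  unfolding majorized_def by (meson order_trans)

lemma majorized_norm_le:
  assumes "majorized r \<rho> F" "\<bar>x\<bar> \<le> r" "\<bar>y\<bar> \<le> r"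
  shows "norm (F x y) \<le> \<rho>"
proof -
  obtain a N where a: "((\<lambda>d. norm (a d) * monom2 d r r) has_sum N) UNIV" "N \<le> \<rho>"
    "((\<lambda>d. a d * of_real (monom2 d x y)) has_sum F x y) UNIV"
    using assms unfolding majorized_def by blast
  have le: "norm (a d * of_real (monom2 d x y)) \<le> norm (a d) * monom2 d r r" for d
    using monom2_le[OF assms(2,3)] by (simp add: norm_mult mult_left_mono)
  have "(\<lambda>d. norm (a d * of_real (monom2 d x y))) summable_on UNIV"
    by (rule summable_on_comparison_test[OF has_sum_imp_summable[OF a(1)] le]) auto
  then have s: "((\<lambda>d. norm (a d * of_real (monom2 d x y))) has_sum (\<Sum>\<^sub>\<infinity>d. norm (a d * of_real (monom2 d x y)))) UNIV"
    by (rule has_sum_infsum)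
  show ?thesis using norm_has_sum_bound[OF s a(3)] has_sum_mono[OF s a(1) le] a(2) by linarith
qed

section \<open>Real analyticity of the normal vector\<close>

lemma real_analytic_on_vec:
  fixes F :: "complex \<Rightarrow> real^3"
  assumes "\<And>z0. z0 \<in> S \<Longrightarrow> \<exists>r>0. \<forall>i. \<exists>\<rho>. majorized r \<rho> (\<lambda>x y. of_real (F (z0 + Complex x y) $ i))"
  shows "real_analytic_on S F"
  unfolding real_analytic_on_def
proof
  fix z0 assume "z0 \<in> S"
  then obtain r where r: "r > 0" "\<forall>i. \<exists>\<rho>. majorized r \<rho> (\<lambda>x y. of_real (F (z0 + Complex x y) $ i))"
    using assms by blast
  have "\<forall>i. \<exists>a :: nat \<times> nat \<Rightarrow> complex. \<forall>x y. \<bar>x\<bar> \<le> r \<longrightarrow> \<bar>y\<bar> \<le> r \<longrightarrow> ((\<lambda>d. a d * of_real (monom2 d x y)) has_sum of_real (F (z0 + Complex x y) $ i)) UNIV"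
    using r(2) unfolding majorized_def by meson
  from choice[OF this] obtain a :: "3 \<Rightarrow> nat \<times> nat \<Rightarrow> complex" where a: "\<forall>i x y. \<bar>x\<bar> \<le> r \<longrightarrow> \<bar>y\<bar> \<le> r \<longrightarrow> ((\<lambda>d. a i d * of_real (monom2 d x y)) has_sum of_real (F (z0 + Complex x y) $ i)) UNIV"
    by blast
  \<comment> \<open>The coefficients of the majorized series are complex; as the monomials and the
    components of \<open>F\<close> are real, the real parts have the same sum.\<close>
  define b :: "nat \<Rightarrow> nat \<Rightarrow> real^3" where "b m n = (\<chi> i. Re (a i (m, n)))" for m n
  have "((\<lambda>(m, n). (Re (z - z0) ^ m * Im (z - z0) ^ n) *\<^sub>R b m n) has_sum F z) UNIV" if z: "z \<in> ball z0 r" for z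
  proof -
    define x y where "x = Re (z - z0)" and "y = Im (z - z0)"
    have xy: "\<bar>x\<bar> \<le> r" "\<bar>y\<bar> \<le> r" and zz: "z0 + Complex x y = z"
      using z abs_Re_le_cmod[of "z - z0"] abs_Im_le_cmod[of "z - z0"] unfolding x_def y_def
      by (auto simp: dist_norm norm_minus_commute complex_eq_iff)
    have comp: "((\<lambda>d. monom2 d x y * Re (a i d)) has_sum F z $ i) UNIV" for i
    proof -
      have "((\<lambda>d. a i d * of_real (monom2 d x y)) has_sum of_real (F z $ i)) UNIV" using a xy zz by metis
      from has_sum_bounded_linear[OF bounded_linear_Re this] show ?thesis by (simp add: mult.commute)
    qed
    have "((\<lambda>d. (monom2 d x y * Re (a i d)) *\<^sub>R axis i (1::real)) has_sum (F z $ i) *\<^sub>R axis i 1) UNIV" for i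
      by (rule has_sum_bounded_linear[OF bounded_linear_scaleR_left comp])
    then have "((\<lambda>d. (monom2 d x y * Re (a 1 d)) *\<^sub>R axis (1::3) (1::real) + (monom2 d x y * Re (a 2 d)) *\<^sub>R axis 2 1 + (monom2 d x y * Re (a 3 d)) *\<^sub>R axis 3 1)
        has_sum ((F z $ 1) *\<^sub>R axis 1 1 + (F z $ 2) *\<^sub>R axis 2 1 + (F z $ 3) *\<^sub>R axis 3 1)) UNIV"
      by (intro has_sum_add)
    moreover have "(F z $ 1) *\<^sub>R axis 1 1 + (F z $ 2) *\<^sub>R axis 2 1 + (F z $ 3) *\<^sub>R axis 3 1 = F z"
      by (simp add: vec_eq_iff forall_3 axis_def)
    moreover have "(\<lambda>d. (monom2 d x y * Re (a 1 d)) *\<^sub>R axis (1::3) (1::real) + (monom2 d x y * Re (a 2 d)) *\<^sub>R axis 2 1 + (monom2 d x y * Re (a 3 d)) *\<^sub>R axis 3 1)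
        = (\<lambda>(m, n). (x ^ m * y ^ n) *\<^sub>R b m n)"
      by (auto simp: fun_eq_iff vec_eq_iff forall_3 axis_def b_def monom2_def)
    ultimately show ?thesis unfolding x_def y_def by metis
  qed
  then show "\<exists>r>0. \<exists>a. \<forall>z\<in>ball z0 r. ((\<lambda>(m, n). (Re (z - z0) ^ m * Im (z - z0) ^ n) *\<^sub>R a m n) has_sum F z) UNIV"
    using r(1) by blast
qed

text \<open>Conjugation changes the sign of the second variable, hence the coefficients by
  \<open>(-1) ^ n\<close>. This carries analyticity over to coordinates of reversed
  orientation.\<close>

lemma real_analytic_on_cnj:
  assumes "real_analytic_on S F"
  shows "real_analytic_on (cnj ` S) (\<lambda>z. F (cnj z))"
  unfolding real_analytic_on_def
proof
  fix z0 assume "z0 \<in> cnj ` S"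
  then have "cnj z0 \<in> S" by auto
  with assms have "\<exists>r>0. \<exists>a. \<forall>z\<in>ball (cnj z0) r.
       ((\<lambda>(m, n). (Re (z - cnj z0) ^ m * Im (z - cnj z0) ^ n) *\<^sub>R a m n) has_sum F z) UNIV"
    unfolding real_analytic_on_def by (rule bspec)
  then obtain r a where r: "r > 0" "\<And>z. z \<in> ball (cnj z0) r \<Longrightarrow>
       ((\<lambda>(m, n). (Re (z - cnj z0) ^ m * Im (z - cnj z0) ^ n) *\<^sub>R a m n) has_sum F z) UNIV"
    by blast
  have "((\<lambda>(m, n). (Re (z - z0) ^ m * Im (z - z0) ^ n) *\<^sub>R ((-1) ^ n *\<^sub>R a m n)) has_sum F (cnj z)) UNIV" if "z \<in> ball z0 r" for z
  proof -
    have "cnj z \<in> ball (cnj z0) r" using that by (simp add: dist_norm flip: complex_cnj_diff)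
    from r(2)[OF this]
    have "((\<lambda>(m, n). (Re (z - z0) ^ m * (- Im (z - z0)) ^ n) *\<^sub>R a m n) has_sum F (cnj z)) UNIV"
      by (simp flip: complex_cnj_diff)
    moreover have "(Re (z - z0) ^ m * (- Im (z - z0)) ^ n) *\<^sub>R a m n = (Re (z - z0) ^ m * Im (z - z0) ^ n) *\<^sub>R ((-1) ^ n *\<^sub>R a m n)" for m n
      by (subst power_minus) (simp add: mult_ac)
    ultimately show ?thesis by (simp only:)
  qed
  then show "\<exists>r>0. \<exists>a. \<forall>z\<in>ball z0 r. ((\<lambda>(m, n). (Re (z - z0) ^ m * Im (z - z0) ^ n) *\<^sub>R a m n) has_sum F (cnj z)) UNIV"
    using r(1) by (intro exI[of _ r]) (auto intro!: exI[of _ "\<lambda>m n. (-1) ^ n *\<^sub>R a m n"])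
qed

text \<open>The Taylor series is evaluated at the double series of x + i y, whose norm on the square
  is at most \<open>2 * r\<close>. With \<open>r = R / 4\<close> this lies below
  \<open>3 * r\<close>, a point inside the disc of convergence, whence absolute convergence.\<close>

lemma majorized_holomorphic:
  assumes R: "R > 0" and M: "M holomorphic_on ball z0 R"
  shows "\<exists>r>0. \<exists>\<rho>. majorized r \<rho> (\<lambda>x y. M (z0 + Complex x y))"
proof -
  define r where "r = R / 4"
  define c where "c = (\<lambda>n. (deriv ^^ n) M z0 / fact n)"
  have r: "r > 0" using R by (simp add: r_def)
  have sums: "(\<lambda>n. c n * (w - z0) ^ n) sums M w" if "w \<in> ball z0 R" for w
    unfolding c_def using holomorphic_power_series[OF M that] .
  have "summable (\<lambda>n. c n * (of_real (3 * r)) ^ n)"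
    using sums[of "z0 + of_real (3 * r)"] R by (auto simp: dist_norm r_def sums_iff)
  from powser_insidea[OF this, of "of_real (2 * r)"] r
  have sm: "summable (\<lambda>n. norm (c n) * (2 * r) ^ n)" by (simp add: norm_mult norm_power)
  have "majorized r (monom2 (1, 0) r r + norm \<i> * monom2 (0, 1) r r)
      (\<lambda>x y. of_real (monom2 (1, 0) x y) + \<i> * of_real (monom2 (0, 1) x y))"
    using r by (intro majorized_add majorized_mult majorized_monom2 majorized_const) auto
  then have U: "majorized r (2 * r) Complex"
    by (simp add: monom2_def Complex_eq[abs_def])
  have nU: "norm (Complex x y) \<le> 2 * r" if "\<bar>x\<bar> \<le> r" "\<bar>y\<bar> \<le> r" for x y
    using majorized_norm_le[OF U that] .
  have "majorized r (\<Sum>n. norm (c n) * (2 * r) ^ n) (\<lambda>x y. M (z0 + Complex x y))"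
  proof (rule majorized_series[OF r majorized_power[OF r U] sm])
    show "0 \<le> (2 * r) ^ n" for n using r by simp
    fix x y assume xy: "\<bar>x\<bar> \<le> r" "\<bar>y\<bar> \<le> r"
    show "((\<lambda>n. c n * Complex x y ^ n) has_sum M (z0 + Complex x y)) UNIV"
    proof (rule norm_summable_imp_has_sum)
      show "summable (\<lambda>n. norm (c n * Complex x y ^ n))"
        by (rule summable_comparison_test'[OF sm, of 0])
          (use nU[OF xy] in \<open>simp only: norm_mult norm_power real_norm_def abs_norm_cancel abs_mult power_abs, intro mult_left_mono power_mono, auto\<close>)
      have "z0 + Complex x y \<in> ball z0 R" using nU[OF xy] R by (simp add: dist_norm r_def)
      from sums[OF this] show "(\<lambda>n. c n * Complex x y ^ n) sums M (z0 + Complex x y)" by simp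
    qed
  qed
  then show ?thesis using r by blast
qed

text \<open>Everything is a polynomial in \<open>M\<close>, its conjugate and the reciprocal of 1 +
  |M|^2, and the reciprocal is a geometric series near each point. The hypothesis \<open>F\<close>
  leaves open which component carries which formula, since that depends on the component of the
  surface chosen as coordinate.\<close>

lemma real_analytic_gauss:
  fixes F :: "complex \<Rightarrow> real^3"
  assumes S: "open S" and M: "M holomorphic_on S"
    and F: "\<And>i. (\<forall>z\<in>S. F z $ i = 1) \<or> (\<forall>z\<in>S. F z $ i = 2 * Re (M z) / (1 + (norm (M z))\<^sup>2))
       \<or> (\<forall>z\<in>S. F z $ i = ((norm (M z))\<^sup>2 - 1) / (1 + (norm (M z))\<^sup>2))"
  shows "real_analytic_on S F"
proof (rule real_analytic_on_vec)
  fix z0 assume z0: "z0 \<in> S"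
  obtain R where R: "R > 0" "ball z0 R \<subseteq> S" using S z0 open_contains_ball by blast
  define H where "H = (\<lambda>x y. M (z0 + Complex x y))"
  obtain r \<rho> where r: "r > 0" and H: "majorized r \<rho> H"
    using majorized_holomorphic[OF R(1) holomorphic_on_subset[OF M R(2)]] unfolding H_def by blast
  \<comment> \<open>\<open>A\<close> is the denominator at \<open>z0\<close>, and \<open>V\<close>
    is 1 minus the denominator divided by \<open>A\<close>. So \<open>V\<close> vanishes at
    \<open>z0\<close>, and the reciprocal is \<open>1 / A\<close> times the sum of the powers of
    \<open>V\<close>.\<close>
  define A where "A = 1 + (norm (M z0))\<^sup>2"
  have A: "A > 0" by (simp add: A_def add_pos_nonneg)
  define V where "V = (\<lambda>x y. of_real ((A - 1) / A) + of_real (- 1 / A) * (H x y * cnj (H x y)))"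
  have "\<exists>\<sigma>. majorized r \<sigma> V"
    unfolding V_def using majorized_add[OF majorized_const majorized_mult[OF r majorized_const majorized_mult[OF r H majorized_cnj[OF H]]] r] by blast
  then obtain \<sigma> where V: "majorized r \<sigma> V" by blast
  have sq: "w * cnj w = of_real ((norm w)\<^sup>2)" for w by (metis complex_norm_square)
  have V0: "V 0 0 = 0"
    using A unfolding V_def H_def sq by (simp add: A_def complex_eq_iff flip: of_real_mult of_real_add of_real_minus of_real_divide) (simp add: zero_complex.code[symmetric])
  have \<sigma>: "\<sigma> \<ge> 0" using majorized_cong_nonneg[OF V] r by simp
  \<comment> \<open>The second bound brings the norm of \<open>V\<close> on the smaller square down
    to 1/2; the third keeps that square inside the disc of radius \<open>R\<close>.\<close>
  define s where "s = Min {r, r / (2 * (\<sigma> + 1)), R / 4}"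
  have s: "s > 0" "s \<le> r" "s \<le> r / (2 * (\<sigma> + 1))" "s \<le> R / 4"
  proof -
    show "s \<le> r" "s \<le> r / (2 * (\<sigma> + 1))" "s \<le> R / 4" unfolding s_def by (rule Min_le; simp)+
    show "s > 0" unfolding s_def using r \<sigma> R by simp
  qed
  have "s / r * \<sigma> \<le> 1 / 2"
  proof -
    have "s / r \<le> 1 / (2 * (\<sigma> + 1))" using s(3) r \<sigma> by (simp add: field_simps)
    then have "s / r * \<sigma> \<le> 1 / (2 * (\<sigma> + 1)) * \<sigma>" using \<sigma> by (intro mult_right_mono)
    also have "\<dots> \<le> 1 / 2" using \<sigma> by (simp add: field_simps)
    finally show ?thesis .
  qed
  then have Vs: "majorized s (1 / 2) V" using majorized_shrink(2)[OF V s(1,2) V0] majorized_mono by blast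
  have Hs: "majorized s \<rho> H" by (rule majorized_shrink(1)[OF H s(1,2)])
  define I where "I = (\<lambda>x y. inverse (1 + H x y * cnj (H x y)))"
  have "majorized s (\<Sum>n. norm (of_real (1 / A) :: complex) * (1 / 2) ^ n) I"
  proof (rule majorized_series[OF s(1) majorized_power[OF s(1) Vs]])
    show "summable (\<lambda>n. norm (of_real (1 / A) :: complex) * (1 / 2) ^ n)"
      by (intro summable_mult summable_geometric) simp
    fix x y assume xy: "\<bar>x\<bar> \<le> s" "\<bar>y\<bar> \<le> s"
    have nV: "norm (V x y) \<le> 1 / 2" using majorized_norm_le[OF Vs xy] .
    have "(\<lambda>n. of_real (1 / A) * V x y ^ n) sums (of_real (1 / A) * (1 / (1 - V x y)))"
      using nV by (intro sums_mult geometric_sums) simp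
    moreover have "of_real (1 / A) * (1 / (1 - V x y)) = I x y"
    proof -
      have "1 - V x y = of_real (1 / A) * (1 + H x y * cnj (H x y))"
        unfolding V_def using A by (simp add: field_simps)
      then show ?thesis using A by (simp add: I_def inverse_eq_divide)
    qed
    moreover have "summable (\<lambda>n. norm (of_real (1 / A) * V x y ^ n))"
    proof (rule summable_comparison_test'[of "\<lambda>n. norm (of_real (1 / A) :: complex) * (1 / 2) ^ n" 0])
      show "summable (\<lambda>n. norm (of_real (1 / A) :: complex) * (1 / 2) ^ n)"
        by (intro summable_mult summable_geometric) simp
      show "norm (norm (of_real (1 / A) * V x y ^ n)) \<le> norm (of_real (1 / A) :: complex) * (1 / 2) ^ n" for n
        unfolding real_norm_def abs_norm_cancel norm_mult norm_power abs_mult power_abs using nV by (intro mult_left_mono power_mono) auto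
    qed
    ultimately show "((\<lambda>n. of_real (1 / A) * V x y ^ n) has_sum I x y) UNIV"
      using norm_summable_imp_has_sum by metis
  qed auto
  then obtain \<tau> where I: "majorized s \<tau> I" by blast
  have I_eq: "I x y = of_real (1 / (1 + (norm (H x y))\<^sup>2))" for x y
    unfolding I_def sq by (simp add: inverse_eq_divide)
  have inS: "z0 + Complex x y \<in> S" if "\<bar>x\<bar> \<le> s" "\<bar>y\<bar> \<le> s" for x y
  proof -
    have "norm (Complex x y) < R" using cmod_le[of "Complex x y"] that s(4) R(1) by simp
    then show ?thesis using R(2) by (auto simp: dist_norm subset_iff)
  qed
  have cong: "\<exists>\<rho>. majorized s \<rho> G'" if "majorized s \<rho>' G" "\<And>x y. \<bar>x\<bar> \<le> s \<Longrightarrow> \<bar>y\<bar> \<le> s \<Longrightarrow> G x y = G' x y" for G G' \<rho>'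
    using that unfolding majorized_def by (intro exI[of _ \<rho>']) (elim exE conjE, intro exI conjI allI impI, assumption+, simp)
  show "\<exists>r>0. \<forall>i. \<exists>\<rho>. majorized r \<rho> (\<lambda>x y. of_real (F (z0 + Complex x y) $ i))"
  proof (rule exI[of _ s], intro conjI allI s(1))
    fix i
    have m1: "majorized s (norm (1::complex)) (\<lambda>x y. 1)" by (rule majorized_const)
    note m2 = majorized_mult[OF s(1) majorized_add[OF Hs majorized_cnj[OF Hs] s(1)] I]
    note m3 = majorized_add[OF majorized_const[of s 1] majorized_mult[OF s(1) majorized_const[of s "-2"] I] s(1)]
    consider "\<forall>z\<in>S. F z $ i = 1" | "\<forall>z\<in>S. F z $ i = 2 * Re (M z) / (1 + (norm (M z))\<^sup>2)"
      | "\<forall>z\<in>S. F z $ i = ((norm (M z))\<^sup>2 - 1) / (1 + (norm (M z))\<^sup>2)" using F by blast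
    then show "\<exists>\<rho>. majorized s \<rho> (\<lambda>x y. of_real (F (z0 + Complex x y) $ i))"
    proof cases
      case 1
      show ?thesis by (rule cong[OF m1]) (use 1 inS in auto)
    next
      case 2
      have "(H x y + cnj (H x y)) * I x y = of_real (2 * Re (H x y) / (1 + (norm (H x y))\<^sup>2))" for x y
        unfolding I_eq complex_add_cnj by (simp flip: of_real_mult)
      then show ?thesis by (intro cong[OF m2]) (use 2 inS in \<open>simp add: H_def\<close>)
    next
      case 3
      have "1 + - 2 * I x y = of_real (((norm (H x y))\<^sup>2 - 1) / (1 + (norm (H x y))\<^sup>2))" for x y
      proof -
        have "((norm (H x y))\<^sup>2 - 1) / (1 + (norm (H x y))\<^sup>2) = 1 + - 2 * (1 / (1 + (norm (H x y))\<^sup>2))"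
          by (simp add: divide_simps add_nonneg_eq_0_iff)
        then show ?thesis unfolding I_eq by (metis of_real_1 of_real_add of_real_mult of_real_minus of_real_numeral)
      qed
      then show ?thesis by (intro cong[OF m3]) (use 3 inS in \<open>simp add: H_def\<close>)
    qed
  qed
qed

section \<open>Closed forms in the plane\<close>

text \<open>The second difference of \<open>F\<close> over a small square with corner
  \<open>p\<close> is h^2 times a value of \<open>Fuv\<close> and also h^2 times a value of
  \<open>Fvu\<close>, by the mean value theorem applied twice in either order. Both values are taken
  near \<open>p\<close>, so continuity finishes the argument.\<close>

lemma mixed_partials_commute:
  fixes F :: "complex \<Rightarrow> real"
  assumes S: "open S" and F: "smooth_on S F" and p: "p \<in> S"
  defines "Fu \<equiv> \<lambda>w. fderiv F w 1" and "Fv \<equiv> \<lambda>w. fderiv F w \<i>"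
  shows "fderiv Fu p \<i> = fderiv Fv p 1"
proof -
  have sm: "smooth_on S Fu" "smooth_on S Fv" unfolding Fu_def Fv_def by (intro smooth_on_frechet F)+
  define Fuv where "Fuv = (\<lambda>w. fderiv Fu w \<i>)"
  define Fvu where "Fvu = (\<lambda>w. fderiv Fv w 1)"
  have cont: "isCont Fuv p" "isCont Fvu p"
    unfolding Fuv_def Fvu_def using smooth_on_continuous[OF smooth_on_frechet[OF sm(1)]] smooth_on_continuous[OF smooth_on_frechet[OF sm(2)]] S p
    by (auto simp: continuous_on_eq_continuous_at)
  have line: "((\<lambda>t. G (z + of_real t * d)) has_real_derivative fderiv G (z + of_real t * d) d) (at t)"
    if "smooth_on S G" "z + of_real t * d \<in> S" for G :: "complex \<Rightarrow> real" and z d t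
  proof -
    note dG = smooth_on_has_derivative[OF S that]
    have "((\<lambda>t. z + of_real t * d) has_derivative (\<lambda>h. of_real h * d)) (at t)"
      by (auto intro!: derivative_eq_intros)
    from has_derivative_compose[OF this dG]
    show ?thesis unfolding has_field_derivative_def
      by (rule has_derivative_eq_rhs)
        (simp add: fun_eq_iff linear_cmul[OF has_derivative_linear[OF dG], unfolded scaleR_conv_of_real])
  qed
  obtain R where R: "R > 0" "ball p R \<subseteq> S" using S p open_contains_ball by blast
  have inS: "p + of_real s * 1 + of_real t * \<i> \<in> S" "p + of_real t * \<i> + of_real s * 1 \<in> S" if "0 \<le> s" "s \<le> h" "0 \<le> t" "t \<le> h" "h < R / 2" for s t h
  proof -
    have "norm (of_real s + of_real t * \<i>) \<le> \<bar>s\<bar> + \<bar>t\<bar>"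
      using norm_triangle_ineq[of "of_real s" "of_real t * \<i>"] by (simp add: norm_mult)
    then show "p + of_real s * 1 + of_real t * \<i> \<in> S" "p + of_real t * \<i> + of_real s * 1 \<in> S"
      using that R by (auto simp: dist_norm subset_iff algebra_simps norm_minus_commute)
  qed
  have MVT: "\<exists>\<xi>. 0 < \<xi> \<and> \<xi> < h \<and> \<phi> h - \<phi> 0 = h * \<phi>' \<xi>"
    if "h > 0" "\<And>t. 0 \<le> t \<Longrightarrow> t \<le> h \<Longrightarrow> (\<phi> has_real_derivative \<phi>' t) (at t)" for \<phi> \<phi>' :: "real \<Rightarrow> real" and h
    using MVT2[OF that(1), of \<phi> \<phi>'] that(2) by auto
  have ex: "\<exists>a b. dist a p < e \<and> dist b p < e \<and> Fuv a = Fvu b" if e: "e > 0" for e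
  proof -
    define h where "h = min (R / 4) (e / 4)"
    have h: "h > 0" "h < R / 2" "h < e / 2" using R e by (auto simp: h_def)
    have near: "dist (p + of_real s * 1 + of_real t * \<i>) p < e" "dist (p + of_real t * \<i> + of_real s * 1) p < e" if "0 < s" "s < h" "0 < t" "t < h" for s t
    proof -
      have "norm (of_real s + of_real t * \<i>) \<le> \<bar>s\<bar> + \<bar>t\<bar>"
        using norm_triangle_ineq[of "of_real s" "of_real t * \<i>"] by (simp add: norm_mult)
      then show "dist (p + of_real s * 1 + of_real t * \<i>) p < e" "dist (p + of_real t * \<i> + of_real s * 1) p < e"
        using that h by (auto simp: dist_norm add.commute)
    qed
    let ?\<Delta> = "F (p + of_real h * 1 + of_real h * \<i>) - F (p + of_real h * 1) - F (p + of_real h * \<i>) + F p"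
    obtain \<xi> where \<xi>: "0 < \<xi>" "\<xi> < h" "?\<Delta> = h * (Fu (p + of_real h * \<i> + of_real \<xi> * 1) - Fu (p + of_real \<xi> * 1))"
    proof -
      have "\<exists>\<xi>. 0 < \<xi> \<and> \<xi> < h \<and> (F (p + of_real h * \<i> + of_real h * 1) - F (p + of_real h * 1)) - (F (p + of_real h * \<i> + of_real 0 * 1) - F (p + of_real 0 * 1))
         = h * (Fu (p + of_real h * \<i> + of_real \<xi> * 1) - Fu (p + of_real \<xi> * 1))"
        unfolding Fu_def
        by (rule MVT[OF h(1)], intro DERIV_diff line F) (use inS[of _ h h] inS[of _ h 0] h in auto)
      then show ?thesis using that by (auto simp: add_ac)
    qed
    obtain \<eta> where \<eta>: "0 < \<eta>" "\<eta> < h" "Fu (p + of_real \<xi> * 1 + of_real h * \<i>) - Fu (p + of_real \<xi> * 1 + of_real 0 * \<i>) = h * Fuv (p + of_real \<xi> * 1 + of_real \<eta> * \<i>)"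
    proof -
      have "\<exists>\<eta>. 0 < \<eta> \<and> \<eta> < h \<and> Fu (p + of_real \<xi> * 1 + of_real h * \<i>) - Fu (p + of_real \<xi> * 1 + of_real 0 * \<i>) = h * Fuv (p + of_real \<xi> * 1 + of_real \<eta> * \<i>)"
        unfolding Fuv_def by (rule MVT[OF h(1)], rule line[OF sm(1)]) (use inS(1)[of \<xi> h] \<xi> h in auto)
      then show ?thesis using that by blast
    qed
    obtain \<xi>' where \<xi>': "0 < \<xi>'" "\<xi>' < h" "?\<Delta> = h * (Fv (p + of_real h * 1 + of_real \<xi>' * \<i>) - Fv (p + of_real \<xi>' * \<i>))"
    proof -
      have "\<exists>\<xi>. 0 < \<xi> \<and> \<xi> < h \<and> (F (p + of_real h * 1 + of_real h * \<i>) - F (p + of_real h * \<i>)) - (F (p + of_real h * 1 + of_real 0 * \<i>) - F (p + of_real 0 * \<i>))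
         = h * (Fv (p + of_real h * 1 + of_real \<xi> * \<i>) - Fv (p + of_real \<xi> * \<i>))"
        unfolding Fv_def
        by (rule MVT[OF h(1)], intro DERIV_diff line F) (use inS[of h h] inS[of 0 h] h in auto)
      then show ?thesis using that by (auto simp: algebra_simps)
    qed
    obtain \<eta>' where \<eta>': "0 < \<eta>'" "\<eta>' < h" "Fv (p + of_real \<xi>' * \<i> + of_real h * 1) - Fv (p + of_real \<xi>' * \<i> + of_real 0 * 1) = h * Fvu (p + of_real \<xi>' * \<i> + of_real \<eta>' * 1)"
    proof -
      have "\<exists>\<eta>. 0 < \<eta> \<and> \<eta> < h \<and> Fv (p + of_real \<xi>' * \<i> + of_real h * 1) - Fv (p + of_real \<xi>' * \<i> + of_real 0 * 1) = h * Fvu (p + of_real \<xi>' * \<i> + of_real \<eta> * 1)"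
        unfolding Fvu_def by (rule MVT[OF h(1)], rule line[OF sm(2)]) (use inS(2)[of _ h \<xi>'] \<xi>' h in auto)
      then show ?thesis using that by blast
    qed
    have "h * (h * Fuv (p + of_real \<xi> * 1 + of_real \<eta> * \<i>)) = h * (h * Fvu (p + of_real \<xi>' * \<i> + of_real \<eta>' * 1))"
      using \<xi>(3) \<eta>(3) \<xi>'(3) \<eta>'(3) by (simp add: add_ac)
    then have "Fuv (p + of_real \<xi> * 1 + of_real \<eta> * \<i>) = Fvu (p + of_real \<xi>' * \<i> + of_real \<eta>' * 1)" using h by simp
    then show ?thesis
      using near(1)[OF \<xi>(1,2) \<eta>(1,2)] near(2)[OF \<eta>'(1,2) \<xi>'(1,2)] by (intro exI conjI)
  qed
  have "Fuv p = Fvu p"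
  proof (rule ccontr)
    assume ne: "Fuv p \<noteq> Fvu p"
    define \<epsilon> where "\<epsilon> = \<bar>Fuv p - Fvu p\<bar> / 2"
    have "\<epsilon> > 0" using ne by (simp add: \<epsilon>_def)
    obtain d1 where d1: "d1 > 0" "\<And>x. dist x p < d1 \<Longrightarrow> dist (Fuv x) (Fuv p) < \<epsilon>"
      using cont(1) \<open>\<epsilon> > 0\<close> unfolding continuous_at_eps_delta by blast
    obtain d2 where d2: "d2 > 0" "\<And>x. dist x p < d2 \<Longrightarrow> dist (Fvu x) (Fvu p) < \<epsilon>"
      using cont(2) \<open>\<epsilon> > 0\<close> unfolding continuous_at_eps_delta by blast
    obtain a b where ab: "dist a p < min d1 d2" "dist b p < min d1 d2" "Fuv a = Fvu b"
      using ex[of "min d1 d2"] d1 d2 by auto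
    have "dist (Fuv a) (Fuv p) < \<epsilon>" using d1(2)[of a] ab(1) by simp
    moreover have "dist (Fuv a) (Fvu p) < \<epsilon>" using d2(2)[of b] ab(2,3) by simp
    ultimately
      show False
      using abs_triangle_ineq4[of "Fuv a - Fvu p" "Fuv a - Fuv p"] by (simp add: \<epsilon>_def dist_real_def)
  qed
  then show ?thesis by (simp add: Fuv_def Fvu_def)
qed

text \<open>Poincare's lemma, by integration along rays from the center. Coefficients of class C^1
  are exactly what differentiation under the integral sign asks for.\<close>

lemma closed_form_exact:
  fixes A B :: "complex \<Rightarrow> real"
  assumes A: "Ck_on 1 (ball p r) A" and B: "Ck_on 1 (ball p r) B"
    and closed: "\<And>w. w \<in> ball p r \<Longrightarrow> fderiv A w \<i> = fderiv B w 1"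
  obtains Y where "\<And>w. w \<in> ball p r \<Longrightarrow> (Y has_derivative (\<lambda>v. Re v * A w + Im v * B w)) (at w)"
proof
  define ray where "ray = (\<lambda>w \<tau>. p + of_real \<tau> * (w - p))"
  define Y where "Y = (\<lambda>w. integral (cbox 0 1) (\<lambda>\<tau>::real. Re (w - p) * A (ray w \<tau>) + Im (w - p) * B (ray w \<tau>)))"
  let ?S = "ball p r"
  have ray: "ray w \<tau> \<in> ?S" if "w \<in> ?S" "\<tau> \<in> cbox 0 1" for w \<tau>
  proof -
    have "\<tau> * norm (w - p) \<le> norm (w - p)" using that by (intro mult_left_le_one_le) auto
    then show ?thesis using that by (simp add: ray_def dist_norm norm_mult norm_minus_commute)
  qed
  have d: "(A has_derivative fderiv A w) (at w)" "(B has_derivative fderiv B w) (at w)" if "w \<in> ?S" for w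
    using Ck_on_SucD[OF open_ball A[unfolded One_nat_def] that] Ck_on_SucD[OF open_ball B[unfolded One_nat_def] that] .
  define Au Av Bu Bv where "Au = (\<lambda>w. fderiv A w 1)" and "Av = (\<lambda>w. fderiv A w \<i>)"
    and "Bu = (\<lambda>w. fderiv B w 1)" and "Bv = (\<lambda>w. fderiv B w \<i>)"
  have cont: "continuous_on ?S A" "continuous_on ?S B" "continuous_on ?S Au" "continuous_on ?S Av" "continuous_on ?S Bu" "continuous_on ?S Bv"
    using A B Ck_on_continuous[OF A] Ck_on_continuous[OF B] by (auto simp: Au_def Av_def Bu_def Bv_def)
  have AB: "Av w = Bu w" if "w \<in> ?S" for w using closed[OF that] by (simp add: Av_def Bu_def)
  have dA: "(A has_derivative (\<lambda>v. Re v * Au w + Im v * Av w)) (at w)" if "w \<in> ?S" for w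
    by (rule has_derivative_eq_rhs[OF d(1)[OF that]], rule ext, subst complex_linear_expand[OF has_derivative_linear[OF d(1)[OF that]]])
      (simp add: Au_def Av_def)
  have dB: "(B has_derivative (\<lambda>v. Re v * Bu w + Im v * Bv w)) (at w)" if "w \<in> ?S" for w
    by (rule has_derivative_eq_rhs[OF d(2)[OF that]], rule ext, subst complex_linear_expand[OF has_derivative_linear[OF d(2)[OF that]]])
      (simp add: Bu_def Bv_def)
  have cray: "continuous_on (?S \<times> cbox 0 1) (\<lambda>z. C (ray (fst z) (snd z)))" if "continuous_on ?S C" for C :: "complex \<Rightarrow> real"
    by (rule continuous_on_compose2[OF that]) (use ray in \<open>auto simp: ray_def intro!: continuous_intros\<close>)
  have cray1: "continuous_on (cbox 0 1) (\<lambda>\<tau>. C (ray w \<tau>))" if "continuous_on ?S C" "w \<in> ?S" for C :: "complex \<Rightarrow> real" and w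
    by (rule continuous_on_compose2[OF that(1)]) (use ray that(2) in \<open>auto simp: ray_def intro!: continuous_intros\<close>)
  let ?P = "\<lambda>w \<tau>. A (ray w \<tau>) + \<tau> * (Re (w - p) * Au (ray w \<tau>) + Im (w - p) * Bu (ray w \<tau>))"
  let ?Q = "\<lambda>w \<tau>. B (ray w \<tau>) + \<tau> * (Re (w - p) * Av (ray w \<tau>) + Im (w - p) * Bv (ray w \<tau>))"
  let ?B = "\<lambda>w \<tau>. ?P w \<tau> *\<^sub>R Blinfun Re + ?Q w \<tau> *\<^sub>R Blinfun Im"
  have apply_B: "blinfun_apply (?B w \<tau>) v = Re v * ?P w \<tau> + Im v * ?Q w \<tau>" for w \<tau> v
    by (simp add: plus_blinfun.rep_eq scaleR_blinfun.rep_eq bounded_linear_Blinfun_apply bounded_linear_Re bounded_linear_Im)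
  fix w assume w: "w \<in> ?S"
  have "(Y has_derivative integral (cbox 0 1) (?B w)) (at w within ?S)"
    unfolding Y_def
  proof (rule leibniz_rule)
    fix y and \<tau> :: real assume y: "y \<in> ?S" "\<tau> \<in> cbox 0 1"
    have dr: "((\<lambda>y. ray y \<tau>) has_derivative (\<lambda>v. of_real \<tau> * v)) (at y)"
      unfolding ray_def by (auto intro!: derivative_eq_intros)
    note dA' = has_derivative_compose[OF dr dA[OF ray[OF y]]]
    note dB' = has_derivative_compose[OF dr dB[OF ray[OF y]]]
    have "((\<lambda>y. Re (y - p) * A (ray y \<tau>) + Im (y - p) * B (ray y \<tau>)) has_derivative
       (\<lambda>v. (Re (y - p) * (Re (of_real \<tau> * v) * Au (ray y \<tau>) + Im (of_real \<tau> * v) * Av (ray y \<tau>)) + Re (v - 0) * A (ray y \<tau>)) +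
            (Im (y - p) * (Re (of_real \<tau> * v) * Bu (ray y \<tau>) + Im (of_real \<tau> * v) * Bv (ray y \<tau>)) + Im (v - 0) * B (ray y \<tau>)))) (at y)"
      by (intro has_derivative_add has_derivative_mult has_derivative_Re has_derivative_Im has_derivative_diff has_derivative_ident has_derivative_const dA' dB')
    then show "((\<lambda>y. Re (y - p) * A (ray y \<tau>) + Im (y - p) * B (ray y \<tau>)) has_derivative blinfun_apply (?B y \<tau>)) (at y within ?S)"
      by (rule has_derivative_at_withinI[OF has_derivative_eq_rhs], intro ext, subst apply_B)
        (use AB[OF ray[OF y]] in \<open>simp add: algebra_simps\<close>)
  next
    show "(\<lambda>\<tau>. Re (y - p) * A (ray y \<tau>) + Im (y - p) * B (ray y \<tau>)) integrable_on cbox 0 1" if "y \<in> ?S" for y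
      by (intro integrable_continuous continuous_intros cray1 cont that)
    show "continuous_on (?S \<times> cbox 0 1) (\<lambda>(w, \<tau>). ?B w \<tau>)"
      unfolding case_prod_beta by (intro continuous_intros cray cont)
  qed (use w in auto)
  moreover have "blinfun_apply (integral (cbox 0 1) (?B w)) = (\<lambda>v. Re v * A w + Im v * B w)"
  proof
    fix v
    have "continuous_on (cbox 0 1) (?B w)"
      by (intro continuous_intros cray1 cont w)
    then have I: "?B w integrable_on cbox 0 1" by (rule integrable_continuous)
    have "blinfun_apply (integral (cbox 0 1) (?B w)) v = integral (cbox 0 1) (\<lambda>\<tau>. blinfun_apply (?B w \<tau>) v)"
      using integral_linear[OF I, of "\<lambda>B. blinfun_apply B v"] by (simp add: o_def blinfun.bounded_linear_left)
    also have "\<dots> = integral {0..1} (\<lambda>\<tau>. Re v * ?P w \<tau> + Im v * ?Q w \<tau>)" unfolding apply_B by simp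
    \<comment> \<open>Closedness exchanges \<open>Av\<close> and \<open>Bu\<close> and turns the
      integrand into the derivative of
      \<open>\<tau> * (Re v * A (ray w \<tau>) + Im v * B (ray w \<tau>))\<close>.\<close>
    also have "\<dots> = (1 * (Re v * A (ray w 1) + Im v * B (ray w 1))) - (0 * (Re v * A (ray w 0) + Im v * B (ray w 0)))"
    proof (rule integral_unique[OF fundamental_theorem_of_calculus])
      fix \<tau> :: real assume \<tau>: "\<tau> \<in> {0..1}"
      then have rw: "ray w \<tau> \<in> ?S" using ray[OF w] by simp
      have dr: "((\<lambda>\<tau>. ray w \<tau>) has_derivative (\<lambda>t. of_real t * (w - p))) (at \<tau> within {0..1})"
        unfolding ray_def by (auto intro!: derivative_eq_intros)
      note dA' = has_derivative_compose[OF dr dA[OF rw]]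
      note dB' = has_derivative_compose[OF dr dB[OF rw]]
      have "((\<lambda>\<tau>. \<tau> * (Re v * A (ray w \<tau>) + Im v * B (ray w \<tau>))) has_derivative
         (\<lambda>t. \<tau> * (Re v * (Re (of_real t * (w - p)) * Au (ray w \<tau>) + Im (of_real t * (w - p)) * Av (ray w \<tau>)) +
                   Im v * (Re (of_real t * (w - p)) * Bu (ray w \<tau>) + Im (of_real t * (w - p)) * Bv (ray w \<tau>))) +
              t * (Re v * A (ray w \<tau>) + Im v * B (ray w \<tau>)))) (at \<tau> within {0..1})"
        by (intro has_derivative_add has_derivative_mult has_derivative_mult_right has_derivative_ident dA' dB')
      then show "((\<lambda>\<tau>. \<tau> * (Re v * A (ray w \<tau>) + Im v * B (ray w \<tau>))) has_vector_derivative Re v * ?P w \<tau> + Im v * ?Q w \<tau>) (at \<tau> within {0..1})"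
        unfolding has_vector_derivative_def
        by (rule has_derivative_eq_rhs, intro ext) (use AB[OF rw] in \<open>simp add: algebra_simps\<close>)
    qed simp
    also have "\<dots> = Re v * A w + Im v * B w" by (simp add: ray_def)
    finally show "blinfun_apply (integral (cbox 0 1) (?B w)) v = Re v * A w + Im v * B w" .
  qed
  ultimately show "(Y has_derivative (\<lambda>v. Re v * A w + Im v * B w)) (at w)"
    using at_within_open[OF w open_ball] by simp
qed

section \<open>Conformal coordinates of a maximal surface\<close>

lemma lorentz_simps:
  "lorentz (x + y) z = lorentz x z + lorentz y z" "lorentz z (x + y) = lorentz z x + lorentz z y"
  "lorentz (x - y) z = lorentz x z - lorentz y z" "lorentz z (x - y) = lorentz z x - lorentz z y"
  "lorentz (c *\<^sub>R x) z = c * lorentz x z" "lorentz z (c *\<^sub>R x) = c * lorentz z x"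
  by (simp_all add: lorentz_def algebra_simps)

lemma lorentz_commute: "lorentz x y = lorentz y x"
  by (simp add: lorentz_def mult_ac)

lemma zero_3: "(0::3) = 3"
  by simp

lemma forall_3_012: "(\<forall>i::3. P i) \<longleftrightarrow> P 0 \<and> P 1 \<and> P 2"
  unfolding zero_3 forall_3 by blast

lemma bounded_bilinear_lorentz: "bounded_bilinear lorentz"
proof (rule bilinear_conv_bounded_bilinear[THEN iffD1])
  show "bilinear lorentz"
    unfolding bilinear_def by (intro conjI allI linearI) (simp_all add: lorentz_simps)
qed

text \<open>The Lorentz cross product \<open>n\<close> of \<open>a\<close> and \<open>b\<close> is
  orthogonal to both and has minus the Gram determinant as its square, so it is timelike and
  completes \<open>a\<close>, \<open>b\<close> to a basis. The last hypothesis quantifies over all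
  unit normals to match the definition of vanishing mean curvature.\<close>

lemma lorentz_orthogonal_zero:
  fixes a b X :: "real^3"
  assumes D: "lorentz a a * lorentz b b - (lorentz a b)\<^sup>2 > 0" and "lorentz X a = 0" "lorentz X b = 0"
    and \<nu>: "\<And>\<nu>. lorentz \<nu> \<nu> = -1 \<Longrightarrow> lorentz \<nu> a = 0 \<Longrightarrow> lorentz \<nu> b = 0 \<Longrightarrow> lorentz X \<nu> = 0"
  shows "X = 0"
proof -
  define c0 c1 c2 where "c0 = a $ 1 * b $ 2 - a $ 2 * b $ 1" and "c1 = a $ 2 * b $ 0 - a $ 0 * b $ 2"
    and "c2 = a $ 0 * b $ 1 - a $ 1 * b $ 0"
  define n :: "real^3" where "n = (\<chi> i. if i = 0 then - c0 else if i = 1 then c1 else c2)"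
  have n: "n $ 0 = - c0" "n $ 1 = c1" "n $ 2 = c2" by (simp_all add: n_def)
  let ?D = "lorentz a a * lorentz b b - (lorentz a b)\<^sup>2"
  have na: "lorentz n a = 0" "lorentz n b = 0"
    unfolding lorentz_def n c0_def c1_def c2_def by algebra+
  have nn: "lorentz n n = - ?D"
    unfolding lorentz_def n c0_def c1_def c2_def by algebra
  have "lorentz ((1 / sqrt ?D) *\<^sub>R n) ((1 / sqrt ?D) *\<^sub>R n) = -1"
    unfolding lorentz_simps nn using D by (simp add: real_sqrt_mult[symmetric] field_simps)
  then have "lorentz X ((1 / sqrt ?D) *\<^sub>R n) = 0" by (rule \<nu>) (simp_all add: lorentz_simps na)
  then have Xn: "lorentz X n = 0" using D by (simp add: lorentz_simps)
  \<comment> \<open>The expansion of \<open>X\<close> in the basis \<open>a\<close>,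
    \<open>b\<close>, \<open>n\<close>, multiplied by the Gram determinant; the negative sign of the
    last term is that of the square of \<open>n\<close>.\<close>
  have eq: "?D * X $ i = (lorentz b b * lorentz X a - lorentz a b * lorentz X b) * a $ i
     + (lorentz a a * lorentz X b - lorentz a b * lorentz X a) * b $ i - lorentz X n * n $ i" for i
  proof -
    have "\<forall>i. ?D * X $ i = (lorentz b b * lorentz X a - lorentz a b * lorentz X b) * a $ i
     + (lorentz a a * lorentz X b - lorentz a b * lorentz X a) * b $ i - lorentz X n * n $ i"
      unfolding forall_3_012 lorentz_def n c0_def c1_def c2_def by (intro conjI) algebra+
    then show ?thesis by blast
  qed
  then have "?D * X $ i = 0" for i using assms(2,3) Xn by simp
  then have "X $ i = 0" for i using D by (metis less_irrefl mult_eq_0_iff)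
  then show ?thesis by (simp add: vec_eq_iff)
qed

text \<open>\<open>X\<close> is d/du (k fu - h fv) + d/dv (e fv - h fu), the Laplacian of
  \<open>f\<close> for a conformal metric of determinant 1. Its tangential part vanishes for every
  conformal immersion: \<open>d\<close> collects the differentiated conformality relations with
  factor \<open>l\<close>, and \<open>n\<close> the differentiated normalization e k - h^2 = 1. The
  mean curvature sits in the normal part alone.\<close>

lemma divergence_orthogonal:
  fixes fu fv fuu fuv fvv :: "real^3"
  assumes E: "lorentz fu fu = l * e" "lorentz fu fv = l * h" "lorentz fv fv = l * k"
    and d: "2 * lorentz fuu fu = lu * e + l * eu" "2 * lorentz fuv fu = lv * e + l * ev"
      "lorentz fuu fv + lorentz fu fuv = lu * h + l * hu" "lorentz fuv fv + lorentz fu fvv = lv * h + l * hv"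
      "2 * lorentz fuv fv = lu * k + l * ku" "2 * lorentz fvv fv = lv * k + l * kv"
    and n: "eu * k + e * ku = 2 * h * hu" "ev * k + e * kv = 2 * h * hv"
  defines "X \<equiv> ku *\<^sub>R fu + k *\<^sub>R fuu - hu *\<^sub>R fv - h *\<^sub>R fuv + ev *\<^sub>R fv + e *\<^sub>R fvv - hv *\<^sub>R fu - h *\<^sub>R fuv"
  shows "lorentz X fu = 0" "lorentz X fv = 0"
proof -
  have c: "lorentz fv fu = l * h" "lorentz fu fuv = lorentz fuv fu" "lorentz fu fvv = lorentz fvv fu"
    using E by (simp_all add: lorentz_commute)
  have 1: "lorentz X fu = ku * (l * e) + k * lorentz fuu fu - hu * (l * h) - h * lorentz fuv fu + ev * (l * h)
      + e * lorentz fvv fu - hv * (l * e) - h * lorentz fuv fu"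
    unfolding X_def lorentz_simps E c by simp
  have 2: "lorentz X fv = ku * (l * h) + k * lorentz fuu fv - hu * (l * k) - h * lorentz fuv fv + ev * (l * k)
      + e * lorentz fvv fv - hv * (l * h) - h * lorentz fuv fv"
    unfolding X_def lorentz_simps E c by simp
  have s: "lorentz fuu fu = (lu * e + l * eu) / 2" "lorentz fuv fu = (lv * e + l * ev) / 2"
    "lorentz fuv fv = (lu * k + l * ku) / 2" "lorentz fvv fv = (lv * k + l * kv) / 2"
    "lorentz fuu fv = lu * h + l * hu - (lv * e + l * ev) / 2"
    "lorentz fvv fu = lv * h + l * hv - (lu * k + l * ku) / 2"
    using d unfolding c by (simp_all add: field_simps)
  have "2 * lorentz X fu = l * (eu * k + e * ku - 2 * h * hu)"
    unfolding 1 s by (simp add: field_simps)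
  then show "lorentz X fu = 0" using n by simp
  have "2 * lorentz X fv = l * (ev * k + e * kv - 2 * h * hv)"
    unfolding 2 s by (simp add: field_simps)
  then show "lorentz X fv = 0" using n by simp
qed

section \<open>Conjugate differentials and their primitives\<close>

lemma continuous_agree_dense:
  fixes \<phi> \<psi> :: "complex \<Rightarrow> 'b::real_normed_vector"
  assumes U: "open U" "U \<subseteq> closure V" and "continuous_on U \<phi>" "continuous_on U \<psi>"
    and eq: "\<And>w. w \<in> U \<inter> V \<Longrightarrow> \<phi> w = \<psi> w" and w: "w \<in> U"
  shows "\<phi> w = \<psi> w"
proof (rule ccontr)
  assume ne: "\<phi> w \<noteq> \<psi> w"
  define S where "S = U \<inter> (\<lambda>w. \<phi> w - \<psi> w) -` (- {0})"
  have "open S" unfolding S_def by (intro continuous_open_preimage continuous_intros assms)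
  moreover have "w \<in> S \<inter> closure V" using ne w U by (auto simp: S_def)
  ultimately obtain w' where "w' \<in> S" "w' \<in> V" using open_Int_closure_eq_empty by blast
  then have "w' \<in> V" "w' \<in> U" "\<phi> w' \<noteq> \<psi> w'" by (auto simp: S_def)
  then show False using eq by auto
qed

lemma frechet_vec_nth:
  fixes f :: "complex \<Rightarrow> real^3"
  assumes "(f has_derivative f') (at w)"
  shows "fderiv (\<lambda>w. f w $ i) w v = f' v $ i"
  using frechet_derivative_at[OF bounded_linear.has_derivative[OF bounded_linear_vec_nth assms]] by metis

lemma vec_mixed_partials_commute:
  fixes f :: "complex \<Rightarrow> real^3"
  assumes U: "open U" and f: "smooth_on U f" and w: "w \<in> U"
  shows "fderiv (\<lambda>w. fderiv f w 1) w \<i> = fderiv (\<lambda>w. fderiv f w \<i>) w 1"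
proof -
  have "fderiv (\<lambda>w. fderiv f w 1) w \<i> $ i = fderiv (\<lambda>w. fderiv f w \<i>) w 1 $ i" for i
  proof -
    have s: "smooth_on U (\<lambda>w. f w $ i)" by (intro smooth_on_vec_nth U f)
    have c: "fderiv (\<lambda>w. f w $ i) w v = fderiv f w v $ i" if "w \<in> U" for w v
      by (rule frechet_vec_nth[OF smooth_on_has_derivative[OF U f that]])
    have cc: "fderiv (\<lambda>w. fderiv (\<lambda>w. f w $ i) w v) w v' = fderiv (\<lambda>w. fderiv f w v) w v' $ i" for v v'
    proof -
      note d = bounded_linear.has_derivative[OF bounded_linear_vec_nth[of i] smooth_on_has_derivative[OF U smooth_on_frechet[OF f, of v] w]]
      have "((\<lambda>w. fderiv (\<lambda>w. f w $ i) w v) has_derivative (\<lambda>v'. fderiv (\<lambda>w. fderiv f w v) w v' $ i)) (at w)"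
        by (rule has_derivative_transform_within_open[OF d U w]) (simp add: c)
      from frechet_derivative_at[OF this] show ?thesis by metis
    qed
    show ?thesis using mixed_partials_commute[OF U s w] unfolding cc .
  qed
  then show ?thesis by (simp add: vec_eq_iff)
qed

lemma C1_metric_on_det_pos:
  assumes g: "C1_metric_on U g" and w: "w \<in> U"
  shows "g w 1 1 > 0" "g w 1 1 * g w \<i> \<i> - (g w 1 \<i>)\<^sup>2 > 0"
    "g w (of_real s + of_real t * \<i>) (of_real s + of_real t * \<i>) = s\<^sup>2 * g w 1 1 + 2 * s * t * g w 1 \<i> + t\<^sup>2 * g w \<i> \<i>"
proof -
  have b: "bilinear (g w)" and sym: "g w \<i> 1 = g w 1 \<i>" and pos: "\<And>v. v \<noteq> 0 \<Longrightarrow> g w v v > 0"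
    using g w unfolding C1_metric_on_def by auto
  have q: "g w (of_real s + of_real t * \<i>) (of_real s + of_real t * \<i>) = s\<^sup>2 * g w 1 1 + 2 * s * t * g w 1 \<i> + t\<^sup>2 * g w \<i> \<i>" for s t
  proof -
    have v: "of_real s + of_real t * \<i> = s *\<^sub>R 1 + t *\<^sub>R \<i>" by (simp add: scaleR_conv_of_real)
    show ?thesis unfolding v
      by (simp only: bilinear_ladd[OF b] bilinear_radd[OF b] bilinear_lmul[OF b] bilinear_rmul[OF b] sym)
        (simp add: algebra_simps power2_eq_square)
  qed
  show "g w (of_real s + of_real t * \<i>) (of_real s + of_real t * \<i>) = s\<^sup>2 * g w 1 1 + 2 * s * t * g w 1 \<i> + t\<^sup>2 * g w \<i> \<i>"
    by (rule q)
  show p1: "g w 1 1 > 0" using pos[of 1] by simp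
  \<comment> \<open>Its square is \<open>g w 1 1\<close> times the determinant.\<close>
  let ?v = "of_real (- g w 1 \<i>) + of_real (g w 1 1) * \<i>"
  have "Im ?v \<noteq> 0" using p1 by simp
  then have "?v \<noteq> 0" by (metis zero_complex.simps(2))
  then have "g w ?v ?v > 0" by (rule pos)
  then have "g w 1 1 * (g w 1 1 * g w \<i> \<i> - (g w 1 \<i>)\<^sup>2) > 0"
    unfolding q by (simp add: algebra_simps power2_eq_square)
  then show "g w 1 1 * g w \<i> \<i> - (g w 1 \<i>)\<^sup>2 > 0" using p1 by (simp add: zero_less_mult_iff)
qed

text \<open>Vanishing of the numerator of the mean curvature, for every unit normal.\<close>

abbreviation mean_curvature_free :: "(complex \<Rightarrow> real^3) \<Rightarrow> complex \<Rightarrow> bool"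
  where "mean_curvature_free f w \<equiv> \<forall>\<nu>. lorentz \<nu> \<nu> = -1 \<longrightarrow> (\<forall>v. lorentz \<nu> (fderiv f w v) = 0) \<longrightarrow>
       lorentz (fderiv f w 1) (fderiv f w 1) * lorentz (fderiv (\<lambda>z. fderiv f z \<i>) w \<i>) \<nu>
       - 2 * lorentz (fderiv f w 1) (fderiv f w \<i>) * lorentz (fderiv (\<lambda>z. fderiv f z \<i>) w 1) \<nu>
       + lorentz (fderiv f w \<i>) (fderiv f w \<i>) * lorentz (fderiv (\<lambda>z. fderiv f z 1) w 1) \<nu> = 0"

abbreviation conformal_pullback :: "(complex \<Rightarrow> complex \<Rightarrow> complex \<Rightarrow> real) \<Rightarrow> (complex \<Rightarrow> real) \<Rightarrow> (complex \<Rightarrow> real^3) \<Rightarrow> complex \<Rightarrow> bool"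
  where "conformal_pullback g \<beta> f w \<equiv> \<beta> w > 0 \<and> (\<forall>v v'. g w v v' = \<beta> w * lorentz (fderiv f w v) (fderiv f w v'))"

text \<open>The one-forms \<open>A du + B dv\<close> below are the conjugate differentials of the components of \<open>f\<close>.
  That they are closed is Laplace's equation for \<open>f\<close> in conformally invariant form.\<close>

lemma conjugate_differential_closed:
  fixes f :: "complex \<Rightarrow> real^3"
  assumes U: "open U" and f: "smooth_on U f" and V: "open V" "U \<subseteq> closure V"
    and g: "C1_metric_on U g"
    and fgU: "\<forall>w\<in>U \<inter> V. conformal_pullback g \<beta> f w"
    and HU: "\<forall>w\<in>U \<inter> V. mean_curvature_free f w"
  defines "\<delta> \<equiv> \<lambda>w. sqrt (g w 1 1 * g w \<i> \<i> - (g w 1 \<i>)\<^sup>2)"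
  defines "e \<equiv> \<lambda>w. g w 1 1 / \<delta> w" and "h \<equiv> \<lambda>w. g w 1 \<i> / \<delta> w" and "k \<equiv> \<lambda>w. g w \<i> \<i> / \<delta> w"
  defines "A \<equiv> \<lambda>i w. h w * fderiv f w 1 $ i - e w * fderiv f w \<i> $ i"
    and "B \<equiv> \<lambda>i w. k w * fderiv f w 1 $ i - h w * fderiv f w \<i> $ i"
  shows "Ck_on 1 U e" "Ck_on 1 U h" "Ck_on 1 U k" "\<And>w. w \<in> U \<Longrightarrow> e w > 0" "\<And>w. w \<in> U \<Longrightarrow> e w * k w - (h w)\<^sup>2 = 1"
    "Ck_on 1 U (A i)" "Ck_on 1 U (B i)"
    "\<And>w. w \<in> U \<Longrightarrow> fderiv (A i) w \<i> = fderiv (B i) w 1"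
    "\<And>w. w \<in> U \<inter> V \<Longrightarrow> \<exists>l>0. lorentz (fderiv f w 1) (fderiv f w 1) = l * e w \<and>
        lorentz (fderiv f w 1) (fderiv f w \<i>) = l * h w \<and>
        lorentz (fderiv f w \<i>) (fderiv f w \<i>) = l * k w"
proof -
  have fg: "\<And>w v v'. w \<in> U \<inter> V \<Longrightarrow> \<beta> w > 0 \<and> g w v v' = \<beta> w * lorentz (fderiv f w v) (fderiv f w v')"
    using fgU by blast
  note pos = C1_metric_on_det_pos(1,2)[OF g]
  have \<delta>: "\<delta> w > 0" if "w \<in> U" for w using pos(2)[OF that] by (simp add: \<delta>_def)
  have G: "Ck_on 1 U (\<lambda>w. g w v v')" for v v' using g by (simp add: C1_metric_on_def)
  have Cm: "Ck_on 1 U (\<lambda>w. \<phi> w * \<psi> w)" if "Ck_on 1 U \<phi>" "Ck_on 1 U \<psi>" for \<phi> \<psi> :: "complex \<Rightarrow> real"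
    using bounded_bilinear.Ck_on_prod[OF bounded_bilinear_mult U that] .
  have Cd: "Ck_on 1 U (\<lambda>w. \<phi> w - \<psi> w)" if "Ck_on 1 U \<phi>" "Ck_on 1 U \<psi>" for \<phi> \<psi> :: "complex \<Rightarrow> real"
    using Ck_on_add[OF U that(1) Ck_on_linear[OF U bounded_linear_minus[OF bounded_linear_ident] that(2)]] by simp
  have C\<delta>: "Ck_on 1 U \<delta>"
    unfolding \<delta>_def power2_eq_square
    by (rule Ck_on_sqrt[OF U]) (use pos(2) in \<open>auto intro!: Cd Cm G simp: power2_eq_square simp del: Ck_on.simps One_nat_def\<close>)
  have C\<delta>': "Ck_on 1 U (\<lambda>w. inverse (\<delta> w))"
    by (rule Ck_on_inverse[OF U C\<delta>]) (use \<delta> in force)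
  show Ce: "Ck_on 1 U e" and Ch: "Ck_on 1 U h" and Ck: "Ck_on 1 U k"
    unfolding e_def h_def k_def divide_inverse by (intro Cm G C\<delta>')+
  show epos: "e w > 0" if "w \<in> U" for w using pos(1)[OF that] \<delta>[OF that] by (simp add: e_def)
  show ek: "e w * k w - (h w)\<^sup>2 = 1" if w: "w \<in> U" for w
  proof -
    have "(\<delta> w)\<^sup>2 = g w 1 1 * g w \<i> \<i> - (g w 1 \<i>)\<^sup>2" using pos(2)[OF w] by (simp add: \<delta>_def)
    moreover have "e w * k w - (h w)\<^sup>2 = (g w 1 1 * g w \<i> \<i> - (g w 1 \<i>)\<^sup>2) / (\<delta> w)\<^sup>2"
      by (simp add: e_def h_def k_def power2_eq_square diff_divide_distrib)
    ultimately show ?thesis using \<delta>[OF w] pos(2)[OF w] by simp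
  qed
  let ?fu = "\<lambda>w. fderiv f w 1" and ?fv = "\<lambda>w. fderiv f w \<i>"
  have sfu: "smooth_on U ?fu" "smooth_on U ?fv" by (intro smooth_on_frechet f)+
  have Cf: "Ck_on 1 U (\<lambda>w. ?fu w $ i)" "Ck_on 1 U (\<lambda>w. ?fv w $ i)" for i
    by (intro smooth_onD smooth_on_vec_nth U sfu)+
  show CA: "Ck_on 1 U (A i)" and CB: "Ck_on 1 U (B i)" for i
    unfolding A_def B_def by (intro Cd Cm Ce Ch Ck Cf)+
  have conf: "\<delta> w / \<beta> w > 0 \<and> lorentz (?fu w) (?fu w) = \<delta> w / \<beta> w * e w \<and>
      lorentz (?fu w) (?fv w) = \<delta> w / \<beta> w * h w \<and> lorentz (?fv w) (?fv w) = \<delta> w / \<beta> w * k w" if w: "w \<in> U \<inter> V" for w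
    using \<delta>[of w] w fg[OF w, of 1 1] fg[OF w, of 1 \<i>] fg[OF w, of \<i> \<i>] by (simp add: e_def h_def k_def)
  then show "\<exists>l>0. lorentz (?fu w) (?fu w) = l * e w \<and> lorentz (?fu w) (?fv w) = l * h w \<and>
        lorentz (?fv w) (?fv w) = l * k w" if "w \<in> U \<inter> V" for w
    using that by blast
  note D1 = Ck_on_SucD[OF U _, of 0, folded One_nat_def]
  let ?fu' = "\<lambda>w. fderiv ?fu w" and ?fv' = "\<lambda>w. fderiv ?fv w"
  have dfu: "(?fu has_derivative ?fu' w) (at w)" "(?fv has_derivative ?fv' w) (at w)" if "w \<in> U" for w
    using smooth_on_has_derivative[OF U sfu(1) that] smooth_on_has_derivative[OF U sfu(2) that] .
  let ?e' = "\<lambda>w. fderiv e w" and ?h' = "\<lambda>w. fderiv h w" and ?k' = "\<lambda>w. fderiv k w"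
  note de = D1[OF Ce] and dh = D1[OF Ch] and dk = D1[OF Ck]
  have dA: "fderiv (A i) w v = h w * ?fu' w v $ i + ?h' w v * ?fu w $ i - (e w * ?fv' w v $ i + ?e' w v * ?fv w $ i)"
    if "w \<in> U" for i w v
    unfolding A_def
    by (subst frechet_derivative_at[OF has_derivative_diff[OF has_derivative_mult[OF dh[OF that] bounded_linear.has_derivative[OF bounded_linear_vec_nth dfu(1)[OF that]]]
          has_derivative_mult[OF de[OF that] bounded_linear.has_derivative[OF bounded_linear_vec_nth dfu(2)[OF that]]]], symmetric]) simp
  have dB: "fderiv (B i) w v = k w * ?fu' w v $ i + ?k' w v * ?fu w $ i - (h w * ?fv' w v $ i + ?h' w v * ?fv w $ i)"
    if "w \<in> U" for i w v
    unfolding B_def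
    by (subst frechet_derivative_at[OF has_derivative_diff[OF has_derivative_mult[OF dk[OF that] bounded_linear.has_derivative[OF bounded_linear_vec_nth dfu(1)[OF that]]]
          has_derivative_mult[OF dh[OF that] bounded_linear.has_derivative[OF bounded_linear_vec_nth dfu(2)[OF that]]]], symmetric]) simp
  have main: "fderiv (A i) w \<i> = fderiv (B i) w 1" if w: "w \<in> U \<inter> V" for i w
  proof -
    have wU: "w \<in> U" and UV: "open (U \<inter> V)" using w U V by auto
    \<comment> \<open>The conformal factor is \<open>\<delta> / \<beta>\<close>, but
      \<open>\<beta>\<close> is only known to be positive; its differentiability is read off from
      this quotient of differentiable functions.\<close>
    define l where "l = (\<lambda>w. lorentz (?fu w) (?fu w) / e w)"
    have l: "l w > 0 \<and> lorentz (?fu w) (?fu w) = l w * e w \<and> lorentz (?fu w) (?fv w) = l w * h w \<and> lorentz (?fv w) (?fv w) = l w * k w"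
      if "w \<in> U \<inter> V" for w
    proof -
      have "l w = \<delta> w / \<beta> w" using conf[OF that] epos[of w] that by (simp add: l_def)
      then show ?thesis using conf[OF that] by simp
    qed
    note dl_E = bounded_bilinear.FDERIV[OF bounded_bilinear_lorentz dfu(1)[OF wU] dfu(1)[OF wU]]
    have "l differentiable (at w)"
      unfolding l_def using dl_E de[OF wU] epos[OF wU]
      by (intro differentiable_divide) (auto simp: differentiable_def)
    then obtain l' where l': "(l has_derivative l') (at w)" by (auto simp: differentiable_def)
    have tr: "\<phi>' v = l w * \<psi>' v + l' v * \<psi> w"
      if "(\<phi> has_derivative \<phi>') (at w)" "(\<psi> has_derivative \<psi>') (at w)" "\<And>w. w \<in> U \<inter> V \<Longrightarrow> \<phi> w = l w * \<psi> w" for \<phi> \<psi> \<phi>' \<psi>' v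
    proof -
      have "(\<phi> has_derivative (\<lambda>v. l w * \<psi>' v + l' v * \<psi> w)) (at w)"
        by (rule has_derivative_transform_within_open[OF has_derivative_mult[OF l' that(2)] UV w]) (use that(3) in auto)
      from has_derivative_unique[OF that(1) this] show ?thesis by metis
    qed
    \<comment> \<open>The derivative of the normalization
      \<open>e * k - h\<^sup>2 = 1\<close>.\<close>
    have n: "?e' w v * k w + e w * ?k' w v = 2 * h w * ?h' w v" for v
    proof -
      have "((\<lambda>w. e w * k w - h w * h w) has_derivative (\<lambda>v. (e w * ?k' w v + ?e' w v * k w) - (h w * ?h' w v + ?h' w v * h w))) (at w)"
        by (intro has_derivative_diff has_derivative_mult de dh dk wU)
      moreover have "((\<lambda>w. e w * k w - h w * h w) has_derivative (\<lambda>v. 0)) (at w)"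
        by (rule has_derivative_transform_within_open[OF has_derivative_const[of 1] U wU]) (use ek in \<open>simp add: power2_eq_square\<close>)
      ultimately have "(\<lambda>v. (e w * ?k' w v + ?e' w v * k w) - (h w * ?h' w v + ?h' w v * h w)) = (\<lambda>v. 0)"
        by (rule has_derivative_unique)
      from fun_cong[OF this, of v] show ?thesis by (simp add: algebra_simps)
    qed
    have sym: "?fu' w \<i> = ?fv' w 1" by (rule vec_mixed_partials_commute[OF U f wU])
    have E: "lorentz (?fu w) (?fu' w v) + lorentz (?fu' w v) (?fu w) = l w * ?e' w v + l' v * e w" for v
      by (rule tr[OF dl_E de[OF wU]]) (use l in blast)
    have F: "lorentz (?fu w) (?fv' w v) + lorentz (?fu' w v) (?fv w) = l w * ?h' w v + l' v * h w" for v
      by (rule tr[OF bounded_bilinear.FDERIV[OF bounded_bilinear_lorentz dfu(1)[OF wU] dfu(2)[OF wU]] dh[OF wU]]) (use l in blast)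
    have G': "lorentz (?fv w) (?fv' w v) + lorentz (?fv' w v) (?fv w) = l w * ?k' w v + l' v * k w" for v
      by (rule tr[OF bounded_bilinear.FDERIV[OF bounded_bilinear_lorentz dfu(2)[OF wU] dfu(2)[OF wU]] dk[OF wU]]) (use l in blast)
    \<comment> \<open>Component \<open>i\<close> of \<open>?X\<close> is the difference of the two
      sides of the claim. The tangential part of \<open>?X\<close> vanishes by conformality, the
      normal part by the vanishing of the mean curvature.\<close>
    let ?X = "?k' w 1 *\<^sub>R ?fu w + k w *\<^sub>R ?fu' w 1 - ?h' w 1 *\<^sub>R ?fv w - h w *\<^sub>R ?fv' w 1 + ?e' w \<i> *\<^sub>R ?fv w + e w *\<^sub>R ?fv' w \<i> - ?h' w \<i> *\<^sub>R ?fu w - h w *\<^sub>R ?fv' w 1"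
    have X0: "?X = 0"
    proof (rule lorentz_orthogonal_zero[of "?fu w" "?fv w"])
      note lw = l[OF w]
      have "lorentz (?fu w) (?fu w) * lorentz (?fv w) (?fv w) - (lorentz (?fu w) (?fv w))\<^sup>2 = (l w)\<^sup>2 * (e w * k w - (h w)\<^sup>2)"
        using lw by (simp add: power2_eq_square algebra_simps)
      then show "lorentz (?fu w) (?fu w) * lorentz (?fv w) (?fv w) - (lorentz (?fu w) (?fv w))\<^sup>2 > 0"
        using lw ek[OF wU] by simp
      have d: "2 * lorentz (?fu' w 1) (?fu w) = l' 1 * e w + l w * ?e' w 1"
        "2 * lorentz (?fv' w 1) (?fu w) = l' \<i> * e w + l w * ?e' w \<i>"
        "lorentz (?fu' w 1) (?fv w) + lorentz (?fu w) (?fv' w 1) = l' 1 * h w + l w * ?h' w 1"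
        "lorentz (?fv' w 1) (?fv w) + lorentz (?fu w) (?fv' w \<i>) = l' \<i> * h w + l w * ?h' w \<i>"
        "2 * lorentz (?fv' w 1) (?fv w) = l' 1 * k w + l w * ?k' w 1"
        "2 * lorentz (?fv' w \<i>) (?fv w) = l' \<i> * k w + l w * ?k' w \<i>"
        using E[of 1] E[of \<i>] F[of 1] F[of \<i>] G'[of 1] G'[of \<i>]
          lorentz_commute[of "?fu w" "?fu' w 1"] lorentz_commute[of "?fu w" "?fv' w 1"]
          lorentz_commute[of "?fv w" "?fv' w 1"] lorentz_commute[of "?fv w" "?fv' w \<i>"]
        unfolding sym by (linarith, linarith, linarith, linarith, linarith, linarith)
      show "lorentz ?X (?fu w) = 0" "lorentz ?X (?fv w) = 0"
        using divergence_orthogonal[OF _ _ _ d n n] lw by blast+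
      fix \<nu> assume \<nu>: "lorentz \<nu> \<nu> = -1" "lorentz \<nu> (?fu w) = 0" "lorentz \<nu> (?fv w) = 0"
      have df: "fderiv f w v = Re v *\<^sub>R ?fu w + Im v *\<^sub>R ?fv w" for v
        by (rule complex_linear_expand[OF has_derivative_linear[OF smooth_on_has_derivative[OF U f wU]]])
      have "\<forall>v. lorentz \<nu> (fderiv f w v) = 0"
        by (intro allI, subst df) (simp add: lorentz_simps \<nu>)
      from HU[rule_format, OF w \<nu>(1) this[rule_format]] lw
      have "l w * (e w * lorentz (?fv' w \<i>) \<nu> - 2 * h w * lorentz (?fv' w 1) \<nu> + k w * lorentz (?fu' w 1) \<nu>) = 0"
        by (simp add: algebra_simps)
      then have "e w * lorentz (?fv' w \<i>) \<nu> - 2 * h w * lorentz (?fv' w 1) \<nu> + k w * lorentz (?fu' w 1) \<nu> = 0"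
        using lw by simp
      moreover have "lorentz (?fu w) \<nu> = 0" "lorentz (?fv w) \<nu> = 0" using \<nu>(2,3) by (simp_all add: lorentz_commute)
      ultimately show "lorentz ?X \<nu> = 0" unfolding lorentz_simps by simp
    qed
    have "?X $ i = 0" unfolding X0 by simp
    then show ?thesis unfolding dA[OF wU] dB[OF wU] sym by (simp add: algebra_simps)
  qed
  \<comment> \<open>\<open>A i\<close> and \<open>B i\<close> are of class C^1 on all of
    \<open>U\<close> because the extended metric is; so the identity spreads by continuity from
    \<open>V\<close> across the singular points.\<close>
  show "fderiv (A i) w \<i> = fderiv (B i) w 1" if "w \<in> U" for i w
  proof (rule continuous_agree_dense[OF U V(2) _ _ main that])
    show "continuous_on U (\<lambda>w. fderiv (A i) w \<i>)" "continuous_on U (\<lambda>w. fderiv (B i) w 1)"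
      using CA[of i] CB[of i] by auto
  qed auto
qed

text \<open>The same facts with the coefficients as opaque names, so that later simplification does
  not unfold the normalized metric.\<close>

lemma conjugate_forms:
  fixes f :: "complex \<Rightarrow> real^3"
  assumes U: "open U" and f: "smooth_on U f" and V: "open V" "U \<subseteq> closure V"
    and g: "C1_metric_on U g"
    and fgU: "\<forall>w\<in>U \<inter> V. conformal_pullback g \<beta> f w"
    and HU: "\<forall>w\<in>U \<inter> V. mean_curvature_free f w"
  obtains e h k :: "complex \<Rightarrow> real" and A B :: "3 \<Rightarrow> complex \<Rightarrow> real"
  where "Ck_on 1 U e" "Ck_on 1 U h" "Ck_on 1 U k" "\<And>w. w \<in> U \<Longrightarrow> e w > 0" "\<And>w. w \<in> U \<Longrightarrow> e w * k w - (h w)\<^sup>2 = 1"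
    "\<And>i. Ck_on 1 U (A i)" "\<And>i. Ck_on 1 U (B i)"
    "\<And>i w. w \<in> U \<Longrightarrow> fderiv (A i) w \<i> = fderiv (B i) w 1"
    "\<And>w. w \<in> U \<inter> V \<Longrightarrow> \<exists>l>0. lorentz (fderiv f w 1) (fderiv f w 1) = l * e w \<and>
        lorentz (fderiv f w 1) (fderiv f w \<i>) = l * h w \<and>
        lorentz (fderiv f w \<i>) (fderiv f w \<i>) = l * k w"
    "A = (\<lambda>i w. h w * fderiv f w 1 $ i - e w * fderiv f w \<i> $ i)"
    "B = (\<lambda>i w. k w * fderiv f w 1 $ i - h w * fderiv f w \<i> $ i)"
proof -
  note c = conjugate_differential_closed[OF U f V g fgU HU]
  show thesis by (rule that[OF c refl refl])
qed

text \<open>The normalized metric is e |du + \<kappa> dv|^2, so \<kappa> = (h + i) / e encodes the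
  conformal structure. Adding the conjugate differential as imaginary part to the differential of
  each component gives \<open>\<alpha> i\<close> (du + \<kappa> dv). These forms are exact on the
  disc and pairwise proportional over the complex functions, so any one with
  \<open>\<alpha> i \<noteq> 0\<close> can serve as a coordinate differential in which the others
  are holomorphic.\<close>

lemma isotropic_primitives:
  fixes f :: "complex \<Rightarrow> real^3" and p :: complex and r :: real
  defines "U \<equiv> ball p r"
  assumes f: "smooth_on U f" and V: "open V" "U \<subseteq> closure V"
    and g: "C1_metric_on U g"
    and fg: "\<forall>w\<in>U \<inter> V. conformal_pullback g \<beta> f w"
    and H: "\<forall>w\<in>U \<inter> V. mean_curvature_free f w"
  obtains \<kappa> :: "complex \<Rightarrow> complex" and \<alpha> G :: "3 \<Rightarrow> complex \<Rightarrow> complex"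
  where "continuous_on U \<kappa>" "\<And>w. w \<in> U \<Longrightarrow> Im (\<kappa> w) > 0" "\<And>i. continuous_on U (\<alpha> i)"
    "\<And>i w. w \<in> U \<Longrightarrow> (G i has_derivative (\<lambda>v. (of_real (Re v) + of_real (Im v) * \<kappa> w) * \<alpha> i w)) (at w)"
    "\<And>i w v. w \<in> U \<Longrightarrow> fderiv f w v $ i = Re ((of_real (Re v) + of_real (Im v) * \<kappa> w) * \<alpha> i w)"
    "\<And>w. w \<in> U \<Longrightarrow> (\<alpha> 0 w)\<^sup>2 = (\<alpha> 1 w)\<^sup>2 + (\<alpha> 2 w)\<^sup>2"
proof -
  have U: "open U" by (simp add: U_def)
  let ?fu = "\<lambda>w. fderiv f w 1" and ?fv = "\<lambda>w. fderiv f w \<i>"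
  show thesis
  proof (rule conjugate_forms[OF U f V g fg H])
    fix e h k :: "complex \<Rightarrow> real" and A B :: "3 \<Rightarrow> complex \<Rightarrow> real"
    assume cl: "Ck_on 1 U e" "Ck_on 1 U h" "Ck_on 1 U k"
    "\<And>w. w \<in> U \<Longrightarrow> e w > 0" "\<And>w. w \<in> U \<Longrightarrow> e w * k w - (h w)\<^sup>2 = 1" "\<And>i. Ck_on 1 U (A i)" "\<And>i. Ck_on 1 U (B i)"
    "\<And>i w. w \<in> U \<Longrightarrow> fderiv (A i) w \<i> = fderiv (B i) w 1"
    "\<And>w. w \<in> U \<inter> V \<Longrightarrow> \<exists>l>0. lorentz (?fu w) (?fu w) = l * e w \<and> lorentz (?fu w) (?fv w) = l * h w \<and> lorentz (?fv w) (?fv w) = l * k w"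
    and A_def: "A = (\<lambda>i w. h w * ?fu w $ i - e w * ?fv w $ i)" and B_def: "B = (\<lambda>i w. k w * ?fu w $ i - h w * ?fv w $ i)"
  have ceh: "continuous_on U e" "continuous_on U h"
    by (rule Ck_on_continuous[OF cl(1)], rule Ck_on_continuous[OF cl(2)])
  have cA: "continuous_on U (A i)" for i by (rule Ck_on_continuous[OF cl(6)])
  note ce = ceh cA
  have e0: "e w > 0" and ek: "e w * k w = 1 + (h w)\<^sup>2" if "w \<in> U" for w using cl(4,5)[OF that] by auto
  have "\<forall>i. \<exists>Y. \<forall>w\<in>U. (Y has_derivative (\<lambda>v. Re v * A i w + Im v * B i w)) (at w)"
  proof
    fix i
    obtain Y where "\<And>w. w \<in> ball p r \<Longrightarrow> (Y has_derivative (\<lambda>v. Re v * A i w + Im v * B i w)) (at w)"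
      using closed_form_exact[OF cl(6,7,8)[unfolded U_def]] by blast
    then show "\<exists>Y. \<forall>w\<in>U. (Y has_derivative (\<lambda>v. Re v * A i w + Im v * B i w)) (at w)" unfolding U_def by blast
  qed
  from choice[OF this] obtain Y where Y: "\<forall>i. \<forall>w\<in>U. (Y i has_derivative (\<lambda>v. Re v * A i w + Im v * B i w)) (at w)" ..
  define \<kappa> where "\<kappa> = (\<lambda>w. Complex (h w / e w) (1 / e w))"
  define \<alpha> where "\<alpha> = (\<lambda>i w. Complex (?fu w $ i) (A i w))"
  define G where "G = (\<lambda>i w. Complex (f w $ i) (Y i w))"
  have \<kappa>\<alpha>: "\<kappa> w * \<alpha> i w = Complex (?fv w $ i) (B i w)" if w: "w \<in> U" for i w
  proof -
    have "Re (\<kappa> w * \<alpha> i w) = ?fv w $ i" using e0[OF w] by (simp add: \<kappa>_def \<alpha>_def A_def field_simps)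
    moreover have "Im (\<kappa> w * \<alpha> i w) = ((1 + (h w)\<^sup>2) * ?fu w $ i) / e w - h w * ?fv w $ i"
      using e0[OF w] by (simp add: \<kappa>_def \<alpha>_def A_def field_simps power2_eq_square)
    then have "Im (\<kappa> w * \<alpha> i w) = B i w" unfolding ek[OF w, symmetric] using e0[OF w] by (simp add: B_def)
    ultimately show ?thesis by (simp add: complex_eq_iff)
  qed
  have \<xi>: "(of_real (Re v) + of_real (Im v) * \<kappa> w) * \<alpha> i w = Complex (Re v * ?fu w $ i + Im v * ?fv w $ i) (Re v * A i w + Im v * B i w)" if "w \<in> U" for v i w
    unfolding distrib_right mult.assoc \<kappa>\<alpha>[OF that] by (simp add: complex_eq_iff \<alpha>_def)
  have df: "fderiv f w v $ i = Re v * ?fu w $ i + Im v * ?fv w $ i" if "w \<in> U" for v i w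
    by (subst complex_linear_expand[OF has_derivative_linear[OF smooth_on_has_derivative[OF U f that]]]) simp
  show thesis
  proof
    show "continuous_on U \<kappa>" unfolding \<kappa>_def by (intro continuous_intros ce) (use e0 in force)+
    show "Im (\<kappa> w) > 0" if "w \<in> U" for w using e0[OF that] by (simp add: \<kappa>_def)
    have "continuous_on U ?fu"
      by (intro smooth_on_continuous smooth_on_frechet f)
    then show c\<alpha>: "continuous_on U (\<alpha> i)" for i unfolding \<alpha>_def by (intro continuous_intros ce)
    show "(G i has_derivative (\<lambda>v. (of_real (Re v) + of_real (Im v) * \<kappa> w) * \<alpha> i w)) (at w)" if w: "w \<in> U" for i w
    proof -
      have "((\<lambda>w. of_real (f w $ i) + \<i> * of_real (Y i w)) has_derivative
          (\<lambda>v. of_real (fderiv f w v $ i) + \<i> * of_real (Re v * A i w + Im v * B i w))) (at w)"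
        using Y w by (intro has_derivative_add has_derivative_of_real has_derivative_mult_right
            bounded_linear.has_derivative[OF bounded_linear_vec_nth] smooth_on_has_derivative[OF U f w]) auto
      then show ?thesis unfolding G_def Complex_eq
        by (rule has_derivative_eq_rhs, intro ext) (simp only: \<xi>[OF w] Complex_eq df[OF w, symmetric])
    qed
    show "fderiv f w v $ i = Re ((of_real (Re v) + of_real (Im v) * \<kappa> w) * \<alpha> i w)" if "w \<in> U" for i w v
      by (subst df[OF that], subst \<xi>[OF that]) simp
    show "(\<alpha> 0 w)\<^sup>2 = (\<alpha> 1 w)\<^sup>2 + (\<alpha> 2 w)\<^sup>2" if "w \<in> U" for w
    proof (rule continuous_agree_dense[OF U V(2) _ _ _ that])
      show "continuous_on U (\<lambda>w. (\<alpha> 0 w)\<^sup>2)" "continuous_on U (\<lambda>w. (\<alpha> 1 w)\<^sup>2 + (\<alpha> 2 w)\<^sup>2)"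
        by (intro continuous_intros c\<alpha>)+
      fix w assume w: "w \<in> U \<inter> V"
      then obtain l where l: "lorentz (?fu w) (?fu w) = l * e w" "lorentz (?fu w) (?fv w) = l * h w" "lorentz (?fv w) (?fv w) = l * k w"
        using cl(9) by blast
      \<comment> \<open>The vector \<open>?fu\<close> turned by a right angle in the conformal
        structure. Equal length of \<open>?fu\<close> and \<open>a\<close> is the real part of the
        isotropy relation, orthogonality its imaginary part.\<close>
      define a where "a = h w *\<^sub>R ?fu w - e w *\<^sub>R ?fv w"
      have aA: "A i w = a $ i" for i by (simp add: A_def a_def)
      have "lorentz (?fu w) a = 0" by (simp add: a_def lorentz_simps l)
      moreover have "lorentz a a = l * e w * (e w * k w - (h w)\<^sup>2)"
        by (simp add: a_def lorentz_simps lorentz_commute[of "?fv w" "?fu w"] l algebra_simps power2_eq_square)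
      then have "lorentz a a = lorentz (?fu w) (?fu w)" using ek w l by simp
      ultimately show "(\<alpha> 0 w)\<^sup>2 = (\<alpha> 1 w)\<^sup>2 + (\<alpha> 2 w)\<^sup>2"
        unfolding \<alpha>_def aA by (simp add: complex_eq_iff power2_eq_square lorentz_def algebra_simps)
    qed
  qed
qed
qed

section \<open>The isothermal coordinate and its smoothness\<close>

lemma cramer2:
  assumes "cross2 a b \<noteq> 0"
  shows "(cross2 v b / cross2 a b) *\<^sub>R a + (cross2 a v / cross2 a b) *\<^sub>R b = v"
  using assms by (simp add: complex_eq_iff divide_simps) (simp add: cross2_def algebra_simps)

lemma has_derivative_Re_Im_form:
  "(\<lambda>v. (of_real (Re v) + of_real (Im v) * \<kappa>) * a) = (\<lambda>v. Re v *\<^sub>R a + Im v *\<^sub>R (\<kappa> * a))"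
  by (simp add: fun_eq_iff scaleR_conv_of_real algebra_simps)

text \<open>The coordinate is \<open>z = G i\<close>, one of the isotropic primitives. In null coordinates for the
  other two components, \<open>df = Re (\<mu> dz), Re (dz / \<mu>), Re dz\<close> with \<open>\<mu>\<close> holomorphic in \<open>z\<close>, and \<open>f\<close> is
  singular where \<open>\<mu>\<close> is real. Since \<open>Im \<mu>\<close> is harmonic, division by it preserves smoothness;
  dividing minors of \<open>df\<close> shows that \<open>\<mu>\<close> and \<open>z\<close> are smooth functions of the given coordinates.\<close>

lemma isothermal_coordinate:
  fixes f :: "complex \<Rightarrow> real^3" and U :: "complex set" and i j :: 3
    and \<kappa> :: "complex \<Rightarrow> complex" and \<alpha> G :: "3 \<Rightarrow> complex \<Rightarrow> complex"
  assumes U: "open U" "p \<in> U" and f: "smooth_on U f" and V: "open V" "U \<subseteq> closure V"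
    and pos: "\<And>w v. w \<in> U \<inter> V \<Longrightarrow> v \<noteq> 0 \<Longrightarrow> lorentz (fderiv f w v) (fderiv f w v) > 0"
    and \<kappa>: "continuous_on U \<kappa>" "\<And>w. w \<in> U \<Longrightarrow> Im (\<kappa> w) > 0" and \<alpha>: "\<And>i. continuous_on U (\<alpha> i)"
    and G: "\<And>i w. w \<in> U \<Longrightarrow> (G i has_derivative (\<lambda>v. (of_real (Re v) + of_real (Im v) * \<kappa> w) * \<alpha> i w)) (at w)"
    and df: "\<And>i w v. w \<in> U \<Longrightarrow> fderiv f w v $ i = Re ((of_real (Re v) + of_real (Im v) * \<kappa> w) * \<alpha> i w)"
    and null: "\<And>w. w \<in> U \<Longrightarrow> (\<alpha> 0 w)\<^sup>2 = (\<alpha> 1 w)\<^sup>2 + (\<alpha> 2 w)\<^sup>2"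
    and ij: "{i, j} = {1, 2}" and \<alpha>p: "\<alpha> i p \<noteq> 0"
  shows "\<exists>r>0. ball p r \<subseteq> U \<and> (\<exists>z \<eta>. inj_on z (ball p r) \<and> smooth_on (ball p r) z \<and> (\<forall>w\<in>ball p r. jacobian z w > 0) \<and>
     smooth_on (ball p r) \<eta> \<and> (\<forall>w\<in>ball p r. \<eta> w $ 0 = 1 \<and> (\<forall>v. lorentz (\<eta> w) (fderiv f w v) = 0)) \<and>
     real_analytic_on (z ` ball p r) (\<eta> \<circ> inv_into (ball p r) z) \<and>
     (\<forall>w\<in>ball p r \<inter> V. \<exists>\<rho>>0. \<forall>v v'. lorentz (fderiv f w v) (fderiv f w v') =
        \<rho> * (fderiv z w v \<bullet> fderiv z w v')))"
proof -
  \<comment> \<open>The differential of \<open>z\<close> is \<open>\<alpha> i\<close> times du +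
    \<kappa> dv; since Im \<kappa> > 0, it is invertible wherever \<open>\<alpha> i\<close> does not
    vanish.\<close>
  define S where "S = U \<inter> \<alpha> i -` (- {0})"
  have S: "open S" "p \<in> S" "S \<subseteq> U"
  proof -
    show "open S" unfolding S_def by (intro continuous_open_preimage \<alpha> U) auto
  qed (use U \<alpha>p in \<open>auto simp: S_def\<close>)
  define z where "z = G i"
  define a where "a = \<alpha> i"
  define b where "b = (\<lambda>w. \<kappa> w * a w)"
  have ca: "continuous_on S a" "continuous_on S b" "continuous_on S \<kappa>" "continuous_on S (\<alpha> i)" for i
    unfolding b_def a_def using S(3) \<alpha> \<kappa>(1) by (auto intro!: continuous_intros intro: continuous_on_subset)
  have dz: "(z has_derivative (\<lambda>v. Re v *\<^sub>R a w + Im v *\<^sub>R b w)) (at w)" if "w \<in> S" for w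
    using G[of w i] that S(3) unfolding has_derivative_Re_Im_form z_def a_def b_def by blast
  define J where "J = (\<lambda>w. cross2 (a w) (b w))"
  have J_eq: "J w = (norm (a w))\<^sup>2 * Im (\<kappa> w)" for w
    by (simp add: J_def b_def cross2_def cmod_power2) (simp add: algebra_simps power2_eq_square)
  have J: "J w > 0" if "w \<in> S" for w
    using \<kappa>(2)[of w] that by (auto simp: J_eq S_def a_def)
  have cJ: "continuous_on S J" unfolding J_def cross2_def by (intro continuous_intros ca)
  obtain U1 V1 \<zeta> where UV: "open U1" "p \<in> U1" "U1 \<subseteq> S" "open V1" "homeomorphism U1 V1 z \<zeta>"
    using local_homeomorphism[OF S(1,2) dz ca(1,2)] J[OF S(2)] unfolding J_def by (metis less_irrefl)
  have \<zeta>: "\<And>w. w \<in> U1 \<Longrightarrow> z w \<in> V1 \<and> \<zeta> (z w) = w" "\<And>y. y \<in> V1 \<Longrightarrow> \<zeta> y \<in> U1 \<and> z (\<zeta> y) = y" "continuous_on V1 \<zeta>"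
    using UV(5) by (auto simp: homeomorphism_def)
  have UU: "w \<in> U" "w \<in> S" if "w \<in> U1" for w using that UV(3) S(3) by auto
  have U1V: "U1 \<subseteq> closure V" using UU(1) V(2) by blast
  note dz1 = dz[OF UU(2)] and J1 = J[OF UU(2)]
  \<comment> \<open>In null coordinates isotropy reads \<open>(\<alpha> 0 - \<alpha> j) * (\<alpha>
    0 + \<alpha> j) = a\<^sup>2\<close>. Hence \<open>\<mu>\<close> has no zeros, and the other null
    component is \<open>a / \<mu>\<close>.\<close>
  define \<mu> where "\<mu> = (\<lambda>w. (\<alpha> 0 w + \<alpha> j w) / a w)"
  have a0: "a w \<noteq> 0" if "w \<in> U1" for w using UU(2)[OF that] by (simp add: S_def a_def)
  have prod: "(\<alpha> 0 w - \<alpha> j w) * (\<alpha> 0 w + \<alpha> j w) = (a w)\<^sup>2" if "w \<in> U1" for w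
  proof -
    have "(i = 1 \<and> j = 2) \<or> (i = 2 \<and> j = 1)" using ij by (auto simp: doubleton_eq_iff)
    then show ?thesis using null[OF UU(1)[OF that]] unfolding a_def by (elim disjE conjE) (simp_all add: algebra_simps power2_eq_square)
  qed
  have \<mu>0: "\<mu> w \<noteq> 0" if "w \<in> U1" for w
    using prod[OF that] a0[OF that] by (auto simp: \<mu>_def)
  have \<mu>_plus: "\<alpha> 0 w + \<alpha> j w = \<mu> w * a w" and \<mu>_minus: "\<alpha> 0 w - \<alpha> j w = a w / \<mu> w" if "w \<in> U1" for w
  proof -
    show p: "\<alpha> 0 w + \<alpha> j w = \<mu> w * a w" using a0[OF that] by (simp add: \<mu>_def)
    have "(\<alpha> 0 w - \<alpha> j w) * \<mu> w * a w = a w * a w" using prod[OF that] unfolding p by (simp add: power2_eq_square mult_ac)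
    then have "(\<alpha> 0 w - \<alpha> j w) * \<mu> w = a w" using a0[OF that] by simp
    then show "\<alpha> 0 w - \<alpha> j w = a w / \<mu> w" using \<mu>0[OF that] by (simp add: field_simps)
  qed
  have c\<mu>: "continuous_on U1 \<mu>"
    unfolding \<mu>_def using continuous_on_subset[OF ca(1) UV(3)] continuous_on_subset[OF ca(4) UV(3)] a0
    by (intro continuous_intros) auto
  define P Q m where "P = (\<lambda>w. Re (\<mu> w))" and "Q = (\<lambda>w. Im (\<mu> w))" and "m = (\<lambda>w. (norm (\<mu> w))\<^sup>2)"
  have m: "m w = (P w)\<^sup>2 + (Q w)\<^sup>2" for w by (simp add: P_def Q_def m_def cmod_power2)
  have m0: "m w > 0" if "w \<in> U1" for w using \<mu>0[OF that] by (simp add: m_def)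
  have cPQ: "continuous_on U1 P" "continuous_on U1 Q" "continuous_on U1 m"
    unfolding P_def Q_def m_def by (intro continuous_intros c\<mu>)+
  let ?\<xi> = "\<lambda>w v. Re v *\<^sub>R a w + Im v *\<^sub>R b w"
  have form: "(of_real (Re v) + of_real (Im v) * \<kappa> w) * (c * a w) = c * ?\<xi> w v" for v w c
    by (simp add: b_def scaleR_conv_of_real algebra_simps)
  let ?D = "\<lambda>w. fderiv f w"
  have Di: "?D w v $ i = Re (?\<xi> w v)" if "w \<in> U1" for w v
    using df[OF UU(1)[OF that], of v i] form[of v w 1] unfolding mult_1_left a_def by (simp only:)
  have Dp: "?D w v $ 0 + ?D w v $ j = P w * Re (?\<xi> w v) - Q w * Im (?\<xi> w v)" if "w \<in> U1" for w v
  proof -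
    have "?D w v $ 0 + ?D w v $ j = Re ((of_real (Re v) + of_real (Im v) * \<kappa> w) * (\<alpha> 0 w + \<alpha> j w))"
      unfolding df[OF UU(1)[OF that]] distrib_left by simp
    then show ?thesis unfolding \<mu>_plus[OF that] form by (simp add: P_def Q_def)
  qed
  have Dm: "?D w v $ 0 - ?D w v $ j = (P w * Re (?\<xi> w v) + Q w * Im (?\<xi> w v)) / m w" if "w \<in> U1" for w v
  proof -
    have "?D w v $ 0 - ?D w v $ j = Re ((of_real (Re v) + of_real (Im v) * \<kappa> w) * (\<alpha> 0 w - \<alpha> j w))"
      unfolding df[OF UU(1)[OF that]] right_diff_distrib by simp
    also have "\<alpha> 0 w - \<alpha> j w = inverse (\<mu> w) * a w" unfolding \<mu>_minus[OF that] by (simp add: divide_inverse)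
    finally show ?thesis unfolding form by (simp add: P_def Q_def m_def cmod_power2 add_divide_distrib)
  qed
  have lor: "lorentz x y = - ((x $ 0 + x $ j) * (y $ 0 - y $ j) + (x $ 0 - x $ j) * (y $ 0 + y $ j)) / 2 + x $ i * y $ i" for x y
  proof -
    have "(i = 1 \<and> j = 2) \<or> (i = 2 \<and> j = 1)" using ij by (auto simp: doubleton_eq_iff)
    then show ?thesis by (elim disjE conjE) (simp_all add: lorentz_def field_simps)
  qed
  \<comment> \<open>The first fundamental form is (Im \<mu>)^2 / |\<mu>|^2 times |dz|^2; it
    degenerates exactly where \<mu> is real.\<close>
  have conf: "lorentz (?D w v) (?D w v') = (Q w)\<^sup>2 / m w * (?\<xi> w v \<bullet> ?\<xi> w v')" if w: "w \<in> U1" for w v v'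
  proof -
    have "m w * lorentz (?D w v) (?D w v') = (Q w)\<^sup>2 * (?\<xi> w v \<bullet> ?\<xi> w v')"
    proof -
      have gen: "M * (- ((p1 * x - q1 * y) * ((p1 * x' + q1 * y') / M) + ((p1 * x + q1 * y) / M) * (p1 * x' - q1 * y')) / 2 + x * x') = q1\<^sup>2 * (x * x' + y * y')"
        if "M = p1\<^sup>2 + q1\<^sup>2" "M \<noteq> 0" for M p1 q1 x y x' y' :: real
        using that(2) by (simp add: field_simps) (simp add: that(1) algebra_simps power2_eq_square)
      show ?thesis
        unfolding lor Di[OF w] Dp[OF w] Dm[OF w] inner_complex_def
        by (rule gen[OF m]) (use m0[OF w] in simp)
    qed
    then show ?thesis using m0[OF w] by (simp add: field_simps)
  qed
  have Q0: "Q w \<noteq> 0" if w: "w \<in> U1 \<inter> V" for w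
  proof
    assume "Q w = 0"
    then have "lorentz (?D w 1) (?D w 1) = 0" using conf[of w 1 1] w by simp
    moreover have "lorentz (?D w 1) (?D w 1) > 0" using pos[of w 1] w UU(1) by simp
    ultimately show False by simp
  qed
  \<comment> \<open>\<open>\<mu>\<close> as a function of \<open>z\<close>. It is the complex
    derivative of \<open>G 0 + G j\<close> with respect to \<open>z\<close>, hence holomorphic,
    although \<open>z\<close> is so far only known to be C^1.\<close>
  define M where "M = (\<lambda>y. \<mu> (\<zeta> y))"
  have M: "M holomorphic_on V1"
  proof -
    let ?H = "\<lambda>y. G 0 (\<zeta> y) + G j (\<zeta> y)"
    have "(?H has_field_derivative M y) (at y)" if y: "y \<in> V1" for y
    proof -
      let ?w = "\<zeta> y"
      have w: "?w \<in> U1" using \<zeta>(2)[OF y] by simp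
      let ?\<zeta>' = "\<lambda>v. Complex (cross2 v (b ?w) / cross2 (a ?w) (b ?w)) (cross2 (a ?w) v / cross2 (a ?w) (b ?w))"
      have c: "cross2 (a ?w) (b ?w) \<noteq> 0" using J1[OF w] by (simp add: J_def)
      have d\<zeta>: "(\<zeta> has_derivative ?\<zeta>') (at y)"
        by (rule has_derivative_local_inverse[OF UV(4) y \<zeta>(3) _ dz1[OF w] c]) (use \<zeta>(2) in blast)
      have "((\<lambda>w. G 0 w + G j w) has_derivative (\<lambda>v. \<mu> ?w * ?\<xi> ?w v)) (at ?w)"
        by (rule has_derivative_eq_rhs[OF has_derivative_add[OF G[OF UU(1)[OF w]] G[OF UU(1)[OF w]]]])
          (simp only: distrib_left[symmetric] \<mu>_plus[OF w] form)
      from has_derivative_compose[OF d\<zeta> this]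
      show ?thesis unfolding has_field_derivative_def
        by (rule has_derivative_eq_rhs) (simp only: complex.sel cramer2[OF c] M_def)
    qed
    then have "?H holomorphic_on V1" and "\<And>y. y \<in> V1 \<Longrightarrow> deriv ?H y = M y"
      using holomorphic_on_open[OF UV(4)] DERIV_imp_deriv by blast+
    then show ?thesis using holomorphic_deriv[OF _ UV(4), of ?H] holomorphic_cong[of V1 V1 "deriv ?H" M] by blast
  qed
  have sD: "smooth_on U1 (\<lambda>w. ?D w v $ i)" for v i
    using smooth_on_subset[OF f] UU(1) by (intro smooth_on_vec_nth UV(1) smooth_on_frechet) blast
  \<comment> \<open>A minor of \<open>df\<close>, formed from component \<open>i\<close> and one
    null component. It is smooth as an expression in \<open>df\<close>, and it equals
    \<open>Q * J\<close>, a harmonic function of \<open>z\<close> times the Jacobian of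
    \<open>z\<close>.\<close>
  define D where "D = (\<lambda>w. - (?D w 1 $ i * (?D w \<i> $ 0 + ?D w \<i> $ j) - ?D w \<i> $ i * (?D w 1 $ 0 + ?D w 1 $ j)))"
  note sm = smooth_on_add[OF UV(1)] smooth_on_diff[OF UV(1)] smooth_on_mult[OF UV(1)] smooth_on_minus[OF UV(1)] smooth_on_const sD
  have smD: "smooth_on U1 D" unfolding D_def by (intro sm)
  have D_eq: "D w = Q w * J w" if "w \<in> U1" for w
    unfolding D_def Di[OF that] Dp[OF that] J_def cross2_def by (simp add: algebra_simps)
  \<comment> \<open>The regularity criterion for all that follows: a continuous \<open>q\<close> is
    smooth as soon as \<open>D * q\<close> is. \<open>Im M\<close> vanishes identically on no disc
    because \<open>Q\<close> has no zeros on the dense set \<open>V\<close>.\<close>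
  have divide: "smooth_on U1 q" if "smooth_on U1 \<phi>" "continuous_on U1 q" "\<And>w. w \<in> U1 \<Longrightarrow> \<phi> w = D w * q w" for \<phi> q
  proof (rule smooth_on_local[OF UV(1)])
    fix w0 assume w0: "w0 \<in> U1"
    show "\<exists>T. open T \<and> w0 \<in> T \<and> smooth_on T q"
    proof (rule division_by_harmonic_at[where U = U1 and Z = z and T = V1 and M = M and J = J and D = D and g = \<phi> and a = "a w0" and b = "b w0"])
      show "cross2 (a w0) (b w0) \<noteq> 0" "J w0 \<noteq> 0" using J1[OF w0] by (auto simp: J_def)
      show "(z has_derivative (\<lambda>v. Re v *\<^sub>R a w0 + Im v *\<^sub>R b w0)) (at w0)" using dz1[OF w0] .
      show "z w0 \<in> V1" using \<zeta>(1)[OF w0] by blast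
      show "continuous_on U1 J" using continuous_on_subset[OF cJ UV(3)] .
      show "D w = Im (M (z w)) * J w" if "w \<in> U1" for w
        using D_eq[OF that] \<zeta>(1)[OF that] by (simp add: M_def Q_def)
      fix e :: real assume e: "e > 0"
      have cz: "continuous_on U1 z"
        using dz1 has_derivative_continuous UV(1) by (metis continuous_on_eq_continuous_at)
      have "open (U1 \<inter> z -` ball (z w0) e)" by (rule continuous_open_preimage[OF cz UV(1) open_ball])
      moreover have "w0 \<in> (U1 \<inter> z -` ball (z w0) e) \<inter> closure V" using w0 e U1V by auto
      ultimately obtain w where "w \<in> U1" "z w \<in> ball (z w0) e" "w \<in> V"
        using open_Int_closure_eq_empty by blast
      then show "\<exists>\<zeta>\<in>ball (z w0) e. Im (M \<zeta>) \<noteq> 0"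
        using Q0[of w] \<zeta>(1)[of w] by (intro bexI[of _ "z w"]) (auto simp: M_def Q_def)
    qed (use UV w0 M smD that in auto)
  qed
  \<comment> \<open>The minor formed with the other null component is \<open>D / m\<close>.\<close>
  have sminv: "smooth_on U1 (\<lambda>w. 1 / m w)"
  proof (rule divide)
    show "smooth_on U1 (\<lambda>w. ?D w 1 $ i * (?D w \<i> $ 0 - ?D w \<i> $ j) - ?D w \<i> $ i * (?D w 1 $ 0 - ?D w 1 $ j))" by (intro sm)
    show "continuous_on U1 (\<lambda>w. 1 / m w)" using m0 by (intro continuous_intros cPQ) force
    show "?D w 1 $ i * (?D w \<i> $ 0 - ?D w \<i> $ j) - ?D w \<i> $ i * (?D w 1 $ 0 - ?D w 1 $ j) = D w * (1 / m w)" if "w \<in> U1" for w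
      unfolding D_eq[OF that] Di[OF that] Dm[OF that] J_def cross2_def using m0[OF that] by (simp add: field_simps)
  qed
  have sm_m: "smooth_on U1 m"
    using smooth_on_inverse[OF UV(1) sminv] m0 by (force simp: inverse_eq_divide)
  have Reab: "2 * (Re (a w) * Re (a w) + Re (b w) * Re (b w)) \<noteq> 0" if "w \<in> U1" for w
  proof -
    have "\<not> (Re (a w) = 0 \<and> Re (b w) = 0)" using J1[OF that] by (auto simp: J_def cross2_def)
    then show ?thesis by (metis sum_squares_eq_zero_iff mult_eq_0_iff zero_neq_numeral)
  qed
  have sa: "smooth_on U1 (\<lambda>w. Re (a w))" "smooth_on U1 (\<lambda>w. Re (b w))"
    by (rule smooth_on_cong[OF UV(1), THEN iffD2, OF _ sD[of 1 i]], simp add: Di)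
      (rule smooth_on_cong[OF UV(1), THEN iffD2, OF _ sD[of \<i> i]], simp add: Di)
  note sm = sm sm_m sa
  have sP: "smooth_on U1 P"
  proof -
    \<comment> \<open>\<open>T w v\<close> equals \<open>2 * P w * Re (?\<xi> w v)\<close>, where
      \<open>Re a\<close> and \<open>Re b\<close> are smooth as partials of component
      \<open>i\<close> of \<open>f\<close>. As they do not vanish together, \<open>P\<close> is
      recovered from the two directions by least squares.\<close>
    define T where "T = (\<lambda>w v. (?D w v $ 0 + ?D w v $ j) + m w * (?D w v $ 0 - ?D w v $ j))"
    have T: "T w v = 2 * P w * Re (?\<xi> w v)" if "w \<in> U1" for w v
      unfolding T_def Dp[OF that] Dm[OF that] using m0[OF that] by simp
    have "smooth_on U1 (\<lambda>w. (T w 1 * Re (a w) + T w \<i> * Re (b w)) / (2 * (Re (a w) * Re (a w) + Re (b w) * Re (b w))))"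
      unfolding T_def by (intro smooth_on_divide UV(1) sm) (rule Reab)
    then show ?thesis
    proof (rule smooth_on_cong[OF UV(1), THEN iffD1, rotated])
      fix w assume w: "w \<in> U1"
      show "(T w 1 * Re (a w) + T w \<i> * Re (b w)) / (2 * (Re (a w) * Re (a w) + Re (b w) * Re (b w))) = P w"
        using Reab[OF w] unfolding T[OF w] by (simp add: nonzero_divide_eq_eq algebra_simps)
    qed
  qed
  note sm = sm sP
  have J0: "J w \<noteq> 0" if "w \<in> U1" for w using J1[OF that] by simp
  have cJ1: "continuous_on U1 J" "continuous_on U1 a" "continuous_on U1 b"
    using continuous_on_subset[OF cJ UV(3)] continuous_on_subset[OF ca(1) UV(3)] continuous_on_subset[OF ca(2) UV(3)] .
  \<comment> \<open>\<open>m - P\<^sup>2\<close> is \<open>Q\<^sup>2 = D * (Q / J)\<close>. A second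
    division by \<open>D\<close> gives \<open>1 / J\<^sup>2\<close>, and \<open>J\<close> follows by
    a root since it is positive.\<close>
  have sQJ: "smooth_on U1 (\<lambda>w. Q w / J w)"
  proof (rule divide)
    show "smooth_on U1 (\<lambda>w. m w - P w * P w)" by (intro sm)
    show "continuous_on U1 (\<lambda>w. Q w / J w)" using J0 by (intro continuous_intros cPQ cJ1) auto
    show "m w - P w * P w = D w * (Q w / J w)" if "w \<in> U1" for w
      unfolding D_eq[OF that] m using J0[OF that] by (simp add: power2_eq_square)
  qed
  have "smooth_on U1 (\<lambda>w. 1 / (J w)\<^sup>2)"
  proof (rule divide[OF sQJ])
    show "continuous_on U1 (\<lambda>w. 1 / (J w)\<^sup>2)" using J0 by (intro continuous_intros cJ1) auto
    show "Q w / J w = D w * (1 / (J w)\<^sup>2)" if "w \<in> U1" for w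
      unfolding D_eq[OF that] using J0[OF that] by (simp add: power2_eq_square)
  qed
  then have "smooth_on U1 (\<lambda>w. inverse (sqrt (1 / (J w)\<^sup>2)))"
    by (intro smooth_on_inverse smooth_on_sqrt UV(1)) (use J1 in \<open>force simp: real_sqrt_divide\<close>)+
  then have sJ: "smooth_on U1 J"
    by (rule smooth_on_cong[OF UV(1), THEN iffD1, rotated]) (use J1 in \<open>force simp: real_sqrt_divide\<close>)
  note sm = sm sJ
  \<comment> \<open>The null component is P Re \<xi> - Q Im \<xi>. With \<open>P\<close> known to be
    smooth, Q Im \<xi> is smooth, and it is \<open>D\<close> times
    \<open>Im (?\<xi> w v) / J w\<close>.\<close>
  have sIm: "smooth_on U1 (\<lambda>w. Im (?\<xi> w v))" for v
  proof -
    have "smooth_on U1 (\<lambda>w. Im (?\<xi> w v) / J w)"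
    proof (rule divide)
      show "smooth_on U1 (\<lambda>w. P w * ?D w v $ i - (?D w v $ 0 + ?D w v $ j))" by (intro sm)
      show "continuous_on U1 (\<lambda>w. Im (?\<xi> w v) / J w)" using J0 by (intro continuous_intros cJ1) auto
      show "P w * ?D w v $ i - (?D w v $ 0 + ?D w v $ j) = D w * (Im (?\<xi> w v) / J w)" if "w \<in> U1" for w
        unfolding D_eq[OF that] Di[OF that] Dp[OF that] using J0[OF that] by simp
    qed
    then have "smooth_on U1 (\<lambda>w. Im (?\<xi> w v) / J w * J w)" by (intro sm)
    then show ?thesis by (rule smooth_on_cong[OF UV(1), THEN iffD1, rotated]) (use J0 in simp)
  qed
  have sab: "smooth_on U1 a" "smooth_on U1 b"
    using smooth_on_Complex[OF UV(1) sa(1) sIm[of 1]] smooth_on_Complex[OF UV(1) sa(2) sIm[of \<i>]] by (simp_all add: complex_surj)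
  have sz: "smooth_on U1 z"
    by (rule smooth_onI_partials[OF UV(1) dz1 sab])
  have fz: "fderiv z w v = ?\<xi> w v" if "w \<in> U1" for w v
    using frechet_derivative_at[OF dz1[OF that]] by metis
  define \<eta> :: "complex \<Rightarrow> real^3" where
    "\<eta> = (\<lambda>w. \<chi> l. if l = 0 then 1 else if l = i then 2 * P w / (1 + m w) else (m w - 1) / (1 + m w))"
  have idx: "i \<noteq> 0" "j \<noteq> 0" "i \<noteq> j"
  proof -
    have "(i = 1 \<and> j = 2) \<or> (i = 2 \<and> j = 1)" using ij by (auto simp: doubleton_eq_iff)
    then show "i \<noteq> 0" "j \<noteq> 0" "i \<noteq> j" by auto
  qed
  have \<eta>: "\<eta> w $ 0 = 1" "\<eta> w $ i = 2 * P w / (1 + m w)" "\<eta> w $ j = (m w - 1) / (1 + m w)" for w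
    using idx by (simp_all add: \<eta>_def)
  have m1: "1 + m w \<noteq> 0" for w by (simp add: m_def add_nonneg_eq_0_iff)
  have s\<eta>: "smooth_on U1 \<eta>"
  proof (rule smooth_on_vec[OF UV(1)])
    fix l
    show "smooth_on U1 (\<lambda>w. \<eta> w $ l)"
      unfolding \<eta>_def vec_lambda_beta
      by (cases "l = 0"; cases "l = i") (use idx m1 in \<open>auto intro!: smooth_on_divide UV(1) sm\<close>)
  qed
  \<comment> \<open>With \<open>X\<close> and \<open>Y\<close> the two null components of
    \<open>df\<close>, the claim reduces to \<open>M * Y + X = 2 * p1 * x\<close>, that is,
    |\<mu>|^2 Re (dz / \<mu>) + Re (\<mu> dz) = 2 Re \<mu> Re dz.\<close>
  have orth: "lorentz (\<eta> w) (?D w v) = 0" if "w \<in> U1" for w v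
  proof -
    have gen: "- ((1 + (M - 1) / (1 + M)) * Y + (1 - (M - 1) / (1 + M)) * X) / 2 + 2 * p1 / (1 + M) * x = 0"
      if "1 + M \<noteq> 0" "M * Y + X = 2 * p1 * x" for M X Y p1 x :: real
    proof -
      have "- ((1 + (M - 1) / (1 + M)) * Y + (1 - (M - 1) / (1 + M)) * X) / 2 + 2 * p1 / (1 + M) * x = (2 * p1 * x - (M * Y + X)) / (1 + M)"
        using that(1) by (simp add: divide_simps) (simp add: algebra_simps)
      then show ?thesis using that(2) by simp
    qed
    show ?thesis unfolding lor \<eta>
    proof (rule gen[OF m1])
      show "m w * (?D w v $ 0 - ?D w v $ j) + (?D w v $ 0 + ?D w v $ j) = 2 * P w * ?D w v $ i"
        unfolding Di[OF that] Dp[OF that] Dm[OF that] using m0[OF that] by simp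
    qed
  qed
  obtain r where r: "r > 0" "ball p r \<subseteq> U1" using UV(1,2) open_contains_ball by blast
  have rU: "w \<in> U1" if "w \<in> ball p r" for w using that r by blast
  have inj: "inj_on z (ball p r)" by (rule inj_on_inverseI[of _ \<zeta>]) (use \<zeta>(1)[OF rU] in blast)
  have inv: "inv_into (ball p r) z y = \<zeta> y" if "y \<in> z ` ball p r" for y
    using that inv_into_f_f[OF inj] \<zeta>(1)[OF rU] by fastforce
  have imV: "z ` ball p r \<subseteq> V1" using \<zeta>(1) rU by blast
  have imo: "open (z ` ball p r)"
  proof -
    have "z ` ball p r = V1 \<inter> \<zeta> -` ball p r"
    proof (intro equalityI subsetI)
      show "y \<in> V1 \<inter> \<zeta> -` ball p r" if "y \<in> z ` ball p r" for y
        using that \<zeta>(1)[OF rU] by fastforce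
      show "y \<in> z ` ball p r" if "y \<in> V1 \<inter> \<zeta> -` ball p r" for y
        using that \<zeta>(2)[of y] by (intro image_eqI[of _ z "\<zeta> y"]) auto
    qed
    then show ?thesis using continuous_open_preimage[OF \<zeta>(3) UV(4) open_ball] by simp
  qed
  have ra: "real_analytic_on (z ` ball p r) (\<eta> \<circ> inv_into (ball p r) z)"
  proof (rule real_analytic_gauss[OF imo holomorphic_on_subset[OF M imV]])
    fix l :: 3
    have "l = 0 \<or> l = i \<or> l = j" using ij forall_3_012[of "\<lambda>l. l = 0 \<or> l = i \<or> l = j"] by blast
    moreover have "P (\<zeta> y) = Re (M y)" "m (\<zeta> y) = (norm (M y))\<^sup>2" for y by (simp_all add: P_def m_def M_def)
    ultimately show "(\<forall>y\<in>z ` ball p r. (\<eta> \<circ> inv_into (ball p r) z) y $ l = 1) \<or>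
       (\<forall>y\<in>z ` ball p r. (\<eta> \<circ> inv_into (ball p r) z) y $ l = 2 * Re (M y) / (1 + (norm (M y))\<^sup>2)) \<or>
       (\<forall>y\<in>z ` ball p r. (\<eta> \<circ> inv_into (ball p r) z) y $ l = ((norm (M y))\<^sup>2 - 1) / (1 + (norm (M y))\<^sup>2))"
      using \<eta> inv by (elim disjE) (simp_all add: comp_def)
  qed
  have cf: "\<exists>\<rho>>0. \<forall>v v'. lorentz (?D w v) (?D w v') = \<rho> * (fderiv z w v \<bullet> fderiv z w v')"
    if w: "w \<in> ball p r \<inter> V" for w
  proof (intro exI[of _ "(Q w)\<^sup>2 / m w"] conjI allI)
    show "(Q w)\<^sup>2 / m w > 0" using Q0[of w] m0[of w] w rU by simp
    show "lorentz (?D w v) (?D w v') = (Q w)\<^sup>2 / m w * (fderiv z w v \<bullet> fderiv z w v')" for v v'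
      using conf[of w v v'] fz[of w] w rU by simp
  qed
  have jac: "jacobian z w > 0" if "w \<in> ball p r" for w
    unfolding jacobian_cross2 using fz[OF rU[OF that]] J1[OF rU[OF that]] by (simp add: J_def)
  show ?thesis
  proof (rule exI[of _ r], intro conjI)
    show "r > 0" "ball p r \<subseteq> U" using r UU(1) by blast+
    show "\<exists>z \<eta>. inj_on z (ball p r) \<and> smooth_on (ball p r) z \<and> (\<forall>w\<in>ball p r. jacobian z w > 0) \<and>
     smooth_on (ball p r) \<eta> \<and> (\<forall>w\<in>ball p r. \<eta> w $ 0 = 1 \<and> (\<forall>v. lorentz (\<eta> w) (?D w v) = 0)) \<and>
     real_analytic_on (z ` ball p r) (\<eta> \<circ> inv_into (ball p r) z) \<and>
     (\<forall>w\<in>ball p r \<inter> V. \<exists>\<rho>>0. \<forall>v v'. lorentz (?D w v) (?D w v') =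
        \<rho> * (fderiv z w v \<bullet> fderiv z w v'))"
      by (rule exI[of _ z], rule exI[of _ \<eta>], intro conjI)
        (rule inj, rule smooth_on_subset[OF sz r(2)], rule ballI, erule jac, rule smooth_on_subset[OF s\<eta> r(2)],
         intro ballI conjI allI \<eta>(1) orth rU, assumption, rule ra, rule ballI, erule cf)
  qed
qed

text \<open>The passage to a disc makes closed forms exact. A suitable index \<open>i\<close> exists
  because isotropy forces \<open>\<alpha> 0 p = 0\<close> once \<open>\<alpha> 1 p\<close> and
  \<open>\<alpha> 2 p\<close> vanish, and then \<open>df\<close> would vanish at \<open>p\<close>;
  this is where condition (2) on admissible points enters.\<close>

lemma conformal_coordinate_at:
  fixes f :: "complex \<Rightarrow> real^3" and U :: "complex set"
  assumes U: "open U" "p \<in> U" and f: "smooth_on U f" and V: "open V" "U \<subseteq> closure V"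
    and g: "C1_metric_on U g"
    and fg: "\<forall>w\<in>U \<inter> V. conformal_pullback g \<beta> f w"
    and H: "\<forall>w\<in>U \<inter> V. mean_curvature_free f w"
    and nz: "fderiv f p v0 \<noteq> 0"
  obtains r and z :: "complex \<Rightarrow> complex" and \<eta> :: "complex \<Rightarrow> real^3" where "r > 0" "ball p r \<subseteq> U" "inj_on z (ball p r)" "smooth_on (ball p r) z"
    "\<And>w. w \<in> ball p r \<Longrightarrow> jacobian z w > 0" "smooth_on (ball p r) \<eta>" "\<And>w. w \<in> ball p r \<Longrightarrow> \<eta> w $ 0 = 1"
    "\<And>w v. w \<in> ball p r \<Longrightarrow> lorentz (\<eta> w) (fderiv f w v) = 0"
    "real_analytic_on (z ` ball p r) (\<eta> \<circ> inv_into (ball p r) z)"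
    "\<And>w. w \<in> ball p r \<inter> V \<Longrightarrow> \<exists>\<rho>>0. \<forall>v v'. lorentz (fderiv f w v) (fderiv f w v') =
        \<rho> * (fderiv z w v \<bullet> fderiv z w v')"
proof -
  obtain r0 where r0: "r0 > 0" "ball p r0 \<subseteq> U" using U open_contains_ball by blast
  let ?B = "ball p r0"
  have f0: "smooth_on ?B f" and V0: "?B \<subseteq> closure V" using smooth_on_subset[OF f r0(2)] V r0 by auto
  have g0: "C1_metric_on ?B g"
    using g r0(2) Ck_on_subset[OF _ r0(2)] unfolding C1_metric_on_def by (meson subsetD)
  have fg0: "\<forall>w\<in>?B \<inter> V. conformal_pullback g \<beta> f w"
    by (intro ballI bspec[OF fg]) (use r0 in blast)
  have pos: "lorentz (fderiv f w v) (fderiv f w v) > 0" if "w \<in> ?B \<inter> V" "v \<noteq> 0" for w v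
  proof -
    have "g w v v > 0" using g0 that unfolding C1_metric_on_def by blast
    then show ?thesis using fg0[rule_format, OF that(1)] by (simp add: zero_less_mult_iff)
  qed
  show thesis
  proof (rule isotropic_primitives[OF f0 V(1) V0 g0 fg0 ballI[OF bspec[OF H]]])
    show "w \<in> U \<inter> V" if "w \<in> ?B \<inter> V" for w using that r0 by blast
    fix \<kappa> and \<alpha> G :: "3 \<Rightarrow> complex \<Rightarrow> complex"
    assume *: "continuous_on ?B \<kappa>" "\<And>w. w \<in> ?B \<Longrightarrow> Im (\<kappa> w) > 0" "\<And>i. continuous_on ?B (\<alpha> i)"
      "\<And>i w. w \<in> ?B \<Longrightarrow> (G i has_derivative (\<lambda>v. (of_real (Re v) + of_real (Im v) * \<kappa> w) * \<alpha> i w)) (at w)"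
      "\<And>i w v. w \<in> ?B \<Longrightarrow> fderiv f w v $ i = Re ((of_real (Re v) + of_real (Im v) * \<kappa> w) * \<alpha> i w)"
      "\<And>w. w \<in> ?B \<Longrightarrow> (\<alpha> 0 w)\<^sup>2 = (\<alpha> 1 w)\<^sup>2 + (\<alpha> 2 w)\<^sup>2"
    have pB: "p \<in> ?B" using r0 by simp
    have "\<exists>i j. {i, j} = {1, 2} \<and> \<alpha> i p \<noteq> 0"
    proof (rule ccontr)
      assume "\<not> ?thesis"
      then have "\<alpha> 1 p = 0" "\<alpha> 2 p = 0" by (metis, metis insert_commute)
      moreover from this have "\<alpha> 0 p = 0" using *(6)[OF pB] by simp
      ultimately have "\<forall>i. \<alpha> i p = 0" unfolding forall_3_012 by blast
      then have "fderiv f p v0 = 0" using *(5)[OF pB] by (simp add: vec_eq_iff)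
      then show False using nz by simp
    qed
    then obtain i j :: 3 where ij: "{i, j} = {1, 2}" "\<alpha> i p \<noteq> 0" by blast
    obtain r and z :: "complex \<Rightarrow> complex" and \<eta> :: "complex \<Rightarrow> real^3" where **: "r > 0" "ball p r \<subseteq> ?B" "inj_on z (ball p r)" "smooth_on (ball p r) z" "\<forall>w\<in>ball p r. jacobian z w > 0"
      "smooth_on (ball p r) \<eta>" "\<forall>w\<in>ball p r. \<eta> w $ 0 = 1 \<and> (\<forall>v. lorentz (\<eta> w) (fderiv f w v) = 0)"
      "real_analytic_on (z ` ball p r) (\<eta> \<circ> inv_into (ball p r) z)"
      "\<forall>w\<in>ball p r \<inter> V. \<exists>\<rho>>0. \<forall>v v'. lorentz (fderiv f w v) (fderiv f w v') =
        \<rho> * (fderiv z w v \<bullet> fderiv z w v')"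
    proof -
      have "\<exists>r>0. ball p r \<subseteq> ?B \<and> (\<exists>z \<eta>. inj_on z (ball p r) \<and> smooth_on (ball p r) z \<and> (\<forall>w\<in>ball p r. jacobian z w > 0) \<and>
         smooth_on (ball p r) \<eta> \<and> (\<forall>w\<in>ball p r. (\<eta> w :: real^3) $ 0 = 1 \<and> (\<forall>v. lorentz (\<eta> w) (fderiv f w v) = 0)) \<and>
         real_analytic_on (z ` ball p r) (\<eta> \<circ> inv_into (ball p r) z) \<and>
         (\<forall>w\<in>ball p r \<inter> V. \<exists>\<rho>>0. \<forall>v v'. lorentz (fderiv f w v) (fderiv f w v') =
            \<rho> * (fderiv z w v \<bullet> fderiv z w v')))"
        by (rule isothermal_coordinate[where \<kappa> = \<kappa> and \<alpha> = \<alpha> and G = G, OF open_ball pB f0 V(1) V0 _ _ _ _ _ _ _ ij])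
          (erule (1) pos, rule *(1), erule *(2), rule *(3), erule *(4), erule *(5), erule *(6))
      then show ?thesis using that by blast
    qed
    show thesis
      by (rule that[OF **(1) subset_trans[OF **(2) r0(2)] **(3,4) bspec[OF **(5)] **(6) _ _ **(8) bspec[OF **(9)]])
        (use **(7) in blast)+
  qed
qed

section \<open>Charts\<close>

lemma is_chart_inj: "is_chart X c \<Longrightarrow> inj_on (snd c) (fst c)"
proof -
  assume c: "is_chart X c"
  then have "inj_on (snd c) (topspace (subtopology X (fst c)))"
    unfolding is_chart_def using homeomorphic_eq_everything_map[of "subtopology X (fst c)"] by blast
  moreover have "topspace (subtopology X (fst c)) = fst c"
    using c openin_subset[of X "fst c"] by (auto simp: is_chart_def)
  ultimately show ?thesis by simp
qed

lemma local_rep_apply: "is_chart X c \<Longrightarrow> q \<in> fst c \<Longrightarrow> local_rep c f (snd c q) = f q"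
  by (simp add: local_rep_def inv_into_f_f is_chart_inj)

lemma chart_open_image:
  assumes "is_chart X c" "openin X S" "S \<subseteq> fst c"
  shows "open (snd c ` S)"
proof -
  have "open_map (subtopology X (fst c)) (top_of_set (snd c ` fst c)) (snd c)"
    using assms(1) homeomorphic_imp_open_map unfolding is_chart_def by blast
  moreover have "openin (subtopology X (fst c)) S" using assms by (auto simp: openin_subtopology)
  ultimately have "openin (top_of_set (snd c ` fst c)) (snd c ` S)" unfolding open_map_def by blast
  then show ?thesis using assms(1) openin_open_trans unfolding is_chart_def by blast
qed

lemma chart_continuous_map: "is_chart X c \<Longrightarrow> continuous_map (subtopology X (fst c)) euclidean (snd c)"
  using homeomorphic_imp_continuous_map continuous_map_into_fulltopology unfolding is_chart_def by blast

lemma chart_open_preimage: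
  assumes c: "is_chart X c" and "open T"
  shows "openin X {q \<in> fst c. snd c q \<in> T}"
proof -
  have D: "openin X (fst c)" using c by (simp add: is_chart_def)
  then have "topspace (subtopology X (fst c)) = fst c" using openin_subset by fastforce
  then have "openin (subtopology X (fst c)) {q \<in> fst c. snd c q \<in> T}"
    using openin_continuous_map_preimage[OF chart_continuous_map[OF c], of T] assms(2) by simp
  then show ?thesis using D openin_trans_full by blast
qed

lemma chart_subset_topspace: "is_chart X c \<Longrightarrow> fst c \<subseteq> topspace X"
  by (simp add: is_chart_def openin_subset)

lemma open_overlap: "is_chart X c \<Longrightarrow> is_chart X d \<Longrightarrow> open (overlap c d)"
  unfolding overlap_def by (intro chart_open_image) (auto simp: is_chart_def)

lemma chart_image_dense:
  assumes c: "is_chart X c" and W: "X closure_of W = topspace X" and S: "openin X S" "S \<subseteq> fst c"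
  shows "snd c ` S \<subseteq> closure (snd c ` (S \<inter> W))"
proof
  fix y assume "y \<in> snd c ` S"
  then obtain q where q: "q \<in> S" "y = snd c q" by blast
  show "y \<in> closure (snd c ` (S \<inter> W))"
    unfolding closure_iff_nhds_not_empty
  proof (intro allI impI)
    fix A T assume T: "T \<subseteq> A" "y \<in> T" "open T"
    have "openin X (S \<inter> {q \<in> fst c. snd c q \<in> T})" using chart_open_preimage[OF c T(3)] S by blast
    moreover have "q \<in> S \<inter> {q \<in> fst c. snd c q \<in> T}" using q T S by blast
    moreover have "q \<in> X closure_of W" unfolding W using q S openin_subset by blast
    ultimately have "\<exists>q'. q' \<in> W \<and> q' \<in> S \<inter> {q \<in> fst c. snd c q \<in> T}"
      unfolding in_closure_of by meson
    then obtain q' where "q' \<in> W" "q' \<in> S" "snd c q' \<in> T" by blast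
    then show "snd c ` (S \<inter> W) \<inter> A \<noteq> {}" using T by blast
  qed
qed

lemma continuous_map_agree_dense:
  fixes e1 e2 :: "'a \<Rightarrow> real^3"
  assumes S: "openin X S" and W: "X closure_of W = topspace X"
    and e: "continuous_map (subtopology X S) euclidean e1" "continuous_map (subtopology X S) euclidean e2"
    and eq: "\<And>q. q \<in> S \<Longrightarrow> q \<in> W \<Longrightarrow> e1 q = e2 q" and q: "q \<in> S"
  shows "e1 q = e2 q"
proof (rule ccontr)
  assume ne: "e1 q \<noteq> e2 q"
  have top: "topspace (subtopology X S) = S" using openin_subset[OF S] by auto
  have "continuous_map (subtopology X S) euclidean (\<lambda>q. e1 q - e2 q)" by (intro continuous_map_diff e)
  from openin_continuous_map_preimage[OF this, of "- {0}"]
  have "openin (subtopology X S) {q \<in> S. e1 q - e2 q \<in> - {0}}" unfolding top by (simp add: open_Compl)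
  then have "openin X {q \<in> S. e1 q - e2 q \<in> - {0}}" using S openin_trans_full by blast
  moreover have "q \<in> {q \<in> S. e1 q - e2 q \<in> - {0}}" using q ne by simp
  moreover have "q \<in> X closure_of W" unfolding W using q S openin_subset by blast
  ultimately have "\<exists>q'. q' \<in> W \<and> q' \<in> {q \<in> S. e1 q - e2 q \<in> - {0}}"
    unfolding in_closure_of by meson
  then obtain q' where "q' \<in> W" "q' \<in> S" "e1 q' \<noteq> e2 q'" by auto
  then show False using eq by blast
qed

text \<open>\<open>h\<close> may lie outside the atlas. Near each point \<open>f\<close> in the
  chart \<open>h\<close> is \<open>f\<close> in a chart \<open>a\<close> of the atlas after a smooth
  change of coordinates, and smoothness is local.\<close>

lemma smooth_transfer:
  assumes A: "smooth_atlas X A" and h: "is_chart X h" and hA: "\<And>a. a \<in> A \<Longrightarrow> smooth_on (overlap h a) (local_rep h (snd a))"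
    and S: "openin X S" "S \<subseteq> fst h" and f: "\<And>a. a \<in> A \<Longrightarrow> smooth_on (snd a ` (fst a \<inter> S)) (local_rep a f)"
  shows "smooth_on (snd h ` S) (local_rep h f)"
proof (rule smooth_on_local[OF chart_open_image[OF h S]])
  fix y assume "y \<in> snd h ` S"
  then obtain q where q: "q \<in> S" "y = snd h q" by blast
  have "q \<in> topspace X" using q S openin_subset by blast
  then obtain a where a: "a \<in> A" "q \<in> fst a" "is_chart X a" using A unfolding smooth_atlas_def by blast
  have o: "openin X (fst a \<inter> S)" using a(3) S by (auto simp: is_chart_def)
  let ?T = "snd h ` (fst a \<inter> S)"
  have oT: "open ?T" "open (snd a ` (fst a \<inter> S))" using chart_open_image[OF h o] chart_open_image[OF a(3) o] S by auto
  have "smooth_on ?T (\<lambda>w. local_rep a f (local_rep h (snd a) w))"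
  proof (rule smooth_on_compose[OF oT f[OF a(1)] smooth_on_subset[OF hA[OF a(1)]]])
    show "?T \<subseteq> overlap h a" using S by (auto simp: overlap_def)
    show "local_rep h (snd a) w \<in> snd a ` (fst a \<inter> S)" if "w \<in> ?T" for w
    proof -
      obtain q where "q \<in> fst a" "q \<in> S" "w = snd h q" using \<open>w \<in> ?T\<close> by blast
      then show ?thesis using local_rep_apply[OF h, of q "snd a"] S by auto
    qed
  qed
  then have "smooth_on ?T (local_rep h f)"
  proof (rule smooth_on_cong[OF oT(1), THEN iffD1, rotated])
    fix w assume "w \<in> ?T"
    then obtain q where "q \<in> fst a" "q \<in> S" "w = snd h q" by blast
    then show "local_rep a f (local_rep h (snd a) w) = local_rep h f w"
      using local_rep_apply[OF h] local_rep_apply[OF a(3)] S by (metis subsetD)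
  qed
  then show "\<exists>T. open T \<and> y \<in> T \<and> smooth_on T (local_rep h f)" using oT q a by blast
qed

lemma smooth_compatible_trans:
  assumes A: "smooth_atlas X A" and h: "is_chart X h" "\<And>a. a \<in> A \<Longrightarrow> smoothly_compatible h a"
    and k: "is_chart X k" "\<And>a. a \<in> A \<Longrightarrow> smoothly_compatible k a"
  shows "smoothly_compatible h k"
proof -
  have o: "openin X (fst h \<inter> fst k)" using h k by (auto simp: is_chart_def)
  have *: "smooth_on (overlap h k) (local_rep h (snd k))"
    if h: "is_chart X h" "\<And>a. a \<in> A \<Longrightarrow> smoothly_compatible h a" and k: "is_chart X k" "\<And>a. a \<in> A \<Longrightarrow> smoothly_compatible k a"
      and o: "openin X (fst h \<inter> fst k)" for h k
    unfolding overlap_def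
  proof (rule smooth_transfer[OF A h(1) _ o])
    show "smooth_on (overlap h a) (local_rep h (snd a))" if "a \<in> A" for a using h(2)[OF that] by (simp add: smoothly_compatible_def)
    show "smooth_on (snd a ` (fst a \<inter> (fst h \<inter> fst k))) (local_rep a (snd k))" if "a \<in> A" for a
      using k(2)[OF that] smooth_on_subset[of "overlap a k" _ "snd a ` (fst a \<inter> (fst h \<inter> fst k))"]
      by (auto simp: smoothly_compatible_def overlap_def)
  qed auto
  show ?thesis unfolding smoothly_compatible_def using *[OF h k o] *[OF k h] o by (simp add: Int_commute)
qed

section \<open>Coordinate changes, orientation and uniqueness of the normal\<close>

definition transition :: "'a chart \<Rightarrow> 'a chart \<Rightarrow> 'a \<Rightarrow> complex \<Rightarrow> complex"
  where "transition c d q = differential c (snd d) q"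

lemma smooth_transition:
  assumes "is_chart X c" "is_chart X d" "smoothly_compatible c d" "q \<in> fst c" "q \<in> fst d"
  shows "(local_rep c (snd d) has_derivative transition c d q) (at (snd c q))"
  unfolding transition_def differential_def
  by (rule smooth_on_has_derivative[OF open_overlap[OF assms(1,2)]])
    (use assms in \<open>auto simp: smoothly_compatible_def overlap_def\<close>)

lemma differential_change:
  fixes f :: "'a \<Rightarrow> 'b::real_normed_vector"
  assumes c: "is_chart X c" and d: "is_chart X d" and cd: "smoothly_compatible c d" and q: "q \<in> fst c" "q \<in> fst d"
    and f: "local_rep d f differentiable (at (snd d q))"
  shows "(local_rep c f has_derivative (\<lambda>v. differential d f q (transition c d q v))) (at (snd c q))"
    and "differential c f q v = differential d f q (transition c d q v)"
proof -
  have e: "local_rep c (snd d) (snd c q) = snd d q" using local_rep_apply[OF c q(1)] .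
  have "(local_rep d f has_derivative differential d f q) (at (local_rep c (snd d) (snd c q)))"
    using f unfolding e differential_def frechet_derivative_works .
  from has_derivative_compose[OF smooth_transition[OF c d cd q] this]
  show 1: "(local_rep c f has_derivative (\<lambda>v. differential d f q (transition c d q v))) (at (snd c q))"
  proof (rule has_derivative_transform_within_open[OF _ open_overlap[OF c d]])
    show "snd c q \<in> overlap c d" using q by (simp add: overlap_def)
    show "local_rep d f (local_rep c (snd d) w) = local_rep c f w" if "w \<in> overlap c d" for w
      using that by (auto simp: overlap_def local_rep_apply[OF c] local_rep_apply[OF d])
  qed
  show "differential c f q v = differential d f q (transition c d q v)"
    using frechet_derivative_at[OF 1] unfolding differential_def by metis
qed

lemma chart_self_derivative:
  assumes c: "is_chart X c" and q: "q \<in> fst c"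
  shows "(local_rep c (snd c) has_derivative (\<lambda>v. v)) (at (snd c q))" "differential c (snd c) q v = v"
proof -
  show 1: "(local_rep c (snd c) has_derivative (\<lambda>v. v)) (at (snd c q))"
  proof (rule has_derivative_transform_within_open[OF has_derivative_ident])
    show "open (snd c ` fst c)" using c by (simp add: is_chart_def)
    show "w = local_rep c (snd c) w" if "w \<in> snd c ` fst c" for w using that by (auto simp: local_rep_apply[OF c])
  qed (use q in auto)
  show "differential c (snd c) q v = v" using frechet_derivative_at[OF 1] unfolding differential_def by metis
qed

lemma transition_inverse:
  assumes c: "is_chart X c" and d: "is_chart X d" and cd: "smoothly_compatible c d" and q: "q \<in> fst c" "q \<in> fst d"
  shows "transition d c q (transition c d q v) = v"
proof -
  have "smoothly_compatible d c" using cd by (simp add: smoothly_compatible_def)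
  then have "local_rep d (snd c) differentiable (at (snd d q))"
    using smooth_transition[OF d c _ q(2,1)] differentiable_def by blast
  from differential_change(2)[OF c d cd q this, of v] show ?thesis
    using chart_self_derivative(2)[OF c q(1)] by (simp add: transition_def)
qed

lemma transition_compose:
  assumes c: "is_chart X c" and d: "is_chart X d" and e: "is_chart X e"
    and "smoothly_compatible c d" "smoothly_compatible d e" and q: "q \<in> fst c" "q \<in> fst d" "q \<in> fst e"
  shows "transition c e q v = transition d e q (transition c d q v)"
proof -
  have "local_rep d (snd e) differentiable (at (snd d q))"
    using smooth_transition[OF d e assms(5) q(2,3)] differentiable_def by blast
  from differential_change(2)[OF c d assms(4) q(1,2) this, of v] show ?thesis by (simp add: transition_def)
qed

definition det2 :: "(complex \<Rightarrow> complex) \<Rightarrow> real"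
  where "det2 L = cross2 (L 1) (L \<i>)"

lemma cross2_linear: "linear L \<Longrightarrow> cross2 (L u) (L v) = det2 L * cross2 u v"
  by (subst complex_linear_expand[of L u], assumption, subst complex_linear_expand[of L v], assumption)
    (simp add: det2_def cross2_def algebra_simps)

lemma jacobian_transition: "jacobian (local_rep c (snd d)) (snd c q) = det2 (transition c d q)"
  by (simp add: jacobian_cross2 det2_def transition_def differential_def)

lemma transition_linear:
  assumes "is_chart X c" "is_chart X d" "smoothly_compatible c d" "q \<in> fst c" "q \<in> fst d"
  shows "linear (transition c d q)"
  using smooth_transition[OF assms] has_derivative_linear by blast

lemma det2_compose:
  assumes "linear L" "linear K" "\<And>v. M v = L (K v)"
  shows "det2 M = det2 L * det2 K"
proof -
  have "det2 M = cross2 (L (K 1)) (L (K \<i>))" by (simp add: det2_def assms(3))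
  also have "\<dots> = det2 L * cross2 (K 1) (K \<i>)" by (rule cross2_linear[OF assms(1)])
  finally show ?thesis by (simp add: det2_def)
qed

lemma det2_transition_inverse:
  assumes c: "is_chart X c" and d: "is_chart X d" and cd: "smoothly_compatible c d" and q: "q \<in> fst c" "q \<in> fst d"
  shows "det2 (transition d c q) * det2 (transition c d q) = 1"
proof -
  have dc: "smoothly_compatible d c" using cd by (simp add: smoothly_compatible_def)
  have "det2 (\<lambda>v. v) = det2 (transition d c q) * det2 (transition c d q)"
    by (rule det2_compose[OF transition_linear[OF d c dc q(2,1)] transition_linear[OF c d cd q]])
      (simp add: transition_inverse[OF c d cd q])
  then show ?thesis by (simp add: det2_def cross2_def)
qed

text \<open>A vector with vanishing components 1 and 2 has non-positive Lorentz square, so a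
  spacelike plane projects bijectively onto the horizontal plane. The difference of the two normals
  is horizontal and orthogonal to the whole spacelike plane, in particular to the vector of it that
  lies over a multiple of this difference.\<close>

lemma causal_normal_unique:
  fixes L :: "complex \<Rightarrow> real^3" and n n' :: "real^3"
  assumes L: "linear L" and pos: "\<And>v. v \<noteq> 0 \<Longrightarrow> lorentz (L v) (L v) > 0"
    and n: "n $ 0 = 1" "\<And>v. lorentz n (L v) = 0" and n': "n' $ 0 = 1" "\<And>v. lorentz n' (L v) = 0"
  shows "n = n'"
proof -
  have Le: "L v $ i = Re v * L 1 $ i + Im v * L \<i> $ i" for v i
    by (subst complex_linear_expand[OF L]) simp
  define d where "d = n - n'"
  have d0: "d $ 0 = 0" by (simp add: d_def n n')
  have dL: "lorentz d (L v) = 0" for v by (simp add: d_def lorentz_simps n n')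
  define a1 a2 b1 b2 where "a1 = L 1 $ 1" and "a2 = L 1 $ 2" and "b1 = L \<i> $ 1" and "b2 = L \<i> $ 2"
  have vert: "v = 0" if "L v $ 1 = 0" "L v $ 2 = 0" for v
  proof (rule ccontr)
    assume "v \<noteq> 0"
    from pos[OF this] that show False by (simp add: lorentz_def not_less flip: power2_eq_square)
  qed
  have Lc: "L (Complex s t) $ 1 = s * a1 + t * b1" "L (Complex s t) $ 2 = s * a2 + t * b2" for s t
    using Le[of "Complex s t" 1] Le[of "Complex s t" 2] by (simp_all only: complex.sel a1_def a2_def b1_def b2_def)
  have "a1 * b2 - a2 * b1 \<noteq> 0"
  proof
    assume k: "a1 * b2 - a2 * b1 = 0"
    have "Complex b1 (- a1) = 0"
      by (rule vert) (use k in \<open>simp_all add: Lc algebra_simps\<close>)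
    moreover have "Complex b2 (- a2) = 0"
      by (rule vert) (use k in \<open>simp_all add: Lc algebra_simps\<close>)
    ultimately have "a1 = 0" "a2 = 0" by (auto simp: complex_eq_iff)
    then have "(1::complex) = 0" by (intro vert) (auto simp: a1_def a2_def)
    then show False by simp
  qed
  moreover have "(a1 * b2 - a2 * b1) * ((d $ 1)\<^sup>2 + (d $ 2)\<^sup>2) = 0"
  proof -
    \<comment> \<open>By Cramer's rule \<open>L ?v\<close> projects to the multiple of
      \<open>d\<close> by the determinant of the projection.\<close>
    let ?v = "Complex (b2 * d $ 1 - b1 * d $ 2) (a1 * d $ 2 - a2 * d $ 1)"
    have l: "L ?v $ 1 = (a1 * b2 - a2 * b1) * d $ 1" "L ?v $ 2 = (a1 * b2 - a2 * b1) * d $ 2"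
      unfolding Lc by (simp_all add: algebra_simps)
    have "d $ 1 * L ?v $ 1 + d $ 2 * L ?v $ 2 = 0" using dL[of ?v] by (simp add: lorentz_def d0)
    then show ?thesis unfolding l by (simp add: algebra_simps power2_eq_square)
  qed
  ultimately have "d $ 1 = 0 \<and> d $ 2 = 0" by (simp add: sum_power2_eq_zero_iff)
  then have "\<forall>i. d $ i = 0" unfolding forall_3_012 using d0 by blast
  then show ?thesis by (simp add: d_def vec_eq_iff)
qed

text \<open>Conformality makes \<open>T 1\<close> and \<open>T \<i>\<close> orthogonal and equally
  long, and positive orientation selects one of the two rotations by a right angle. In the
  computation, the squared distance of \<open>T \<i>\<close> from \<open>\<i> * T 1\<close> comes
  out as 0.\<close>

lemma conformal_linear_complex:
  assumes "\<And>v v'. \<rho> * (v \<bullet> v') = \<sigma> * (T v \<bullet> T v')" "\<rho> > 0" "cross2 (T 1) (T \<i>) > 0"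
  shows "T \<i> = \<i> * T 1"
proof -
  let ?a = "T 1" and ?b = "T \<i>"
  have \<sigma>: "\<sigma> \<noteq> 0" using assms(1)[of 1 1] assms(2) by auto
  have "\<sigma> * (?a \<bullet> ?a) = \<sigma> * (?b \<bullet> ?b)" "\<sigma> * (?a \<bullet> ?b) = 0"
    using assms(1)[of 1 1] assms(1)[of \<i> \<i>] assms(1)[of 1 \<i>] by (simp_all add: inner_complex_def)
  then have e: "(Re ?a)\<^sup>2 + (Im ?a)\<^sup>2 = (Re ?b)\<^sup>2 + (Im ?b)\<^sup>2" "Re ?a * Re ?b + Im ?a * Im ?b = 0"
    using \<sigma> by (simp_all add: inner_complex_def power2_eq_square)
  define k where "k = Re ?a * Im ?b - Im ?a * Re ?b"
  have k: "k > 0" using assms(3) by (simp add: k_def cross2_def)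
  have n: "k\<^sup>2 = ((Re ?a)\<^sup>2 + (Im ?a)\<^sup>2)\<^sup>2"
  proof -
    have "k\<^sup>2 + (Re ?a * Re ?b + Im ?a * Im ?b)\<^sup>2 = ((Re ?a)\<^sup>2 + (Im ?a)\<^sup>2) * ((Re ?b)\<^sup>2 + (Im ?b)\<^sup>2)"
      unfolding k_def by (simp add: power2_eq_square algebra_simps)
    then show ?thesis using e by (simp add: power2_eq_square)
  qed
  then have n': "k = (Re ?a)\<^sup>2 + (Im ?a)\<^sup>2" using k by (simp add: power2_eq_iff_nonneg)
  have "(Re ?b + Im ?a)\<^sup>2 + (Im ?b - Re ?a)\<^sup>2 = ((Re ?a)\<^sup>2 + (Im ?a)\<^sup>2) + ((Re ?b)\<^sup>2 + (Im ?b)\<^sup>2) - 2 * k"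
    unfolding k_def by (simp add: power2_eq_square algebra_simps)
  then have "(Re ?b + Im ?a)\<^sup>2 + (Im ?b - Re ?a)\<^sup>2 = 0" using e n' by simp
  then have "Re ?b + Im ?a = 0 \<and> Im ?b - Re ?a = 0" by (simp only: sum_power2_eq_zero_iff)
  then show ?thesis by (auto simp: complex_eq_iff)
qed

lemma real_analytic_on_cong:
  assumes S: "open S" and eq: "\<And>z. z \<in> S \<Longrightarrow> F z = G z" and F: "real_analytic_on S F"
  shows "real_analytic_on S G"
  unfolding real_analytic_on_def
proof
  fix z0 assume z0: "z0 \<in> S"
  with F have "\<exists>r>0. \<exists>a. \<forall>z\<in>ball z0 r. ((\<lambda>(m, n). (Re (z - z0) ^ m * Im (z - z0) ^ n) *\<^sub>R a m n) has_sum F z) UNIV"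
    unfolding real_analytic_on_def by (rule bspec)
  then obtain r a where r: "r > 0" "\<And>z. z \<in> ball z0 r \<Longrightarrow> ((\<lambda>(m, n). (Re (z - z0) ^ m * Im (z - z0) ^ n) *\<^sub>R a m n) has_sum F z) UNIV" by blast
  obtain t where t: "t > 0" "ball z0 t \<subseteq> S" using S z0 open_contains_ball by blast
  have *: "((\<lambda>(m, n). (Re (z - z0) ^ m * Im (z - z0) ^ n) *\<^sub>R a m n) has_sum G z) UNIV" if "z \<in> ball z0 (min r t)" for z
  proof -
    have "z \<in> ball z0 r" "z \<in> S" using that t by auto
    then show ?thesis using r(2)[of z] eq[of z] by simp
  qed
  show "\<exists>r>0. \<exists>a. \<forall>z\<in>ball z0 r. ((\<lambda>(m, n). (Re (z - z0) ^ m * Im (z - z0) ^ n) *\<^sub>R a m n) has_sum G z) UNIV"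
    by (rule exI[of _ "min r t"], rule conjI, use r(1) t(1) in simp, rule exI[of _ a], rule ballI, erule *)
qed

lemma smooth_open_image:
  fixes Z :: "complex \<Rightarrow> complex"
  assumes "open S" "smooth_on S Z" "inj_on Z S" "T \<subseteq> S" "open T"
  shows "open (Z ` T)"
  using assms by (intro invariance_of_domain smooth_on_continuous smooth_on_subset[OF assms(2)] inj_on_subset[OF assms(3)])

lemma cross2_cnj: "cross2 (cnj a) (cnj b) = - cross2 a b"
  by (simp add: cross2_def)

lemma inner_cnj: "cnj a \<bullet> cnj b = a \<bullet> b"
  by (simp add: inner_complex_def)

text \<open>Holomorphic coordinate changes require equally oriented charts, so the sign of the
  Jacobian is prescribed. If it comes out wrong, \<open>z\<close> is conjugated, which affects
  neither conformality nor real analyticity.\<close>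

lemma conformal_coordinate_signed:
  fixes f :: "complex \<Rightarrow> real^3" and U :: "complex set" and \<epsilon> :: real
  assumes U: "open U" "p \<in> U" and f: "smooth_on U f" and V: "open V" "U \<subseteq> closure V"
    and g: "C1_metric_on U g"
    and fg: "\<forall>w\<in>U \<inter> V. conformal_pullback g \<beta> f w"
    and H: "\<forall>w\<in>U \<inter> V. mean_curvature_free f w"
    and nz: "fderiv f p v0 \<noteq> 0" and \<epsilon>: "\<epsilon> = 1 \<or> \<epsilon> = -1"
  obtains r and Z :: "complex \<Rightarrow> complex" and \<eta> :: "complex \<Rightarrow> real^3" where "r > 0" "ball p r \<subseteq> U" "inj_on Z (ball p r)" "smooth_on (ball p r) Z"
    "\<And>w. w \<in> ball p r \<Longrightarrow> \<epsilon> * jacobian Z w > 0" "smooth_on (ball p r) \<eta>" "\<And>w. w \<in> ball p r \<Longrightarrow> \<eta> w $ 0 = 1"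
    "\<And>w v. w \<in> ball p r \<Longrightarrow> lorentz (\<eta> w) (fderiv f w v) = 0"
    "real_analytic_on (Z ` ball p r) (\<eta> \<circ> inv_into (ball p r) Z)"
    "\<And>w. w \<in> ball p r \<inter> V \<Longrightarrow> \<exists>\<rho>>0. \<forall>v v'. lorentz (fderiv f w v) (fderiv f w v') =
        \<rho> * (fderiv Z w v \<bullet> fderiv Z w v')"
proof (rule conformal_coordinate_at[OF U f V g fg H nz])
  fix r and z :: "complex \<Rightarrow> complex" and \<eta> :: "complex \<Rightarrow> real^3"
  let ?B = "ball p r"
  assume *: "r > 0" "?B \<subseteq> U" "inj_on z ?B" "smooth_on ?B z" "\<And>w. w \<in> ?B \<Longrightarrow> jacobian z w > 0" "smooth_on ?B \<eta>" "\<And>w. w \<in> ?B \<Longrightarrow> \<eta> w $ 0 = 1"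
    "\<And>w v. w \<in> ?B \<Longrightarrow> lorentz (\<eta> w) (fderiv f w v) = 0"
    "real_analytic_on (z ` ?B) (\<eta> \<circ> inv_into ?B z)"
    "\<And>w. w \<in> ?B \<inter> V \<Longrightarrow> \<exists>\<rho>>0. \<forall>v v'. lorentz (fderiv f w v) (fderiv f w v') =
        \<rho> * (fderiv z w v \<bullet> fderiv z w v')"
  show thesis
  proof (cases "\<epsilon> = 1")
    case True
    show thesis by (rule that[OF *(1,2,3,4) _ *(6,7,8,9,10)]) (use *(5) True in auto)
  next
    case False
    then have \<epsilon>: "\<epsilon> = -1" using \<epsilon> by simp
    define Z where "Z = (\<lambda>w. cnj (z w))"
    have fr: "fderiv Z w v = cnj (fderiv z w v)" if "w \<in> ?B" for w v
      using frechet_derivative_at[OF bounded_linear.has_derivative[OF bounded_linear_cnj smooth_on_has_derivative[OF open_ball *(4) that]]]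
      unfolding Z_def by metis
    have inj: "inj_on Z ?B" using *(3) by (auto simp: Z_def inj_on_def)
    have sZ: "smooth_on ?B Z" unfolding Z_def by (intro smooth_on_cnj open_ball *(4))
    have im: "Z ` ?B = cnj ` (z ` ?B)" by (simp add: Z_def image_image)
    show thesis
    proof (rule that[OF *(1,2) inj sZ _ *(6,7,8)])
      show "\<epsilon> * jacobian Z w > 0" if "w \<in> ?B" for w
        using *(5)[OF that] fr[OF that] \<epsilon> by (simp add: jacobian_cross2 cross2_cnj)
      show "real_analytic_on (Z ` ?B) (\<eta> \<circ> inv_into ?B Z)"
      proof (rule real_analytic_on_cong[OF smooth_open_image[OF open_ball sZ inj order_refl open_ball]])
        show "real_analytic_on (Z ` ?B) (\<lambda>y. (\<eta> \<circ> inv_into ?B z) (cnj y))"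
          unfolding im by (rule real_analytic_on_cnj[OF *(9)])
        show "(\<eta> \<circ> inv_into ?B z) (cnj y) = (\<eta> \<circ> inv_into ?B Z) y" if y: "y \<in> Z ` ?B" for y
        proof -
          obtain w where w: "w \<in> ?B" "y = Z w" using y by blast
          have "inv_into ?B Z y = w" "inv_into ?B z (cnj y) = w"
            using inv_into_f_f[OF inj w(1)] inv_into_f_f[OF *(3) w(1)] w(2) by (simp_all add: Z_def)
          then show ?thesis by simp
        qed
      qed
      show "\<exists>\<rho>>0. \<forall>v v'. lorentz (fderiv f w v) (fderiv f w v') =
        \<rho> * (fderiv Z w v \<bullet> fderiv Z w v')" if "w \<in> ?B \<inter> V" for w
        using *(10)[OF that] that by (simp add: fr inner_cnj)
    qed
  qed
qed

section \<open>Oriented conformal charts of a maxface\<close>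

lemma is_chartI:
  assumes N: "openin X N" and inj: "inj_on \<phi> N" and cont: "continuous_map (subtopology X N) euclidean \<phi>"
    and op: "\<And>S. openin X S \<Longrightarrow> S \<subseteq> N \<Longrightarrow> open (\<phi> ` S)"
  shows "is_chart X (N, \<phi>)"
proof -
  have top: "topspace (subtopology X N) = N" using openin_subset[OF N] by auto
  have "homeomorphic_map (subtopology X N) (top_of_set (\<phi> ` N)) \<phi>"
  proof (rule bijective_open_imp_homeomorphic_map)
    show "continuous_map (subtopology X N) (top_of_set (\<phi> ` N)) \<phi>"
      using cont top by (simp add: continuous_map_in_subtopology)
    show "open_map (subtopology X N) (top_of_set (\<phi> ` N)) \<phi>"
      unfolding open_map_def
    proof (intro allI impI)
      fix S assume S: "openin (subtopology X N) S"
      then have "openin X S" "S \<subseteq> N" using openin_trans_full[OF S N] openin_subset[OF S] top by auto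
      then have "open (\<phi> ` S)" "\<phi> ` S \<subseteq> \<phi> ` N" using op by blast+
      then show "openin (top_of_set (\<phi> ` N)) (\<phi> ` S)" by (meson open_openin openin_open_eq openin_subset_trans open_subset)
    qed
    show "\<phi> ` topspace (subtopology X N) = topspace (top_of_set (\<phi> ` N))" "inj_on \<phi> (topspace (subtopology X N))"
      using top inj by simp_all
  qed
  then show ?thesis using N op[OF N order_refl] by (simp add: is_chart_def)
qed

lemma smooth_map_differentiable:
  assumes "smooth_map A f" "c \<in> A" "is_chart X c" "q \<in> fst c"
  shows "local_rep c f differentiable (at (snd c q))"
    "(local_rep c f has_derivative differential c f q) (at (snd c q))"
proof -
  show 1: "(local_rep c f has_derivative differential c f q) (at (snd c q))"
    unfolding differential_def
    by (rule smooth_on_has_derivative[of "snd c ` fst c"]) (use assms in \<open>auto simp: smooth_map_def is_chart_def\<close>)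
  then show "local_rep c f differentiable (at (snd c q))" using differentiable_def by blast
qed

lemma positive_semidefinite_nondegenerate:
  fixes E F G :: real
  assumes psd: "\<And>s t. s\<^sup>2 * E + 2 * s * t * F + t\<^sup>2 * G \<ge> 0" and nd: "E * G - F\<^sup>2 \<noteq> 0"
  shows "E > 0" "E * G - F\<^sup>2 > 0"
proof -
  have E0: "E \<ge> 0" and G0: "G \<ge> 0" using psd[of 1 0] psd[of 0 1] by simp_all
  have "E \<noteq> 0"
  proof
    assume "E = 0"
    then have "F \<noteq> 0" using nd by auto
    \<comment> \<open>At this vector a form with \<open>E = 0\<close> takes the value -1.\<close>
    have "(-(G + 1) / (2 * F))\<^sup>2 * E + 2 * (-(G + 1) / (2 * F)) * 1 * F + 1\<^sup>2 * G \<ge> 0" by (rule psd)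
    then show False using \<open>E = 0\<close> \<open>F \<noteq> 0\<close> by (simp add: field_simps)
  qed
  then show E: "E > 0" using E0 by simp
  have "(-F)\<^sup>2 * E + 2 * (-F) * E * F + E\<^sup>2 * G \<ge> 0" by (rule psd)
  then have "E * (E * G - F\<^sup>2) \<ge> 0" by (simp add: power2_eq_square algebra_simps)
  then have "E * G - F\<^sup>2 \<ge> 0" using E by (simp add: zero_le_mult_iff)
  then show "E * G - F\<^sup>2 > 0" using nd by simp
qed

lemma bilinear_complex_expand:
  fixes b :: "complex \<Rightarrow> complex \<Rightarrow> real"
  assumes b: "bilinear b"
  shows "b v v' = Re v * (Re v' * b 1 1 + Im v' * b 1 \<i>) + Im v * (Re v' * b \<i> 1 + Im v' * b \<i> \<i>)"
proof -
  have e: "b (s *\<^sub>R 1 + t *\<^sub>R \<i>) (s' *\<^sub>R 1 + t' *\<^sub>R \<i>) = s * (s' * b 1 1 + t' * b 1 \<i>) + t * (s' * b \<i> 1 + t' * b \<i> \<i>)" for s t s' t'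
    by (simp only: bilinear_ladd[OF b] bilinear_radd[OF b] bilinear_lmul[OF b] bilinear_rmul[OF b])
      (simp add: algebra_simps)
  have v: "Re v *\<^sub>R 1 + Im v *\<^sub>R \<i> = v" for v by (simp add: complex_eq_iff)
  show ?thesis using e[of "Re v" "Im v" "Re v'" "Im v'"] unfolding v .
qed

text \<open>At a regular point the first fundamental form itself is the required metric, also outside \<open>W\<close>.\<close>

lemma local_conformal_metric:
  fixes f :: "'a \<Rightarrow> real^3"
  assumes A: "smooth_atlas X A" and reg: "maxface_regular_on X A W f" and p: "p \<in> topspace X"
  shows "\<exists>c\<in>A. \<exists>S \<beta> g. openin X S \<and> p \<in> S \<and> S \<subseteq> fst c \<and> C1_metric_on (snd c ` S) g \<and>
     (\<forall>q\<in>S \<inter> W. \<beta> q > (0::real) \<and> (\<forall>v v'. g (snd c q) v v' = \<beta> q * first_form c f q v v')) \<and>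
     (\<exists>v. differential c f p v \<noteq> 0)"
proof -
  have f: "smooth_map A f" and W: "openin X W" "X closure_of W = topspace X" and imm: "spacelike_immersion_on A W f"
    and adm: "\<And>p. p \<in> topspace X \<Longrightarrow> singular_point A f p \<Longrightarrow> admissible_point X A W f p"
    using reg by (auto simp: maxface_regular_on_def)
  have ch: "is_chart X c" if "c \<in> A" for c using A that by (simp add: smooth_atlas_def)
  have comp: "smoothly_compatible c d" if "c \<in> A" "d \<in> A" for c d using A that by (simp add: smooth_atlas_def)
  show ?thesis
  proof (cases "singular_point A f p")
    case True
    then obtain c S \<beta> g c' v where c: "c \<in> A" "openin X S" "p \<in> S" "S \<subseteq> fst c" "\<forall>q\<in>S \<inter> W. \<beta> q > (0::real)"
      "C1_metric_on (snd c ` S) g" "\<forall>q\<in>S \<inter> W. \<forall>v w. g (snd c q) v w = \<beta> q * first_form c f q v w"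
      and c': "c' \<in> A" "p \<in> fst c'" "differential c' f p v \<noteq> 0"
      using adm[OF p True] unfolding admissible_point_def by blast
    have pc: "p \<in> fst c" using c by blast
    \<comment> \<open>Admissibility may provide the extended metric and the non-zero differential in
      two different charts; the latter is carried over to \<open>c\<close>.\<close>
    have "differential c f p (transition c' c p v) \<noteq> 0"
      using differential_change(2)[OF ch[OF c'(1)] ch[OF c(1)] comp[OF c'(1) c(1)] c'(2) pc smooth_map_differentiable(1)[OF f c(1) ch[OF c(1)] pc], of v] c'(3) by simp
    then show ?thesis using c by (intro bexI[of _ c] exI[of _ S] exI[of _ \<beta>] exI[of _ g]) blast+
  next
    case False
    obtain c where c: "c \<in> A" "p \<in> fst c" using p A unfolding smooth_atlas_def by blast
    let ?F = "local_rep c f" and ?\<Omega> = "snd c ` fst c"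
    have \<Omega>: "open ?\<Omega>" using ch[OF c(1)] by (simp add: is_chart_def)
    have sF: "smooth_on ?\<Omega> ?F" using f c by (simp add: smooth_map_def)
    let ?D = "\<lambda>w. fderiv ?F w"
    have dF: "(?F has_derivative ?D w) (at w)" if "w \<in> ?\<Omega>" for w by (rule smooth_on_has_derivative[OF \<Omega> sF that])
    define G where "G = (\<lambda>w v v'. lorentz (?D w v) (?D w v'))"
    have ff: "first_form c f q v v' = G (snd c q) v v'" for q v v' by (simp add: first_form_def differential_def G_def)
    have sG: "smooth_on ?\<Omega> (\<lambda>w. G w v v')" for v v'
      unfolding G_def smooth_on_def
      by (intro allI bounded_bilinear.Ck_on_prod[OF bounded_bilinear_lorentz \<Omega>] smooth_onD smooth_on_frechet sF)
    have bil: "bilinear (G w)" if "w \<in> ?\<Omega>" for w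
      unfolding bilinear_def G_def
      by (intro conjI allI linearI) (simp_all add: linear_add[OF has_derivative_linear[OF dF[OF that]]]
          linear_cmul[OF has_derivative_linear[OF dF[OF that]]] lorentz_simps)
    have sym: "G w v v' = G w v' v" for w v v' by (simp add: G_def lorentz_commute)
    have expand: "G w v v = (Re v)\<^sup>2 * G w 1 1 + 2 * Re v * Im v * G w 1 \<i> + (Im v)\<^sup>2 * G w \<i> \<i>" if "w \<in> ?\<Omega>" for w v
      unfolding bilinear_complex_expand[OF bil[OF that], of v v] sym[of w \<i> 1] by (simp add: algebra_simps power2_eq_square)
    let ?det = "\<lambda>w. G w 1 1 * G w \<i> \<i> - (G w 1 \<i>)\<^sup>2"
    let ?w = "snd c p"
    have w: "?w \<in> ?\<Omega>" using c by blast
    \<comment> \<open>\<open>p\<close> may lie outside \<open>W\<close>; semidefiniteness reaches it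
      from the dense set \<open>W\<close> by continuity.\<close>
    have "s\<^sup>2 * G ?w 1 1 + 2 * s * t * G ?w 1 \<i> + t\<^sup>2 * G ?w \<i> \<i> \<ge> 0" for s t
    proof (rule ccontr)
      assume neg: "\<not> ?thesis"
      let ?v = "Complex s t"
      have "G ?w ?v ?v < 0" using neg expand[OF w, of ?v] by simp
      define T where "T = ?\<Omega> \<inter> (\<lambda>w. G w ?v ?v) -` {..<0}"
      have "open T"
        unfolding T_def by (rule continuous_open_preimage[OF smooth_on_continuous[OF sG] \<Omega>]) simp
      moreover have "?w \<in> closure (snd c ` (fst c \<inter> W))"
        using chart_image_dense[OF ch[OF c(1)] W(2), of "fst c"] c ch[OF c(1)] by (auto simp: is_chart_def)
      moreover have "?w \<in> T" using \<open>G ?w ?v ?v < 0\<close> w by (simp add: T_def)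
      ultimately have "T \<inter> snd c ` (fst c \<inter> W) \<noteq> {}"
        using open_Int_closure_eq_empty[of T "snd c ` (fst c \<inter> W)"] by fast
      then obtain q where q: "q \<in> fst c" "q \<in> W" "G (snd c q) ?v ?v < 0" by (auto simp: T_def)
      have "?v \<noteq> 0"
      proof
        assume "?v = 0"
        then have "G (snd c q) ?v ?v = 0" using expand[of "snd c q" 0] q by simp
        then show False using q by simp
      qed
      with imm[unfolded spacelike_immersion_on_def, rule_format, OF c(1) IntI[OF q(1,2)], of ?v]
      have "G (snd c q) ?v ?v > 0" unfolding ff by simp
      then show False using q by simp
    qed
    \<comment> \<open>A degenerate form would have a kernel vector, either 1 or the vector
      \<open>?v\<close> below, and \<open>p\<close> would be singular.\<close>
    moreover have "?det ?w \<noteq> 0"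
    proof
      assume d: "?det ?w = 0"
      have deg: "\<exists>v'. G ?w v v' \<noteq> 0" if "v \<noteq> 0" for v
      proof (rule ccontr)
        assume "\<not> ?thesis"
        then have "singular_point A f p"
          unfolding singular_point_def by (intro bexI[of _ c] conjI exI[of _ v]) (use c that ff in simp_all)
        then show False using False by simp
      qed
      have bw: "G ?w v v' = Re v * (Re v' * G ?w 1 1 + Im v' * G ?w 1 \<i>) + Im v * (Re v' * G ?w 1 \<i> + Im v' * G ?w \<i> \<i>)" for v v'
        unfolding bilinear_complex_expand[OF bil[OF w], of v v'] sym[of ?w \<i> 1] ..
      show False
      proof (cases "G ?w 1 1 = 0 \<and> G ?w 1 \<i> = 0")
        case True
        have "G ?w 1 v' = 0" for v' by (subst bw) (simp add: True)
        then show False using deg[of 1] by simp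
      next
        case False
        let ?v = "Complex (- G ?w 1 \<i>) (G ?w 1 1)"
        have "?v \<noteq> 0" using False by (auto simp: complex_eq_iff)
        moreover have "\<forall>v'. G ?w ?v v' = 0"
        proof
          fix v'
          have "G ?w ?v v' = Im v' * ?det ?w" unfolding bw[of ?v v'] by (simp add: algebra_simps power2_eq_square)
          then show "G ?w ?v v' = 0" using d by simp
        qed
        ultimately show False using deg by blast
      qed
    qed
    ultimately have pp: "G ?w 1 1 > 0" "?det ?w > 0" using positive_semidefinite_nondegenerate by blast+
    define T where "T = (?\<Omega> \<inter> (\<lambda>w. G w 1 1) -` {0<..}) \<inter> (?\<Omega> \<inter> ?det -` {0<..})"
    have T: "open T"
    proof -
      have "open (?\<Omega> \<inter> (\<lambda>w. G w 1 1) -` {0<..})"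
        by (rule continuous_open_preimage[OF smooth_on_continuous[OF sG] \<Omega>]) simp
      moreover have "continuous_on ?\<Omega> ?det" by (intro continuous_intros smooth_on_continuous[OF sG])
      from continuous_open_preimage[OF this \<Omega>, of "{0<..}"] have "open (?\<Omega> \<inter> ?det -` {0<..})" by simp
      ultimately show ?thesis unfolding T_def by (rule open_Int)
    qed
    have wT: "?w \<in> T" using pp w by (simp add: T_def)
    define S where "S = {q \<in> fst c. snd c q \<in> T}"
    have S: "openin X S" "p \<in> S" "S \<subseteq> fst c" using chart_open_preimage[OF ch[OF c(1)] T] wT c by (auto simp: S_def)
    have ST: "snd c ` S \<subseteq> T" by (auto simp: S_def)
    have "C1_metric_on (snd c ` S) G"
      unfolding C1_metric_on_def
    proof (intro conjI ballI allI impI)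
      fix y assume y: "y \<in> snd c ` S"
      then have yT: "y \<in> ?\<Omega>" "G y 1 1 > 0" "?det y > 0" using ST by (auto simp: T_def)
      show "bilinear (G y)" by (rule bil[OF yT(1)])
      show "G y v v' = G y v' v" for v v' by (rule sym)
      fix v :: complex assume v: "v \<noteq> 0"
      \<comment> \<open>Completing the square.\<close>
      have "G y 1 1 * G y v v = (Re v * G y 1 1 + Im v * G y 1 \<i>)\<^sup>2 + (Im v)\<^sup>2 * ?det y"
        unfolding expand[OF yT(1), of v] by (simp add: power2_eq_square algebra_simps)
      also have "\<dots> > 0"
      proof (cases "Im v = 0")
        case True
        then have "Re v \<noteq> 0" using v by (simp add: complex_eq_iff)
        then show ?thesis using True yT(2) by simp
      next
        case False
        then show ?thesis using yT(3) by (intro add_nonneg_pos mult_pos_pos) auto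
      qed
      finally show "G y v v > 0" using yT(2) by (simp add: zero_less_mult_iff)
    next
      show "Ck_on 1 (snd c ` S) (\<lambda>w. G w v v')" for v v'
      proof (rule smooth_onD[OF smooth_on_subset[OF sG]])
        show "snd c ` S \<subseteq> ?\<Omega>" using S(3) by blast
      qed
    qed
    moreover have "differential c f p 1 \<noteq> 0"
    proof
      assume "differential c f p 1 = 0"
      then have "G ?w 1 1 = 0" by (simp add: G_def differential_def lorentz_def)
      then show False using pp by simp
    qed
    ultimately show ?thesis
      using c S ff by (intro bexI[of _ c] exI[of _ S] exI[of _ "\<lambda>_. 1"] exI[of _ G]) auto
  qed
qed

lemma C1_metric_on_subset: "C1_metric_on D g \<Longrightarrow> S \<subseteq> D \<Longrightarrow> C1_metric_on S g"
  unfolding C1_metric_on_def using Ck_on_subset[of 1 D _ S] by (meson subsetD)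

lemma smoothly_compatible_sym: "smoothly_compatible c d \<Longrightarrow> smoothly_compatible d c"
  by (simp add: smoothly_compatible_def)

lemma continuous_on_jacobian:
  assumes "smooth_on S F"
  shows "continuous_on S (jacobian F)"
  unfolding jacobian_cross2[abs_def] cross2_def
  by (intro continuous_intros smooth_on_continuous smooth_on_frechet assms)

lemma chart_ball:
  assumes c: "is_chart X c" and S: "S \<subseteq> snd c ` fst c" "open S"
    and Z: "smooth_on S Z" "inj_on Z S"
  defines "h \<equiv> ({q \<in> fst c. snd c q \<in> S}, \<lambda>q. Z (snd c q))"
  shows "is_chart X h" "snd h ` fst h = Z ` S"
proof -
  let ?N = "{q \<in> fst c. snd c q \<in> S}"
  have N: "openin X ?N" by (rule chart_open_preimage[OF c S(2)])
  have im: "snd c ` ?N = S" using S(1) by auto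
  show "snd h ` fst h = Z ` S" unfolding h_def fst_conv snd_conv using im by (metis image_image)
  show "is_chart X h"
    unfolding h_def
  proof (rule is_chartI[OF N])
    show "inj_on (\<lambda>q. Z (snd c q)) ?N"
    proof (rule inj_onI)
      fix x y assume xy: "x \<in> ?N" "y \<in> ?N" "Z (snd c x) = Z (snd c y)"
      then have "snd c x = snd c y" using inj_onD[OF Z(2)] by simp
      then show "x = y" using inj_onD[OF is_chart_inj[OF c]] xy by simp
    qed
    have "continuous_map (subtopology X ?N) euclidean (snd c)"
      by (rule continuous_map_from_subtopology_mono[OF chart_continuous_map[OF c]]) auto
    then have "continuous_map (subtopology X ?N) (top_of_set S) (snd c)"
      by (rule continuous_map_into_subtopology) auto
    moreover have "continuous_map (top_of_set S) euclidean Z" using smooth_on_continuous[OF Z(1)] by simp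
    ultimately show "continuous_map (subtopology X ?N) euclidean (\<lambda>q. Z (snd c q))"
      using continuous_map_compose[of _ _ "snd c" _ Z] by (simp add: comp_def)
    fix T assume T: "openin X T" "T \<subseteq> ?N"
    have "open (snd c ` T)" by (rule chart_open_image[OF c T(1)]) (use T(2) in auto)
    moreover have "snd c ` T \<subseteq> S" using T(2) by auto
    ultimately have "open (Z ` snd c ` T)" using smooth_open_image[OF S(2) Z] by blast
    then show "open ((\<lambda>q. Z (snd c q)) ` T)" by (simp add: image_image)
  qed
qed

text \<open>\<open>B\<close> stands for an oriented atlas, with respect to which \<open>h\<close> is
  positively oriented. The normal field is carried as a function \<open>e\<close> of the coordinate,
  because its analyticity refers to \<open>h\<close>.\<close>

definition normal_chart ::
    "'a topology \<Rightarrow> 'a chart set \<Rightarrow> 'a chart set \<Rightarrow> 'a set \<Rightarrow> ('a \<Rightarrow> real^3) \<Rightarrow> 'a chart \<Rightarrow> (complex \<Rightarrow> real^3) \<Rightarrow> bool"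
  where "normal_chart X A B W f h e \<longleftrightarrow> is_chart X h \<and> (\<forall>a\<in>A. smoothly_compatible h a) \<and>
    (\<forall>b\<in>B. \<forall>q\<in>fst h \<inter> fst b. det2 (transition h b q) > 0) \<and>
    smooth_on (snd h ` fst h) e \<and> real_analytic_on (snd h ` fst h) e \<and>
    (\<forall>q\<in>fst h. e (snd h q) $ 0 = 1 \<and> (\<forall>v. lorentz (e (snd h q)) (differential h f q v) = 0)) \<and>
    (\<forall>q\<in>fst h \<inter> W. \<exists>\<rho>>0. \<forall>v v'. first_form h f q v v' = \<rho> * (v \<bullet> v'))"

lemma normal_chart_exists:
  fixes f :: "'a \<Rightarrow> real^3"
  assumes A: "smooth_atlas X A" and B: "smooth_atlas X B" and BA: "\<forall>b\<in>B. \<forall>c\<in>A. smoothly_compatible b c"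
    and Bpos: "\<forall>b\<in>B. \<forall>c\<in>B. \<forall>z\<in>overlap b c. jacobian (local_rep b (snd c)) z > 0"
    and reg: "maxface_regular_on X A W f" and p: "p \<in> topspace X"
  shows "\<exists>h e. p \<in> fst h \<and> normal_chart X A B W f h e"
proof -
  have f: "smooth_map A f" and W: "openin X W" "X closure_of W = topspace X" and zmc: "zero_mean_curvature_on A W f"
    using reg by (auto simp: maxface_regular_on_def)
  have ch: "is_chart X c" if "c \<in> A" for c using A that by (simp add: smooth_atlas_def)
  have chB: "is_chart X c" if "c \<in> B" for c using B that by (simp add: smooth_atlas_def)
  obtain c S \<beta> g v0 where c: "c \<in> A" and S: "openin X S" "p \<in> S" "S \<subseteq> fst c" and g: "C1_metric_on (snd c ` S) g"
    and gf: "\<forall>q\<in>S \<inter> W. \<beta> q > (0::real) \<and> (\<forall>v v'. g (snd c q) v v' = \<beta> q * first_form c f q v v')" and v0: "differential c f p v0 \<noteq> 0"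
    using local_conformal_metric[OF A reg p] by blast
  obtain b where b: "b \<in> B" "p \<in> fst b" using p B unfolding smooth_atlas_def by blast
  note hc = ch[OF c] and hb = chB[OF b(1)]
  have cb: "smoothly_compatible c b" using BA b(1) c smoothly_compatible_sym by blast
  have pc: "p \<in> fst c" using S by blast
  let ?jac = "jacobian (local_rep c (snd b))"
  \<comment> \<open>The charts of \<open>A\<close> need not be oriented. \<open>\<epsilon>\<close>
    is the orientation of \<open>c\<close> relative to the oriented chart \<open>b\<close> at
    \<open>p\<close>, and \<open>U\<close> below is the region where it persists; a coordinate whose
    Jacobian has the same sign is then positively oriented.\<close>
  define \<epsilon> where "\<epsilon> = sgn (?jac (snd c p))"
  have "?jac (snd c p) \<noteq> 0"
    using det2_transition_inverse[OF hc hb cb pc b(2)] unfolding jacobian_transition by auto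
  then have \<epsilon>: "\<epsilon> = 1 \<or> \<epsilon> = -1" and \<epsilon>p: "\<epsilon> * ?jac (snd c p) > 0" by (auto simp: \<epsilon>_def sgn_if)
  let ?F = "local_rep c f" and ?\<Omega> = "snd c ` fst c"
  define S1 where "S1 = S \<inter> fst b"
  have S1: "openin X S1" "S1 \<subseteq> fst c" using S hb by (auto simp: S1_def is_chart_def)
  have S1o: "snd c ` S1 \<subseteq> overlap c b" using S by (auto simp: S1_def overlap_def)
  have oS1: "open (snd c ` S1)" by (rule chart_open_image[OF hc S1])
  define U where "U = snd c ` S1 \<inter> (\<lambda>w. \<epsilon> * ?jac w) -` {0<..}"
  have U: "open U"
  proof -
    have "continuous_on (snd c ` S1) ?jac"
      by (intro continuous_on_jacobian smooth_on_subset[OF _ S1o]) (use cb in \<open>simp add: smoothly_compatible_def\<close>)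
    then have "continuous_on (snd c ` S1) (\<lambda>w. \<epsilon> * ?jac w)" by (intro continuous_intros)
    from continuous_open_preimage[OF this oS1, of "{0<..}"] show ?thesis by (simp add: U_def)
  qed
  have pU: "snd c p \<in> U" using S b \<epsilon>p by (auto simp: U_def S1_def)
  have U\<Omega>: "U \<subseteq> ?\<Omega>" using S1 by (auto simp: U_def)
  have US1: "q \<in> S1" if "q \<in> fst c" "snd c q \<in> U" for q
  proof -
    obtain q' where q': "q' \<in> S1" "snd c q = snd c q'" using \<open>snd c q \<in> U\<close> by (auto simp: U_def)
    then have "q = q'" using inj_onD[OF is_chart_inj[OF hc] q'(2)] that(1) S1(2) by blast
    then show ?thesis using q' by simp
  qed
  define V where "V = snd c ` (fst c \<inter> W)"
  have oD: "openin X (fst c)" using hc by (simp add: is_chart_def)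
  have V: "open V" "U \<subseteq> closure V"
    using chart_open_image[OF hc, of "fst c \<inter> W"] W(1) oD chart_image_dense[OF hc W(2) oD order_refl] U\<Omega>
    by (auto simp: V_def)
  have UV: "\<exists>q. q \<in> S1 \<and> q \<in> W \<and> w = snd c q" if "w \<in> U \<inter> V" for w
  proof -
    obtain q where "q \<in> fst c" "q \<in> W" "w = snd c q" using \<open>w \<in> U \<inter> V\<close> by (auto simp: V_def)
    then show ?thesis using US1[of q] that by blast
  qed
  have sF: "smooth_on U ?F" by (rule smooth_on_subset[OF _ U\<Omega>]) (use f c in \<open>simp add: smooth_map_def\<close>)
  have gU: "C1_metric_on U g" by (rule C1_metric_on_subset[OF g]) (auto simp: U_def S1_def)
  have gf': "\<forall>w\<in>U \<inter> V. local_rep c \<beta> w > 0 \<and> (\<forall>v v'. g w v v' = local_rep c \<beta> w * lorentz (fderiv ?F w v) (fderiv ?F w v'))"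
  proof
    fix w assume "w \<in> U \<inter> V"
    then obtain q where q: "q \<in> S1" "q \<in> W" "w = snd c q" using UV by blast
    have "q \<in> fst c" "q \<in> S \<inter> W" using q S1 by (auto simp: S1_def)
    then show "local_rep c \<beta> w > 0 \<and> (\<forall>v v'. g w v v' = local_rep c \<beta> w * lorentz (fderiv ?F w v) (fderiv ?F w v'))"
      using bspec[OF gf, of q] unfolding q(3) by (simp add: local_rep_apply[OF hc] first_form_def differential_def)
  qed
  let ?D = "\<lambda>w. fderiv ?F w"
  have H: "\<forall>w\<in>U \<inter> V. \<forall>\<nu>. lorentz \<nu> \<nu> = -1 \<longrightarrow> (\<forall>v. lorentz \<nu> (?D w v) = 0) \<longrightarrow>
       lorentz (?D w 1) (?D w 1) * lorentz (fderiv (\<lambda>z. ?D z \<i>) w \<i>) \<nu>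
       - 2 * lorentz (?D w 1) (?D w \<i>) * lorentz (fderiv (\<lambda>z. ?D z \<i>) w 1) \<nu>
       + lorentz (?D w \<i>) (?D w \<i>) * lorentz (fderiv (\<lambda>z. ?D z 1) w 1) \<nu> = 0"
  proof (intro ballI allI impI)
    fix w \<nu> assume w: "w \<in> U \<inter> V" and \<nu>: "lorentz \<nu> \<nu> = -1" "\<forall>v. lorentz \<nu> (?D w v) = 0"
    then obtain q where q: "q \<in> S1" "q \<in> W" "w = snd c q" using UV by blast
    have qc: "q \<in> fst c \<inter> W" using q S1 by auto
    have "unit_normal_at c f q \<nu>" using \<nu> by (simp add: unit_normal_at_def differential_def q(3))
    then have mc: "mean_curvature c f q \<nu> = 0" using zmc c qc unfolding zero_mean_curvature_on_def by blast
    \<comment> \<open>\<open>mean_curvature\<close> is a quotient, and division by 0 yields 0; only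
      with a non-zero denominator, inherited here from \<open>g\<close>, does its vanishing say that
      the numerator is 0.\<close>
    have "lorentz (?D w 1) (?D w 1) * lorentz (?D w \<i>) (?D w \<i>) - (lorentz (?D w 1) (?D w \<i>))\<^sup>2 \<noteq> 0"
    proof
      assume d: "lorentz (?D w 1) (?D w 1) * lorentz (?D w \<i>) (?D w \<i>) - (lorentz (?D w 1) (?D w \<i>))\<^sup>2 = 0"
      let ?b = "local_rep c \<beta> w"
      have ge: "g w v v' = ?b * lorentz (?D w v) (?D w v')" for v v' using bspec[OF gf' w] by blast
      have "g w 1 1 * g w \<i> \<i> - (g w 1 \<i>)\<^sup>2 = ?b\<^sup>2 * (lorentz (?D w 1) (?D w 1) * lorentz (?D w \<i>) (?D w \<i>) - (lorentz (?D w 1) (?D w \<i>))\<^sup>2)"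
        unfolding ge by (simp add: power2_eq_square algebra_simps)
      then show False using d C1_metric_on_det_pos(2)[OF gU, of w] w by simp
    qed
    then show "lorentz (?D w 1) (?D w 1) * lorentz (fderiv (\<lambda>z. ?D z \<i>) w \<i>) \<nu>
       - 2 * lorentz (?D w 1) (?D w \<i>) * lorentz (fderiv (\<lambda>z. ?D z \<i>) w 1) \<nu>
       + lorentz (?D w \<i>) (?D w \<i>) * lorentz (fderiv (\<lambda>z. ?D z 1) w 1) \<nu> = 0"
      using mc unfolding mean_curvature_def Let_def first_form_def differential_def second_derivative_def q(3)
      by simp
  qed
  have nz: "?D (snd c p) v0 \<noteq> 0" using v0 by (simp add: differential_def)
  show ?thesis
  proof (rule conformal_coordinate_signed[OF U pU sF V gU gf' H nz \<epsilon>])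
    fix r and Z :: "complex \<Rightarrow> complex" and \<eta> :: "complex \<Rightarrow> real^3"
    let ?B = "ball (snd c p) r"
    assume r: "r > 0" "?B \<subseteq> U" and Z: "inj_on Z ?B" "smooth_on ?B Z" "\<And>w. w \<in> ?B \<Longrightarrow> \<epsilon> * jacobian Z w > 0"
      and \<eta>: "smooth_on ?B \<eta>" "\<And>w. w \<in> ?B \<Longrightarrow> \<eta> w $ 0 = 1" "\<And>w v. w \<in> ?B \<Longrightarrow> lorentz (\<eta> w) (?D w v) = 0"
      "real_analytic_on (Z ` ?B) (\<eta> \<circ> inv_into ?B Z)"
      and conf: "\<And>w. w \<in> ?B \<inter> V \<Longrightarrow> \<exists>\<rho>>0. \<forall>v v'. lorentz (?D w v) (?D w v') = \<rho> * (fderiv Z w v \<bullet> fderiv Z w v')"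
    define N where "N = {q \<in> fst c. snd c q \<in> ?B}"
    define h where "h = (N, \<lambda>q. Z (snd c q))"
    have fsth: "fst h = N" and sndh: "snd h q = Z (snd c q)" for q by (simp_all add: h_def)
    have B\<Omega>: "?B \<subseteq> ?\<Omega>" using r(2) U\<Omega> by blast
    note hh = chart_ball[OF hc B\<Omega> open_ball Z(2,1), folded N_def, folded h_def]
    have imN: "snd c ` N = ?B" using B\<Omega> by (auto simp: N_def)
    have NB: "snd c q \<in> ?B" "q \<in> fst c" if "q \<in> N" for q using that by (auto simp: N_def)
    have NS1: "q \<in> S1" if "q \<in> N" for q using US1[OF NB(2)[OF that]] NB(1)[OF that] r(2) by blast
    obtain \<zeta> where \<zeta>: "homeomorphism ?B (Z ` ?B) Z \<zeta>"
      using invariance_of_domain_homeomorphism[OF open_ball smooth_on_continuous[OF Z(2)] _ Z(1)] by auto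
    have \<zeta>Z: "\<zeta> (Z w) = w" if "w \<in> ?B" for w using homeomorphism_apply1[OF \<zeta> that] .
    have oZB: "open (Z ` ?B)" by (rule smooth_open_image[OF open_ball Z(2,1) order_refl open_ball])
    have s\<zeta>: "smooth_on (Z ` ?B) \<zeta>"
    proof (rule smooth_on_local_inverse[OF open_ball oZB Z(2)])
      show "continuous_on (Z ` ?B) \<zeta>" using \<zeta> by (simp add: homeomorphism_def)
      show "\<zeta> y \<in> ?B" "Z (\<zeta> y) = y" if "y \<in> Z ` ?B" for y using that \<zeta>Z by auto
      show "jacobian Z w \<noteq> 0" if "w \<in> ?B" for w using Z(3)[OF that] by auto
    qed
    have ha: "smoothly_compatible h a" if a: "a \<in> A" for a
      unfolding smoothly_compatible_def
    proof
      note hha = ch[OF a]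
      have ca: "smoothly_compatible c a" using A c a by (simp add: smooth_atlas_def)
      have sub: "overlap h a \<subseteq> Z ` ?B" unfolding hh(2)[symmetric] by (auto simp: overlap_def)
      have "smooth_on (overlap h a) (\<lambda>w. local_rep c (snd a) (\<zeta> w))"
      proof (rule smooth_on_compose[OF open_overlap[OF hh(1) hha] open_overlap[OF hc hha] _ smooth_on_subset[OF s\<zeta> sub]])
        show "smooth_on (overlap c a) (local_rep c (snd a))" using ca by (simp add: smoothly_compatible_def)
        fix w assume "w \<in> overlap h a"
        then obtain q where q: "q \<in> N" "q \<in> fst a" "w = Z (snd c q)" by (auto simp: overlap_def fsth sndh)
        then show "\<zeta> w \<in> overlap c a" using \<zeta>Z[OF NB(1)] NB(2) by (auto simp: overlap_def)
      qed
      then show "smooth_on (overlap h a) (local_rep h (snd a))"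
      proof (rule smooth_on_cong[OF open_overlap[OF hh(1) hha], THEN iffD1, rotated])
        fix w assume "w \<in> overlap h a"
        then obtain q where q: "q \<in> N" "q \<in> fst a" "w = Z (snd c q)" by (auto simp: overlap_def fsth sndh)
        have "local_rep h (snd a) w = snd a q" unfolding q(3) sndh[symmetric] by (rule local_rep_apply[OF hh(1)]) (simp add: fsth q)
        then show "local_rep c (snd a) (\<zeta> w) = local_rep h (snd a) w"
          unfolding q(3) \<zeta>Z[OF NB(1)[OF q(1)]] by (simp add: local_rep_apply[OF hc NB(2)[OF q(1)]])
      qed
      have o: "open (overlap a h)" by (rule open_overlap[OF hha hh(1)])
      have sub': "overlap a h \<subseteq> overlap a c" using NB(2) by (auto simp: overlap_def fsth)
      have val: "\<exists>q. q \<in> N \<and> q \<in> fst a \<and> w = snd a q \<and> local_rep a (snd c) w = snd c q" if "w \<in> overlap a h" for w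
        using that by (auto simp: overlap_def fsth local_rep_apply[OF hha])
      have "smooth_on (overlap a h) (\<lambda>w. Z (local_rep a (snd c) w))"
      proof (rule smooth_on_compose[OF o open_ball Z(2) smooth_on_subset[OF _ sub']])
        show "smooth_on (overlap a c) (local_rep a (snd c))" using ca by (simp add: smoothly_compatible_def)
        show "local_rep a (snd c) w \<in> ?B" if "w \<in> overlap a h" for w using val[OF that] NB(1) by auto
      qed
      then show "smooth_on (overlap a h) (local_rep a (snd h))"
      proof (rule smooth_on_cong[OF o, THEN iffD1, rotated])
        fix w assume "w \<in> overlap a h"
        from val[OF this] obtain q where "q \<in> N" "q \<in> fst a" "w = snd a q" "local_rep a (snd c) w = snd c q" by blast
        then show "Z (local_rep a (snd c) w) = local_rep a (snd h) w" by (simp add: local_rep_apply[OF hha] sndh)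
      qed
    qed
    have hcc: "smoothly_compatible h c" by (rule ha[OF c])
    have tch: "transition c h q v = fderiv Z (snd c q) v" if q: "q \<in> N" for q v
    proof -
      have "(local_rep c (snd h) has_derivative fderiv Z (snd c q)) (at (snd c q))"
      proof (rule has_derivative_transform_within_open[OF smooth_on_has_derivative[OF open_ball Z(2) NB(1)[OF q]] open_ball NB(1)[OF q]])
        fix w assume "w \<in> ?B"
        then obtain q' where "q' \<in> fst c" "w = snd c q'" using B\<Omega> by blast
        then show "Z w = local_rep c (snd h) w" by (simp add: local_rep_apply[OF hc] sndh)
      qed
      from frechet_derivative_at[OF this] show ?thesis unfolding transition_def differential_def by metis
    qed
    have det_ch: "\<epsilon> * det2 (transition c h q) > 0" if "q \<in> N" for q
      using Z(3)[OF NB(1)[OF that]] by (simp add: det2_def tch[OF that] jacobian_cross2)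
    \<comment> \<open>The orientation is followed from \<open>h\<close> through \<open>c\<close> and
      \<open>b\<close> to \<open>b'\<close>. The sign \<open>\<epsilon>\<close> occurs in the first
      two steps and cancels.\<close>
    have det_hb: "det2 (transition h b' q) > 0" if b': "b' \<in> B" and q: "q \<in> fst h \<inter> fst b'" for b' q
    proof -
      note hb' = chB[OF b']
      have qN: "q \<in> N" and qb': "q \<in> fst b'" using q by (auto simp: fsth)
      note qc = NB(2)[OF qN]
      have qb: "q \<in> fst b" using NS1[OF qN] by (simp add: S1_def)
      have bb': "smoothly_compatible b b'" using B b(1) b' by (simp add: smooth_atlas_def)
      have qh: "q \<in> fst h" using qN by (simp add: fsth)
      have hb1: "smoothly_compatible h b"
        by (rule smooth_compatible_trans[OF A hh(1) ha hb]) (use BA b(1) in auto)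
      have d1: "det2 (transition h b q) = det2 (transition c b q) * det2 (transition h c q)"
        by (rule det2_compose[OF transition_linear[OF hc hb cb qc qb] transition_linear[OF hh(1) hc hcc qh qc]])
          (rule transition_compose[OF hh(1) hc hb hcc cb qh qc qb])
      have d2: "det2 (transition h b' q) = det2 (transition b b' q) * det2 (transition h b q)"
        by (rule det2_compose[OF transition_linear[OF hb hb' bb' qb qb'] transition_linear[OF hh(1) hb hb1 qh qb]])
          (rule transition_compose[OF hh(1) hb hb' hb1 bb' qh qb qb'])
      have inv: "det2 (transition h c q) * det2 (transition c h q) = 1"
        by (rule det2_transition_inverse[OF hc hh(1) smoothly_compatible_sym[OF hcc] qc qh])
      have "\<epsilon> * det2 (transition h c q) > 0"
      proof (rule zero_less_mult_pos2[OF _ det_ch[OF qN]])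
        have "\<epsilon> * det2 (transition h c q) * (\<epsilon> * det2 (transition c h q)) = 1"
          using inv \<epsilon> by auto
        then show "\<epsilon> * det2 (transition h c q) * (\<epsilon> * det2 (transition c h q)) > 0" by simp
      qed
      moreover have "\<epsilon> * det2 (transition c b q) > 0"
        using r(2) NB(1)[OF qN] unfolding U_def jacobian_transition[symmetric] by auto
      moreover have "det2 (transition b b' q) > 0"
        unfolding jacobian_transition[symmetric] using Bpos b(1) b' qb qb' by (auto simp: overlap_def)
      ultimately show ?thesis unfolding d2 d1 using \<epsilon> by (auto simp: zero_less_mult_iff)
    qed
    have dh: "differential h f q v = ?D (snd c q) (transition h c q v)" if "q \<in> N" for q v
      using differential_change(2)[OF hh(1) hc hcc _ NB(2)[OF that] smooth_map_differentiable(1)[OF f c hc NB(2)[OF that]], of v] that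
      by (simp add: fsth differential_def)
    have e: "(\<eta> \<circ> \<zeta>) (snd h q) = \<eta> (snd c q)" if "q \<in> N" for q by (simp add: sndh \<zeta>Z[OF NB(1)[OF that]])
    have "normal_chart X A B W f h (\<eta> \<circ> \<zeta>)"
      unfolding normal_chart_def
    proof (intro conjI ballI)
      show "smooth_on (snd h ` fst h) (\<eta> \<circ> \<zeta>)"
        unfolding hh(2) comp_def by (rule smooth_on_compose[OF oZB open_ball \<eta>(1) s\<zeta>]) (use \<zeta>Z in auto)
      show "real_analytic_on (snd h ` fst h) (\<eta> \<circ> \<zeta>)"
        unfolding hh(2)
      proof (rule real_analytic_on_cong[OF oZB _ \<eta>(4)])
        fix y assume "y \<in> Z ` ?B"
        then obtain w where "w \<in> ?B" "y = Z w" by blast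
        then show "(\<eta> \<circ> inv_into ?B Z) y = (\<eta> \<circ> \<zeta>) y" by (simp add: \<zeta>Z inv_into_f_f[OF Z(1)])
      qed
      show "(\<eta> \<circ> \<zeta>) (snd h q) $ 0 = 1" if "q \<in> fst h" for q
        using that e[of q] \<eta>(2)[OF NB(1)[of q]] unfolding fsth by simp
      show "\<forall>v. lorentz ((\<eta> \<circ> \<zeta>) (snd h q)) (differential h f q v) = 0" if "q \<in> fst h" for q
        using that e[of q] dh[of q] \<eta>(3)[OF NB(1)[of q]] unfolding fsth by simp
      show "\<exists>\<rho>>0. \<forall>v v'. first_form h f q v v' = \<rho> * (v \<bullet> v')" if q: "q \<in> fst h \<inter> W" for q
      proof -
        have qN: "q \<in> N" using q by (simp add: fsth)
        have "snd c q \<in> ?B \<inter> V" using NB[OF qN] q by (auto simp: V_def)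
        then obtain \<rho> where \<rho>: "\<rho> > 0" "\<And>v v'. lorentz (?D (snd c q) v) (?D (snd c q) v') = \<rho> * (fderiv Z (snd c q) v \<bullet> fderiv Z (snd c q) v')"
          using conf[of "snd c q"] by blast
        have "fderiv Z (snd c q) (transition h c q v) = v" for v
          using transition_inverse[OF hh(1) hc hcc _ NB(2)[OF qN], of v] qN unfolding tch[OF qN] fsth by simp
        then have "first_form h f q v v' = \<rho> * (v \<bullet> v')" for v v' unfolding first_form_def dh[OF qN] \<rho>(2) by simp
        then show ?thesis using \<rho>(1) by blast
      qed
    qed (use hh(1) ha det_hb in auto)
    moreover have "p \<in> fst h" using pc r(1) by (simp add: fsth N_def)
    ultimately show ?thesis by blast
  qed
qed

section \<open>Gluing the local normal fields\<close>

lemma smooth_map_continuous_map: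
  fixes \<phi> :: "'a \<Rightarrow> 'b::real_normed_vector"
  assumes A: "smooth_atlas X A" and \<phi>: "smooth_map A \<phi>"
  shows "continuous_map X euclidean \<phi>"
  unfolding continuous_map_def
proof (intro conjI allI impI)
  fix T :: "'b set" assume "openin euclidean T"
  then have T: "open T" by simp
  show "openin X {q \<in> topspace X. \<phi> q \<in> T}"
  proof (subst openin_subopen, intro ballI)
    fix q assume q: "q \<in> {q \<in> topspace X. \<phi> q \<in> T}"
    then obtain c where c: "c \<in> A" "q \<in> fst c" "is_chart X c" using A unfolding smooth_atlas_def by blast
    let ?T = "snd c ` fst c \<inter> local_rep c \<phi> -` T"
    have "continuous_on (snd c ` fst c) (local_rep c \<phi>)" using \<phi> c(1) smooth_on_continuous by (auto simp: smooth_map_def)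
    moreover have "open (snd c ` fst c)" using c(3) by (simp add: is_chart_def)
    ultimately have "open ?T" using T by (rule continuous_open_preimage)
    then have "openin X {q \<in> fst c. snd c q \<in> ?T}" by (rule chart_open_preimage[OF c(3)])
    moreover have "q \<in> {q \<in> fst c. snd c q \<in> ?T}" using q c by (auto simp: local_rep_apply[OF c(3)])
    moreover have "{q \<in> fst c. snd c q \<in> ?T} \<subseteq> {q \<in> topspace X. \<phi> q \<in> T}"
    proof
      fix x assume "x \<in> {q \<in> fst c. snd c q \<in> ?T}"
      then have "x \<in> fst c" "local_rep c \<phi> (snd c x) \<in> T" by auto
      then show "x \<in> {q \<in> topspace X. \<phi> q \<in> T}"
        using chart_subset_topspace[OF c(3)] by (auto simp: local_rep_apply[OF c(3)])
    qed
    ultimately show "\<exists>T'. openin X T' \<and> q \<in> T' \<and> T' \<subseteq> {q \<in> topspace X. \<phi> q \<in> T}" by blast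
  qed
qed auto

text \<open>One normal chart is chosen around each point, and these charts themselves form the
  complex structure. Over \<open>W\<close> the tangent planes are spacelike, so the local normals
  with time component 1 agree there, and on all of an overlap by density. Likewise the coordinate
  changes are conformal and orientation preserving over \<open>W\<close>, which gives the
  Cauchy-Riemann equations there and then everywhere.\<close>

lemma orientable_normal_field:
  fixes f :: "'a \<Rightarrow> real^3"
  assumes A: "smooth_atlas X A" and ori: "orientable X A" and reg: "maxface_regular_on X A W f"
  obtains \<eta> :: "'a \<Rightarrow> real^3" and H where "\<And>q. q \<in> topspace X \<Longrightarrow> \<eta> q $ 0 = 1" "normal_vector_field X A f \<eta>" "smooth_map A \<eta>"
    "maxface_complex_structure X A f H" "real_analytic_map H \<eta>"
proof -
  have f: "smooth_map A f" and W: "openin X W" "X closure_of W = topspace X" using reg by (auto simp: maxface_regular_on_def)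
  have ch: "is_chart X c" if "c \<in> A" for c using A that by (simp add: smooth_atlas_def)
  obtain B where B: "smooth_atlas X B" "\<forall>b\<in>B. \<forall>c\<in>A. smoothly_compatible b c"
    "\<forall>b\<in>B. \<forall>c\<in>B. \<forall>z\<in>overlap b c. jacobian (local_rep b (snd c)) z > 0"
    using ori unfolding orientable_def by blast
  have chB: "is_chart X c" if "c \<in> B" for c using B(1) that by (simp add: smooth_atlas_def)
  have "\<forall>p\<in>topspace X. \<exists>he. p \<in> fst (fst he) \<and> normal_chart X A B W f (fst he) (snd he)"
    using normal_chart_exists[OF A B reg] by simp
  from bchoice[OF this] obtain he where he: "\<forall>p\<in>topspace X. p \<in> fst (fst (he p)) \<and> normal_chart X A B W f (fst (he p)) (snd (he p))" ..
  define h where "h = (\<lambda>p. fst (he p))"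
  define e where "e = (\<lambda>p. snd (he p))"
  have ph: "p \<in> fst (h p)" and nc: "normal_chart X A B W f (h p) (e p)" if "p \<in> topspace X" for p
    using he that by (simp_all add: h_def e_def)
  have hch: "is_chart X (h p)" and hA: "a \<in> A \<Longrightarrow> smoothly_compatible (h p) a"
    and hB: "b \<in> B \<Longrightarrow> q \<in> fst (h p) \<inter> fst b \<Longrightarrow> det2 (transition (h p) b q) > 0"
    and es: "smooth_on (snd (h p) ` fst (h p)) (e p)" and era: "real_analytic_on (snd (h p) ` fst (h p)) (e p)"
    and e0: "q \<in> fst (h p) \<Longrightarrow> e p (snd (h p) q) $ 0 = 1"
    and en: "q \<in> fst (h p) \<Longrightarrow> lorentz (e p (snd (h p) q)) (differential (h p) f q v) = 0"
    and econf: "q \<in> fst (h p) \<inter> W \<Longrightarrow> \<exists>\<rho>>0. \<forall>v v'. first_form (h p) f q v v' = \<rho> * (v \<bullet> v')"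
    if "p \<in> topspace X" for p a b q v
    using nc[OF that] unfolding normal_chart_def by simp_all
  have hh: "smoothly_compatible (h p) (h p')" if "p \<in> topspace X" "p' \<in> topspace X" for p p'
    using smooth_compatible_trans[OF A hch[OF that(1)] hA[OF that(1)] hch[OF that(2)] hA[OF that(2)]] .
  have sf: "smooth_on (snd (h p) ` fst (h p)) (local_rep (h p) f)" if p: "p \<in> topspace X" for p
  proof (rule smooth_transfer[OF A hch[OF p]])
    show "openin X (fst (h p))" using hch[OF p] by (simp add: is_chart_def)
    show "smooth_on (overlap (h p) a) (local_rep (h p) (snd a))" if "a \<in> A" for a using hA[OF p that] by (simp add: smoothly_compatible_def)
    show "smooth_on (snd a ` (fst a \<inter> fst (h p))) (local_rep a f)" if "a \<in> A" for a
      using f that smooth_on_subset[of "snd a ` fst a" "local_rep a f" "snd a ` (fst a \<inter> fst (h p))"] by (auto simp: smooth_map_def)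
  qed auto
  have sfd: "(local_rep (h p) f has_derivative differential (h p) f q) (at (snd (h p) q))" if "p \<in> topspace X" "q \<in> fst (h p)" for p q
    unfolding differential_def
    by (rule smooth_on_has_derivative[OF _ sf[OF that(1)]]) (use hch[OF that(1)] that(2) in \<open>auto simp: is_chart_def\<close>)
  then have dif: "local_rep (h p) f differentiable (at (snd (h p) q))" if "p \<in> topspace X" "q \<in> fst (h p)" for p q
    using that differentiable_def by blast
  have agree: "e p (snd (h p) q) = e p' (snd (h p') q)" if p: "p \<in> topspace X" "p' \<in> topspace X" and q: "q \<in> fst (h p)" "q \<in> fst (h p')" for p p' q
  proof (rule continuous_map_agree_dense[OF _ W(2), of "fst (h p) \<inter> fst (h p')"])
    show o: "openin X (fst (h p) \<inter> fst (h p'))" using hch[OF p(1)] hch[OF p(2)] by (auto simp: is_chart_def)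
    have cont: "continuous_map (subtopology X S) euclidean (\<lambda>q. e p (snd (h p) q))" if p: "p \<in> topspace X" and S: "S \<subseteq> fst (h p)" for p S
    proof -
      have "continuous_map (subtopology X S) euclidean (snd (h p))"
        by (rule continuous_map_from_subtopology_mono[OF chart_continuous_map[OF hch[OF p]] S])
      then have "continuous_map (subtopology X S) (top_of_set (snd (h p) ` fst (h p))) (snd (h p))"
        by (rule continuous_map_into_subtopology) (use S in auto)
      moreover have "continuous_map (top_of_set (snd (h p) ` fst (h p))) euclidean (e p)" using smooth_on_continuous[OF es[OF p]] by simp
      ultimately show ?thesis using continuous_map_compose[of _ _ "snd (h p)" _ "e p"] by (simp add: comp_def)
    qed
    show "continuous_map (subtopology X (fst (h p) \<inter> fst (h p'))) euclidean (\<lambda>q. e p (snd (h p) q))"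
      "continuous_map (subtopology X (fst (h p) \<inter> fst (h p'))) euclidean (\<lambda>q. e p' (snd (h p') q))"
      using cont[OF p(1)] cont[OF p(2)] by auto
    fix q assume q: "q \<in> fst (h p) \<inter> fst (h p')" "q \<in> W"
    obtain \<rho> where \<rho>: "\<rho> > 0" "\<And>v v'. first_form (h p') f q v v' = \<rho> * (v \<bullet> v')" using econf[OF p(2), of q] q by blast
    show "e p (snd (h p) q) = e p' (snd (h p') q)"
    proof (rule causal_normal_unique[of "differential (h p') f q"])
      show "linear (differential (h p') f q)" using has_derivative_linear[OF sfd[OF p(2)]] q by simp
      show "lorentz (differential (h p') f q v) (differential (h p') f q v) > 0" if "v \<noteq> 0" for v
        using \<rho>(2)[of v v] \<rho>(1) that by (simp add: first_form_def)
      show "lorentz (e p (snd (h p) q)) (differential (h p') f q v) = 0" for v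
        using en[OF p(1), of q] q differential_change(2)[OF hch[OF p(2)] hch[OF p(1)] hh[OF p(2,1)] _ _ dif[OF p(1)], of q v] by simp
    qed (use e0[OF p(1), of q] e0[OF p(2), of q] en[OF p(2), of q] q in auto)
  qed (use q in auto)
  define \<eta> where "\<eta> = (\<lambda>q. e q (snd (h q) q))"
  have \<eta>: "\<eta> q = e p (snd (h p) q)" if "p \<in> topspace X" "q \<in> fst (h p)" for p q
  proof -
    have "q \<in> topspace X" using chart_subset_topspace[OF hch[OF that(1)]] that(2) by blast
    then show ?thesis unfolding \<eta>_def using agree[OF _ that(1) ph that(2)] by blast
  qed
  have nf: "normal_vector_field X A f \<eta>"
    unfolding normal_vector_field_def
  proof (intro conjI ballI allI)
    show "\<eta> q \<noteq> 0" if "q \<in> topspace X" for q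
    proof
      assume "\<eta> q = 0"
      then show False using e0[OF that ph[OF that]] \<eta>[OF that ph[OF that]] by simp
    qed
    fix c q v assume c: "c \<in> A" "q \<in> fst c"
    have q: "q \<in> topspace X" using chart_subset_topspace[OF ch[OF c(1)]] c(2) by blast
    have "smoothly_compatible c (h q)" by (rule smoothly_compatible_sym[OF hA[OF q c(1)]])
    from differential_change(2)[OF ch[OF c(1)] hch[OF q] this c(2) ph[OF q] dif[OF q ph[OF q]], of v]
    show "lorentz (\<eta> q) (differential c f q v) = 0" using en[OF q ph[OF q]] by (simp add: \<eta>_def)
  qed
  have s\<eta>: "smooth_map A \<eta>"
    unfolding smooth_map_def
  proof
    fix c assume c: "c \<in> A"
    note hc = ch[OF c]
    show "smooth_on (snd c ` fst c) (local_rep c \<eta>)"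
    proof (rule smooth_on_local)
      show "open (snd c ` fst c)" using hc by (simp add: is_chart_def)
      fix y assume "y \<in> snd c ` fst c"
      then obtain q where q: "q \<in> fst c" "y = snd c q" by blast
      have qX: "q \<in> topspace X" using chart_subset_topspace[OF hc] q(1) by blast
      note hq = hch[OF qX]
      have o: "open (overlap c (h q))" by (rule open_overlap[OF hc hq])
      have "smooth_on (overlap c (h q)) (\<lambda>w. e q (local_rep c (snd (h q)) w))"
      proof (rule smooth_on_compose[OF o _ es[OF qX]])
        show "open (snd (h q) ` fst (h q))" using hq by (simp add: is_chart_def)
        show "smooth_on (overlap c (h q)) (local_rep c (snd (h q)))" using hA[OF qX c] by (simp add: smoothly_compatible_def)
        show "local_rep c (snd (h q)) w \<in> snd (h q) ` fst (h q)" if "w \<in> overlap c (h q)" for w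
          using that by (auto simp: overlap_def local_rep_apply[OF hc])
      qed
      then have "smooth_on (overlap c (h q)) (local_rep c \<eta>)"
        by (rule smooth_on_cong[OF o, THEN iffD1, rotated]) (auto simp: overlap_def local_rep_apply[OF hc] \<eta>[OF qX])
      moreover have "y \<in> overlap c (h q)" using q ph[OF qX] by (auto simp: overlap_def)
      ultimately show "\<exists>T. open T \<and> y \<in> T \<and> smooth_on T (local_rep c \<eta>)" using o by blast
    qed
  qed
  let ?H = "h ` topspace X"
  have ra: "real_analytic_map ?H \<eta>"
    unfolding real_analytic_map_def
  proof
    fix k assume "k \<in> ?H"
    then obtain p where p: "p \<in> topspace X" "k = h p" by blast
    show "real_analytic_on (snd k ` fst k) (local_rep k \<eta>)"
      unfolding p(2)
    proof (rule real_analytic_on_cong[OF _ _ era[OF p(1)]])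
      show "open (snd (h p) ` fst (h p))" using hch[OF p(1)] by (simp add: is_chart_def)
      show "e p w = local_rep (h p) \<eta> w" if "w \<in> snd (h p) ` fst (h p)" for w
        using that by (auto simp: local_rep_apply[OF hch[OF p(1)]] \<eta>[OF p(1)])
    qed
  qed
  have hol: "local_rep (h p) (snd (h p')) holomorphic_on overlap (h p) (h p')" if p: "p \<in> topspace X" "p' \<in> topspace X" for p p'
  proof -
    let ?\<tau> = "local_rep (h p) (snd (h p'))" and ?O = "overlap (h p) (h p')"
    have O: "open ?O" by (rule open_overlap[OF hch[OF p(1)] hch[OF p(2)]])
    have s\<tau>: "smooth_on ?O ?\<tau>" using hh[OF p] by (simp add: smoothly_compatible_def)
    let ?T = "\<lambda>y. fderiv ?\<tau> y"
    have o: "openin X (fst (h p) \<inter> fst (h p'))" using hch[OF p(1)] hch[OF p(2)] by (auto simp: is_chart_def)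
    have dense: "?O \<subseteq> closure (snd (h p) ` (fst (h p) \<inter> fst (h p') \<inter> W))"
      unfolding overlap_def by (rule chart_image_dense[OF hch[OF p(1)] W(2) o]) auto
    have lin: "?T y \<i> = \<i> * ?T y 1" if "y \<in> ?O" for y
    proof (rule continuous_agree_dense[OF O dense _ _ _ that])
      show "continuous_on ?O (\<lambda>y. ?T y \<i>)" "continuous_on ?O (\<lambda>y. \<i> * ?T y 1)"
        by (intro continuous_intros smooth_on_continuous smooth_on_frechet s\<tau>)+
      fix y assume "y \<in> ?O \<inter> snd (h p) ` (fst (h p) \<inter> fst (h p') \<inter> W)"
      then obtain q where q: "q \<in> fst (h p)" "q \<in> fst (h p')" "q \<in> W" "y = snd (h p) q" by blast
      obtain \<rho> where \<rho>: "\<rho> > 0" "\<And>v v'. first_form (h p) f q v v' = \<rho> * (v \<bullet> v')" using econf[OF p(1), of q] q by blast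
      obtain \<sigma> where \<sigma>: "\<And>v v'. first_form (h p') f q v v' = \<sigma> * (v \<bullet> v')" using econf[OF p(2), of q] q by blast
      let ?t = "transition (h p) (h p') q"
      have Tt: "?T y v = ?t v" for v by (simp add: transition_def differential_def q(4))
      have "differential (h p) f q v = differential (h p') f q (?t v)" for v
        by (rule differential_change(2)[OF hch[OF p(1)] hch[OF p(2)] hh[OF p] q(1,2) dif[OF p(2) q(2)]])
      then have eq: "\<rho> * (v \<bullet> v') = \<sigma> * (?t v \<bullet> ?t v')" for v v'
        using \<rho>(2)[of v v'] \<sigma>[of "?t v" "?t v'"] by (simp add: first_form_def)
      have qX: "q \<in> topspace X" using chart_subset_topspace[OF hch[OF p(1)]] q(1) by blast
      obtain b where b: "b \<in> B" "q \<in> fst b" using qX B(1) unfolding smooth_atlas_def by blast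
      have hb: "smoothly_compatible (h p'') b" if "p'' \<in> topspace X" for p''
        by (rule smooth_compatible_trans[OF A hch[OF that] hA[OF that] chB[OF b(1)]]) (use B(2) b(1) in auto)
      have d: "det2 (transition b (h p') q) * det2 (transition (h p') b q) = 1"
        by (rule det2_transition_inverse[OF hch[OF p(2)] chB[OF b(1)] hb[OF p(2)] q(2) b(2)])
      \<comment> \<open>The coordinate change is factored through the oriented chart
        \<open>b\<close> to obtain its positive orientation.\<close>
      have "det2 ?t = det2 (transition b (h p') q) * det2 (transition (h p) b q)"
        by (rule det2_compose[OF transition_linear[OF chB[OF b(1)] hch[OF p(2)] smoothly_compatible_sym[OF hb[OF p(2)]] b(2) q(2)]
              transition_linear[OF hch[OF p(1)] chB[OF b(1)] hb[OF p(1)] q(1) b(2)]])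
          (rule transition_compose[OF hch[OF p(1)] chB[OF b(1)] hch[OF p(2)] hb[OF p(1)] smoothly_compatible_sym[OF hb[OF p(2)]] q(1) b(2) q(2)])
      moreover have "det2 (transition (h p) b q) > 0" "det2 (transition (h p') b q) > 0"
        using hB[OF p(1) b(1), of q] hB[OF p(2) b(1), of q] q b by auto
      moreover have "det2 (transition b (h p') q) > 0"
        by (rule zero_less_mult_pos2[OF _ calculation(3)]) (simp add: d)
      ultimately have "cross2 (?t 1) (?t \<i>) > 0" by (simp add: det2_def)
      from conformal_linear_complex[OF eq \<rho>(1) this] show "?T y \<i> = \<i> * ?T y 1" by (simp add: Tt)
    qed
    have "(?\<tau> has_field_derivative ?T y 1) (at y)" if y: "y \<in> ?O" for y
    proof -
      note d = smooth_on_has_derivative[OF O s\<tau> y]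
      have "?T y v = ?T y 1 * v" for v
        by (subst complex_linear_expand[OF has_derivative_linear[OF d]]) (simp add: lin[OF y] complex_eq_iff algebra_simps)
      then have "?T y = (*) (?T y 1)" by (rule ext)
      then show ?thesis unfolding has_field_derivative_def using d by simp
    qed
    then show ?thesis unfolding holomorphic_on_open[OF O] by blast
  qed
  have cover: "(\<Union>k\<in>?H. fst k) = topspace X"
  proof (intro equalityI subsetI)
    show "q \<in> topspace X" if q: "q \<in> (\<Union>k\<in>?H. fst k)" for q
    proof -
      obtain p where "p \<in> topspace X" "q \<in> fst (h p)" using q by blast
      then show ?thesis using chart_subset_topspace[OF hch] by blast
    qed
    show "q \<in> (\<Union>k\<in>?H. fst k)" if "q \<in> topspace X" for q using ph[OF that] that by blast
  qed
  have "complex_structure X A ?H"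
    unfolding complex_structure_def smooth_atlas_def using hch hA hh hol cover by auto
  moreover have "conformal_on ?H W f" unfolding conformal_on_def using econf by auto
  ultimately have "maxface_complex_structure X A f ?H" using reg unfolding maxface_complex_structure_def by blast
  moreover have "\<eta> q $ 0 = 1" if "q \<in> topspace X" for q using e0[OF that ph[OF that]] by (simp add: \<eta>_def)
  ultimately show thesis using that nf s\<eta> ra by blast
qed

section \<open>Frontals from normal fields\<close>

text \<open>Lowers the index with the Lorentz metric, since covectors pair with vectors by the
  Euclidean product.\<close>

definition covector :: "real^3 \<Rightarrow> real^3"
  where "covector \<eta> = (\<chi> i. if i = 0 then - \<eta> $ 0 else \<eta> $ i)"

lemma covector_inner: "covector \<eta> \<bullet> v = lorentz \<eta> v"
proof -
  have "covector \<eta> \<bullet> v = covector \<eta> $ 1 * v $ 1 + covector \<eta> $ 2 * v $ 2 + covector \<eta> $ 0 * v $ 0"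
    by (simp add: inner_vec_def sum_3 zero_3)
  then show ?thesis by (simp add: covector_def lorentz_def)
qed

lemma span_in_affine_lines: "\<xi> \<noteq> 0 \<Longrightarrow> span {\<xi>} \<in> affine_lines i \<longleftrightarrow> \<xi> $ i \<noteq> 0"
  by (auto simp: affine_lines_def proj_line_def span_singleton)

lemma affine_point_span:
  fixes \<xi> :: "real^3"
  assumes "\<xi> $ i \<noteq> 0"
  shows "affine_point i (span {\<xi>}) = inverse (\<xi> $ i) *\<^sub>R \<xi>"
  unfolding affine_point_def span_singleton
proof (rule the_equality)
  fix \<zeta> assume "\<zeta> \<in> range (\<lambda>k. k *\<^sub>R \<xi>) \<and> \<zeta> $ i = 1"
  then obtain k where k: "\<zeta> = k *\<^sub>R \<xi>" "\<zeta> $ i = 1" by blast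
  then have "k * \<xi> $ i = 1" by simp
  with k(1) show "\<zeta> = inverse (\<xi> $ i) *\<^sub>R \<xi>" by (metis inverse_unique inverse_inverse_eq mult.commute)
qed (use assms in auto)

text \<open>The covector of \<open>\<eta>\<close> annihilates the image of \<open>df\<close>, so the
  lines it spans form a lift tangent to the contact field; as it never vanishes, the covector itself
  lifts this map further to the cotangent bundle. In an affine chart of the projective plane the
  line becomes the covector divided by one of its components.\<close>

lemma co_orientable_frontalI:
  fixes f \<eta> :: "'a \<Rightarrow> real^3"
  assumes A: "smooth_atlas X A" and f: "smooth_map A f" and \<eta>: "smooth_map A \<eta>" "normal_vector_field X A f \<eta>"
  shows "co_orientable_frontal X A f"
proof -
  have ch: "is_chart X c" if "c \<in> A" for c using A that by (simp add: smooth_atlas_def)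
  define \<xi> where "\<xi> = (\<lambda>q. covector (\<eta> q))"
  have \<xi>0: "\<xi> q \<noteq> 0" if "q \<in> topspace X" for q
  proof
    assume "\<xi> q = 0"
    then have "\<forall>i. \<eta> q $ i = 0" by (auto simp: \<xi>_def covector_def vec_eq_iff split: if_splits)
    then have "\<eta> q = 0" by (simp add: vec_eq_iff)
    then show False using \<eta>(2) that by (simp add: normal_vector_field_def)
  qed
  have s\<xi>: "smooth_map A \<xi>"
    unfolding smooth_map_def
  proof
    fix c assume c: "c \<in> A"
    have o: "open (snd c ` fst c)" using ch[OF c] by (simp add: is_chart_def)
    have s: "smooth_on (snd c ` fst c) (local_rep c \<eta>)" using \<eta>(1) c by (simp add: smooth_map_def)
    show "smooth_on (snd c ` fst c) (local_rep c \<xi>)"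
    proof (rule smooth_on_vec[OF o])
      fix i
      show "smooth_on (snd c ` fst c) (\<lambda>w. local_rep c \<xi> w $ i)"
        using smooth_on_minus[OF o smooth_on_vec_nth[OF o s, of 0]] smooth_on_vec_nth[OF o s, of i]
        by (cases "i = 0") (simp_all add: local_rep_def \<xi>_def covector_def)
    qed
  qed
  let ?\<Lambda> = "\<lambda>q. (f q, span {\<xi> q})" and ?\<mu> = "\<lambda>q. (f q, \<xi> q)"
  have aff: "{q \<in> S. span {\<xi> q} \<in> affine_lines i} = {q \<in> S. \<xi> q $ i \<noteq> 0}" if "S \<subseteq> topspace X" for S i
    using that span_in_affine_lines[OF \<xi>0] by blast
  have op: "openin X {q \<in> topspace X. \<xi> q $ i \<noteq> 0}" for i
  proof -
    have "open {x :: real^3. x $ i \<noteq> 0}"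
      by (intro open_Collect_neq continuous_intros)
    then have "openin euclidean {x :: real^3. x $ i \<noteq> 0}" by simp
    from openin_continuous_map_preimage[OF smooth_map_continuous_map[OF A s\<xi>] this] show ?thesis by simp
  qed
  have "smooth_map_PT X A ?\<Lambda>"
    unfolding smooth_map_PT_def
  proof (intro conjI ballI allI)
    show "smooth_map A (\<lambda>p. fst (?\<Lambda> p))" using f by simp
    show "proj_line (snd (?\<Lambda> p))" if "p \<in> topspace X" for p using \<xi>0[OF that] by (auto simp: proj_line_def)
    show "openin X {p \<in> topspace X. snd (?\<Lambda> p) \<in> affine_lines i}" for i using op[of i] by (simp add: aff)
    fix i c assume c: "c \<in> A"
    let ?S = "{q \<in> fst c. \<xi> q $ i \<noteq> 0}"
    have "openin X (fst c \<inter> {q \<in> topspace X. \<xi> q $ i \<noteq> 0})" using op[of i] ch[OF c] by (auto simp: is_chart_def)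
    moreover have "fst c \<inter> {q \<in> topspace X. \<xi> q $ i \<noteq> 0} = ?S" using chart_subset_topspace[OF ch[OF c]] by blast
    ultimately have S: "openin X ?S" by simp
    have o: "open (snd c ` ?S)" by (rule chart_open_image[OF ch[OF c] S]) auto
    have s: "smooth_on (snd c ` ?S) (local_rep c \<xi>)"
      by (rule smooth_on_subset[of "snd c ` fst c"]) (use s\<xi> c in \<open>auto simp: smooth_map_def\<close>)
    have "smooth_on (snd c ` ?S) (\<lambda>w. inverse (local_rep c \<xi> w $ i) *\<^sub>R local_rep c \<xi> w)"
      by (intro smooth_on_scaleR smooth_on_inverse smooth_on_vec_nth o s) (auto simp: local_rep_apply[OF ch[OF c]])
    then have "smooth_on (snd c ` ?S) (local_rep c (\<lambda>p. affine_point i (span {\<xi> p})))"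
      by (rule smooth_on_cong[OF o, THEN iffD1, rotated]) (auto simp: local_rep_apply[OF ch[OF c]] affine_point_span)
    then show "smooth_on (snd c ` {p \<in> fst c. snd (?\<Lambda> p) \<in> affine_lines i}) (local_rep c (\<lambda>p. affine_point i (snd (?\<Lambda> p))))"
      using aff[OF chart_subset_topspace[OF ch[OF c]], of i] by simp
  qed
  moreover have "contact_tangent A ?\<Lambda>"
    unfolding contact_tangent_def
  proof (intro ballI allI)
    fix c p v \<zeta> assume c: "c \<in> A" "p \<in> fst c" and "\<zeta> \<in> snd (?\<Lambda> p)"
    then obtain k where "\<zeta> = k *\<^sub>R \<xi> p" by (auto simp: span_singleton)
    moreover have "lorentz (\<eta> p) (differential c f p v) = 0" using \<eta>(2) c by (simp add: normal_vector_field_def)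
    ultimately show "\<zeta> \<bullet> differential c (\<lambda>q. fst (?\<Lambda> q)) p v = 0" by (simp add: \<xi>_def covector_inner)
  qed
  ultimately have fl: "frontal_lift X A f ?\<Lambda>" by (simp add: frontal_lift_def)
  have s\<mu>: "smooth_map A ?\<mu>"
    unfolding smooth_map_def
  proof
    fix c assume c: "c \<in> A"
    have "open (snd c ` fst c)" using ch[OF c] by (simp add: is_chart_def)
    from smooth_on_Pair[OF this, of "local_rep c f" "local_rep c \<xi>"]
    show "smooth_on (snd c ` fst c) (local_rep c ?\<mu>)"
      using f s\<xi> c by (simp add: smooth_map_def local_rep_def comp_def)
  qed
  show ?thesis
    unfolding co_orientable_frontal_def
  proof (intro conjI f exI[of _ ?\<Lambda>] fl exI[of _ ?\<mu>] s\<mu>)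
    show "\<forall>p\<in>topspace X. snd (?\<mu> p) \<noteq> 0 \<and> ?\<Lambda> p = (fst (?\<mu> p), span {snd (?\<mu> p)})" using \<xi>0 by simp
  qed
qed

section \<open>Descent along the orientable double covering\<close>

lemma det2_surj:
  assumes "linear L" "det2 L \<noteq> 0"
  obtains v where "L v = u"
proof
  let ?v = "Complex (cross2 u (L \<i>) / cross2 (L 1) (L \<i>)) (cross2 (L 1) u / cross2 (L 1) (L \<i>))"
  show "L ?v = u"
    by (subst complex_linear_expand[OF assms(1)]) (use cramer2[of "L 1" "L \<i>" u] assms(2) in \<open>simp add: det2_def\<close>)
qed

text \<open>\<open>T\<close> is the differential of the covering in charts. As it is invertible, the
  differentials of \<open>f\<close> at \<open>\<pi> q\<close> and of \<open>f \<circ> \<pi>\<close>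
  at \<open>q\<close> have the same image, so normals upstairs are normals downstairs.\<close>

lemma covering_chart:
  fixes f :: "'a \<Rightarrow> real^3"
  assumes dc: "double_covering Y B \<pi> X A" and A: "smooth_atlas X A" and B: "smooth_atlas Y B" and f: "smooth_map A f"
    and k: "k \<in> B" and c: "c \<in> A" and q: "q \<in> fst k" "\<pi> q \<in> fst c"
  defines "T \<equiv> fderiv (local_rep k (snd c \<circ> \<pi>)) (snd k q)"
    and "S \<equiv> snd k ` {q \<in> fst k. \<pi> q \<in> fst c}"
  shows "open S" "snd k q \<in> S" "smooth_on S (local_rep k (snd c \<circ> \<pi>))" "linear T" "det2 T \<noteq> 0"
    "differential k (f \<circ> \<pi>) q v = differential c f (\<pi> q) (T v)"
proof -
  have hk: "is_chart Y k" using B k by (simp add: smooth_atlas_def)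
  have hc: "is_chart X c" using A c by (simp add: smooth_atlas_def)
  have \<pi>: "continuous_map Y X \<pi>" using dc by (simp add: double_covering_def)
  have "openin Y {q \<in> topspace Y. \<pi> q \<in> fst c}"
    using openin_continuous_map_preimage[OF \<pi>] hc by (simp add: is_chart_def)
  then have "openin Y (fst k \<inter> {q \<in> topspace Y. \<pi> q \<in> fst c})" using hk by (auto simp: is_chart_def)
  moreover have "fst k \<inter> {q \<in> topspace Y. \<pi> q \<in> fst c} = {q \<in> fst k. \<pi> q \<in> fst c}"
    using chart_subset_topspace[OF hk] by blast
  ultimately have "openin Y {q \<in> fst k. \<pi> q \<in> fst c}" by simp
  then show S: "open S" unfolding S_def by (rule chart_open_image[OF hk]) auto
  show qS: "snd k q \<in> S" using q by (auto simp: S_def)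
  show s: "smooth_on S (local_rep k (snd c \<circ> \<pi>))" using dc k c unfolding double_covering_def S_def by blast
  have dT: "(local_rep k (snd c \<circ> \<pi>) has_derivative T) (at (snd k q))"
    unfolding T_def by (rule smooth_on_has_derivative[OF S s qS])
  then show "linear T" by (rule has_derivative_linear)
  have "jacobian (local_rep k (snd c \<circ> \<pi>)) (snd k q) \<noteq> 0" using dc k c qS unfolding double_covering_def S_def by blast
  then show "det2 T \<noteq> 0" by (simp add: jacobian_cross2 det2_def T_def)
  have e: "local_rep k (snd c \<circ> \<pi>) (snd k q) = snd c (\<pi> q)" by (simp add: local_rep_apply[OF hk q(1)])
  have "(local_rep c f has_derivative differential c f (\<pi> q)) (at (local_rep k (snd c \<circ> \<pi>) (snd k q)))"
    unfolding e by (rule smooth_map_differentiable(2)[OF f c hc q(2)])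
  from has_derivative_compose[OF dT this]
  have "(local_rep k (f \<circ> \<pi>) has_derivative (\<lambda>v. differential c f (\<pi> q) (T v))) (at (snd k q))"
  proof (rule has_derivative_transform_within_open[OF _ S qS])
    fix w assume "w \<in> S"
    then obtain q' where q': "q' \<in> fst k" "\<pi> q' \<in> fst c" "w = snd k q'" by (auto simp: S_def)
    show "local_rep c f (local_rep k (snd c \<circ> \<pi>) w) = local_rep k (f \<circ> \<pi>) w"
      unfolding q'(3) local_rep_apply[OF hk q'(1)] by (simp add: local_rep_apply[OF hc q'(2)])
  qed
  from frechet_derivative_at[OF this] show "differential k (f \<circ> \<pi>) q v = differential c f (\<pi> q) (T v)"
    unfolding differential_def by metis
qed

text \<open>The two points of a fibre see the same image of \<open>df\<close>, so uniqueness of the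
  normal with time component 1 identifies the values of \<open>\<eta>'\<close> over
  \<open>W\<close>, and density identifies them everywhere. A unit normal determined only up to sign
  would not have to descend.\<close>

lemma normal_field_descends:
  fixes f :: "'a \<Rightarrow> real^3" and \<eta>' :: "'b \<Rightarrow> real^3"
  assumes dc: "double_covering Y B \<pi> X A" and A: "smooth_atlas X A" and B: "smooth_atlas Y B" and f: "smooth_map A f"
    and reg: "maxface_regular_on Y B W (f \<circ> \<pi>)"
    and \<eta>': "\<And>q. q \<in> topspace Y \<Longrightarrow> \<eta>' q $ 0 = 1" "normal_vector_field Y B (f \<circ> \<pi>) \<eta>'" "smooth_map B \<eta>'"
  obtains \<eta> :: "'a \<Rightarrow> real^3" where "\<And>q. q \<in> topspace Y \<Longrightarrow> \<eta> (\<pi> q) = \<eta>' q" "normal_vector_field X A f \<eta>" "smooth_map A \<eta>"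
proof -
  have W: "Y closure_of W = topspace Y" and imm: "spacelike_immersion_on B W (f \<circ> \<pi>)"
    using reg by (auto simp: maxface_regular_on_def)
  have hA: "is_chart X c" if "c \<in> A" for c using A that by (simp add: smooth_atlas_def)
  have hB: "is_chart Y k" if "k \<in> B" for k using B that by (simp add: smooth_atlas_def)
  have \<pi>: "continuous_map Y X \<pi>" using dc by (simp add: double_covering_def)
  have \<pi>X: "\<pi> q \<in> topspace X" if "q \<in> topspace Y" for q using continuous_map_image_subset_topspace[OF \<pi>] that by blast
  have cA: "\<exists>c\<in>A. x \<in> fst c" if "x \<in> topspace X" for x using A that unfolding smooth_atlas_def by blast
  have cB: "\<exists>k\<in>B. q \<in> fst k" if "q \<in> topspace Y" for q using B that unfolding smooth_atlas_def by blast
  have normal: "lorentz (\<eta>' q) (differential c f (\<pi> q) u) = 0" if q: "q \<in> topspace Y" and c: "c \<in> A" "\<pi> q \<in> fst c" for q c u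
  proof -
    obtain k where k: "k \<in> B" "q \<in> fst k" using cB[OF q] by blast
    note cc = covering_chart[OF dc A B f k(1) c(1) k(2) c(2)]
    obtain v where "fderiv (local_rep k (snd c \<circ> \<pi>)) (snd k q) v = u" using det2_surj[OF cc(4,5)] .
    then have "differential c f (\<pi> q) u = differential k (f \<circ> \<pi>) q v" using cc(6)[of v] by simp
    then show ?thesis using \<eta>'(2) k by (simp add: normal_vector_field_def)
  qed
  \<comment> \<open>It is enough that \<open>q\<close> lies in \<open>W\<close>: whether the tangent
    plane is spacelike depends on \<open>\<pi> q\<close> alone.\<close>
  have on_W: "\<eta>' q = \<eta>' q'" if q: "q \<in> topspace Y" "q' \<in> topspace Y" "\<pi> q = \<pi> q'" "q \<in> W" for q q'
  proof -
    obtain k where k: "k \<in> B" "q \<in> fst k" using cB[OF q(1)] by blast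
    obtain c where c: "c \<in> A" "\<pi> q \<in> fst c" using cA[OF \<pi>X[OF q(1)]] by blast
    note cc = covering_chart[OF dc A B f k(1) c(1) k(2) c(2)]
    let ?L = "differential k (f \<circ> \<pi>) q"
    have fp: "smooth_map B (f \<circ> \<pi>)" using reg by (simp add: maxface_regular_on_def)
    show ?thesis
    proof (rule causal_normal_unique[of ?L])
      show "linear ?L" by (rule has_derivative_linear[OF smooth_map_differentiable(2)[OF fp k(1) hB[OF k(1)] k(2)]])
      show "lorentz (?L v) (?L v) > 0" if "v \<noteq> 0" for v
        using imm[unfolded spacelike_immersion_on_def, rule_format, OF k(1) IntI[OF k(2) q(4)] that] by (simp add: first_form_def)
      show "lorentz (\<eta>' q) (?L v) = 0" for v using \<eta>'(2) k by (simp add: normal_vector_field_def)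
      show "lorentz (\<eta>' q') (?L v) = 0" for v
        using normal[OF q(2) c(1)] c(2) unfolding q(3) cc(6) by simp
    qed (use \<eta>'(1) q in auto)
  qed
  have c\<eta>': "continuous_map Y euclidean \<eta>'" by (rule smooth_map_continuous_map[OF B \<eta>'(3)])
  \<comment> \<open>With \<open>s\<close> the local inverse of \<open>\<pi>\<close> around
    \<open>q'\<close>, the point \<open>s (\<pi> y)\<close> lies in the fibre of \<open>y\<close>
    and depends continuously on \<open>y\<close> near \<open>q\<close>; so the equality over
    \<open>W\<close> extends to \<open>q\<close> by density.\<close>
  have wd: "\<eta>' q = \<eta>' q'" if q: "q \<in> topspace Y" "q' \<in> topspace Y" "\<pi> q = \<pi> q'" for q q'
  proof -
    obtain U V1 V2 where U: "openin X U" "\<pi> q \<in> U" and V: "openin Y V1" "openin Y V2" "V1 \<union> V2 = {q \<in> topspace Y. \<pi> q \<in> U}"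
      "homeomorphic_map (subtopology Y V1) (subtopology X U) \<pi>" "homeomorphic_map (subtopology Y V2) (subtopology X U) \<pi>"
      using dc \<pi>X[OF q(1)] unfolding double_covering_def by meson
    have qV: "q \<in> V1 \<union> V2" "q' \<in> V1 \<union> V2" using U(2) q V(3) by auto
    obtain Va where Va: "openin Y Va" "q \<in> Va" "homeomorphic_map (subtopology Y Va) (subtopology X U) \<pi>"
      using qV(1) V by (elim UnE) blast+
    obtain Vb where Vb: "openin Y Vb" "q' \<in> Vb" "homeomorphic_map (subtopology Y Vb) (subtopology X U) \<pi>"
      using qV(2) V by (elim UnE) blast+
    have topa: "topspace (subtopology Y Va) = Va" and topb: "topspace (subtopology Y Vb) = Vb" and topU: "topspace (subtopology X U) = U"
      using openin_subset[OF Va(1)] openin_subset[OF Vb(1)] openin_subset[OF U(1)] by auto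
    obtain s where s: "homeomorphic_maps (subtopology Y Vb) (subtopology X U) \<pi> s"
      using Vb(3) homeomorphic_map_maps by blast
    have s1: "s (\<pi> y) = y" if "y \<in> Vb" for y using s that topb by (simp add: homeomorphic_maps_def)
    have s2: "\<pi> (s x) = x" if "x \<in> U" for x using s that topU by (simp add: homeomorphic_maps_def)
    have cs: "continuous_map (subtopology X U) (subtopology Y Vb) s" using s by (simp add: homeomorphic_maps_def)
    have sV: "s x \<in> Vb" if "x \<in> U" for x using continuous_map_image_subset_topspace[OF cs] topb topU that by blast
    have c\<pi>: "continuous_map (subtopology Y Va) (subtopology X U) \<pi>" by (rule homeomorphic_imp_continuous_map[OF Va(3)])
    have \<pi>U: "\<pi> y \<in> U" if "y \<in> Va" for y using continuous_map_image_subset_topspace[OF c\<pi>] topa topU that by blast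
    have "continuous_map (subtopology Y Vb) euclidean \<eta>'" by (rule continuous_map_from_subtopology[OF c\<eta>'])
    then have "continuous_map (subtopology Y Va) euclidean (\<eta>' \<circ> (s \<circ> \<pi>))"
      by (intro continuous_map_compose[OF continuous_map_compose[OF c\<pi> cs]])
    then have "\<eta>' q = (\<eta>' \<circ> (s \<circ> \<pi>)) q"
    proof (rule continuous_map_agree_dense[OF Va(1) W continuous_map_from_subtopology[OF c\<eta>']])
      fix y assume y: "y \<in> Va" "y \<in> W"
      show "\<eta>' y = (\<eta>' \<circ> (s \<circ> \<pi>)) y"
        using on_W[of y "s (\<pi> y)"] y sV[OF \<pi>U[OF y(1)]] s2[OF \<pi>U[OF y(1)]] openin_subset[OF Va(1)] openin_subset[OF Vb(1)]
        by auto
    qed (rule Va(2))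
    then show ?thesis using s1[OF Vb(2)] q(3) by simp
  qed
  have lift: "\<exists>q. q \<in> topspace Y \<and> \<pi> q = x" if x: "x \<in> topspace X" for x
  proof -
    obtain U V1 where U: "openin X U" "x \<in> U" "openin Y V1" "homeomorphic_map (subtopology Y V1) (subtopology X U) \<pi>"
      using dc x unfolding double_covering_def by meson
    have "\<pi> ` topspace (subtopology Y V1) = topspace (subtopology X U)"
      by (rule homeomorphic_imp_surjective_map[OF U(4)])
    moreover have "x \<in> topspace (subtopology X U)" using U(2) x by simp
    ultimately obtain q where "q \<in> topspace (subtopology Y V1)" "\<pi> q = x" by (metis imageE)
    then show ?thesis by auto
  qed
  define \<eta> where "\<eta> = (\<lambda>x. \<eta>' (SOME q. q \<in> topspace Y \<and> \<pi> q = x))"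
  have \<eta>: "\<eta> (\<pi> q) = \<eta>' q" if "q \<in> topspace Y" for q
  proof -
    have "(SOME q'. q' \<in> topspace Y \<and> \<pi> q' = \<pi> q) \<in> topspace Y \<and> \<pi> (SOME q'. q' \<in> topspace Y \<and> \<pi> q' = \<pi> q) = \<pi> q"
      by (rule someI[of "\<lambda>q'. q' \<in> topspace Y \<and> \<pi> q' = \<pi> q" q]) (use that in simp)
    then show ?thesis unfolding \<eta>_def using wd that by blast
  qed
  show thesis
  proof (rule that[OF \<eta>])
    show "normal_vector_field X A f \<eta>"
      unfolding normal_vector_field_def
    proof (intro conjI ballI allI)
      fix x assume "x \<in> topspace X"
      then obtain q where q: "q \<in> topspace Y" "\<pi> q = x" using lift by blast
      show "\<eta> x \<noteq> 0"
      proof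
        assume "\<eta> x = 0"
        then show False using \<eta>'(1)[OF q(1)] \<eta>[OF q(1)] q(2) by simp
      qed
    next
      fix c x v assume c: "c \<in> A" "x \<in> fst c"
      then obtain q where q: "q \<in> topspace Y" "\<pi> q = x" using lift chart_subset_topspace[OF hA[OF c(1)]] by blast
      show "lorentz (\<eta> x) (differential c f x v) = 0" using normal[OF q(1) c(1), of v] c(2) \<eta>[OF q(1)] q(2) by simp
    qed
    show "smooth_map A \<eta>"
      unfolding smooth_map_def
    proof
      fix c assume c: "c \<in> A"
      note hc = hA[OF c]
      show "smooth_on (snd c ` fst c) (local_rep c \<eta>)"
      proof (rule smooth_on_local)
        show "open (snd c ` fst c)" using hc by (simp add: is_chart_def)
        fix y assume "y \<in> snd c ` fst c"
        then obtain x where x: "x \<in> fst c" "y = snd c x" by blast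
        obtain q where q: "q \<in> topspace Y" "\<pi> q = x" using lift x(1) chart_subset_topspace[OF hc] by blast
        obtain k where k: "k \<in> B" "q \<in> fst k" using cB[OF q(1)] by blast
        note hk = hB[OF k(1)]
        have qc: "\<pi> q \<in> fst c" using q x by simp
        let ?F = "local_rep k (snd c \<circ> \<pi>)" and ?S = "snd k ` {q \<in> fst k. \<pi> q \<in> fst c}"
        note cc = covering_chart[OF dc A B f k(1) c k(2) qc]
        have jac: "jacobian ?F w \<noteq> 0" if "w \<in> ?S" for w using dc k(1) c that unfolding double_covering_def by blast
        let ?a = "\<lambda>w. fderiv ?F w 1" and ?b = "\<lambda>w. fderiv ?F w \<i>"
        \<comment> \<open>\<open>G\<close> is a smooth local section of the covering in charts, and
          \<open>\<eta>\<close> in the chart \<open>c\<close> is \<open>\<eta>'\<close> along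
          it.\<close>
        obtain U1 V1 G where UV: "open U1" "snd k q \<in> U1" "U1 \<subseteq> ?S" "open V1" "homeomorphism U1 V1 ?F G"
        proof (rule local_homeomorphism[OF cc(1,2)])
          show "(?F has_derivative (\<lambda>v. Re v *\<^sub>R ?a w + Im v *\<^sub>R ?b w)) (at w)" if "w \<in> ?S" for w
          proof -
            note d = smooth_on_has_derivative[OF cc(1,3) that]
            show ?thesis
              by (rule has_derivative_eq_rhs[OF d]) (rule ext, rule complex_linear_expand[OF has_derivative_linear[OF d]])
          qed
          show "continuous_on ?S ?a" "continuous_on ?S ?b" by (intro smooth_on_continuous smooth_on_frechet cc(3))+
          show "cross2 (?a (snd k q)) (?b (snd k q)) \<noteq> 0" using jac[OF cc(2)] by (simp add: jacobian_cross2)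
        qed (rule that)
        have G: "G w \<in> U1" "?F (G w) = w" if "w \<in> V1" for w using UV(5) that by (auto simp: homeomorphism_def)
        have sG: "smooth_on V1 G"
          by (rule smooth_on_local_inverse[OF UV(1,4) smooth_on_subset[OF cc(3) UV(3)]])
            (use G UV(3,5) jac in \<open>auto simp: homeomorphism_def\<close>)
        have "smooth_on V1 (\<lambda>w. local_rep k \<eta>' (G w))"
        proof (rule smooth_on_compose[OF UV(4) _ _ sG])
          show "open (snd k ` fst k)" using hk by (simp add: is_chart_def)
          show "smooth_on (snd k ` fst k) (local_rep k \<eta>')" using \<eta>'(3) k(1) by (simp add: smooth_map_def)
          show "G w \<in> snd k ` fst k" if "w \<in> V1" for w using G(1)[OF that] UV(3) by auto
        qed
        then have "smooth_on V1 (local_rep c \<eta>)"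
        proof (rule smooth_on_cong[OF UV(4), THEN iffD1, rotated])
          fix w assume w: "w \<in> V1"
          obtain q' where q': "q' \<in> fst k" "\<pi> q' \<in> fst c" "G w = snd k q'" using G(1)[OF w] UV(3) by auto
          have "w = snd c (\<pi> q')" using G(2)[OF w] unfolding q'(3) local_rep_apply[OF hk q'(1)] by simp
          moreover have "q' \<in> topspace Y" using chart_subset_topspace[OF hk] q'(1) by blast
          ultimately show "local_rep k \<eta>' (G w) = local_rep c \<eta> w"
            unfolding q'(3) local_rep_apply[OF hk q'(1)] by (simp add: local_rep_apply[OF hc q'(2)] \<eta>)
        qed
        moreover have "y \<in> V1"
        proof -
          have "?F (snd k q) \<in> V1" using UV(2,5) by (auto simp: homeomorphism_def)
          then show ?thesis using q x by (simp add: local_rep_apply[OF hk k(2)])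
        qed
        ultimately show "\<exists>T. open T \<and> y \<in> T \<and> smooth_on T (local_rep c \<eta>)" using UV(4) by blast
      qed
    qed
  qed
qed

theorem proposition5p2:
  fixes X :: "'a topology" and A :: "'a chart set" and f :: "'a \<Rightarrow> real^3"
  assumes "smooth_2manifold X A" and "connected_space X" and "maxface X A f"
  shows "(\<exists>\<eta>. normal_vector_field X A f \<eta> \<and> maxface_real_analytic X A f \<eta>) \<and>
    co_orientable_frontal X A f"
proof -
  have A: "smooth_atlas X A" using assms(1) by (simp add: smooth_2manifold_def)
  show ?thesis
  proof (cases "orientable X A")
    case True
    then obtain W where reg: "maxface_regular_on X A W f"
      using assms(3) by (auto simp: maxface_def orientable_maxface_def)
    then have f: "smooth_map A f" by (simp add: maxface_regular_on_def)
    obtain \<eta> :: "'a \<Rightarrow> real^3" and H where \<eta>: "normal_vector_field X A f \<eta>" "smooth_map A \<eta>"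
      "maxface_complex_structure X A f H" "real_analytic_map H \<eta>"
      by (rule orientable_normal_field[OF A True reg]) (rule that)
    have "maxface_real_analytic X A f \<eta>" using True \<eta>(3,4) by (auto simp: maxface_real_analytic_def)
    then show ?thesis using \<eta>(1) co_orientable_frontalI[OF A f \<eta>(2,1)] by blast
  next
    case False
    then have f: "smooth_map A f" using assms(3) by (simp add: maxface_def)
    obtain Y B \<pi> where cov: "orientable_double_covering Y B \<pi> X A" and mf: "orientable_maxface Y B (f \<circ> \<pi>)"
      using False assms(3) by (auto simp: maxface_def)
    have B: "smooth_atlas Y B" and oY: "orientable Y B" and dc: "double_covering Y B \<pi> X A"
      using cov by (auto simp: orientable_double_covering_def smooth_2manifold_def)
    obtain W where reg: "maxface_regular_on Y B W (f \<circ> \<pi>)" using mf by (auto simp: orientable_maxface_def)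
    obtain \<eta>' :: "'a \<times> bool \<Rightarrow> real^3" and H where \<eta>': "\<And>q. q \<in> topspace Y \<Longrightarrow> \<eta>' q $ 0 = 1"
      "normal_vector_field Y B (f \<circ> \<pi>) \<eta>'" "smooth_map B \<eta>'" "maxface_complex_structure Y B (f \<circ> \<pi>) H" "real_analytic_map H \<eta>'"
      by (rule orientable_normal_field[OF B oY reg]) (rule that)
    obtain \<eta> :: "'a \<Rightarrow> real^3" where \<eta>: "\<And>q. q \<in> topspace Y \<Longrightarrow> \<eta> (\<pi> q) = \<eta>' q" "normal_vector_field X A f \<eta>" "smooth_map A \<eta>"
      by (rule normal_field_descends[OF dc A B f reg \<eta>'(1,2,3)]) (assumption, rule that)
    have hH: "is_chart Y h" if "h \<in> H" for h
      using \<eta>'(4) that by (auto simp: maxface_complex_structure_def complex_structure_def smooth_atlas_def)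
    \<comment> \<open>In the charts of \<open>H\<close> the pullback of \<open>\<eta>\<close> is the
      field \<open>\<eta>'\<close>, whose analyticity is known.\<close>
    have "real_analytic_map H (\<eta> \<circ> \<pi>)"
      unfolding real_analytic_map_def
    proof
      fix h assume h: "h \<in> H"
      show "real_analytic_on (snd h ` fst h) (local_rep h (\<eta> \<circ> \<pi>))"
      proof (rule real_analytic_on_cong[of _ "local_rep h \<eta>'"])
        show "open (snd h ` fst h)" using hH[OF h] by (simp add: is_chart_def)
        show "real_analytic_on (snd h ` fst h) (local_rep h \<eta>')" using \<eta>'(5) h by (simp add: real_analytic_map_def)
        fix w assume "w \<in> snd h ` fst h"
        then obtain q where q: "q \<in> fst h" "w = snd h q" by blast
        then have "q \<in> topspace Y" using chart_subset_topspace[OF hH[OF h]] by blast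
        then show "local_rep h \<eta>' w = local_rep h (\<eta> \<circ> \<pi>) w"
          unfolding q(2) local_rep_apply[OF hH[OF h] q(1)] by (simp add: \<eta>(1))
      qed
    qed
    then have "maxface_real_analytic X A f \<eta>"
      unfolding maxface_real_analytic_def using False cov \<eta>'(4) by auto
    then show ?thesis using \<eta>(2) co_orientable_frontalI[OF A f \<eta>(3,2)] by blast
  qed
qed

end
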